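(* Let $n \geq 2$ and let $\tau : \mathbb{C}^n \longrightarrow E \longrightarrow \mathbb{C}P^n$ be the (complex) tangent bundle over $\mathbb{C}P^n$. Then the total space $P(E)$ of the projectivization bundle $P(\tau) : \mathbb{C}P^{n-1} \longrightarrow P(E) \longrightarrow \mathbb{C}P^{n}$ has the rational homotopy type of the homogeneous space $\mathrm{U}(n+1) / (\mathrm{U}(1) \times \mathrm{U}(1) \times \mathrm{U}(n-1))$.
   Context: For a complex vector bundle $\xi : \mathbb{C}^n \to E \to B$ with transition functions $g_{\alpha\beta} : U_\alpha \cap U_\beta \to GL(n,\mathbb{C})$, the projectivization $P(\xi) : \mathbb{C}P^{n-1} \to P(E) \to B$ is the fibre bundle with fibre $\mathbb{C}P^{n-1}$ whose transition functions are the compositions $U_\alpha \cap U_\beta \to GL(n,\mathbb{C}) \to PGL(n,\mathbb{C})$; i.e. each fibre $\mathbb{C}^n$ of $\xi$ is replaced by its projective space of complex lines. The subgroup $\mathrm{U}(1)\times\mathrm{U}(1)\times\mathrm{U}(n-1)\subset \mathrm{U}(n+1)$ is the standard block-diagonal one. Two simply connected spaces of finite type have the same rational homotopy type if their minimal Sullivan models (over $\mathbb{Q}$) are isomorphic as commutative differential graded algebras. A (minimal) Sullivan model of such a space $X$ is a (minimal) Sullivan algebra $(\Lambda V,d)$ with a quasi-isomorphism to $A_{PL}(X)$, Sullivan's commutative differential graded algebra of polynomial forms on $X$. *)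

theory Defs
  imports
    "HOL-Analysis.Analysis"
    "HOL-Homology.Homology"
    "HOL-Algebra.QuotRing"
    "HOL-Algebra.Subrings"
    "Jordan_Normal_Form.Schur_Decomposition"
begin

unbundle no vec_syntax
hide_const (open) Multiset.mult Polynomial.smult

section \<open>Differential graded algebras over the rationals\<close>

text \<open>
  Graded algebras are cochain algebras graded over the natural numbers; \<open>carrier A\<close> is the direct
  sum of the homogeneous components \<open>grade A p\<close>.
\<close>

record 'a dga = "(rat, 'a) module" +
  grade :: "nat \<Rightarrow> 'a set"
  diff :: "'a \<Rightarrow> 'a"

abbreviation rat_ring :: "rat ring" where
  "rat_ring \<equiv> class_ring"

locale cdga = ring A + Module.module rat_ring A
  for A :: "'a dga" (structure) +
  assumes smult_mult_left:
      "\<lbrakk>x \<in> carrier A; y \<in> carrier A\<rbrakk> \<Longrightarrow> (c \<odot> x) \<otimes> y = c \<odot> (x \<otimes> y)"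
    and smult_mult_right:
      "\<lbrakk>x \<in> carrier A; y \<in> carrier A\<rbrakk> \<Longrightarrow> x \<otimes> (c \<odot> y) = c \<odot> (x \<otimes> y)"
    and grade_submodule: "Module.submodule (grade A p) rat_ring A"
    and grade_direct_sum:
      "x \<in> carrier A \<Longrightarrow>
        \<exists>!f. (\<forall>p. f p \<in> grade A p) \<and> finite {p. f p \<noteq> \<zero>} \<and> x = finsum A f {p. f p \<noteq> \<zero>}"
    and one_grade: "\<one> \<in> grade A 0"
    and mult_grade:
      "\<lbrakk>x \<in> grade A p; y \<in> grade A q\<rbrakk> \<Longrightarrow> x \<otimes> y \<in> grade A (p + q)"
    and graded_commute:
      "\<lbrakk>x \<in> grade A p; y \<in> grade A q\<rbrakk> \<Longrightarrow> x \<otimes> y = (-1) ^ (p * q) \<odot> (y \<otimes> x)"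
    and diff_add:
      "\<lbrakk>x \<in> carrier A; y \<in> carrier A\<rbrakk> \<Longrightarrow> diff A (x \<oplus> y) = diff A x \<oplus> diff A y"
    and diff_smult: "x \<in> carrier A \<Longrightarrow> diff A (c \<odot> x) = c \<odot> diff A x"
    and diff_grade: "x \<in> grade A p \<Longrightarrow> diff A x \<in> grade A (Suc p)"
    and diff_diff: "x \<in> carrier A \<Longrightarrow> diff A (diff A x) = \<zero>"
    and diff_mult:
      "\<lbrakk>x \<in> grade A p; y \<in> carrier A\<rbrakk> \<Longrightarrow>
        diff A (x \<otimes> y) = (diff A x \<otimes> y) \<oplus> (-1) ^ p \<odot> (x \<otimes> diff A y)"

definition dga_hom :: "'a dga \<Rightarrow> 'b dga \<Rightarrow> ('a \<Rightarrow> 'b) set" where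
  "dga_hom A B = {f \<in> Ring.ring_hom A B.
     (\<forall>q. \<forall>x\<in>carrier A. f (q \<odot>\<^bsub>A\<^esub> x) = q \<odot>\<^bsub>B\<^esub> f x) \<and>
     (\<forall>p. f ` grade A p \<subseteq> grade B p) \<and>
     (\<forall>x\<in>carrier A. f (diff A x) = diff B (f x))}"

definition dga_isomorphic :: "'a dga \<Rightarrow> 'b dga \<Rightarrow> bool" where
  "dga_isomorphic A B \<longleftrightarrow> (\<exists>f\<in>dga_hom A B. bij_betw f (carrier A) (carrier B))"

definition cocycles :: "'a dga \<Rightarrow> nat \<Rightarrow> 'a set" where
  "cocycles A p = {x \<in> grade A p. diff A x = \<zero>\<^bsub>A\<^esub>}"

definition coboundaries :: "'a dga \<Rightarrow> nat \<Rightarrow> 'a set" where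
  "coboundaries A p = (case p of 0 \<Rightarrow> {\<zero>\<^bsub>A\<^esub>} | Suc r \<Rightarrow> diff A ` grade A r)"

definition dga_cohomology :: "'a dga \<Rightarrow> nat \<Rightarrow> 'a set monoid" where
  "dga_cohomology A p = (add_monoid A)\<lparr>carrier := cocycles A p\<rparr> Mod coboundaries A p"

definition cohomology_map :: "'b dga \<Rightarrow> nat \<Rightarrow> ('a \<Rightarrow> 'b) \<Rightarrow> 'a set \<Rightarrow> 'b set" where
  "cohomology_map B p f C = (\<Union>x\<in>C. coboundaries B p +>\<^bsub>B\<^esub> f x)"

definition quasi_isomorphism :: "'a dga \<Rightarrow> 'b dga \<Rightarrow> ('a \<Rightarrow> 'b) \<Rightarrow> bool" where
  "quasi_isomorphism A B f \<longleftrightarrow> f \<in> dga_hom A B \<and>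
     (\<forall>p. cohomology_map B p f \<in> iso (dga_cohomology A p) (dga_cohomology B p))"

section \<open>Graded-commutative algebras by generators and relations\<close>

text \<open>
  The free associative algebra on letters \<open>'g\<close> is the monoid algebra of the free monoid of words.
  Words are a separate type because \<open>'g list\<close> is not an instance of \<open>monoid_add\<close>.
\<close>

datatype 'g word = Word (letters: "'g list")

instantiation word :: (type) monoid_add
begin

definition zero_word :: "'a word" where
  "zero_word = Word []"

definition plus_word :: "'a word \<Rightarrow> 'a word \<Rightarrow> 'a word" where
  "plus_word u v = Word (letters u @ letters v)"

instance
  by standard (auto simp: zero_word_def plus_word_def)

end

type_synonym 'g tensor = "'g word \<Rightarrow>\<^sub>0 rat"

definition scalar :: "rat \<Rightarrow> 'g tensor" where
  "scalar q = Poly_Mapping.single 0 q"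

definition letter :: "'g \<Rightarrow> 'g tensor" where
  "letter v = Poly_Mapping.single (Word [v]) 1"

definition tensor_algebra :: "'g set \<Rightarrow> 'g tensor ring" where
  "tensor_algebra S =
     \<lparr>carrier = {x. \<forall>w\<in>Poly_Mapping.keys x. set (letters w) \<subseteq> S},
      mult = (*), one = 1, zero = 0, add = (+)\<rparr>"

definition word_degree :: "('g \<Rightarrow> nat) \<Rightarrow> 'g word \<Rightarrow> nat" where
  "word_degree dg w = sum_list (map dg (letters w))"

definition graded_commutators :: "'g set \<Rightarrow> ('g \<Rightarrow> nat) \<Rightarrow> 'g tensor set" where
  "graded_commutators S dg =
     {letter v * letter w - scalar ((-1) ^ (dg v * dg w)) * letter w * letter v | v w.
        v \<in> S \<and> w \<in> S}"

definition gca_ideal :: "'g set \<Rightarrow> ('g \<Rightarrow> nat) \<Rightarrow> 'g tensor set \<Rightarrow> 'g tensor set" where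
  "gca_ideal S dg R = genideal (tensor_algebra S) (graded_commutators S dg \<union> R)"

text \<open>
  \<open>gca_class S dg R P\<close> consists of the residue classes of the tensors all of whose words satisfy
  \<open>P\<close>. \<open>presented_dga S dg R d\<close> is the graded-commutative algebra generated by \<open>S\<close> (a letter \<open>v\<close>
  has degree \<open>dg v\<close>) with relations \<open>R\<close> (meant to be homogeneous), equipped with the map \<open>d\<close> on
  residue classes.
\<close>

definition gca_class ::
    "'g set \<Rightarrow> ('g \<Rightarrow> nat) \<Rightarrow> 'g tensor set \<Rightarrow> ('g word \<Rightarrow> bool) \<Rightarrow> 'g tensor set set" where
  "gca_class S dg R P =
     (\<lambda>x. gca_ideal S dg R +>\<^bsub>tensor_algebra S\<^esub> x) `
       {x \<in> carrier (tensor_algebra S). \<forall>w\<in>Poly_Mapping.keys x. P w}"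

definition presented_dga ::
    "'g set \<Rightarrow> ('g \<Rightarrow> nat) \<Rightarrow> 'g tensor set \<Rightarrow> ('g tensor set \<Rightarrow> 'g tensor set) \<Rightarrow>
      'g tensor set dga" where
  "presented_dga S dg R d =
     (let I = gca_ideal S dg R; Q = tensor_algebra S Quot I in
      \<lparr>carrier = carrier Q, mult = mult Q, one = one Q, zero = zero Q, add = add Q,
       smult = (\<lambda>q C. \<Union>x\<in>C. I +>\<^bsub>tensor_algebra S\<^esub> (scalar q * x)),
       grade = (\<lambda>p. gca_class S dg R (\<lambda>w. word_degree dg w = p)),
       diff = d\<rparr>)"

section \<open>Sullivan algebras\<close>

text \<open>
  \<open>free_dga S dg d\<close> is \<open>(\<Lambda>V, d)\<close>, where \<open>V\<close> is the graded vector space with homogeneous basis \<open>S\<close>.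
\<close>

abbreviation free_dga ::
    "'g set \<Rightarrow> ('g \<Rightarrow> nat) \<Rightarrow> ('g tensor set \<Rightarrow> 'g tensor set) \<Rightarrow> 'g tensor set dga" where
  "free_dga S dg d \<equiv> presented_dga S dg {} d"

definition generating_space :: "'g set \<Rightarrow> ('g \<Rightarrow> nat) \<Rightarrow> nat \<Rightarrow> 'g tensor set set" where
  "generating_space S dg p =
     gca_class S dg {} (\<lambda>w. length (letters w) = 1 \<and> word_degree dg w = p)"

definition decomposables :: "'g set \<Rightarrow> ('g \<Rightarrow> nat) \<Rightarrow> 'g tensor set set" where
  "decomposables S dg = gca_class S dg {} (\<lambda>w. 2 \<le> length (letters w))"

definition generated_subalgebra :: "'a dga \<Rightarrow> 'a set \<Rightarrow> 'a set" where
  "generated_subalgebra A X = \<Inter>{B. X \<subseteq> B \<and> subring B A \<and> Module.submodule B rat_ring A}"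

text \<open>
  \<open>F k\<close> is the \<open>k\<close>-th stage \<open>V(k)\<close> of the filtration of \<open>V\<close> by graded subspaces, with degree \<open>p\<close>
  component \<open>F k p\<close>.
\<close>

definition sullivan_algebra ::
    "'g set \<Rightarrow> ('g \<Rightarrow> nat) \<Rightarrow> ('g tensor set \<Rightarrow> 'g tensor set) \<Rightarrow> bool" where
  "sullivan_algebra S dg d \<longleftrightarrow>
     (\<forall>v\<in>S. 1 \<le> dg v) \<and>
     cdga (free_dga S dg d) \<and>
     (\<exists>F :: nat \<Rightarrow> nat \<Rightarrow> 'g tensor set set.
        (\<forall>k p. Module.submodule (F k p) rat_ring (free_dga S dg d)) \<and>
        (\<forall>k p. F k p \<subseteq> F (Suc k) p) \<and>
        (\<forall>p. (\<Union>k. F k p) = generating_space S dg p) \<and>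
        (\<forall>p. \<forall>v\<in>F 0 p. d v = \<zero>\<^bsub>free_dga S dg d\<^esub>) \<and>
        (\<forall>k p. \<forall>v\<in>F (Suc k) p.
            d v \<in> generated_subalgebra (free_dga S dg d) (\<Union>q. F k q)))"

definition minimal_sullivan_algebra ::
    "'g set \<Rightarrow> ('g \<Rightarrow> nat) \<Rightarrow> ('g tensor set \<Rightarrow> 'g tensor set) \<Rightarrow> bool" where
  "minimal_sullivan_algebra S dg d \<longleftrightarrow>
     sullivan_algebra S dg d \<and> d ` carrier (free_dga S dg d) \<subseteq> decomposables S dg"

section \<open>Polynomial forms on a space\<close>

text \<open>
  The polynomial forms on the standard \<open>n\<close>-simplex are generated by the barycentric coordinates
  \<open>Coord 0, \<dots>, Coord n\<close> and their differentials \<open>DCoord 0, \<dots>, DCoord n\<close>, subject to the relations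
  that the coordinates sum to 1 and the differentials to 0.
\<close>

datatype pl_letter = Coord nat | DCoord nat

fun pl_degree :: "pl_letter \<Rightarrow> nat" where
  "pl_degree (Coord i) = 0"
| "pl_degree (DCoord i) = 1"

definition pl_letters :: "nat \<Rightarrow> pl_letter set" where
  "pl_letters n = Coord ` {..n} \<union> DCoord ` {..n}"

definition pl_relations :: "nat \<Rightarrow> pl_letter tensor set" where
  "pl_relations n = {(\<Sum>i\<le>n. letter (Coord i)) - 1, \<Sum>i\<le>n. letter (DCoord i)}"

fun pl_diff_letter :: "pl_letter \<Rightarrow> pl_letter tensor" where
  "pl_diff_letter (Coord i) = letter (DCoord i)"
| "pl_diff_letter (DCoord i) = 0"

fun pl_diff_letters :: "pl_letter list \<Rightarrow> pl_letter tensor" where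
  "pl_diff_letters [] = 0"
| "pl_diff_letters (a # as) =
     pl_diff_letter a * Poly_Mapping.single (Word as) 1 +
     scalar ((-1) ^ pl_degree a) * letter a * pl_diff_letters as"

definition pl_diff_tensor :: "pl_letter tensor \<Rightarrow> pl_letter tensor" where
  "pl_diff_tensor x =
     (\<Sum>w\<in>Poly_Mapping.keys x. scalar (Poly_Mapping.lookup x w) * pl_diff_letters (letters w))"

type_synonym pl_form = "pl_letter tensor set"

definition pl_class :: "nat \<Rightarrow> pl_letter tensor \<Rightarrow> pl_form" where
  "pl_class n x =
     gca_ideal (pl_letters n) pl_degree (pl_relations n) +>\<^bsub>tensor_algebra (pl_letters n)\<^esub> x"

definition pl_forms :: "nat \<Rightarrow> pl_form dga" where
  "pl_forms n =
     presented_dga (pl_letters n) pl_degree (pl_relations n)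
       (\<lambda>C. \<Union>x\<in>C. pl_class n (pl_diff_tensor x))"

text \<open>
  A monotone map \<open>\<theta>: {0..p} \<rightarrow> {0..q}\<close> induces the affine map \<open>simplex_map p \<theta>\<close> from the standard
  \<open>p\<close>-simplex to the standard \<open>q\<close>-simplex which sends the \<open>i\<close>-th vertex to the \<open>\<theta> i\<close>-th one;
  \<open>pl_pullback p \<theta>\<close> is the pullback of polynomial forms along it.
\<close>

definition monotone_map :: "nat \<Rightarrow> nat \<Rightarrow> (nat \<Rightarrow> nat) \<Rightarrow> bool" where
  "monotone_map p q \<theta> \<longleftrightarrow> mono_on {..p} \<theta> \<and> \<theta> ` {..p} \<subseteq> {..q}"

definition simplex_map :: "nat \<Rightarrow> (nat \<Rightarrow> nat) \<Rightarrow> (nat \<Rightarrow> real) \<Rightarrow> nat \<Rightarrow> real" where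
  "simplex_map p \<theta> x = (\<lambda>j. \<Sum>i | i \<le> p \<and> \<theta> i = j. x i)"

fun pl_pullback_letter :: "nat \<Rightarrow> (nat \<Rightarrow> nat) \<Rightarrow> pl_letter \<Rightarrow> pl_letter tensor" where
  "pl_pullback_letter p \<theta> (Coord j) = (\<Sum>i | i \<le> p \<and> \<theta> i = j. letter (Coord i))"
| "pl_pullback_letter p \<theta> (DCoord j) = (\<Sum>i | i \<le> p \<and> \<theta> i = j. letter (DCoord i))"

definition pl_pullback_tensor ::
    "nat \<Rightarrow> (nat \<Rightarrow> nat) \<Rightarrow> pl_letter tensor \<Rightarrow> pl_letter tensor" where
  "pl_pullback_tensor p \<theta> x =
     (\<Sum>w\<in>Poly_Mapping.keys x. scalar (Poly_Mapping.lookup x w) *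
        prod_list (map (pl_pullback_letter p \<theta>) (letters w)))"

definition pl_pullback :: "nat \<Rightarrow> (nat \<Rightarrow> nat) \<Rightarrow> pl_form \<Rightarrow> pl_form" where
  "pl_pullback p \<theta> C = (\<Union>x\<in>C. pl_class p (pl_pullback_tensor p \<theta> x))"

type_synonym 'x sing_simplex = "nat \<times> ((nat \<Rightarrow> real) \<Rightarrow> 'x)"

definition singular_simplices :: "'x topology \<Rightarrow> 'x sing_simplex set" where
  "singular_simplices X = {(n, \<sigma>). singular_simplex n X \<sigma>}"

text \<open>
  A \<open>p\<close>-form on \<open>X\<close> is a map of simplicial sets from the singular simplices of \<open>X\<close> to the polynomial
  \<open>p\<close>-forms. Since the dimension of the simplices is unbounded, a family of inhomogeneous forms need
  not be a finite sum of homogeneous ones, whence the explicit description of the direct sum.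
\<close>

definition apl_grade :: "'x topology \<Rightarrow> nat \<Rightarrow> ('x sing_simplex \<Rightarrow> pl_form) set" where
  "apl_grade X r =
     {\<omega> \<in> (\<Pi>\<^sub>E (n, \<sigma>)\<in>singular_simplices X. grade (pl_forms n) r).
        \<forall>p q \<theta> \<sigma>. monotone_map p q \<theta> \<and> singular_simplex q X \<sigma> \<longrightarrow>
          \<omega> (p, restrict (\<sigma> \<circ> simplex_map p \<theta>) (standard_simplex p)) =
          pl_pullback p \<theta> (\<omega> (q, \<sigma>))}"

definition apl :: "'x topology \<Rightarrow> ('x sing_simplex \<Rightarrow> pl_form) dga" where
  "apl X =
     \<lparr>carrier = {\<lambda>(n, \<sigma>)\<in>singular_simplices X. finsum (pl_forms n) (\<lambda>r. \<eta> r (n, \<sigma>)) {..N} | \<eta> N.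
        \<forall>r. \<eta> r \<in> apl_grade X r},
      mult = (\<lambda>\<omega> \<eta>. \<lambda>(n, \<sigma>)\<in>singular_simplices X. \<omega> (n, \<sigma>) \<otimes>\<^bsub>pl_forms n\<^esub> \<eta> (n, \<sigma>)),
      one = (\<lambda>(n, \<sigma>)\<in>singular_simplices X. \<one>\<^bsub>pl_forms n\<^esub>),
      zero = (\<lambda>(n, \<sigma>)\<in>singular_simplices X. \<zero>\<^bsub>pl_forms n\<^esub>),
      add = (\<lambda>\<omega> \<eta>. \<lambda>(n, \<sigma>)\<in>singular_simplices X. \<omega> (n, \<sigma>) \<oplus>\<^bsub>pl_forms n\<^esub> \<eta> (n, \<sigma>)),
      smult = (\<lambda>c \<omega>. \<lambda>(n, \<sigma>)\<in>singular_simplices X. c \<odot>\<^bsub>pl_forms n\<^esub> \<omega> (n, \<sigma>)),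
      grade = apl_grade X,
      diff = (\<lambda>\<omega>. \<lambda>(n, \<sigma>)\<in>singular_simplices X. diff (pl_forms n) (\<omega> (n, \<sigma>)))\<rparr>"

section \<open>Rational homotopy type\<close>

definition minimal_sullivan_model ::
    "'x topology \<Rightarrow> 'g set \<Rightarrow> ('g \<Rightarrow> nat) \<Rightarrow> ('g tensor set \<Rightarrow> 'g tensor set) \<Rightarrow> bool" where
  "minimal_sullivan_model X S dg d \<longleftrightarrow>
     minimal_sullivan_algebra S dg d \<and>
     (\<exists>m. quasi_isomorphism (free_dga S dg d) (apl X) m)"

text \<open>
  Quantifying over models requires a fixed type of generators. A minimal model of a path-connected
  space has at most as many generators as the (infinite) algebra of forms has elements, so
  generators labelled by a number and a family of forms suffice, and by uniqueness of minimal models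
  the notion does not depend on this choice.
\<close>

type_synonym 'x generator = "nat \<times> ('x sing_simplex \<Rightarrow> pl_form)"

definition same_rational_homotopy_type :: "'x topology \<Rightarrow> 'y topology \<Rightarrow> bool" where
  "same_rational_homotopy_type X Y \<longleftrightarrow>
     (\<exists>(S :: 'x generator set) dg d (S' :: 'y generator set) dg' d'.
        minimal_sullivan_model X S dg d \<and> minimal_sullivan_model Y S' dg' d' \<and>
        dga_isomorphic (free_dga S dg d) (free_dga S' dg' d'))"

section \<open>Quotient spaces and complex coordinate spaces\<close>

definition quotient_topology :: "'a topology \<Rightarrow> ('a \<Rightarrow> 'b) \<Rightarrow> 'b topology" where
  "quotient_topology X q =
     topology (\<lambda>V. V \<subseteq> q ` topspace X \<and> openin X {x \<in> topspace X. q x \<in> V})"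

lemma openin_quotient_topology:
  "openin (quotient_topology X q) V \<longleftrightarrow>
     V \<subseteq> q ` topspace X \<and> openin X {x \<in> topspace X. q x \<in> V}"
proof -
  define P where "P V \<longleftrightarrow> V \<subseteq> q ` topspace X \<and> openin X {x \<in> topspace X. q x \<in> V}" for V
  have P_Int: "P (S \<inter> T)" if "P S" "P T" for S T
  proof -
    have eq: "{x \<in> topspace X. q x \<in> S \<inter> T} =
        {x \<in> topspace X. q x \<in> S} \<inter> {x \<in> topspace X. q x \<in> T}"
      by blast
    show ?thesis
      using that unfolding P_def eq by (meson le_infI1 openin_Int)
  qed
  have P_Union: "P (\<Union>\<K>)" if "\<forall>K\<in>\<K>. P K" for \<K>
  proof -
    have eq: "{x \<in> topspace X. q x \<in> \<Union>\<K>} = \<Union>((\<lambda>K. {x \<in> topspace X. q x \<in> K}) ` \<K>)"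
      by blast
    show ?thesis
      using that unfolding P_def eq by (intro conjI openin_Union) blast+
  qed
  have "istopology P"
    unfolding istopology_def using P_Int P_Union by blast
  moreover have "quotient_topology X q = topology P"
    unfolding quotient_topology_def P_def ..
  ultimately show ?thesis
    by (simp only: topology_inverse' P_def)
qed

lemma topspace_quotient_topology: "topspace (quotient_topology X q) = q ` topspace X"
proof
  show "topspace (quotient_topology X q) \<subseteq> q ` topspace X"
    by (meson openin_quotient_topology openin_topspace)
  have "{x \<in> topspace X. q x \<in> q ` topspace X} = topspace X"
    by blast
  then have "openin (quotient_topology X q) (q ` topspace X)"
    by (simp only: openin_quotient_topology openin_topspace order_refl simp_thms)
  then show "q ` topspace X \<subseteq> topspace (quotient_topology X q)"
    by (rule openin_subset)
qed

lemma quotient_map_quotient_topology: "quotient_map X (quotient_topology X q) q"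
  unfolding quotient_map_def openin_quotient_topology topspace_quotient_topology by blast

definition cvec_space :: "nat \<Rightarrow> complex Matrix.vec topology" where
  "cvec_space n =
     pullback_topology (carrier_vec n) (\<lambda>v. \<lambda>i\<in>{..<n}. v $ i)
       (product_topology (\<lambda>_. euclidean) {..<n})"

definition cmat_space :: "nat \<Rightarrow> complex mat topology" where
  "cmat_space n =
     pullback_topology (carrier_mat n n) (\<lambda>A. \<lambda>ij\<in>{..<n} \<times> {..<n}. A $$ ij)
       (product_topology (\<lambda>_. euclidean) ({..<n} \<times> {..<n}))"

section \<open>Projective spaces\<close>

definition complex_line :: "complex Matrix.vec \<Rightarrow> complex Matrix.vec set" where
  "complex_line v = {c \<cdot>\<^sub>v v | c. True}"

text \<open>
  \<open>lines_space k\<close> is the space of complex lines through the origin of complex \<open>k\<close>-space, that is,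
  complex projective space of dimension \<open>k - 1\<close>.
\<close>

definition lines_space :: "nat \<Rightarrow> complex Matrix.vec set topology" where
  "lines_space k = quotient_topology (subtopology (cvec_space k) (- {0\<^sub>v k})) complex_line"

definition CP :: "nat \<Rightarrow> complex Matrix.vec set topology" where
  "CP n = lines_space (Suc n)"

definition CP_domain :: "nat \<Rightarrow> nat \<Rightarrow> complex Matrix.vec set set" where
  "CP_domain n i = {L \<in> topspace (CP n). \<exists>v\<in>L. v $ i \<noteq> 0}"

text \<open>The affine coordinates \<open>v\<^sub>j / v\<^sub>i\<close>, for \<open>j \<noteq> i\<close> in increasing order.\<close>

definition CP_chart :: "nat \<Rightarrow> nat \<Rightarrow> complex Matrix.vec set \<Rightarrow> complex Matrix.vec" where
  "CP_chart n i L =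
     (let v = (THE v. v \<in> L \<and> v $ i = 1)
      in Matrix.vec n (\<lambda>k. v $ (if k < i then k else Suc k)))"

section \<open>Vector bundles and their projectivizations\<close>

text \<open>
  A complex vector bundle is given by its transition functions: \<open>trans i j x\<close>, for \<open>x\<close> in
  \<open>cover i \<inter> cover j\<close>, converts fibre coordinates over \<open>cover j\<close> to fibre coordinates over \<open>cover i\<close>.
\<close>

record ('i, 'b) complex_bundle =
  base :: "'b topology"
  rank :: nat
  index :: "'i set"
  cover :: "'i \<Rightarrow> 'b set"
  trans :: "'i \<Rightarrow> 'i \<Rightarrow> 'b \<Rightarrow> complex mat"

text \<open>
  Total space of the fibre bundle with fibre \<open>F\<close> glued from the products \<open>U i \<times> F\<close> by means of
  transition functions \<open>g i j x\<close> acting on \<open>F\<close>.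
\<close>

definition glue_rel ::
    "'i set \<Rightarrow> ('i \<Rightarrow> 'b set) \<Rightarrow> 'f topology \<Rightarrow> ('i \<Rightarrow> 'i \<Rightarrow> 'b \<Rightarrow> 'f \<Rightarrow> 'f) \<Rightarrow>
      (('i \<times> 'b \<times> 'f) \<times> ('i \<times> 'b \<times> 'f)) set" where
  "glue_rel I U F g =
     {((j, x, y), (i, x, g i j x y)) | i j x y.
        i \<in> I \<and> j \<in> I \<and> x \<in> U i \<inter> U j \<and> y \<in> topspace F}"

definition glued_space ::
    "'b topology \<Rightarrow> 'i set \<Rightarrow> ('i \<Rightarrow> 'b set) \<Rightarrow> 'f topology \<Rightarrow> ('i \<Rightarrow> 'i \<Rightarrow> 'b \<Rightarrow> 'f \<Rightarrow> 'f) \<Rightarrow>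
      ('i \<times> 'b \<times> 'f) set topology" where
  "glued_space B I U F g =
     quotient_topology (sum_topology (\<lambda>i. prod_topology (subtopology B (U i)) F) I)
       (\<lambda>e. glue_rel I U F g `` {e})"

text \<open>The action of the class of \<open>A\<close> in the projective linear group on complex lines.\<close>

definition projective_map ::
    "complex mat \<Rightarrow> complex Matrix.vec set \<Rightarrow> complex Matrix.vec set" where
  "projective_map A L = (\<lambda>v. A *\<^sub>v v) ` L"

definition projectivization ::
    "('i, 'b) complex_bundle \<Rightarrow> ('i \<times> 'b \<times> complex Matrix.vec set) set topology" where
  "projectivization \<xi> =
     glued_space (base \<xi>) (index \<xi>) (cover \<xi>) (lines_space (rank \<xi>))
       (\<lambda>i j x. projective_map (trans \<xi> i j x))"

text \<open>
  The complex tangent bundle of a complex manifold with an atlas of charts \<open>\<phi> i\<close> from \<open>U i\<close> to complex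
  \<open>n\<close>-space has the holomorphic Jacobian matrices of the changes of charts as transition functions.
\<close>

definition complex_jacobian ::
    "nat \<Rightarrow> (complex Matrix.vec \<Rightarrow> complex Matrix.vec) \<Rightarrow> complex Matrix.vec \<Rightarrow> complex mat" where
  "complex_jacobian n f z =
     mat n n (\<lambda>(a, b). deriv (\<lambda>t. f (Matrix.vec n (\<lambda>c. if c = b then t else z $ c)) $ a) (z $ b))"

definition complex_tangent_bundle ::
    "'b topology \<Rightarrow> nat \<Rightarrow> 'i set \<Rightarrow> ('i \<Rightarrow> 'b set) \<Rightarrow> ('i \<Rightarrow> 'b \<Rightarrow> complex Matrix.vec) \<Rightarrow>
      ('i, 'b) complex_bundle" where
  "complex_tangent_bundle B n I U \<phi> =
     \<lparr>base = B, rank = n, index = I, cover = U,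
      trans = (\<lambda>i j x. complex_jacobian n (\<phi> i \<circ> the_inv_into (U j) (\<phi> j)) (\<phi> j x))\<rparr>"

definition tangent_bundle_CP :: "nat \<Rightarrow> (nat, complex Matrix.vec set) complex_bundle" where
  "tangent_bundle_CP n = complex_tangent_bundle (CP n) n {..n} (CP_domain n) (CP_chart n)"

section \<open>Homogeneous spaces of unitary groups\<close>

definition unitary_group :: "nat \<Rightarrow> complex mat monoid" where
  "unitary_group m =
     \<lparr>carrier = {A \<in> carrier_mat m m. mat_adjoint A * A = 1\<^sub>m m}, mult = (*), one = 1\<^sub>m m\<rparr>"

definition unitary_homogeneous_space :: "nat \<Rightarrow> complex mat set \<Rightarrow> complex mat set topology" where
  "unitary_homogeneous_space m H =
     quotient_topology (subtopology (cmat_space m) (carrier (unitary_group m)))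
       (\<lambda>A. A <#\<^bsub>unitary_group m\<^esub> H)"

definition block_unitary :: "nat \<Rightarrow> nat \<Rightarrow> nat \<Rightarrow> complex mat set" where
  "block_unitary a b c =
     {diag_block_mat [A, B, C] | A B C.
        A \<in> carrier (unitary_group a) \<and> B \<in> carrier (unitary_group b) \<and>
        C \<in> carrier (unitary_group c)}"

end

theory Submission
  imports Defs
begin

text \<open>
  The projectivized tangent bundle of \<open>CP\<^sup>n\<close> is the manifold of flags of a line and a plane
  containing it. In the chart \<open>i\<close>, a base line spanned by \<open>v\<close> and a tangent line spanned by \<open>w\<close>
  determine the line \<open>\<langle>u\<rangle>\<close>, where \<open>u\<close> is the component orthogonal to \<open>v\<close> of \<open>w\<close>, padded by 0 in
  position \<open>i\<close>. The Jacobian matrices of the changes of charts change the padded vector by a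
  nonzero factor and a multiple of \<open>v\<close>, so the pair of orthogonal projections onto \<open>\<langle>v\<rangle>\<close> and \<open>\<langle>u\<rangle>\<close>
  is a continuous injective function on the glued space. The pair of projections onto the first two
  columns of a unitary matrix is a complete invariant of its coset. Both spaces are compact, being
  images of the unitary group, and have the same image in the Hausdorff space of pairs of matrices;
  hence they are homeomorphic.

  Homeomorphic spaces have isomorphic algebras of polynomial forms, so it remains to exhibit one
  minimal model of the first space whose generators can be counted. In the class of all minimal
  systems of generators over \<open>A\<^sub>P\<^sub>L\<close> with vanishing relative cohomology below the degrees of the
  generators, a maximal element exists by Zorn's lemma and is a model, for otherwise a further
  generator could be attached. Path-connectedness enters through \<open>H\<^sup>0 = \<rat>\<close>.
\<close>

section \<open>Tensors\<close>

text \<open>The notion of rational homotopy type fixes the type of the generators, so a model must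
  be built explicitly enough to be counted. The construction works with pairs \<open>(z, a)\<close>
  of a cocycle \<open>z\<close> of the free algebra and an element \<open>a\<close> bounding its
  image, that is, with cocycles of the mapping cone. A single condition, \<open>rel_trivial\<close>,
  then covers both halves of a quasi-isomorphism: general pairs test injectivity, pairs
  \<open>(0, a)\<close> test surjectivity, and one kind of attachment removes either defect. New
  generators can create further relative classes of their own degree, for instance through products
  with generators of degree 1, so passing through the degrees once is not enough; Zorn's lemma
  absorbs the iteration.

  On the geometric side, a line has no continuous choice of a spanning vector, and a quotient
  topology gives no direct access to separation. Projection matrices settle both points: they vary
  continuously with the line and lie in a Hausdorff space.\<close>

lemma letters_zero [simp]: "letters 0 = []"
  by (simp add: zero_word_def)

lemma letters_plus [simp]: "letters (u + v) = letters u @ letters v"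
  by (simp add: plus_word_def)

lemma Word_letters [simp]: "Word (letters w) = w"
  by (cases w) simp

lemma word_degree_zero [simp]: "word_degree dg 0 = 0"
  and word_degree_plus [simp]: "word_degree dg (u + v) = word_degree dg u + word_degree dg v"
  and word_degree_Word [simp]: "word_degree dg (Word l) = sum_list (map dg l)"
  by (simp_all add: word_degree_def)

text \<open>The set \<open>W\<close> travels with the induction, so that support conditions such as
  those of \<open>tens\<close>, \<open>homog\<close> and \<open>long\<close> stay available for both
  summands.\<close>

lemma tensor_induct_keys [consumes 1, case_names zero single add]:
  fixes x :: "'g tensor"
  assumes "Poly_Mapping.keys x \<subseteq> W" and "P 0"
    and s: "\<And>w q. w \<in> W \<Longrightarrow> P (Poly_Mapping.single w q)"
    and a: "\<And>x y. P x \<Longrightarrow> P y \<Longrightarrow> Poly_Mapping.keys x \<subseteq> W \<Longrightarrow> Poly_Mapping.keys y \<subseteq> W \<Longrightarrow> P (x + y)"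
  shows "P x"
  using assms(1)
proof (induction x rule: Poly_Mapping.update_induct)
  case const show ?case by (rule assms(2))
next
  case (update f w q)
  have eq: "Poly_Mapping.update w q f = f + Poly_Mapping.single w q"
    using update(1) by (intro poly_mapping_eqI)
      (auto simp: lookup_update lookup_add lookup_single when_def not_in_keys_iff_lookup_eq_zero)
  have k: "Poly_Mapping.keys (Poly_Mapping.update w q f) = insert w (Poly_Mapping.keys f)"
    using update(2) by (simp add: keys_update)
  then show ?case
    using update k by (auto simp: eq intro!: a s split: if_splits)
qed

lemma tensor_induct [case_names zero single add]:
  fixes x :: "'g tensor"
  assumes "P 0" "\<And>w q. P (Poly_Mapping.single w q)" "\<And>x y. P x \<Longrightarrow> P y \<Longrightarrow> P (x + y)"
  shows "P x"
  by (rule tensor_induct_keys[of x UNIV P]) (use assms in auto)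

text \<open>Identities between maps defined word by word come down to monomials; additivity is all
  that is asked, because coefficients are absorbed into the monomial.\<close>

lemma tensor_additive_eqI:
  fixes f g :: "'g tensor \<Rightarrow> 'b::ab_group_add"
  assumes f: "\<And>x y. f (x + y) = f x + f y" and g: "\<And>x y. g (x + y) = g x + g y"
    and s: "\<And>w q. w \<in> Poly_Mapping.keys x \<Longrightarrow> f (Poly_Mapping.single w q) = g (Poly_Mapping.single w q)"
  shows "f x = g x"
proof -
  have "f 0 = 0" "g 0 = 0"
    using f[of 0 0] g[of 0 0] by auto
  then show ?thesis
    by (intro tensor_induct_keys[of x "Poly_Mapping.keys x" "\<lambda>x. f x = g x"]) (auto simp: f g s)
qed

lemma scalar_add: "scalar (p + q) = scalar p + scalar q"
  and scalar_mult: "scalar (p * q) = scalar p * scalar q"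
  and scalar_uminus: "scalar (- q) = - scalar q"
  and scalar_0 [simp]: "scalar 0 = 0"
  and scalar_1 [simp]: "scalar 1 = 1"
  by (simp_all add: scalar_def single_add mult_single single_uminus)

lemma scalar_mult_single: "scalar q * Poly_Mapping.single w r = Poly_Mapping.single w (q * r)"
  by (simp add: scalar_def mult_single)

lemma single_mult_scalar: "Poly_Mapping.single w r * scalar q = Poly_Mapping.single w (q * r)"
  by (simp add: scalar_def mult_single mult.commute)

lemma scalar_commute: "x * scalar q = scalar q * x"
  by (rule tensor_additive_eqI[where x=x and f="\<lambda>x. x * scalar q" and g="\<lambda>x. scalar q * x"])
    (simp_all add: algebra_simps scalar_mult_single single_mult_scalar)

lemma scalar_left_commute: "x * (scalar q * y) = scalar q * (x * y)"
  by (metis mult.assoc scalar_commute)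

lemma single_eq: "Poly_Mapping.single w q = scalar q * Poly_Mapping.single w 1"
  by (simp add: scalar_mult_single)

lemma single_Word_append:
  "Poly_Mapping.single (Word (k @ l)) (1::rat) = Poly_Mapping.single (Word k) 1 * Poly_Mapping.single (Word l) 1"
  by (simp add: mult_single plus_word_def)

lemma single_Word_Nil: "Poly_Mapping.single (Word []) (1::rat) = 1"
  by (metis single_one zero_word_def)

lemma single_Word_Cons:
  "Poly_Mapping.single (Word (v # l)) (1::rat) = letter v * Poly_Mapping.single (Word l) 1"
  by (simp add: letter_def mult_single plus_word_def)

lemma scalar_eq_iff: "scalar p = scalar q \<longleftrightarrow> p = q"
  unfolding scalar_def by (metis lookup_single_eq)

lemma keys_scalar_mult: "Poly_Mapping.keys (scalar q * x) \<subseteq> Poly_Mapping.keys x"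
proof -
  have "Poly_Mapping.keys (scalar q * x) \<subseteq> {a + b | a b. a \<in> Poly_Mapping.keys (scalar q) \<and> b \<in> Poly_Mapping.keys x}"
    by (rule keys_mult)
  also have "\<dots> \<subseteq> Poly_Mapping.keys x"
    by (auto simp: scalar_def split: if_splits)
  finally show ?thesis .
qed

section \<open>Linear extension from words\<close>

definition lin :: "('g word \<Rightarrow> 'h tensor) \<Rightarrow> 'g tensor \<Rightarrow> 'h tensor" where
  "lin f x = (\<Sum>w\<in>Poly_Mapping.keys x. scalar (Poly_Mapping.lookup x w) * f w)"

text \<open>Two summands have different supports, so additivity requires writing all sums over one
  common finite set.\<close>

lemma lin_superset:
  assumes "finite W" "Poly_Mapping.keys x \<subseteq> W"
  shows "lin f x = (\<Sum>w\<in>W. scalar (Poly_Mapping.lookup x w) * f w)"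
  unfolding lin_def using assms
  by (intro sum.mono_neutral_left) (auto simp: not_in_keys_iff_lookup_eq_zero)

lemma lin_add [simp]: "lin f (x + y) = lin f x + lin f y"
proof -
  let ?W = "Poly_Mapping.keys x \<union> Poly_Mapping.keys y"
  have W: "finite ?W" "Poly_Mapping.keys (x + y) \<subseteq> ?W"
    using keys_add[of x y] by auto
  have "lin f (x + y) = (\<Sum>w\<in>?W. scalar (Poly_Mapping.lookup (x + y) w) * f w)"
    by (rule lin_superset) (use W in auto)
  also have "\<dots> = (\<Sum>w\<in>?W. scalar (Poly_Mapping.lookup x w) * f w) + (\<Sum>w\<in>?W. scalar (Poly_Mapping.lookup y w) * f w)"
    by (simp add: lookup_add scalar_add distrib_right sum.distrib)
  also have "\<dots> = lin f x + lin f y"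
    by (subst (1 2) lin_superset[of ?W]) auto
  finally show ?thesis .
qed

lemma lin_single [simp]: "lin f (Poly_Mapping.single w q) = scalar q * f w"
  by (auto simp: lin_def)

lemma lin_0 [simp]: "lin f 0 = 0"
  by (simp add: lin_def)

lemma lin_uminus [simp]: "lin f (- x) = - lin f x"
  by (metis add.right_inverse add_eq_0_iff lin_0 lin_add)

lemma lin_diff [simp]: "lin f (x - y) = lin f x - lin f y"
  by (metis lin_add lin_uminus diff_conv_add_uminus)

lemma lin_sum: "lin f (\<Sum>i\<in>A. x i) = (\<Sum>i\<in>A. lin f (x i))"
  by (induction A rule: infinite_finite_induct) auto

lemma lin_scalar [simp]: "lin f (scalar q * x) = scalar q * lin f x"
  by (rule tensor_additive_eqI[where x=x and f="\<lambda>x. lin f (scalar q * x)" and g="\<lambda>x. scalar q * lin f x"])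
    (simp_all add: algebra_simps scalar_mult_single scalar_mult, metis scalar_left_commute)

lemma lin_letter [simp]: "lin f (letter v) = f (Word [v])"
  by (simp add: letter_def)

lemma lin_1 [simp]: "lin f 1 = f 0"
  by (metis lin_single mult_1 scalar_1 single_one)

text \<open>The algebra homomorphism out of the free associative algebra with prescribed values on
  letters. Pullback of forms, the sign involution, renaming of generators and evaluation at a vertex
  are all instances.\<close>

definition subst :: "('g \<Rightarrow> 'h tensor) \<Rightarrow> 'g tensor \<Rightarrow> 'h tensor" where
  "subst \<phi> = lin (\<lambda>w. prod_list (map \<phi> (letters w)))"

lemma subst_simps [simp]:
  "subst \<phi> (x + y) = subst \<phi> x + subst \<phi> y" "subst \<phi> (x - y) = subst \<phi> x - subst \<phi> y"
  "subst \<phi> (- x) = - subst \<phi> x"  "subst \<phi> 0 = 0" "subst \<phi> 1 = 1" "subst \<phi> (letter v) = \<phi> v"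
  "subst \<phi> (scalar q) = scalar q"
  "subst \<phi> (Poly_Mapping.single w q) = scalar q * prod_list (map \<phi> (letters w))"
  "subst \<phi> (sum f A) = (\<Sum>i\<in>A. subst \<phi> (f i))"
  unfolding subst_def using lin_scalar[of "\<lambda>w. prod_list (map \<phi> (letters w))" q 1] by (simp_all add: lin_sum del: lin_scalar)

lemma subst_mult [simp]: "subst \<phi> (x * y) = subst \<phi> x * subst \<phi> y"
proof (rule tensor_additive_eqI[where x=x and f="\<lambda>x. subst \<phi> (x * y)" and g="\<lambda>x. subst \<phi> x * subst \<phi> y"])
  fix w q
  show "subst \<phi> (Poly_Mapping.single w q * y) = subst \<phi> (Poly_Mapping.single w q) * subst \<phi> y"
    by (rule tensor_additive_eqI[where x=y and f="\<lambda>y. subst \<phi> (_ * y)" and g="\<lambda>y. _ * subst \<phi> y"])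
      (simp_all add: algebra_simps mult_single scalar_mult, metis scalar_left_commute)
qed (simp_all add: algebra_simps)

lemma subst_subst: "subst \<phi> (subst \<psi> x) = subst (\<lambda>v. subst \<phi> (\<psi> v)) x"
proof (rule tensor_additive_eqI[where x=x and f="\<lambda>x. subst \<phi> (subst \<psi> x)" and g="subst (\<lambda>v. subst \<phi> (\<psi> v))"])
  fix w q
  have "subst \<phi> (prod_list (map \<psi> l)) = prod_list (map (\<lambda>v. subst \<phi> (\<psi> v)) l)" for l
    by (induction l) auto
  then show "subst \<phi> (subst \<psi> (Poly_Mapping.single w q)) = subst (\<lambda>v. subst \<phi> (\<psi> v)) (Poly_Mapping.single w q)"
    by simp
qed auto

lemma prod_list_letters: "prod_list (map letter l) = Poly_Mapping.single (Word l) 1"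
  by (induction l) (simp_all add: single_Word_Nil single_Word_Cons)

lemma subst_letter [simp]: "subst letter x = x"
  by (rule tensor_additive_eqI[where x=x and f="subst letter" and g="\<lambda>x. x"])
    (auto simp: prod_list_letters scalar_mult_single)

section \<open>Tensors supported on a set of letters\<close>

definition tens :: "'g set \<Rightarrow> 'g tensor set" where
  "tens S = {x. \<forall>w\<in>Poly_Mapping.keys x. set (letters w) \<subseteq> S}"

lemma tens_mono: "S \<subseteq> T \<Longrightarrow> tens S \<subseteq> tens T"
  unfolding tens_def by blast

lemma tens_UNIV [simp]: "tens UNIV = UNIV"
  by (simp add: tens_def)

lemma tens_induct [consumes 1, case_names zero single add]:
  assumes "x \<in> tens S" "P 0"
    "\<And>l q. set l \<subseteq> S \<Longrightarrow> P (Poly_Mapping.single (Word l) q)"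
    "\<And>x y. P x \<Longrightarrow> P y \<Longrightarrow> x \<in> tens S \<Longrightarrow> y \<in> tens S \<Longrightarrow> P (x + y)"
  shows "P x"
proof (rule tensor_induct_keys[of x "{w. set (letters w) \<subseteq> S}"])
  fix w :: "'a word" and q assume "w \<in> {w. set (letters w) \<subseteq> S}"
  then show "P (Poly_Mapping.single w q)" using assms(3)[of "letters w"] by simp
next
  fix x y :: "'a tensor"
  assume "P x" "P y" "Poly_Mapping.keys x \<subseteq> {w. set (letters w) \<subseteq> S}" "Poly_Mapping.keys y \<subseteq> {w. set (letters w) \<subseteq> S}"
  then show "P (x + y)" by (intro assms(4)) (auto simp: tens_def)
qed (use assms in \<open>auto simp: tens_def\<close>)

lemma tens_0 [simp]: "0 \<in> tens S"
  and tens_single: "set (letters w) \<subseteq> S \<Longrightarrow> Poly_Mapping.single w q \<in> tens S"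
  and tens_letter: "v \<in> S \<Longrightarrow> letter v \<in> tens S"
  and tens_scalar [simp]: "scalar q \<in> tens S"
  and tens_1 [simp]: "1 \<in> tens S"
  by (auto simp: tens_def letter_def scalar_def split: if_splits)

lemma tens_add: "x \<in> tens S \<Longrightarrow> y \<in> tens S \<Longrightarrow> x + y \<in> tens S"
  unfolding tens_def using keys_add[of x y] by blast

lemma tens_uminus: "x \<in> tens S \<Longrightarrow> - x \<in> tens S"
  unfolding tens_def by (auto simp: in_keys_iff)

lemma tens_diff: "x \<in> tens S \<Longrightarrow> y \<in> tens S \<Longrightarrow> x - y \<in> tens S"
  by (metis diff_conv_add_uminus tens_add tens_uminus)

lemma tens_mult: "x \<in> tens S \<Longrightarrow> y \<in> tens S \<Longrightarrow> x * y \<in> tens S"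
  unfolding tens_def using keys_mult[of x y] by fastforce

lemma tens_sum: "(\<And>i. i \<in> A \<Longrightarrow> f i \<in> tens S) \<Longrightarrow> sum f A \<in> tens S"
  by (induction A rule: infinite_finite_induct) (auto intro: tens_add)

lemma tens_prod_list: "(\<And>x. x \<in> set l \<Longrightarrow> x \<in> tens S) \<Longrightarrow> prod_list l \<in> tens S"
  by (induction l) (auto intro: tens_mult)

lemmas tens_intros = tens_add tens_diff tens_uminus tens_mult tens_sum tens_letter

lemma lin_tens:
  assumes "x \<in> tens S" "\<And>w. set (letters w) \<subseteq> S \<Longrightarrow> f w \<in> tens T"
  shows "lin f x \<in> tens T"
  using assms unfolding lin_def by (auto intro!: tens_sum tens_mult simp: tens_def[of S])

lemma subst_tens:
  assumes "x \<in> tens S" "\<And>v. v \<in> S \<Longrightarrow> \<phi> v \<in> tens T"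
  shows "subst \<phi> x \<in> tens T"
  unfolding subst_def using assms by (intro lin_tens tens_prod_list) auto

lemma lin_cong:
  assumes "x \<in> tens S" "\<And>w. set (letters w) \<subseteq> S \<Longrightarrow> f w = g w"
  shows "lin f x = lin g x"
  using assms unfolding lin_def by (auto intro!: sum.cong simp: tens_def)

lemma subst_cong:
  assumes "x \<in> tens S" "\<And>v. v \<in> S \<Longrightarrow> \<phi> v = \<psi> v"
  shows "subst \<phi> x = subst \<psi> x"
  unfolding subst_def using assms
  by (intro lin_cong[OF assms(1)] arg_cong[where f=prod_list] map_cong) auto

section \<open>Homogeneous tensors and components\<close>

definition homog :: "('g \<Rightarrow> nat) \<Rightarrow> nat \<Rightarrow> 'g tensor set" where
  "homog dg p = {x. \<forall>w\<in>Poly_Mapping.keys x. word_degree dg w = p}"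

lemma homog_0 [simp]: "0 \<in> homog dg p"
  and homog_single: "word_degree dg w = p \<Longrightarrow> Poly_Mapping.single w q \<in> homog dg p"
  and homog_letter: "dg v = p \<Longrightarrow> letter v \<in> homog dg p"
  and homog_scalar [simp]: "scalar q \<in> homog dg 0"
  and homog_1 [simp]: "1 \<in> homog dg 0"
  by (auto simp: homog_def letter_def scalar_def split: if_splits)

lemma homog_add: "x \<in> homog dg p \<Longrightarrow> y \<in> homog dg p \<Longrightarrow> x + y \<in> homog dg p"
  unfolding homog_def using keys_add[of x y] by blast

lemma homog_uminus: "x \<in> homog dg p \<Longrightarrow> - x \<in> homog dg p"
  unfolding homog_def by (auto simp: in_keys_iff)

lemma homog_diff: "x \<in> homog dg p \<Longrightarrow> y \<in> homog dg p \<Longrightarrow> x - y \<in> homog dg p"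
  by (metis diff_conv_add_uminus homog_add homog_uminus)

lemma homog_mult: "x \<in> homog dg p \<Longrightarrow> y \<in> homog dg q \<Longrightarrow> x * y \<in> homog dg (p + q)"
  unfolding homog_def using keys_mult[of x y] by fastforce

lemma homog_scalar_mult: "x \<in> homog dg p \<Longrightarrow> scalar q * x \<in> homog dg p"
  using homog_mult[OF homog_scalar] by fastforce

lemma homog_sum: "(\<And>i. i \<in> A \<Longrightarrow> f i \<in> homog dg p) \<Longrightarrow> sum f A \<in> homog dg p"
  by (induction A rule: infinite_finite_induct) (auto intro: homog_add)

lemma homog_induct [consumes 2, case_names zero single add]:
  assumes "x \<in> tens S" "x \<in> homog dg p" "P 0"
    "\<And>l q. set l \<subseteq> S \<Longrightarrow> sum_list (map dg l) = p \<Longrightarrow> P (Poly_Mapping.single (Word l) q)"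
    "\<And>x y. P x \<Longrightarrow> P y \<Longrightarrow> x \<in> tens S \<Longrightarrow> y \<in> tens S \<Longrightarrow> x \<in> homog dg p \<Longrightarrow> y \<in> homog dg p \<Longrightarrow> P (x + y)"
  shows "P x"
proof (rule tensor_induct_keys[of x "{w. set (letters w) \<subseteq> S \<and> word_degree dg w = p}"])
  fix w :: "'a word" and q assume "w \<in> {w. set (letters w) \<subseteq> S \<and> word_degree dg w = p}"
  then show "P (Poly_Mapping.single w q)" using assms(4)[of "letters w"] by (simp add: word_degree_def)
next
  fix x y :: "'a tensor"
  assume "P x" "P y" "Poly_Mapping.keys x \<subseteq> {w. set (letters w) \<subseteq> S \<and> word_degree dg w = p}"
    "Poly_Mapping.keys y \<subseteq> {w. set (letters w) \<subseteq> S \<and> word_degree dg w = p}"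
  then show "P (x + y)" by (intro assms(5)) (auto simp: tens_def homog_def)
qed (use assms in \<open>auto simp: tens_def homog_def\<close>)

definition hcomp :: "('g \<Rightarrow> nat) \<Rightarrow> nat \<Rightarrow> 'g tensor \<Rightarrow> 'g tensor" where
  "hcomp dg p = lin (\<lambda>w. if word_degree dg w = p then Poly_Mapping.single w 1 else 0)"

lemma hcomp_add: "hcomp dg p (x + y) = hcomp dg p x + hcomp dg p y"
  and hcomp_diff: "hcomp dg p (x - y) = hcomp dg p x - hcomp dg p y"
  and hcomp_0 [simp]: "hcomp dg p 0 = 0"
  and hcomp_sum: "hcomp dg p (sum f A) = (\<Sum>i\<in>A. hcomp dg p (f i))"
  by (simp_all add: hcomp_def lin_sum)

lemma hcomp_single: "hcomp dg p (Poly_Mapping.single w q) = (if word_degree dg w = p then Poly_Mapping.single w q else 0)"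
  by (simp add: hcomp_def scalar_mult_single)

lemma hcomp_homog: "x \<in> homog dg q \<Longrightarrow> hcomp dg p x = (if p = q then x else 0)"
proof (rule tensor_induct_keys[of x "{w. word_degree dg w = q}" "\<lambda>x. hcomp dg p x = (if p = q then x else 0)"])
qed (auto simp: homog_def hcomp_single hcomp_add)

lemma homog_hcomp: "hcomp dg p x \<in> homog dg p"
  by (induction x rule: tensor_induct) (auto simp: hcomp_add hcomp_single homog_add homog_single)

lemma hcomp_tens: "x \<in> tens S \<Longrightarrow> hcomp dg p x \<in> tens S"
  unfolding hcomp_def by (erule lin_tens) (auto intro: tens_single)

lemma hcomp_decomposition:
  assumes "finite P" "word_degree dg ` Poly_Mapping.keys x \<subseteq> P"
  shows "x = (\<Sum>p\<in>P. hcomp dg p x)"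
proof (rule tensor_additive_eqI[where x=x and f="\<lambda>x. x" and g="\<lambda>x. \<Sum>p\<in>P. hcomp dg p x"])
  fix w q assume "w \<in> Poly_Mapping.keys x"
  then have "word_degree dg w \<in> P" using assms(2) by auto
  then show "Poly_Mapping.single w q = (\<Sum>p\<in>P. hcomp dg p (Poly_Mapping.single w q))"
    using assms(1) by (simp add: hcomp_single)
qed (simp_all add: hcomp_add sum.distrib)

lemma hcomp_eq_0: "p \<notin> word_degree dg ` Poly_Mapping.keys x \<Longrightarrow> hcomp dg p x = 0"
  unfolding hcomp_def lin_def by (auto intro!: sum.neutral)

subsection \<open>Antiderivations\<close>

text \<open>With this sign involution on the left factor the graded Leibniz rule
  \<open>der_mult\<close> holds for inhomogeneous left factors as well.\<close>

definition invol :: "('g \<Rightarrow> nat) \<Rightarrow> 'g tensor \<Rightarrow> 'g tensor" where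
  "invol dg = subst (\<lambda>v. scalar ((-1) ^ dg v) * letter v)"

lemma invol_single: "invol dg (Poly_Mapping.single w q) = scalar ((-1) ^ word_degree dg w) * Poly_Mapping.single w q"
proof -
  have "prod_list (map (\<lambda>v. scalar ((-1) ^ dg v) * letter v) l) = scalar ((-1) ^ sum_list (map dg l)) * Poly_Mapping.single (Word l) 1" for l
  proof (induction l)
    case (Cons v l)
    then show ?case
      by (simp add: single_Word_Cons power_add scalar_mult mult.assoc
          scalar_left_commute[of "letter v" "(-1) ^ sum_list (map dg l)"])
  qed (simp add: single_Word_Nil)
  from this[of "letters w"] show ?thesis
    unfolding invol_def by (simp add: word_degree_def scalar_mult_single mult.commute flip: mult.assoc)
qed

lemma invol_homog: "x \<in> homog dg p \<Longrightarrow> invol dg x = scalar ((-1) ^ p) * x"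
proof (rule tensor_induct_keys[of x "{w. word_degree dg w = p}" "\<lambda>x. invol dg x = scalar ((-1) ^ p) * x"])
qed (auto simp: homog_def invol_single, simp_all add: invol_def distrib_left)

lemma invol_simps [simp]:
  "invol dg (x + y) = invol dg x + invol dg y" "invol dg (x - y) = invol dg x - invol dg y"
  "invol dg (x * y) = invol dg x * invol dg y" "invol dg 0 = 0" "invol dg (scalar q) = scalar q" "invol dg 1 = 1"
  "invol dg (- x) = - invol dg x"
  by (simp_all add: invol_def)

lemma invol_tens: "x \<in> tens S \<Longrightarrow> invol dg x \<in> tens S"
  unfolding invol_def by (erule subst_tens) (auto intro: tens_intros)

lemma invol_invol [simp]: "invol dg (invol dg x) = x"
  by (rule tensor_additive_eqI[where x=x and f="\<lambda>x. invol dg (invol dg x)" and g="\<lambda>x. x"])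
    (simp_all add: invol_single flip: mult.assoc scalar_mult power_mult_distrib)

text \<open>The Leibniz rule read as a recursion from the left; \<open>pl_diff_letters\<close> is
  the case of polynomial forms. The degrees of the values are left open, so that the same operator
  serves the differential and the contraction used for closed functions.\<close>

fun der_list :: "('g \<Rightarrow> nat) \<Rightarrow> ('g \<Rightarrow> 'g tensor) \<Rightarrow> 'g list \<Rightarrow> 'g tensor" where
  "der_list dg \<delta> [] = 0"
| "der_list dg \<delta> (v # l) = \<delta> v * Poly_Mapping.single (Word l) 1 + scalar ((-1) ^ dg v) * letter v * der_list dg \<delta> l"

definition der :: "('g \<Rightarrow> nat) \<Rightarrow> ('g \<Rightarrow> 'g tensor) \<Rightarrow> 'g tensor \<Rightarrow> 'g tensor" where
  "der dg \<delta> = lin (\<lambda>w. der_list dg \<delta> (letters w))"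

lemma der_simps [simp]:
  "der dg \<delta> (x + y) = der dg \<delta> x + der dg \<delta> y" "der dg \<delta> (x - y) = der dg \<delta> x - der dg \<delta> y"
  "der dg \<delta> (- x) = - der dg \<delta> x" "der dg \<delta> 0 = 0"
  "der dg \<delta> (sum f A) = (\<Sum>i\<in>A. der dg \<delta> (f i))"
  "der dg \<delta> (scalar q * x) = scalar q * der dg \<delta> x"
  "der dg \<delta> (Poly_Mapping.single w q) = scalar q * der_list dg \<delta> (letters w)"
  "der dg \<delta> (letter v) = \<delta> v" "der dg \<delta> 1 = 0" "der dg \<delta> (scalar q) = 0"
  using lin_scalar[of "\<lambda>w. der_list dg \<delta> (letters w)" q 1] by (simp_all add: der_def lin_sum single_Word_Nil)

text \<open>Passing the whole word \<open>k\<close> collects its total sign, which is the involution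
  applied to \<open>k\<close>. This is the Leibniz rule on words.\<close>

lemma der_list_append:
  "der_list dg \<delta> (k @ l) = der_list dg \<delta> k * Poly_Mapping.single (Word l) 1 +
     invol dg (Poly_Mapping.single (Word k) 1) * der_list dg \<delta> l"
proof (induction k)
  case Nil then show ?case by (simp add: single_Word_Nil)
next
  case (Cons v k)
  have "invol dg (Poly_Mapping.single (Word (v # k)) 1) = scalar ((-1) ^ dg v) * letter v * invol dg (Poly_Mapping.single (Word k) 1)"
    unfolding single_Word_Cons invol_simps by (simp add: invol_def)
  then show ?case
    using Cons by (simp add: single_Word_append algebra_simps)
qed

lemma der_mult: "der dg \<delta> (x * y) = der dg \<delta> x * y + invol dg x * der dg \<delta> y"
proof (rule tensor_additive_eqI[where x=x and f="\<lambda>x. der dg \<delta> (x * y)" and g="\<lambda>x. der dg \<delta> x * y + invol dg x * der dg \<delta> y"])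
  fix w q
  show "der dg \<delta> (Poly_Mapping.single w q * y) = der dg \<delta> (Poly_Mapping.single w q) * y + invol dg (Poly_Mapping.single w q) * der dg \<delta> y"
  proof (rule tensor_additive_eqI[where x=y and f="\<lambda>y. der dg \<delta> (_ * y)" and g="\<lambda>y. _ * y + _ * der dg \<delta> y"])
    fix v r
    have *: "scalar (q * r) * der_list dg \<delta> (letters w @ letters v) =
      scalar q * der_list dg \<delta> (letters w) * Poly_Mapping.single v r +
       invol dg (Poly_Mapping.single w q) * (scalar r * der_list dg \<delta> (letters v))"
      unfolding der_list_append single_eq[of v r] single_eq[of w q] invol_simps scalar_mult
      by (simp add: distrib_left mult.assoc scalar_left_commute[of "der_list dg \<delta> (letters w)" r]
          scalar_left_commute[of "invol dg (Poly_Mapping.single w 1)" r])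
    then show "der dg \<delta> (Poly_Mapping.single w q * Poly_Mapping.single v r) =
        der dg \<delta> (Poly_Mapping.single w q) * Poly_Mapping.single v r +
        invol dg (Poly_Mapping.single w q) * der dg \<delta> (Poly_Mapping.single v r)"
      by (simp add: mult_single)
  qed (simp_all add: algebra_simps)
qed (simp_all add: algebra_simps)

lemma der_list_tens: "(\<And>v. v \<in> S \<Longrightarrow> \<delta> v \<in> tens S) \<Longrightarrow> set l \<subseteq> S \<Longrightarrow> der_list dg \<delta> l \<in> tens S"
  by (induction l) (auto intro!: tens_intros tens_single)

lemma der_tens: "x \<in> tens S \<Longrightarrow> (\<And>v. v \<in> S \<Longrightarrow> \<delta> v \<in> tens S) \<Longrightarrow> der dg \<delta> x \<in> tens S"
  unfolding der_def by (erule lin_tens) (auto intro: der_list_tens)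

lemma der_list_homog:
  assumes "\<And>v. v \<in> S \<Longrightarrow> \<delta> v \<in> homog dg (Suc (dg v))" "set l \<subseteq> S"
  shows "der_list dg \<delta> l \<in> homog dg (Suc (sum_list (map dg l)))"
  using assms(2)
proof (induction l)
  case (Cons v l)
  have "\<delta> v * Poly_Mapping.single (Word l) 1 \<in> homog dg (Suc (dg v) + sum_list (map dg l))"
    using assms(1) Cons by (intro homog_mult homog_single) auto
  moreover have "letter v * der_list dg \<delta> l \<in> homog dg (dg v + Suc (sum_list (map dg l)))"
    using Cons by (intro homog_mult homog_letter) auto
  ultimately show ?case
    by (auto intro!: homog_add homog_scalar_mult simp: mult.assoc)
qed simp

lemma der_homog:
  assumes "x \<in> tens S" "x \<in> homog dg p" "\<And>v. v \<in> S \<Longrightarrow> \<delta> v \<in> homog dg (Suc (dg v))"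
  shows "der dg \<delta> x \<in> homog dg (Suc p)"
  using assms(1,2)
proof (induction rule: homog_induct)
  case (single l q)
  then show ?case using der_list_homog[OF assms(3), of S l] by (auto intro: homog_scalar_mult)
qed (auto intro: homog_add)

section \<open>Commutative differential graded algebras\<close>

lemma cring_rat_ring: "cring rat_ring"
  by (intro cringI abelian_groupI comm_monoidI) (auto simp: algebra_simps intro: exI[of _ "- _"])

context cdga
begin

lemma ring_A: "ring A"
  by intro_locales

lemmas A_one_closed = monoid.one_closed[OF ring.is_monoid[OF ring_A]]
  and A_finsum_closed = abelian_monoid.finsum_closed[OF abelian_group.axioms(1)[OF ring.is_abelian_group[OF ring_A]]]
  and A_finsum_insert = abelian_monoid.finsum_insert[OF abelian_group.axioms(1)[OF ring.is_abelian_group[OF ring_A]]]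

lemma smult_carrier [simp, intro]: "x \<in> carrier A \<Longrightarrow> c \<odot> x \<in> carrier A"
  using smult_closed[of c x] by simp

lemma smult_add: "x \<in> carrier A \<Longrightarrow> (b + c) \<odot> x = b \<odot> x \<oplus> c \<odot> x"
  using smult_l_distr[of b c x] by simp

lemma smult_smult: "x \<in> carrier A \<Longrightarrow> b \<odot> (c \<odot> x) = (b * c) \<odot> x"
  using smult_assoc1[of b c x] by simp

lemma smult_1 [simp]: "x \<in> carrier A \<Longrightarrow> 1 \<odot> x = x"
  using smult_one[of x] by simp

lemma smult_0 [simp]: "x \<in> carrier A \<Longrightarrow> 0 \<odot> x = \<zero>"
  using smult_l_null[of x] by simp

lemma smult_zero [simp]: "c \<odot> \<zero> = \<zero>"
  using smult_r_null[of c] by simp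

lemma smult_right_add: "x \<in> carrier A \<Longrightarrow> y \<in> carrier A \<Longrightarrow> c \<odot> (x \<oplus> y) = c \<odot> x \<oplus> c \<odot> y"
  using smult_r_distr[of c x y] by simp

lemma smult_minus_one: "x \<in> carrier A \<Longrightarrow> (-1) \<odot> x = \<ominus> x"
  using smult_add[of x "-1" 1] abelian_group.minus_equality[OF ring.is_abelian_group[OF ring_A], of "(-1) \<odot> x" x]
  by simp

lemma grade_carrier: "x \<in> grade A p \<Longrightarrow> x \<in> carrier A"
  using submoduleE(1)[OF grade_submodule] by blast

lemma grade_add: "x \<in> grade A p \<Longrightarrow> y \<in> grade A p \<Longrightarrow> x \<oplus> y \<in> grade A p"
  using submoduleE(5)[OF grade_submodule] by blast

lemma grade_smult: "x \<in> grade A p \<Longrightarrow> c \<odot> x \<in> grade A p"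
  using submoduleE(4)[OF grade_submodule, of c] by simp

lemma grade_a_inv: "x \<in> grade A p \<Longrightarrow> \<ominus> x \<in> grade A p"
  using submoduleE(3)[OF grade_submodule] by blast

lemma grade_zero [simp]: "\<zero> \<in> grade A p"
  using subgroup.one_closed[OF submodule.axioms(1)[OF grade_submodule]] by simp

lemma grade_minus: "x \<in> grade A p \<Longrightarrow> y \<in> grade A p \<Longrightarrow> x \<ominus> y \<in> grade A p"
  unfolding a_minus_def by (intro grade_add grade_a_inv)

lemma finsum_graded_carrier:
  assumes "\<And>p. f p \<in> grade A p"
  shows "finsum A f P \<in> carrier A"
  using assms grade_carrier by (intro A_finsum_closed) auto

text \<open>The axioms place the differential of homogeneous elements only; a general element is the
  finite sum of its components.\<close>

lemma diff_carrier [simp, intro]: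
  assumes "x \<in> carrier A"
  shows "diff A x \<in> carrier A"
proof -
  have *: "diff A (finsum A f P) \<in> carrier A" if "finite P" "\<And>p. f p \<in> grade A p" for f :: "nat \<Rightarrow> 'a" and P
    using that(1)
  proof (induction P)
    case empty
    then show ?case using diff_grade[OF grade_zero, of 0] grade_carrier by simp
  next
    case (insert p P)
    have "diff A (f p) \<in> carrier A" using diff_grade[OF that(2)] grade_carrier by blast
    moreover have "finsum A f (insert p P) = f p \<oplus> finsum A f P"
      using insert that(2) grade_carrier by (intro A_finsum_insert) auto
    ultimately show ?case
      using insert grade_carrier[OF that(2)] finsum_graded_carrier[of f P, OF that(2)] by (simp add: diff_add)
  qed
  obtain f where "\<forall>p. f p \<in> grade A p" "finite {p. f p \<noteq> \<zero>}" "x = finsum A f {p. f p \<noteq> \<zero>}"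
    using grade_direct_sum[OF assms] by blast
  then show ?thesis using *[of "{p. f p \<noteq> \<zero>}" f] by simp
qed

lemma diff_zero [simp]: "diff A \<zero> = \<zero>"
  using diff_smult[of \<zero> 0] by simp

lemma diff_a_inv: "x \<in> carrier A \<Longrightarrow> diff A (\<ominus> x) = \<ominus> diff A x"
  using diff_smult[of x "-1"] smult_minus_one by auto

lemma diff_minus: "x \<in> carrier A \<Longrightarrow> y \<in> carrier A \<Longrightarrow> diff A (x \<ominus> y) = diff A x \<ominus> diff A y"
  unfolding a_minus_def by (simp add: diff_add diff_a_inv)

text \<open>Applied to 1 = 1 * 1, the Leibniz rule gives d 1 = d 1 + d 1.\<close>

lemma diff_one: "diff A \<one> = \<zero>"
proof -
  have "diff A (\<one> \<otimes> \<one>) = diff A \<one> \<otimes> \<one> \<oplus> (-1) ^ 0 \<odot> (\<one> \<otimes> diff A \<one>)"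
    by (rule diff_mult[OF one_grade A_one_closed])
  then have "diff A \<one> = diff A \<one> \<oplus> diff A \<one>" by simp
  then show ?thesis
    using group.l_cancel_one[OF abelian_group.a_group[OF ring.is_abelian_group[OF ring_A]], of "diff A \<one>" "diff A \<one>"]
      A_one_closed diff_carrier[of \<one>] by simp
qed

end

section \<open>Algebras by generators and relations\<close>

text \<open>The two-sided ideal as the span of word multiples of \<open>K\<close>. Unlike
  \<open>genideal\<close>, an intersection of ideals, it comes with an induction rule. One scalar on
  the left suffices since scalars are central.\<close>

inductive_set relspan :: "'g set \<Rightarrow> 'g tensor set \<Rightarrow> 'g tensor set" for S K where
  zero: "0 \<in> relspan S K"
| gen: "set k \<subseteq> S \<Longrightarrow> r \<in> K \<Longrightarrow> set l \<subseteq> S \<Longrightarrow>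
    Poly_Mapping.single (Word k) q * r * Poly_Mapping.single (Word l) 1 \<in> relspan S K"
| add: "x \<in> relspan S K \<Longrightarrow> y \<in> relspan S K \<Longrightarrow> x + y \<in> relspan S K"

lemma relspan_lmult:
  assumes "u \<in> tens S" "x \<in> relspan S K"
  shows "u * x \<in> relspan S K"
  using assms(1)
proof (induction rule: tens_induct)
  case (single l q)
  from assms(2) show ?case
  proof (induction rule: relspan.induct)
    case (gen k r l' q')
    have "Poly_Mapping.single (Word l) q * (Poly_Mapping.single (Word k) q' * r * Poly_Mapping.single (Word l') 1)
       = Poly_Mapping.single (Word (l @ k)) (q * q') * r * Poly_Mapping.single (Word l') 1"
      by (simp add: mult_single plus_word_def flip: mult.assoc)
    then show ?case using gen single relspan.gen[of "l @ k" S r K l'] by auto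
  qed (auto simp: distrib_left intro: relspan.intros)
qed (auto simp: distrib_right intro: relspan.intros)

lemma relspan_rmult:
  assumes "u \<in> tens S" "x \<in> relspan S K"
  shows "x * u \<in> relspan S K"
  using assms(1)
proof (induction rule: tens_induct)
  case (single l q)
  from assms(2) show ?case
  proof (induction rule: relspan.induct)
    case (gen k r l' q')
    have "Poly_Mapping.single (Word k) q' * r * Poly_Mapping.single (Word l') 1 * Poly_Mapping.single (Word l) q
       = Poly_Mapping.single (Word k) q' * r * (Poly_Mapping.single (Word l') 1 * Poly_Mapping.single (Word l) q)"
      by (simp add: mult.assoc)
    also have "Poly_Mapping.single (Word l') 1 * Poly_Mapping.single (Word l) q = scalar q * Poly_Mapping.single (Word (l' @ l)) 1"
      by (simp add: mult_single plus_word_def scalar_mult_single)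
    also have "Poly_Mapping.single (Word k) q' * r * (scalar q * Poly_Mapping.single (Word (l' @ l)) 1)
      = (scalar q * Poly_Mapping.single (Word k) q') * r * Poly_Mapping.single (Word (l' @ l)) 1"
      by (simp only: scalar_left_commute mult.assoc)
    also have "\<dots> = Poly_Mapping.single (Word k) (q * q') * r * Poly_Mapping.single (Word (l' @ l)) 1"
      by (simp add: scalar_mult_single)
    finally show ?case using gen single relspan.gen[of k S r K "l' @ l"] by auto
  qed (auto simp: distrib_right intro: relspan.intros)
qed (auto simp: distrib_left intro: relspan.intros)

lemma relspan_tens: "K \<subseteq> tens S \<Longrightarrow> relspan S K \<subseteq> tens S"
proof
  fix x assume "K \<subseteq> tens S" "x \<in> relspan S K"
  show "x \<in> tens S" using \<open>x \<in> relspan S K\<close>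
    by (induction rule: relspan.induct) (use \<open>K \<subseteq> tens S\<close> in \<open>auto intro!: tens_intros tens_single\<close>)
qed

lemma relspan_superset: "K \<subseteq> relspan S K"
  using relspan.gen[of "[]" S _ K "[]" 1] by (auto simp: single_Word_Nil)

lemma relspan_uminus: "x \<in> relspan S K \<Longrightarrow> - x \<in> relspan S K"
  using relspan_lmult[where u="- 1" and x=x] by (simp add: tens_uminus)

lemma tensor_algebra_simps [simp]:
  "carrier (tensor_algebra S) = tens S" "mult (tensor_algebra S) = (*)" "one (tensor_algebra S) = 1"
  "zero (tensor_algebra S) = 0" "add (tensor_algebra S) = (+)"
  by (simp_all add: tensor_algebra_def tens_def)

lemma ring_tensor_algebra: "ring (tensor_algebra S)"
proof (rule ringI)
  show "abelian_group (tensor_algebra S)"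
  proof (rule abelian_groupI)
    fix x assume "x \<in> carrier (tensor_algebra S)"
    then show "\<exists>y\<in>carrier (tensor_algebra S). y \<oplus>\<^bsub>tensor_algebra S\<^esub> x = \<zero>\<^bsub>tensor_algebra S\<^esub>"
      by (intro bexI[of _ "- x"]) (auto intro: tens_uminus)
  qed (auto intro: tens_intros)
  show "Group.monoid (tensor_algebra S)"
    by (rule monoidI) (auto intro: tens_intros simp: mult.assoc)
qed (auto simp: algebra_simps)

lemma tensor_algebra_a_inv: "x \<in> tens S \<Longrightarrow> \<ominus>\<^bsub>tensor_algebra S\<^esub> x = - x"
  using abelian_group.minus_equality[OF ring.is_abelian_group[OF ring_tensor_algebra], where x=x and y="- x"]
  by (simp add: tens_uminus)

lemma ideal_relspan:
  assumes "K \<subseteq> tens S"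
  shows "ideal (relspan S K) (tensor_algebra S)"
proof (rule idealI[OF ring_tensor_algebra])
  show "subgroup (relspan S K) (add_monoid (tensor_algebra S))"
  proof (rule subgroup.intro)
    fix x assume "x \<in> relspan S K"
    moreover have "inv\<^bsub>add_monoid (tensor_algebra S)\<^esub> x = - x"
      using calculation tensor_algebra_a_inv relspan_tens[OF assms] unfolding a_inv_def by blast
    ultimately show "inv\<^bsub>add_monoid (tensor_algebra S)\<^esub> x \<in> relspan S K"
      by (simp add: relspan_uminus)
  qed (use relspan_tens[OF assms] in \<open>auto intro: relspan.intros\<close>)
qed (auto intro: relspan_lmult relspan_rmult)

lemma graded_commutators_tens: "graded_commutators S dg \<subseteq> tens S"
  unfolding graded_commutators_def by (auto intro!: tens_intros)

lemma gca_ideal_eq: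
  assumes "R \<subseteq> tens S"
  shows "gca_ideal S dg R = relspan S (graded_commutators S dg \<union> R)"
proof
  let ?K = "graded_commutators S dg \<union> R" and ?T = "tensor_algebra S"
  have K: "?K \<subseteq> tens S" using assms graded_commutators_tens by auto
  interpret ring ?T by (rule ring_tensor_algebra)
  show "gca_ideal S dg R \<subseteq> relspan S ?K"
    unfolding gca_ideal_def by (intro genideal_minimal ideal_relspan K relspan_superset)
  interpret I: ideal "Idl\<^bsub>?T\<^esub> ?K" ?T using genideal_ideal K by simp
  show "relspan S ?K \<subseteq> gca_ideal S dg R"
    unfolding gca_ideal_def
  proof
    fix x assume "x \<in> relspan S ?K"
    then show "x \<in> Idl\<^bsub>?T\<^esub> ?K"
    proof (induction rule: relspan.induct)
      case zero show ?case using I.additive_subgroup_axioms additive_subgroup.zero_closed by fastforce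
    next
      case (gen k r l q)
      then have "r \<in> Idl\<^bsub>?T\<^esub> ?K" using genideal_self[of ?K] K by auto
      then have "Poly_Mapping.single (Word k) q * r \<in> Idl\<^bsub>?T\<^esub> ?K"
        using I.I_l_closed[of r "Poly_Mapping.single (Word k) q"] gen by (simp add: tens_single)
      then show ?case using I.I_r_closed[of _ "Poly_Mapping.single (Word l) 1"] gen by (simp add: tens_single)
    next
      case (add x y)
      then show ?case using I.a_closed by simp
    qed
  qed
qed

text \<open>A coset in a form that does not mention the ambient \<open>tensor_algebra S\<close>,
  whose addition is that of the type for every \<open>S\<close>.\<close>

definition cls :: "'g tensor set \<Rightarrow> 'g tensor \<Rightarrow> 'g tensor set" where
  "cls J x = (\<lambda>j. j + x) ` J"

lemma a_r_coset_tensor_algebra: "J +>\<^bsub>tensor_algebra S\<^esub> x = cls J x"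
  unfolding a_r_coset_def r_coset_def cls_def by auto

locale presentation =
  fixes S :: "'g set" and dg :: "'g \<Rightarrow> nat" and R :: "'g tensor set"
  assumes R_tens: "R \<subseteq> tens S"
    and R_homog: "r \<in> R \<Longrightarrow> \<exists>p. r \<in> homog dg p"
begin

abbreviation J :: "'g tensor set" where
  "J \<equiv> gca_ideal S dg R"

abbreviation cl :: "'g tensor \<Rightarrow> 'g tensor set" where
  "cl \<equiv> cls J"

lemma J_relspan: "J = relspan S (graded_commutators S dg \<union> R)"
  by (rule gca_ideal_eq[OF R_tens])

lemma K_tens: "graded_commutators S dg \<union> R \<subseteq> tens S"
  using R_tens graded_commutators_tens by auto

lemma K_homog: "r \<in> graded_commutators S dg \<union> R \<Longrightarrow> \<exists>p. r \<in> homog dg p"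
proof (elim UnE)
  assume "r \<in> graded_commutators S dg"
  then obtain v w where r: "r = letter v * letter w - scalar ((-1) ^ (dg v * dg w)) * letter w * letter v"
    unfolding graded_commutators_def by auto
  have "scalar ((-1) ^ (dg v * dg w)) * (letter w * letter v) \<in> homog dg (dg v + dg w)"
    by (metis add.commute homog_letter homog_mult homog_scalar_mult)
  then have "r \<in> homog dg (dg v + dg w)"
    unfolding r mult.assoc by (intro homog_diff) (auto intro: homog_mult homog_letter)
  then show ?thesis by blast
qed (rule R_homog)

lemma J_tens: "x \<in> J \<Longrightarrow> x \<in> tens S"
  using relspan_tens[OF K_tens] J_relspan by blast

lemma J_0 [simp]: "0 \<in> J"
  and J_add: "x \<in> J \<Longrightarrow> y \<in> J \<Longrightarrow> x + y \<in> J"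
  and J_uminus: "x \<in> J \<Longrightarrow> - x \<in> J"
  and J_lmult: "u \<in> tens S \<Longrightarrow> x \<in> J \<Longrightarrow> u * x \<in> J"
  and J_rmult: "u \<in> tens S \<Longrightarrow> x \<in> J \<Longrightarrow> x * u \<in> J"
  and J_superset: "graded_commutators S dg \<union> R \<subseteq> J"
  unfolding J_relspan
  by (auto intro: relspan.intros relspan_uminus relspan_lmult relspan_rmult relspan_superset[THEN subsetD])

lemma J_diff: "x \<in> J \<Longrightarrow> y \<in> J \<Longrightarrow> x - y \<in> J"
  by (metis J_add J_uminus diff_conv_add_uminus)

lemma J_sum: "(\<And>i. i \<in> A \<Longrightarrow> f i \<in> J) \<Longrightarrow> sum f A \<in> J"
  by (induction A rule: infinite_finite_induct) (auto intro: J_add)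

lemma J_induct [consumes 1, case_names zero gen add]:
  assumes "x \<in> J" "P 0"
    "\<And>k r l q. set k \<subseteq> S \<Longrightarrow> r \<in> graded_commutators S dg \<union> R \<Longrightarrow> set l \<subseteq> S \<Longrightarrow> r \<in> tens S \<Longrightarrow>
      P (Poly_Mapping.single (Word k) q * r * Poly_Mapping.single (Word l) 1)"
    "\<And>x y. P x \<Longrightarrow> P y \<Longrightarrow> x \<in> J \<Longrightarrow> y \<in> J \<Longrightarrow> P (x + y)"
  shows "P x"
  using assms(1) unfolding J_relspan
  by (induction rule: relspan.induct) (use assms K_tens in \<open>auto simp flip: J_relspan\<close>)

text \<open>The generators of the ideal are homogeneous, so the ideal is graded. This is what makes
  the homogeneous components of a residue class unique.\<close>

lemma J_hcomp:
  assumes "x \<in> J"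
  shows "hcomp dg p x \<in> J"
  using assms
proof (induction rule: J_induct)
  case (gen k r l q)
  obtain m where m: "r \<in> homog dg m" using K_homog gen by blast
  let ?y = "Poly_Mapping.single (Word k) q * r * Poly_Mapping.single (Word l) 1"
  have "?y \<in> homog dg (sum_list (map dg k) + m + sum_list (map dg l))"
    by (intro homog_mult homog_single m) auto
  moreover have "?y \<in> J"
    unfolding J_relspan by (rule relspan.gen) (use gen in auto)
  ultimately show ?case by (simp add: hcomp_homog)
qed (auto simp: hcomp_add intro: J_add)

lemma J_invol:
  assumes "x \<in> J"
  shows "invol dg x \<in> J"
  using assms
proof (induction rule: J_induct)
  case (gen k r l q)
  obtain m where m: "r \<in> homog dg m" using K_homog gen by blast
  have "r \<in> J" using gen J_superset by auto
  then have "invol dg r \<in> J" by (simp add: invol_homog[OF m] J_lmult)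
  then show ?case
    unfolding invol_simps using gen by (intro J_rmult J_lmult invol_tens tens_single) auto
qed (auto intro: J_add)

text \<open>The relations concern two letters only. A letter is moved past a word by induction on
  the word, then a word past a word by induction on the first one, the signs adding up in the
  exponent.\<close>

lemma J_graded_commute:
  assumes x: "x \<in> tens S" "x \<in> homog dg p" and y: "y \<in> tens S" "y \<in> homog dg q"
  shows "x * y - scalar ((-1) ^ (p * q)) * (y * x) \<in> J"
proof -
  have 1: "letter v * Poly_Mapping.single (Word l) 1 -
      scalar ((-1) ^ (dg v * sum_list (map dg l))) * (Poly_Mapping.single (Word l) 1 * letter v) \<in> J"
    if "v \<in> S" "set l \<subseteq> S" for v l
    using that(2)
  proof (induction l)
    case Nil
    then show ?case by (simp add: single_Word_Nil)
  next
    case (Cons w l)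
    let ?l = "Poly_Mapping.single (Word l) (1::rat)" and ?a = "(-1) ^ (dg v * dg w) :: rat"
      and ?b = "(-1) ^ (dg v * sum_list (map dg l)) :: rat"
    have "letter v * letter w - scalar ?a * letter w * letter v \<in> J"
      using J_superset that Cons.prems unfolding graded_commutators_def by auto
    then have "(letter v * letter w - scalar ?a * letter w * letter v) * ?l \<in> J"
      using Cons.prems by (intro J_rmult tens_single) auto
    moreover have "(scalar ?a * letter w) * (letter v * ?l - scalar ?b * (?l * letter v)) \<in> J"
      using Cons by (intro J_lmult) (auto intro: tens_intros)
    ultimately have "(letter v * letter w - scalar ?a * letter w * letter v) * ?l +
        (scalar ?a * letter w) * (letter v * ?l - scalar ?b * (?l * letter v)) \<in> J"
      by (rule J_add)
    moreover have "letter v * Poly_Mapping.single (Word (w # l)) 1 -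
      scalar ((-1) ^ (dg v * sum_list (map dg (w # l)))) * (Poly_Mapping.single (Word (w # l)) 1 * letter v)
      = (letter v * letter w - scalar ?a * letter w * letter v) * ?l +
        (scalar ?a * letter w) * (letter v * ?l - scalar ?b * (?l * letter v))"
    proof -
      have e: "scalar ((-1) ^ (dg v * sum_list (map dg (w # l)))) = scalar ?a * (scalar ?b :: 'g tensor)"
        by (simp add: power_add algebra_simps flip: scalar_mult)
      show ?thesis
        unfolding e single_Word_Cons
        by (simp add: right_diff_distrib left_diff_distrib mult.assoc scalar_left_commute[of "letter w" ?b])
    qed
    ultimately show ?case by simp
  qed
  have 2: "Poly_Mapping.single (Word k) 1 * Poly_Mapping.single (Word l) 1 -
      scalar ((-1) ^ (sum_list (map dg k) * sum_list (map dg l))) *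
        (Poly_Mapping.single (Word l) 1 * Poly_Mapping.single (Word k) 1) \<in> J"
    if "set k \<subseteq> S" "set l \<subseteq> S" for k l
    using that(1)
  proof (induction k)
    case Nil
    then show ?case by (simp add: single_Word_Nil)
  next
    case (Cons v k)
    let ?l = "Poly_Mapping.single (Word l) (1::rat)" and ?k = "Poly_Mapping.single (Word k) (1::rat)"
      and ?a = "(-1) ^ (dg v * sum_list (map dg l)) :: rat"
      and ?b = "(-1) ^ (sum_list (map dg k) * sum_list (map dg l)) :: rat"
    have "letter v * (?k * ?l - scalar ?b * (?l * ?k)) \<in> J"
      using Cons by (intro J_lmult) (auto intro: tens_intros)
    moreover have "scalar ?b * ((letter v * ?l - scalar ?a * (?l * letter v)) * ?k) \<in> J"
      using Cons 1[of v l] that(2) by (intro J_lmult[OF tens_scalar] J_rmult tens_single) auto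
    ultimately have "letter v * (?k * ?l - scalar ?b * (?l * ?k)) + scalar ?b * ((letter v * ?l - scalar ?a * (?l * letter v)) * ?k) \<in> J"
      by (rule J_add)
    moreover have "Poly_Mapping.single (Word (v # k)) 1 * Poly_Mapping.single (Word l) 1 -
      scalar ((-1) ^ (sum_list (map dg (v # k)) * sum_list (map dg l))) *
        (Poly_Mapping.single (Word l) 1 * Poly_Mapping.single (Word (v # k)) 1) =
      letter v * (?k * ?l - scalar ?b * (?l * ?k)) + scalar ?b * ((letter v * ?l - scalar ?a * (?l * letter v)) * ?k)"
    proof -
      have e: "scalar ((-1) ^ (sum_list (map dg (v # k)) * sum_list (map dg l))) = scalar ?b * (scalar ?a :: 'g tensor)"
        by (simp add: power_add algebra_simps flip: scalar_mult)
      show ?thesis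
        unfolding e single_Word_Cons
        by (simp add: right_diff_distrib left_diff_distrib mult.assoc scalar_left_commute[of "letter v" ?b])
    qed
    ultimately show ?case by simp
  qed
  from x show ?thesis
  proof (induction rule: homog_induct)
    case (single k a)
    from y show ?case
    proof (induction rule: homog_induct)
      case (single l b)
      have "scalar (a * b) * (Poly_Mapping.single (Word k) 1 * Poly_Mapping.single (Word l) 1 -
      scalar ((-1) ^ (p * q)) * (Poly_Mapping.single (Word l) 1 * Poly_Mapping.single (Word k) 1)) \<in> J"
        using 2[of k l] single \<open>set k \<subseteq> S\<close> \<open>sum_list (map dg k) = p\<close> by (intro J_lmult) auto
      then show ?case
        by (simp add: right_diff_distrib mult_single scalar_mult_single ac_simps)
    next
      case (add x1 x2)
      from J_add[OF add(1,2)] show ?case by (simp add: algebra_simps)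
    qed auto
  next
    case (add x1 x2)
    from J_add[OF add(1,2)] show ?case by (simp add: algebra_simps)
  qed auto
qed

lemma cl_eq_iff: "cl x = cl y \<longleftrightarrow> x - y \<in> J"
proof
  assume "cl x = cl y"
  moreover have "x \<in> cl x" unfolding cls_def by (auto intro: image_eqI[of _ _ 0])
  ultimately obtain j where "j \<in> J" "x = j + y" unfolding cls_def by auto
  then show "x - y \<in> J" by simp
next
  have *: "cl x \<subseteq> cl y" if "x - y \<in> J" for x y
  proof
    fix z assume "z \<in> cl x"
    then obtain j where "j \<in> J" "z = j + x" unfolding cls_def by auto
    then show "z \<in> cl y" using J_add[OF _ that, of j] unfolding cls_def
      by (intro image_eqI[of _ _ "j + (x - y)"]) (auto simp: algebra_simps)
  qed
  assume "x - y \<in> J"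
  then show "cl x = cl y" using *[of x y] *[of y x] J_uminus[of "x - y"] by auto
qed

lemma mem_cl_iff: "y \<in> cl x \<longleftrightarrow> y - x \<in> J"
  unfolding cls_def by (auto simp: image_iff algebra_simps) (metis add.commute diff_add_cancel)

lemma cl_self: "x \<in> cl x"
  by (simp add: mem_cl_iff)

lemma cl_tens: "x \<in> tens S \<Longrightarrow> cl x \<subseteq> tens S"
  unfolding cls_def using J_tens by (auto intro: tens_add)

lemma cl_0: "cl 0 = J"
  unfolding cls_def by auto

text \<open>Operations on residue classes are defined as unions over all representatives; when the
  operation respects the ideal, all terms of the union coincide.\<close>

lemma UN_cl:
  assumes x: "x \<in> tens S" and f: "\<And>y z. y \<in> tens S \<Longrightarrow> z \<in> tens S \<Longrightarrow> y - z \<in> J \<Longrightarrow> f y = f z"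
  shows "(\<Union>y\<in>cl x. f y) = f x"
proof -
  have "f y = f x" if "y \<in> cl x" for y
    using that cl_tens[OF x] x f[of y x] by (auto simp: mem_cl_iff)
  then show ?thesis using cl_self[of x] by blast
qed

section \<open>The quotient algebra\<close>

context
  fixes d :: "'g tensor set \<Rightarrow> 'g tensor set"
begin

abbreviation Q :: "'g tensor set dga" where
  "Q \<equiv> presented_dga S dg R d"

lemma ideal_J: "ideal J (tensor_algebra S)"
  unfolding J_relspan by (rule ideal_relspan[OF K_tens])

lemma carrier_Q: "carrier Q = cl ` tens S"
  by (auto simp: presented_dga_def Let_def FactRing_def A_RCOSETS_def' a_r_coset_tensor_algebra)

lemma zero_Q: "\<zero>\<^bsub>Q\<^esub> = cl 0"
  by (simp add: presented_dga_def Let_def FactRing_def cl_0)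

lemma one_Q: "\<one>\<^bsub>Q\<^esub> = cl 1"
  by (simp add: presented_dga_def Let_def FactRing_def a_r_coset_tensor_algebra)

lemma add_Q: "x \<in> tens S \<Longrightarrow> y \<in> tens S \<Longrightarrow> cl x \<oplus>\<^bsub>Q\<^esub> cl y = cl (x + y)"
  using abelian_subgroup.a_rcos_sum[OF ideal.axioms(1)[OF ideal_J, THEN abelian_subgroupI3], of x y]
    ring.is_abelian_group[OF ring_tensor_algebra, of S]
  by (simp add: presented_dga_def Let_def FactRing_def a_r_coset_tensor_algebra)

lemma mult_Q: "x \<in> tens S \<Longrightarrow> y \<in> tens S \<Longrightarrow> cl x \<otimes>\<^bsub>Q\<^esub> cl y = cl (x * y)"
  using ideal.rcoset_mult_add[OF ideal_J, of x y]
  by (simp add: presented_dga_def Let_def FactRing_def a_r_coset_tensor_algebra)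

lemma smult_Q:
  assumes "x \<in> tens S"
  shows "q \<odot>\<^bsub>Q\<^esub> cl x = cl (scalar q * x)"
proof -
  have "q \<odot>\<^bsub>Q\<^esub> cl x = (\<Union>y\<in>cl x. cl (scalar q * y))"
    by (simp add: presented_dga_def a_r_coset_tensor_algebra Let_def)
  also have "\<dots> = cl (scalar q * x)"
    by (rule UN_cl[OF assms]) (auto simp: cl_eq_iff simp flip: right_diff_distrib intro: J_lmult)
  finally show ?thesis .
qed

lemma gca_class_eq: "gca_class S dg R P = cl ` {x \<in> tens S. \<forall>w\<in>Poly_Mapping.keys x. P w}"
  by (simp add: gca_class_def a_r_coset_tensor_algebra)

lemma grade_Q: "grade Q p = cl ` (tens S \<inter> homog dg p)"
  by (simp add: presented_dga_def gca_class_eq homog_def Collect_conj_eq Let_def)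

lemma diff_Q: "diff Q = d"
  by (simp add: presented_dga_def Let_def)

lemmas Q_simps = carrier_Q zero_Q one_Q add_Q mult_Q smult_Q grade_Q diff_Q

lemma ring_Q: "ring Q"
proof (rule ringI)
  show "abelian_group Q"
  proof (rule abelian_groupI)
    fix x assume "x \<in> carrier Q"
    then obtain y where y: "x = cl y" "y \<in> tens S" by (auto simp: carrier_Q)
    show "\<exists>y\<in>carrier Q. y \<oplus>\<^bsub>Q\<^esub> x = \<zero>\<^bsub>Q\<^esub>"
      by (intro bexI[of _ "cl (- y)"]) (auto simp: y carrier_Q add_Q zero_Q tens_uminus)
  qed (auto simp: Q_simps tens_add algebra_simps)
  show "Group.monoid Q"
    by (rule monoidI) (auto simp: Q_simps tens_mult mult.assoc)
qed (auto simp: Q_simps tens_mult tens_add algebra_simps)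

lemma module_Q: "Module.module rat_ring Q"
proof (rule moduleI[OF cring_rat_ring ring.is_abelian_group[OF ring_Q]])
qed (auto simp: Q_simps tens_mult tens_add scalar_add scalar_mult distrib_left distrib_right mult.assoc)

lemma a_inv_Q: "x \<in> tens S \<Longrightarrow> \<ominus>\<^bsub>Q\<^esub> cl x = cl (- x)"
  using abelian_group.minus_equality[OF ring.is_abelian_group[OF ring_Q], of "cl (- x)" "cl x"]
  by (auto simp: Q_simps tens_uminus)

lemma finsum_Q:
  assumes "finite P" "\<And>p. p \<in> P \<Longrightarrow> f p \<in> tens S"
  shows "finsum Q (\<lambda>p. cl (f p)) P = cl (sum f P)"
  using assms
proof (induction P)
  interpret ring Q by (rule ring_Q)
  {
    case empty show ?case by (simp add: zero_Q)
  next
    case (insert p P)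
    have "finsum Q (\<lambda>p. cl (f p)) (insert p P) = cl (f p) \<oplus>\<^bsub>Q\<^esub> finsum Q (\<lambda>p. cl (f p)) P"
      using insert by (intro finsum_insert) (auto simp: carrier_Q)
    then show ?case using insert by (simp add: add_Q tens_sum)
  }
qed

lemma submodule_QI:
  assumes "H \<subseteq> tens S" "0 \<in> H" "\<And>x y. x \<in> H \<Longrightarrow> y \<in> H \<Longrightarrow> x + y \<in> H" "\<And>x q. x \<in> H \<Longrightarrow> scalar q * x \<in> H"
  shows "Module.submodule (cl ` H) rat_ring Q"
proof -
  interpret Module.module rat_ring Q by (rule module_Q)
  have m: "- x \<in> H" if "x \<in> H" for x using assms(4)[OF that, of "-1"] by (simp add: scalar_uminus)
  show ?thesis
    using assms(1) by (intro submoduleI) (auto simp: Q_simps subset_iff a_inv_Q intro: assms m)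
qed

end

end

text \<open>Only the parity of the change of degree is prescribed, since the signs depend on nothing
  else. The differential of forms raises degrees by one and the contraction with the Euler field
  lowers them by one; both are instances.\<close>

locale antiderivation_presentation = presentation +
  fixes \<delta> :: "'a \<Rightarrow> 'a tensor"
  assumes \<delta>_tens: "v \<in> S \<Longrightarrow> \<delta> v \<in> tens S"
    and \<delta>_parity: "v \<in> S \<Longrightarrow> \<exists>e. \<delta> v \<in> homog dg e \<and> odd (dg v + e)"
    and \<delta>_R: "r \<in> R \<Longrightarrow> der dg \<delta> r \<in> J"
begin

abbreviation D :: "'a tensor \<Rightarrow> 'a tensor" where
  "D \<equiv> der dg \<delta>"

lemma D_tens: "x \<in> tens S \<Longrightarrow> D x \<in> tens S"
  using der_tens \<delta>_tens by metis

lemma J_graded_commute_\<delta>: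
  assumes "v \<in> S" "w \<in> S"
  shows "\<delta> v * letter w - scalar ((-1) ^ (Suc (dg v) * dg w)) * (letter w * \<delta> v) \<in> J"
    and "letter w * \<delta> v - scalar ((-1) ^ (dg w * Suc (dg v))) * (\<delta> v * letter w) \<in> J"
proof -
  obtain e where e: "\<delta> v \<in> homog dg e" "odd (dg v + e)" using \<delta>_parity assms by blast
  \<comment> \<open>The true degree \<open>e\<close> of \<open>\<delta> v\<close> has the parity of
    \<open>Suc (dg v)\<close> and therefore produces the same signs.\<close>
  then have "(-1 :: rat) ^ e = (-1) ^ Suc (dg v)" by (cases "even e") auto
  then have eq: "(-1 :: rat) ^ (e * dg w) = (-1) ^ (Suc (dg v) * dg w)" by (simp only: power_mult)
  have eq2: "(-1 :: rat) ^ (dg w * Suc (dg v)) = (-1) ^ (dg w * e)"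
    using eq by (simp only: mult.commute[of "dg w" "Suc (dg v)"] mult.commute[of "dg w" e])
  show "\<delta> v * letter w - scalar ((-1) ^ (Suc (dg v) * dg w)) * (letter w * \<delta> v) \<in> J"
    unfolding eq[symmetric] using assms e by (intro J_graded_commute) (auto intro: tens_intros \<delta>_tens homog_letter)
  show "letter w * \<delta> v - scalar ((-1) ^ (dg w * Suc (dg v))) * (\<delta> v * letter w) \<in> J"
    unfolding eq2 using assms e
    by (intro J_graded_commute) (auto intro: tens_intros \<delta>_tens homog_letter)
qed

text \<open>The derivative of a graded commutator of letters is the commutator of
  \<open>\<delta> v\<close> with \<open>w\<close> plus, up to sign, that of \<open>v\<close> with
  \<open>\<delta> w\<close>; both lie in the ideal.\<close>

lemma D_commutator:
  assumes "r \<in> graded_commutators S dg"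
  shows "D r \<in> J"
proof -
  obtain v w where r: "r = letter v * letter w - scalar ((-1) ^ (dg v * dg w)) * letter w * letter v"
    and vw: "v \<in> S" "w \<in> S"
    using assms unfolding graded_commutators_def by auto
  have i: "invol dg (letter v) = scalar ((-1) ^ dg v) * letter v" "invol dg (letter w) = scalar ((-1) ^ dg w) * letter w"
    by (simp_all add: invol_def)
  note 1 = J_graded_commute_\<delta>(1)[OF vw] and 2 = J_graded_commute_\<delta>(2)[OF vw(2,1)]
  have "\<delta> v * letter w - scalar ((-1) ^ (Suc (dg v) * dg w)) * (letter w * \<delta> v)
      + scalar ((-1) ^ dg v) * (letter v * \<delta> w - scalar ((-1) ^ (dg v * Suc (dg w))) * (\<delta> w * letter v)) \<in> J"
    using 1 2 by (intro J_add J_lmult) auto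
  also have "\<delta> v * letter w - scalar ((-1) ^ (Suc (dg v) * dg w)) * (letter w * \<delta> v)
      + scalar ((-1) ^ dg v) * (letter v * \<delta> w - scalar ((-1) ^ (dg v * Suc (dg w))) * (\<delta> w * letter v)) = D r"
  proof -
    have a: "scalar ((-1) ^ (Suc (dg v) * dg w)) = scalar ((-1) ^ (dg v * dg w)) * (scalar ((-1) ^ dg w) :: 'a tensor)"
      by (simp add: power_add mult.commute flip: scalar_mult)
    have "(-1) ^ dg v * (-1) ^ (dg v * Suc (dg w)) = ((-1) ^ (dg v * dg w) :: rat)"
      by (simp add: power_add flip: power_mult_distrib mult.assoc)
    then have "scalar ((-1) ^ dg v) * scalar ((-1) ^ (dg v * Suc (dg w))) = (scalar ((-1) ^ (dg v * dg w)) :: 'a tensor)"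
      by (simp only: flip: scalar_mult)
    then have b: "scalar ((-1) ^ dg v) * (scalar ((-1) ^ (dg v * Suc (dg w))) * x) = scalar ((-1) ^ (dg v * dg w)) * x"
      for x :: "'a tensor" by (metis mult.assoc)
    have "D r = \<delta> v * letter w + scalar ((-1) ^ dg v) * letter v * \<delta> w
        - scalar ((-1) ^ (dg v * dg w)) * (\<delta> w * letter v + scalar ((-1) ^ dg w) * letter w * \<delta> v)"
      unfolding r by (simp add: der_mult i mult.assoc)
    then show ?thesis
      unfolding a right_diff_distrib b by (simp add: distrib_left mult.assoc)
  qed
  finally show ?thesis .
qed

lemma D_J:
  assumes "x \<in> J"
  shows "D x \<in> J"
  using assms
proof (induction rule: J_induct)
  case (gen k r l q)
  have r: "r \<in> J" "D r \<in> J" using gen J_superset D_commutator \<delta>_R by auto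
  have t: "Poly_Mapping.single (Word k) q \<in> tens S" "Poly_Mapping.single (Word l) (1::rat) \<in> tens S"
    using gen by (auto intro!: tens_single)
  have "D (Poly_Mapping.single (Word k) q) * r \<in> J" "invol dg (Poly_Mapping.single (Word k) q) * D r \<in> J"
    "invol dg (Poly_Mapping.single (Word k) q) * invol dg r \<in> J"
    using t r J_invol[of r] by (auto simp del: der_simps intro!: J_lmult D_tens invol_tens)
  then show ?case
    unfolding der_mult invol_simps using t by (intro J_add J_rmult[OF t(2)] J_rmult[OF D_tens[OF t(2)]]) auto
qed (auto intro: J_add)

text \<open>An odd operator anticommutes with the sign involution. This cancels the mixed terms in
  the square of the differential and in the Lie derivative of a product.\<close>

lemma D_invol: "x \<in> tens S \<Longrightarrow> D (invol dg x) = - invol dg (D x)"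
proof (induction rule: tens_induct)
  case (single l q)
  have "D (invol dg (Poly_Mapping.single (Word l) 1)) = - invol dg (D (Poly_Mapping.single (Word l) 1))" using single
  proof (induction l)
    case (Cons v l)
    let ?x = "letter v" and ?y = "Poly_Mapping.single (Word l) (1::rat)"
    obtain e where e: "\<delta> v \<in> homog dg e" "odd (dg v + e)" using \<delta>_parity Cons by force
    then have s: "(-1 :: rat) ^ e = - ((-1) ^ dg v)" by (cases "even e") auto
    have "invol dg ?x = scalar ((-1) ^ dg v) * ?x" by (simp add: invol_def)
    then have x: "D (invol dg ?x) = - invol dg (D ?x)"
      by (simp add: invol_homog[OF e(1)] s scalar_uminus)
    have y: "D (invol dg ?y) = - invol dg (D ?y)"
      using Cons by simp
    have "D (invol dg (?x * ?y)) = - invol dg (D (?x * ?y))"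
      unfolding invol_simps der_mult x y by simp
    then show ?case by (simp add: single_Word_Cons)
  qed (simp add: single_Word_Nil)
  then have "scalar q * D (invol dg (Poly_Mapping.single (Word l) 1)) = scalar q * (- invol dg (D (Poly_Mapping.single (Word l) 1)))"
    by simp
  then show ?case
    unfolding single_eq[of _ q] invol_simps der_simps(6) by simp
qed auto

end

locale differential_presentation = presentation +
  fixes \<delta> :: "'a \<Rightarrow> 'a tensor"
  assumes d_tens: "v \<in> S \<Longrightarrow> \<delta> v \<in> tens S"
    and d_homog: "v \<in> S \<Longrightarrow> \<delta> v \<in> homog dg (Suc (dg v))"
    and d_R: "r \<in> R \<Longrightarrow> der dg \<delta> r \<in> J"
    and d_d: "v \<in> S \<Longrightarrow> der dg \<delta> (\<delta> v) \<in> J"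
begin

sublocale antiderivation_presentation
proof
  fix v assume "v \<in> S"
  then show "\<exists>e. \<delta> v \<in> homog dg e \<and> odd (dg v + e)"
    using d_homog by (intro exI[of _ "Suc (dg v)"]) auto
qed (use d_tens d_R in auto)

lemma D_homog: "x \<in> tens S \<Longrightarrow> x \<in> homog dg p \<Longrightarrow> D x \<in> homog dg (Suc p)"
  using der_homog d_homog by metis

text \<open>Without mixed terms, \<open>D (D (x * y))\<close> is the sum of
  \<open>D (D x) * y\<close> and \<open>x * D (D y)\<close>, so the square vanishes modulo the ideal
  as soon as it does on letters.\<close>

lemma D_D: "x \<in> tens S \<Longrightarrow> D (D x) \<in> J"
proof (induction rule: tens_induct)
  case (single l q)
  have "D (D (Poly_Mapping.single (Word l) 1)) \<in> J" using single
  proof (induction l)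
    case (Cons v l)
    let ?x = "letter v" and ?y = "Poly_Mapping.single (Word l) (1::rat)"
    have t: "?x \<in> tens S" "?y \<in> tens S" using Cons by (auto intro!: tens_letter tens_single)
    have "D (D (?x * ?y)) = D (D ?x) * ?y + invol dg (D ?x) * D ?y + D (invol dg ?x) * D ?y + ?x * D (D ?y)"
      by (simp add: der_mult del: der_simps(7,8))
    also have "\<dots> = D (D ?x) * ?y + ?x * D (D ?y)"
      using t by (simp add: D_invol del: der_simps(7,8))
    also have "\<dots> \<in> J"
      using t Cons d_d[of v] by (intro J_add J_lmult[OF t(1)] J_rmult[OF t(2)]) auto
    finally show ?case by (simp add: single_Word_Cons)
  qed (simp add: single_Word_Nil)
  then have "scalar q * D (D (Poly_Mapping.single (Word l) 1)) \<in> J"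
    by (intro J_lmult) auto
  then show ?case by simp
qed (auto intro: J_add)

lemma cl_D_D: "x \<in> tens S \<Longrightarrow> cl (D (D x)) = cl 0"
  by (simp add: cl_eq_iff D_D)

lemma UN_cl_D: "x \<in> tens S \<Longrightarrow> (\<Union>y\<in>cl x. cl (D y)) = cl (D x)"
  by (rule UN_cl) (auto simp: cl_eq_iff D_J simp flip: der_simps(2))

end

text \<open>The differential remains a parameter of which only the values on residue classes are
  prescribed, so that both \<open>pl_d\<close> and \<open>free_diff\<close> fit.\<close>

locale presented_cdga = differential_presentation +
  fixes d :: "'a tensor set \<Rightarrow> 'a tensor set"
  assumes d_cl: "x \<in> tens S \<Longrightarrow> d (cl x) = cl (D x)"
begin

sublocale cdga "presented_dga S dg R d"
proof (intro cdga.intro cdga_axioms.intro ring_Q module_Q)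
  let ?Q = "presented_dga S dg R d"
  fix p show "Module.submodule (grade ?Q p) rat_ring ?Q"
    unfolding grade_Q by (rule submodule_QI) (auto intro: tens_intros homog_add homog_scalar_mult)
next
  let ?Q = "presented_dga S dg R d"
  interpret ring ?Q by (rule ring_Q)
  fix x assume "x \<in> carrier ?Q"
  then obtain y where y: "x = cl y" "y \<in> tens S" by (auto simp: carrier_Q)
  \<comment> \<open>The components in the quotient are the classes of the components of any
    representative.\<close>
  let ?g = "\<lambda>p. cl (hcomp dg p y)"
  let ?P = "word_degree dg ` Poly_Mapping.keys y"
  show "\<exists>!f. (\<forall>p. f p \<in> grade ?Q p) \<and> finite {p. f p \<noteq> \<zero>\<^bsub>?Q\<^esub>} \<and> x = finsum ?Q f {p. f p \<noteq> \<zero>\<^bsub>?Q\<^esub>}"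
  proof (intro ex1I[of _ ?g] conjI allI)
    fix p show "?g p \<in> grade ?Q p"
      using y by (auto simp: grade_Q intro!: imageI hcomp_tens homog_hcomp)
  next
    have sub: "{p. ?g p \<noteq> \<zero>\<^bsub>?Q\<^esub>} \<subseteq> ?P"
    proof
      fix p assume "p \<in> {p. ?g p \<noteq> \<zero>\<^bsub>?Q\<^esub>}"
      then have "hcomp dg p y \<noteq> 0" unfolding zero_Q by force
      then show "p \<in> ?P" using hcomp_eq_0[of p dg y] by blast
    qed
    then show fin: "finite {p. ?g p \<noteq> \<zero>\<^bsub>?Q\<^esub>}"
      by (rule finite_subset) auto
    have "x = cl (\<Sum>p\<in>?P. hcomp dg p y)"
      using hcomp_decomposition[of ?P dg y] y by simp
    also have "\<dots> = finsum ?Q ?g ?P"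
      using y by (intro finsum_Q[symmetric]) (auto intro: hcomp_tens)
    also have "\<dots> = finsum ?Q ?g {p. ?g p \<noteq> \<zero>\<^bsub>?Q\<^esub>}"
      using sub y by (intro add.finprod_mono_neutral_cong_right) (auto simp: carrier_Q intro: hcomp_tens)
    finally show "x = finsum ?Q ?g {p. ?g p \<noteq> \<zero>\<^bsub>?Q\<^esub>}" .
  next
    fix f assume f: "(\<forall>p. f p \<in> grade ?Q p) \<and> finite {p. f p \<noteq> \<zero>\<^bsub>?Q\<^esub>} \<and> x = finsum ?Q f {p. f p \<noteq> \<zero>\<^bsub>?Q\<^esub>}"
    let ?F = "{p. f p \<noteq> \<zero>\<^bsub>?Q\<^esub>}"
    have "\<forall>p. \<exists>z. z \<in> tens S \<and> z \<in> homog dg p \<and> f p = cl z"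
      using f unfolding grade_Q by blast
    then obtain z where z: "\<And>p. z p \<in> tens S" "\<And>p. z p \<in> homog dg p" "\<And>p. f p = cl (z p)"
      by metis
    have fz: "f = (\<lambda>p. cl (z p))" using z(3) by (rule ext)
    have "finsum ?Q (\<lambda>p. cl (z p)) ?F = cl (\<Sum>p\<in>?F. z p)"
      by (rule finsum_Q) (use f z(1) in blast)+
    then have "cl y = cl (\<Sum>p\<in>?F. z p)"
      using conjunct2[OF conjunct2[OF f]] y(1) by (simp only: fz[symmetric])
    then have "y - (\<Sum>p\<in>?F. z p) \<in> J" by (simp only: cl_eq_iff)
    \<comment> \<open>For uniqueness, parts of degree \<open>q\<close> may be compared modulo the
      ideal because the ideal is graded.\<close>
    then have J: "hcomp dg q y - hcomp dg q (\<Sum>p\<in>?F. z p) \<in> J" for q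
      using J_hcomp[of _ q] by (simp flip: hcomp_diff)
    show "f = ?g"
    proof
      fix q
      have "hcomp dg q (\<Sum>p\<in>?F. z p) = (\<Sum>p\<in>?F. if p = q then z q else 0)"
        unfolding hcomp_sum by (intro sum.cong) (auto simp: hcomp_homog[OF z(2)])
      also have "\<dots> = (if q \<in> ?F then z q else 0)"
        using f by (subst sum.delta) auto
      finally have "cl (hcomp dg q y) = cl (if q \<in> ?F then z q else 0)"
        using J[of q] by (simp only: cl_eq_iff)
      also have "\<dots> = f q" by (auto simp: z(3) zero_Q)
      finally show "f q = ?g q" ..
    qed
  qed
next
  let ?Q = "presented_dga S dg R d"
  fix x y p assume "x \<in> grade ?Q p" "y \<in> carrier ?Q"
  then obtain x' y' where x: "x = cl x'" "x' \<in> tens S" "x' \<in> homog dg p" and y: "y = cl y'" "y' \<in> tens S"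
    by (auto simp: grade_Q carrier_Q)
  show "diff ?Q (x \<otimes>\<^bsub>?Q\<^esub> y) = (diff ?Q x \<otimes>\<^bsub>?Q\<^esub> y) \<oplus>\<^bsub>?Q\<^esub> (-1) ^ p \<odot>\<^bsub>?Q\<^esub> (x \<otimes>\<^bsub>?Q\<^esub> diff ?Q y)"
    using x y by (simp add: Q_simps d_cl D_tens tens_mult der_mult invol_homog mult.assoc)
next
  let ?Q = "presented_dga S dg R d"
  fix x y p q assume "x \<in> grade ?Q p" "y \<in> grade ?Q q"
  then obtain x' y' where x: "x = cl x'" "x' \<in> tens S" "x' \<in> homog dg p" and y: "y = cl y'" "y' \<in> tens S" "y' \<in> homog dg q"
    by (auto simp: grade_Q)
  show "x \<otimes>\<^bsub>?Q\<^esub> y = (-1) ^ (p * q) \<odot>\<^bsub>?Q\<^esub> (y \<otimes>\<^bsub>?Q\<^esub> x)"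
    using x y J_graded_commute[of x' p y' q] by (simp add: Q_simps tens_mult cl_eq_iff)
  show "x \<otimes>\<^bsub>?Q\<^esub> y \<in> grade ?Q (p + q)"
    using x y by (auto simp: Q_simps intro!: imageI tens_mult homog_mult)
qed (auto simp: Q_simps tens_mult tens_add d_cl D_tens scalar_left_commute mult.assoc cl_D_D
      intro!: imageI D_homog)

end

subsection \<open>Homomorphisms out of algebras by generators and relations\<close>

text \<open>The counterpart of \<open>subst\<close> for values in an abstract algebra, where sums
  and products are operations of a record.\<close>

definition ev_word :: "'a dga \<Rightarrow> ('g \<Rightarrow> 'a) \<Rightarrow> 'g list \<Rightarrow> 'a" where
  "ev_word A \<phi> l = foldr (\<lambda>v a. \<phi> v \<otimes>\<^bsub>A\<^esub> a) l \<one>\<^bsub>A\<^esub>"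

definition ev :: "'a dga \<Rightarrow> ('g \<Rightarrow> 'a) \<Rightarrow> 'g tensor \<Rightarrow> 'a" where
  "ev A \<phi> x = finsum A (\<lambda>w. Poly_Mapping.lookup x w \<odot>\<^bsub>A\<^esub> ev_word A \<phi> (letters w)) (Poly_Mapping.keys x)"

context cdga
begin

lemmas A_abelian_monoid = abelian_group.axioms(1)[OF ring.is_abelian_group[OF ring_A]]

lemmas A_m_closed = monoid.m_closed[OF ring.is_monoid[OF ring_A]]
  and A_m_assoc = monoid.m_assoc[OF ring.is_monoid[OF ring_A]]
  and A_l_one = monoid.l_one[OF ring.is_monoid[OF ring_A]]
  and A_r_one = monoid.r_one[OF ring.is_monoid[OF ring_A]]

lemma A_l_distr: "x \<in> carrier A \<Longrightarrow> y \<in> carrier A \<Longrightarrow> z \<in> carrier A \<Longrightarrow> (x \<oplus> y) \<otimes> z = x \<otimes> z \<oplus> y \<otimes> z"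
  by (rule ring.ring_simprules[OF ring_A])

lemma A_minus_eq_zero: "x \<in> carrier A \<Longrightarrow> y \<in> carrier A \<Longrightarrow> x \<ominus> y = \<zero> \<longleftrightarrow> x = y"
  using abelian_group.minus_equality[OF ring.is_abelian_group[OF ring_A], of x "\<ominus> y"]
  by (auto simp: a_minus_def ring.ring_simprules[OF ring_A])

lemma A_r_distr: "x \<in> carrier A \<Longrightarrow> y \<in> carrier A \<Longrightarrow> z \<in> carrier A \<Longrightarrow> z \<otimes> (x \<oplus> y) = z \<otimes> x \<oplus> z \<otimes> y"
  by (rule ring.ring_simprules[OF ring_A])

context
  fixes S :: "'g set" and \<phi> :: "'g \<Rightarrow> 'a"
  assumes \<phi>: "\<And>v. v \<in> S \<Longrightarrow> \<phi> v \<in> carrier A"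
begin

lemma ev_word_carrier: "set l \<subseteq> S \<Longrightarrow> ev_word A \<phi> l \<in> carrier A"
  by (induction l) (auto simp: ev_word_def A_one_closed intro!: A_m_closed \<phi>)

lemma ev_superset:
  assumes "finite W" "Poly_Mapping.keys x \<subseteq> W" "\<And>w. w \<in> W \<Longrightarrow> set (letters w) \<subseteq> S"
  shows "ev A \<phi> x = finsum A (\<lambda>w. Poly_Mapping.lookup x w \<odot> ev_word A \<phi> (letters w)) W"
  unfolding ev_def finsum_def using assms
  by (intro comm_monoid.finprod_mono_neutral_cong_left[OF abelian_monoid.a_comm_monoid[OF A_abelian_monoid]])
    (auto simp: not_in_keys_iff_lookup_eq_zero ev_word_carrier)

lemma ev_carrier: "x \<in> tens S \<Longrightarrow> ev A \<phi> x \<in> carrier A"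
  unfolding ev_def tens_def by (intro A_finsum_closed) (auto intro!: ev_word_carrier)

lemma ev_add:
  assumes "x \<in> tens S" "y \<in> tens S"
  shows "ev A \<phi> (x + y) = ev A \<phi> x \<oplus> ev A \<phi> y"
proof -
  let ?W = "Poly_Mapping.keys x \<union> Poly_Mapping.keys y"
  have W: "w \<in> ?W \<Longrightarrow> set (letters w) \<subseteq> S" for w
    using assms by (auto simp: tens_def)
  have k: "Poly_Mapping.keys (x + y) \<subseteq> ?W" using keys_add[of x y] by auto
  have "ev A \<phi> (x + y) = finsum A (\<lambda>w. Poly_Mapping.lookup (x + y) w \<odot> ev_word A \<phi> (letters w)) ?W"
    by (rule ev_superset) (use W k in auto)
  also have "\<dots> = finsum A (\<lambda>w. Poly_Mapping.lookup x w \<odot> ev_word A \<phi> (letters w) \<oplus> Poly_Mapping.lookup y w \<odot> ev_word A \<phi> (letters w)) ?W"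
    using W by (intro abelian_monoid.finsum_cong'[OF A_abelian_monoid]) (auto simp: lookup_add smult_add ev_word_carrier)
  also have "\<dots> = finsum A (\<lambda>w. Poly_Mapping.lookup x w \<odot> ev_word A \<phi> (letters w)) ?W
      \<oplus> finsum A (\<lambda>w. Poly_Mapping.lookup y w \<odot> ev_word A \<phi> (letters w)) ?W"
    using W by (intro abelian_monoid.finsum_addf[OF A_abelian_monoid]) (auto intro!: ev_word_carrier)
  also have "\<dots> = ev A \<phi> x \<oplus> ev A \<phi> y"
    using W by (subst (1 2) ev_superset[of ?W]) auto
  finally show ?thesis .
qed

lemma ev_single: "set l \<subseteq> S \<Longrightarrow> ev A \<phi> (Poly_Mapping.single (Word l) q) = q \<odot> ev_word A \<phi> l"
  using ev_superset[of "{Word l}" "Poly_Mapping.single (Word l) q"] ev_word_carrier[of l]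
  by (simp add: A_finsum_insert)

lemma ev_0 [simp]: "ev A \<phi> 0 = \<zero>"
  by (simp add: ev_def)

lemma ev_scalar: "ev A \<phi> (scalar q) = q \<odot> \<one>"
  using ev_single[of "[]" q] by (simp add: ev_word_def scalar_def zero_word_def)

lemma ev_1: "ev A \<phi> 1 = \<one>"
  using ev_scalar[of 1] A_one_closed by simp

lemma ev_letter: "v \<in> S \<Longrightarrow> ev A \<phi> (letter v) = \<phi> v"
  using ev_single[of "[v]" 1] \<phi>[of v] by (simp add: ev_word_def letter_def A_r_one)

lemma ev_word_append: "set k \<subseteq> S \<Longrightarrow> set l \<subseteq> S \<Longrightarrow> ev_word A \<phi> (k @ l) = ev_word A \<phi> k \<otimes> ev_word A \<phi> l"
proof (induction k)
  case Nil
  then show ?case using ev_word_carrier[of l] A_l_one by (simp add: ev_word_def)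
next
  case (Cons v k)
  then show ?case using ev_word_carrier[of k] ev_word_carrier[of l] \<phi>[of v]
    by (simp add: ev_word_def A_m_assoc)
qed

lemma ev_mult:
  assumes "x \<in> tens S" "y \<in> tens S"
  shows "ev A \<phi> (x * y) = ev A \<phi> x \<otimes> ev A \<phi> y"
  using assms(1)
proof (induction rule: tens_induct)
  case zero
  then show ?case using ring.ring_simprules(24)[OF ring_A] ev_carrier[OF assms(2)] by simp
next
  case (single k q)
  from assms(2) show ?case
  proof (induction rule: tens_induct)
    case zero
    then show ?case using ring.ring_simprules(25)[OF ring_A] single ev_carrier[of "Poly_Mapping.single (Word k) q"]
      by (simp add: tens_single)
  next
    case (single l p)
    have "Poly_Mapping.single (Word k) q * Poly_Mapping.single (Word l) p = Poly_Mapping.single (Word (k @ l)) (q * p)"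
      by (simp add: mult_single plus_word_def)
    then show ?case
      using single \<open>set k \<subseteq> S\<close> ev_word_carrier[of k] ev_word_carrier[of l]
      by (simp add: ev_single ev_word_append smult_mult_left smult_mult_right smult_smult A_m_closed mult.commute)
  next
    case (add y z)
    have "Poly_Mapping.single (Word k) q \<in> tens S" using single by (auto intro!: tens_single)
    then show ?case
      using add by (simp add: distrib_left ev_add tens_mult A_r_distr ev_carrier)
  qed
next
  case (add x z)
  then show ?case
    using assms(2) by (simp add: distrib_right ev_add tens_mult A_l_distr ev_carrier)
qed

lemma ev_scalar_mult: "x \<in> tens S \<Longrightarrow> ev A \<phi> (scalar q * x) = q \<odot> ev A \<phi> x"
  using ev_carrier[of x] A_one_closed by (simp add: ev_mult ev_scalar smult_mult_left A_l_one)

lemma ev_uminus: "x \<in> tens S \<Longrightarrow> ev A \<phi> (- x) = \<ominus> ev A \<phi> x"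
  using ev_scalar_mult[of x "-1"] ev_carrier[of x] by (simp add: scalar_uminus smult_minus_one)

lemma ev_diff: "x \<in> tens S \<Longrightarrow> y \<in> tens S \<Longrightarrow> ev A \<phi> (x - y) = ev A \<phi> x \<ominus> ev A \<phi> y"
  using ev_add[of x "- y"] by (simp add: tens_uminus ev_uminus a_minus_def)

lemma ev_word_grade:
  assumes "\<And>v. v \<in> S \<Longrightarrow> \<phi> v \<in> grade A (dg v)" "set l \<subseteq> S"
  shows "ev_word A \<phi> l \<in> grade A (sum_list (map dg l))"
  using assms(2)
proof (induction l)
  case Nil
  then show ?case by (simp add: ev_word_def one_grade)
next
  case (Cons v l)
  then have "\<phi> v \<otimes> ev_word A \<phi> l \<in> grade A (dg v + sum_list (map dg l))"
    by (intro mult_grade assms(1)) auto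
  then show ?case by (simp add: ev_word_def)
qed

lemma ev_grade:
  assumes "\<And>v. v \<in> S \<Longrightarrow> \<phi> v \<in> grade A (dg v)" "x \<in> tens S" "x \<in> homog dg p"
  shows "ev A \<phi> x \<in> grade A p"
  using assms(2,3)
proof (induction rule: homog_induct)
  case (single l q)
  then show ?case using ev_word_grade[of dg l] assms(1) by (auto simp: ev_single intro!: grade_smult)
qed (auto simp: ev_add grade_add)

text \<open>Both sides obey the same Leibniz rule, so agreement on generators is enough; the
  evaluation is then a cochain map.\<close>

lemma ev_der:
  assumes "\<And>v. v \<in> S \<Longrightarrow> \<phi> v \<in> grade A (dg v)" "\<And>v. v \<in> S \<Longrightarrow> \<delta> v \<in> tens S"
    "\<And>v. v \<in> S \<Longrightarrow> ev A \<phi> (\<delta> v) = diff A (\<phi> v)" "x \<in> tens S"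
  shows "ev A \<phi> (der dg \<delta> x) = diff A (ev A \<phi> x)"
  using assms(4)
proof (induction rule: tens_induct)
  case (single l q)
  have "ev A \<phi> (der_list dg \<delta> l) = diff A (ev_word A \<phi> l)"
    using single
  proof (induction l)
    case Nil
    then show ?case by (simp add: ev_word_def diff_one)
  next
    case (Cons v l)
    have t: "v \<in> S" "set l \<subseteq> S" "der_list dg \<delta> l \<in> tens S" "Poly_Mapping.single (Word l) (1::rat) \<in> tens S" "letter v \<in> tens S"
      using Cons assms(2) by (auto intro!: der_list_tens tens_single tens_letter)
    have "ev A \<phi> (der_list dg \<delta> (v # l)) = diff A (\<phi> v) \<otimes> ev_word A \<phi> l \<oplus> (-1) ^ dg v \<odot> (\<phi> v \<otimes> diff A (ev_word A \<phi> l))"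
      using t Cons assms ev_word_carrier[of l] \<phi>[of v]
      by (simp add: ev_add ev_mult ev_scalar smult_mult_left A_l_one A_one_closed A_m_closed tens_mult ev_single ev_letter mult.assoc)
    also have "\<dots> = diff A (\<phi> v \<otimes> ev_word A \<phi> l)"
      using t by (intro diff_mult[symmetric] assms(1) ev_word_carrier)
    finally show ?case by (simp add: ev_word_def)
  qed
  then show ?case
    using single assms(2) ev_word_carrier[of l]
    by (simp add: ev_single ev_scalar_mult der_list_tens diff_smult)
next
  case (add x y)
  then show ?case using assms(2) by (simp add: ev_add der_tens diff_add ev_carrier)
qed auto

end

end

context presented_cdga
begin

abbreviation pres_dga where
  "pres_dga \<equiv> presented_dga S dg R d"

text \<open>Graded commutativity of \<open>A\<close> kills the commutators of letters, the
  assumption kills \<open>R\<close>, and evaluation is multiplicative.\<close>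

lemma ev_J:
  assumes A: "cdga A" and \<phi>: "\<And>v. v \<in> S \<Longrightarrow> \<phi> v \<in> grade A (dg v)"
    and R: "\<And>r. r \<in> R \<Longrightarrow> ev A \<phi> r = \<zero>\<^bsub>A\<^esub>" and x: "x \<in> J"
  shows "ev A \<phi> x = \<zero>\<^bsub>A\<^esub>"
proof -
  interpret A: cdga A by (rule A)
  have \<phi>c: "\<And>v. v \<in> S \<Longrightarrow> \<phi> v \<in> carrier A" using \<phi> A.grade_carrier by blast
  note A.ev_add[of S \<phi>, simp] A.ev_mult[of S \<phi>, simp] A.ev_letter[of S \<phi>, simp] A.ev_diff[of S \<phi>, simp] A.ev_carrier[of S \<phi>, simp] A.ev_scalar[of S \<phi>, simp] A.smult_mult_left[simp] A.A_l_one[simp] A.A_one_closed[simp] A.A_m_closed[simp]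
  note ri = ring.ring_simprules[OF A.ring_A]
  from x show ?thesis
  proof (induction rule: J_induct)
    case (gen k r l q)
    have "ev A \<phi> r = \<zero>\<^bsub>A\<^esub>"
    proof (cases "r \<in> R")
      case False
      then obtain v w where r: "r = letter v * letter w - scalar ((-1) ^ (dg v * dg w)) * letter w * letter v" "v \<in> S" "w \<in> S"
        using gen unfolding graded_commutators_def by auto
      have "\<phi> v \<otimes>\<^bsub>A\<^esub> \<phi> w = (-1) ^ (dg v * dg w) \<odot>\<^bsub>A\<^esub> (\<phi> w \<otimes>\<^bsub>A\<^esub> \<phi> v)"
        using r \<phi> by (intro A.graded_commute) auto
      moreover have "ev A \<phi> r = \<phi> v \<otimes>\<^bsub>A\<^esub> \<phi> w \<ominus>\<^bsub>A\<^esub> (-1) ^ (dg v * dg w) \<odot>\<^bsub>A\<^esub> (\<phi> w \<otimes>\<^bsub>A\<^esub> \<phi> v)"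
        unfolding r(1) mult.assoc using r(2,3) \<phi>c by (simp add: tens_mult tens_letter)
      ultimately show ?thesis
        using r(2,3) \<phi>c by (simp add: a_minus_def A.A_m_closed ri)
    qed (rule R)
    then show ?case
      using gen \<phi>c by (simp add: tens_mult tens_single ri)
  next
    case (add x y)
    then show ?case using J_tens \<phi>c by (simp add: ri)
  qed (use A.ev_0[of S \<phi>] \<phi>c in blast)
qed

lemma dga_hom_exists:
  assumes A: "cdga A" and \<phi>: "\<And>v. v \<in> S \<Longrightarrow> \<phi> v \<in> grade A (dg v)"
    and R: "\<And>r. r \<in> R \<Longrightarrow> ev A \<phi> r = \<zero>\<^bsub>A\<^esub>"
    and \<delta>: "\<And>v. v \<in> S \<Longrightarrow> ev A \<phi> (\<delta> v) = diff A (\<phi> v)"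
  obtains f where "f \<in> dga_hom pres_dga A" "\<And>x. x \<in> tens S \<Longrightarrow> f (cl x) = ev A \<phi> x"
proof
  interpret A: cdga A by (rule A)
  have \<phi>c: "\<And>v. v \<in> S \<Longrightarrow> \<phi> v \<in> carrier A" using \<phi> A.grade_carrier by blast
  \<comment> \<open>The values lie in an arbitrary type, where a union over representatives makes no
    sense; one representative is chosen instead.\<close>
  define f where "f C = ev A \<phi> (SOME x. x \<in> C)" for C
  show f: "f (cl x) = ev A \<phi> x" if "x \<in> tens S" for x
  proof -
    define y where "y = (SOME y. y \<in> cl x)"
    have y: "y \<in> cl x" unfolding y_def by (rule someI[of "\<lambda>y. y \<in> cl x", OF cl_self])
    then have "ev A \<phi> (y - x) = \<zero>\<^bsub>A\<^esub>" using ev_J[OF A \<phi> R] by (simp add: mem_cl_iff)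
    then have "ev A \<phi> y \<ominus>\<^bsub>A\<^esub> ev A \<phi> x = \<zero>\<^bsub>A\<^esub>"
      using y cl_tens[OF that] that \<phi>c by (subst (asm) A.ev_diff) auto
    then have "ev A \<phi> y = ev A \<phi> x"
      using y cl_tens[OF that] that \<phi>c
      by (subst (asm) A.A_minus_eq_zero) (auto intro!: A.ev_carrier[of S])
    then show ?thesis by (simp add: f_def y_def)
  qed
  show "f \<in> dga_hom pres_dga A"
    unfolding dga_hom_def Ring.ring_hom_def
    using \<phi>c \<delta>_tens \<phi> \<delta> A.ev_scalar_mult[of S \<phi>]
    by (auto simp: Q_simps f tens_mult tens_add A.ev_add[of S] A.ev_mult[of S] A.ev_1[of S] A.ev_scalar[of S]
        A.ev_carrier[of S] A.smult_mult_left A.A_l_one A.A_one_closed d_cl D_tens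
        intro!: A.ev_carrier A.ev_grade[of S] A.ev_der[of S])
qed

end

text \<open>The images of letters keep their degrees, so commutators of letters become graded
  commutators of homogeneous tensors, which lie in the target ideal by
  \<open>J_graded_commute\<close>.\<close>

lemma (in presentation) subst_J:
  assumes P: "presentation S' dg' R'"
    and \<phi>_tens: "\<And>v. v \<in> S \<Longrightarrow> \<phi> v \<in> tens S'" and \<phi>_homog: "\<And>v. v \<in> S \<Longrightarrow> \<phi> v \<in> homog dg' (dg v)"
    and R: "\<And>r. r \<in> R \<Longrightarrow> subst \<phi> r \<in> gca_ideal S' dg' R'"
    and x: "x \<in> J"
  shows "subst \<phi> x \<in> gca_ideal S' dg' R'"
proof -
  interpret P: presentation S' dg' R' by (rule P)
  from x show ?thesis
  proof (induction rule: J_induct)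
    case (gen k r l q)
    have "subst \<phi> r \<in> P.J"
    proof (cases "r \<in> R")
      case False
      then obtain v w where r: "r = letter v * letter w - scalar ((-1) ^ (dg v * dg w)) * letter w * letter v" "v \<in> S" "w \<in> S"
        using gen unfolding graded_commutators_def by auto
      then show ?thesis
        using P.J_graded_commute[of "\<phi> v" "dg v" "\<phi> w" "dg w"] \<phi>_tens \<phi>_homog by (simp add: mult.assoc)
    qed (rule R)
    moreover have "subst \<phi> (Poly_Mapping.single (Word k) q) \<in> tens S'" "subst \<phi> (Poly_Mapping.single (Word l) (1::rat)) \<in> tens S'"
      using gen by (auto simp del: subst_simps intro!: subst_tens[of _ S] \<phi>_tens tens_single)
    ultimately show ?case
      unfolding subst_mult by (intro P.J_rmult P.J_lmult)
  qed (auto intro: P.J_add)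
qed

lemma subst_homog:
  assumes "x \<in> tens S" "x \<in> homog dg p" "\<And>v. v \<in> S \<Longrightarrow> \<phi> v \<in> homog dg' (dg v)"
  shows "subst \<phi> x \<in> homog dg' p"
  using assms(1,2)
proof (induction rule: homog_induct)
  case (single l q)
  have "prod_list (map \<phi> l) \<in> homog dg' (sum_list (map dg l))"
    using single(1) by (induction l) (auto intro: homog_mult assms(3))
  then show ?case using single by (auto intro: homog_scalar_mult)
qed (auto intro: homog_add)

lemma subst_der:
  assumes x: "x \<in> tens S" and \<phi>: "\<And>v. v \<in> S \<Longrightarrow> \<phi> v \<in> homog dg' (dg v)"
    and \<delta>: "\<And>v. v \<in> S \<Longrightarrow> der dg' \<delta>' (\<phi> v) = subst \<phi> (\<delta> v)"
  shows "der dg' \<delta>' (subst \<phi> x) = subst \<phi> (der dg \<delta> x)"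
  using x
proof (induction rule: tens_induct)
  case (single l q)
  have "der dg' \<delta>' (prod_list (map \<phi> l)) = subst \<phi> (der_list dg \<delta> l)"
    using single
  proof (induction l)
    case (Cons v l)
    then have "der dg' \<delta>' (prod_list (map \<phi> (v # l))) =
        subst \<phi> (\<delta> v) * prod_list (map \<phi> l) + scalar ((-1) ^ dg v) * \<phi> v * subst \<phi> (der_list dg \<delta> l)"
      by (simp add: der_mult \<delta> invol_homog[OF \<phi>])
    then show ?case by simp
  qed simp
  then show ?case by simp
qed auto

text \<open>Coefficients are rational, so nonzero eigenvalues of the Lie derivative can be divided
  out.\<close>

lemma (in presentation) J_scalar_cancel:
  assumes "c \<noteq> 0" "scalar c * x \<in> J"
  shows "x \<in> J"
proof -
  have "scalar (1 / c) * (scalar c * x) \<in> J" by (rule J_lmult[OF tens_scalar assms(2)])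
  moreover have "scalar (1 / c) * scalar c = (scalar (1 / c * c) :: 'g tensor)"
    by (simp only: scalar_mult)
  then have "scalar (1 / c) * (scalar c * x) = x"
    using assms(1) by (simp flip: mult.assoc)
  ultimately show ?thesis by simp
qed

section \<open>Polynomial forms\<close>

lemma finite_pl_letters_cases:
  assumes "v \<in> pl_letters n"
  obtains j where "j \<le> n" "v = Coord j" | j where "j \<le> n" "v = DCoord j"
  using assms unfolding pl_letters_def by auto

lemma Coord_in_pl_letters [simp]: "Coord j \<in> pl_letters n \<longleftrightarrow> j \<le> n"
  and DCoord_in_pl_letters [simp]: "DCoord j \<in> pl_letters n \<longleftrightarrow> j \<le> n"
  unfolding pl_letters_def by auto

abbreviation pl_ideal :: "nat \<Rightarrow> pl_letter tensor set" where
  "pl_ideal n \<equiv> gca_ideal (pl_letters n) pl_degree (pl_relations n)"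

lemma presentation_pl: "presentation (pl_letters n) pl_degree (pl_relations n)"
proof
  show "pl_relations n \<subseteq> tens (pl_letters n)"
    by (auto simp: pl_relations_def intro!: tens_intros)
  fix r assume "r \<in> pl_relations n"
  then consider "r = (\<Sum>i\<le>n. letter (Coord i)) - 1" | "r = (\<Sum>i\<le>n. letter (DCoord i))"
    by (auto simp: pl_relations_def)
  then show "\<exists>p. r \<in> homog pl_degree p"
  proof cases
    case 1
    then show ?thesis by (intro exI[of _ 0]) (auto intro!: homog_diff homog_sum homog_letter)
  next
    case 2
    then show ?thesis by (intro exI[of _ 1]) (auto intro!: homog_sum homog_letter)
  qed
qed

lemma pl_class_eq: "pl_class n x = cls (pl_ideal n) x"
  by (simp add: pl_class_def a_r_coset_tensor_algebra)

lemma pl_diff_letters_eq: "pl_diff_letters l = der_list pl_degree pl_diff_letter l"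
  by (induction l) auto

lemma pl_diff_tensor_eq: "pl_diff_tensor x = der pl_degree pl_diff_letter x"
  by (simp add: pl_diff_tensor_def der_def lin_def pl_diff_letters_eq)

lemma pl_relations_in_pl_ideal: "pl_relations n \<subseteq> pl_ideal n"
  using presentation.J_superset[OF presentation_pl] by auto

text \<open>The differential sends the first relation to the second and the second to 0, and hence
  descends to the quotient.\<close>

lemma differential_presentation_pl:
  "differential_presentation (pl_letters n) pl_degree (pl_relations n) pl_diff_letter"
proof (intro differential_presentation.intro presentation_pl differential_presentation_axioms.intro)
  interpret presentation "pl_letters n" pl_degree "pl_relations n" by (rule presentation_pl)
  fix r assume "r \<in> pl_relations n"
  then have "der pl_degree pl_diff_letter r \<in> {0, \<Sum>i\<le>n. letter (DCoord i)}"
    by (auto simp: pl_relations_def)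
  moreover have "(\<Sum>i\<le>n. letter (DCoord i)) \<in> pl_ideal n"
    by (rule subsetD[OF pl_relations_in_pl_ideal]) (simp add: pl_relations_def)
  ultimately show "der pl_degree pl_diff_letter r \<in> pl_ideal n"
    by (elim insertE) auto
next
  interpret presentation "pl_letters n" pl_degree "pl_relations n" by (rule presentation_pl)
  fix v assume "v \<in> pl_letters n"
  then show "der pl_degree pl_diff_letter (pl_diff_letter v) \<in> pl_ideal n"
    by (rule finite_pl_letters_cases) auto
qed (auto elim!: finite_pl_letters_cases intro!: tens_letter homog_letter)

abbreviation pl_d :: "nat \<Rightarrow> pl_form \<Rightarrow> pl_form" where
  "pl_d n \<equiv> \<lambda>C. \<Union>x\<in>C. pl_class n (pl_diff_tensor x)"

text \<open>The rewrite turns the facts of the locale into facts about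
  \<open>pl_forms n\<close>.\<close>

interpretation pl: presented_cdga "pl_letters n" pl_degree "pl_relations n" pl_diff_letter "pl_d n"
  rewrites "presented_dga (pl_letters n) pl_degree (pl_relations n) (pl_d n) = pl_forms n" for n
proof -
  interpret differential_presentation "pl_letters n" pl_degree "pl_relations n" pl_diff_letter
    by (rule differential_presentation_pl)
  show "presented_cdga (pl_letters n) pl_degree (pl_relations n) pl_diff_letter (pl_d n)"
    by unfold_locales (simp add: pl_class_eq pl_diff_tensor_eq UN_cl_D)
  show "presented_dga (pl_letters n) pl_degree (pl_relations n) (pl_d n) = pl_forms n"
    by (simp add: pl_forms_def)
qed

abbreviation plcl :: "nat \<Rightarrow> pl_letter tensor \<Rightarrow> pl_form" where
  "plcl n \<equiv> cls (pl_ideal n)"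

lemmas pl_simps =
  pl.carrier_Q[of n "pl_d n", folded pl_forms_def] pl.zero_Q[of n "pl_d n", folded pl_forms_def]
  pl.one_Q[of n "pl_d n", folded pl_forms_def]
  pl.add_Q[of _ n _ "pl_d n", folded pl_forms_def] pl.mult_Q[of _ n _ "pl_d n", folded pl_forms_def]
  pl.smult_Q[of _ n "pl_d n", folded pl_forms_def] pl.grade_Q[of n "pl_d n", folded pl_forms_def] for n

lemma pl_diff: "x \<in> tens (pl_letters n) \<Longrightarrow> diff (pl_forms n) (plcl n x) = plcl n (der pl_degree pl_diff_letter x)"
  using pl.d_cl[of x n] pl.diff_Q[of n "pl_d n", folded pl_forms_def] by simp

lemma cdga_pl_forms: "cdga (pl_forms n)"
  by (rule pl.cdga_axioms)

subsection \<open>Pullback\<close>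

lemma pl_pullback_tensor_eq: "pl_pullback_tensor p \<theta> = subst (pl_pullback_letter p \<theta>)"
  by (rule ext) (simp add: pl_pullback_tensor_def subst_def lin_def)

lemma pl_pullback_letter_tens: "pl_pullback_letter p \<theta> v \<in> tens (pl_letters p)"
  by (cases v) (auto intro!: tens_intros)

lemma pl_pullback_letter_homog: "pl_pullback_letter p \<theta> v \<in> homog pl_degree (pl_degree v)"
  by (cases v) (auto intro!: homog_sum homog_letter)

lemma pl_pullback_tens: "subst (pl_pullback_letter p \<theta>) x \<in> tens (pl_letters p)"
  by (rule subst_tens[of _ UNIV]) (auto intro: pl_pullback_letter_tens)

context
  fixes p q :: nat and \<theta> :: "nat \<Rightarrow> nat"
  assumes \<theta>: "monotone_map p q \<theta>"
begin

text \<open>The fibres of \<open>\<theta>\<close> partition the vertices. Hence the pullbacks of all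
  coordinates add up to the sum of all coordinates, and likewise for differentials, so that the
  relations are preserved.\<close>

lemma pl_pullback_sum:
  "(\<Sum>j\<le>q. \<Sum>i | i \<le> p \<and> \<theta> i = j. f i) = (\<Sum>i\<le>p. f i)" for f :: "nat \<Rightarrow> 'b::comm_monoid_add"
proof -
  show ?thesis
    using sum.group[of "{..p}" "{..q}" \<theta> f] \<theta> unfolding monotone_map_def by simp
qed

lemma pl_pullback_ideal:
  assumes "x \<in> pl_ideal q"
  shows "subst (pl_pullback_letter p \<theta>) x \<in> pl_ideal p"
proof (rule presentation.subst_J[OF presentation_pl presentation_pl _ _ _ assms])
  fix r assume "r \<in> pl_relations q"
  then have "subst (pl_pullback_letter p \<theta>) r \<in> pl_relations p"
    by (auto simp: pl_relations_def pl_pullback_sum)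
  then show "subst (pl_pullback_letter p \<theta>) r \<in> pl_ideal p"
    using pl_relations_in_pl_ideal by blast
qed (auto intro: pl_pullback_letter_tens pl_pullback_letter_homog)

lemma pl_pullback_cl:
  assumes "x \<in> tens (pl_letters q)"
  shows "pl_pullback p \<theta> (plcl q x) = plcl p (subst (pl_pullback_letter p \<theta>) x)"
  unfolding pl_pullback_def pl_pullback_tensor_eq pl_class_eq using assms
  by (rule pl.UN_cl) (auto simp: pl.cl_eq_iff simp flip: subst_simps(2) intro: pl_pullback_ideal)

lemma pl_pullback_dga_hom: "pl_pullback p \<theta> \<in> dga_hom (pl_forms q) (pl_forms p)"
proof -
  have "der pl_degree pl_diff_letter (subst (pl_pullback_letter p \<theta>) x) =
      subst (pl_pullback_letter p \<theta>) (der pl_degree pl_diff_letter x)" for x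
  proof (rule subst_der[of x UNIV])
    fix v show "der pl_degree pl_diff_letter (pl_pullback_letter p \<theta> v) = subst (pl_pullback_letter p \<theta>) (pl_diff_letter v)"
      by (cases v) auto
  qed (auto intro: pl_pullback_letter_homog)
  then show ?thesis
    unfolding dga_hom_def Ring.ring_hom_def
    by (auto simp: pl_simps pl_pullback_cl pl_pullback_tens tens_add tens_mult pl_diff pl.D_tens
        intro!: imageI subst_homog[of _ UNIV] pl_pullback_letter_homog)
qed

end

subsection \<open>Closed functions on a simplex\<close>

definition euler_letter :: "pl_letter \<Rightarrow> pl_letter tensor" where
  "euler_letter v = (case v of Coord j \<Rightarrow> 0 | DCoord j \<Rightarrow> letter (Coord j) - (if j = 0 then 1 else 0))"

lemma euler_letter_simps [simp]:
  "euler_letter (Coord j) = 0" "euler_letter (DCoord j) = letter (Coord j) - (if j = 0 then 1 else 0)"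
  by (simp_all add: euler_letter_def)

text \<open>
  \<open>euler_letter\<close> is contraction with the Euler vector field centred at vertex 0, so that the Lie
  derivative \<open>lie = dh + hd\<close> multiplies a monomial of degree \<open>k\<close> in the coordinates centred at that
  vertex by \<open>k\<close>.
\<close>

interpretation eu: antiderivation_presentation "pl_letters n" pl_degree "pl_relations n" euler_letter for n
proof
  fix v assume v: "v \<in> pl_letters n"
  then show "euler_letter v \<in> tens (pl_letters n)"
    by (rule finite_pl_letters_cases) (auto intro!: tens_intros)
  show "\<exists>e. euler_letter v \<in> homog pl_degree e \<and> odd (pl_degree v + e)"
    using v
  proof (rule finite_pl_letters_cases)
    fix j assume "v = Coord j" then show ?thesis by (intro exI[of _ 1]) auto
  next
    fix j assume "v = DCoord j" then show ?thesis by (intro exI[of _ 0]) (auto intro!: homog_diff homog_letter)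
  qed
next
  fix r assume "r \<in> pl_relations n"
  \<comment> \<open>Centring at vertex 0 subtracts 1 exactly once, so contraction carries the
    relation between the differentials to the relation between the coordinates.\<close>
  moreover have "(\<Sum>i\<le>n. letter (Coord i) - (if i = 0 then 1 else 0)) = (\<Sum>i\<le>n. letter (Coord i)) - (1 :: pl_letter tensor)"
    by (simp add: sum_subtractf)
  ultimately have "der pl_degree euler_letter r \<in> {0, (\<Sum>i\<le>n. letter (Coord i)) - 1}"
    by (auto simp: pl_relations_def)
  moreover have "(\<Sum>i\<le>n. letter (Coord i)) - 1 \<in> pl_ideal n"
    by (rule subsetD[OF pl_relations_in_pl_ideal]) (simp add: pl_relations_def)
  ultimately show "der pl_degree euler_letter r \<in> pl_ideal n"
    by (elim insertE) auto
qed

section \<open>The Lie derivative and its eigenvectors\<close>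

definition lie :: "pl_letter tensor \<Rightarrow> pl_letter tensor" where
  "lie x = der pl_degree pl_diff_letter (der pl_degree euler_letter x) + der pl_degree euler_letter (der pl_degree pl_diff_letter x)"

lemma lie_simps [simp]:
  "lie (x + y) = lie x + lie y" "lie (x - y) = lie x - lie y" "lie (scalar q * x) = scalar q * lie x"
  "lie 0 = 0" "lie 1 = 0" "lie (scalar q) = 0" "lie (sum f A) = (\<Sum>i\<in>A. lie (f i))"
  "lie (letter (Coord j)) = letter (Coord j) - (if j = 0 then 1 else 0)"
  by (simp_all add: lie_def algebra_simps sum.distrib)

lemma lie_J: "x \<in> pl_ideal n \<Longrightarrow> lie x \<in> pl_ideal n"
  unfolding lie_def by (intro pl.J_add pl.D_J eu.D_J)

text \<open>The mixed terms of the two compositions of odd operators cancel by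
  \<open>D_invol\<close>, which leaves a derivation without signs.\<close>

lemma lie_mult: "x \<in> tens (pl_letters n) \<Longrightarrow> y \<in> tens (pl_letters n) \<Longrightarrow> lie (x * y) = lie x * y + x * lie y"
  unfolding lie_def der_mult der_simps invol_invol
  using pl.D_invol[of x n] eu.D_invol[of x n] by (simp add: algebra_simps)

text \<open>Eigenvectors of the Lie derivative on the level of tensors, not only modulo the
  relations. Weight 0 is required to consist of constants, because the part of weight 0 is what
  remains of a closed function.\<close>

definition eigen :: "nat \<Rightarrow> nat \<Rightarrow> pl_letter tensor \<Rightarrow> bool" where
  "eigen n k x \<longleftrightarrow> x \<in> tens (pl_letters n) \<and> lie x = scalar (of_nat k) * x \<and> (k = 0 \<longrightarrow> (\<exists>c. x = scalar c))"

lemma eigen_add: "eigen n k x \<Longrightarrow> eigen n k y \<Longrightarrow> eigen n k (x + y)"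
  unfolding eigen_def by (auto simp: distrib_left tens_add) (metis scalar_add)

lemma eigen_scalar_mult: "eigen n k x \<Longrightarrow> eigen n k (scalar q * x)"
  unfolding eigen_def scalar_left_commute[of "scalar (of_nat k)" q x]
  by (auto simp: tens_mult simp del: lie_simps(6) intro: exI[of _ "q * _"] simp flip: scalar_mult)

lemma eigen_0 [simp]: "eigen n k 0"
  unfolding eigen_def by (auto intro: exI[of _ 0])

text \<open>The Lie derivative is a derivation and the centred coordinate has weight 1, so weights
  add.\<close>

lemma eigen_Coord_mult:
  assumes "eigen n k x" "j \<le> n"
  shows "eigen n (Suc k) ((letter (Coord j) - (if j = 0 then 1 else 0)) * x)"
proof -
  let ?y = "letter (Coord j) - (if j = 0 then 1 else 0) :: pl_letter tensor"
  have y: "?y \<in> tens (pl_letters n)" "lie ?y = ?y" using assms by (auto intro!: tens_intros)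
  have x: "x \<in> tens (pl_letters n)" "lie x = scalar (of_nat k) * x" using assms unfolding eigen_def by auto
  have "lie (?y * x) = ?y * x + ?y * (scalar (of_nat k) * x)"
    using lie_mult[of ?y n x] x y by simp
  also have "?y * (scalar (of_nat k) * x) = scalar (of_nat k) * (?y * x)"
    by (rule scalar_left_commute)
  also have "?y * x + scalar (of_nat k) * (?y * x) = scalar (of_nat (Suc k)) * (?y * x)"
    by (simp add: scalar_add distrib_right)
  finally show ?thesis
    unfolding eigen_def using tens_mult[OF y(1) x(1)] by blast
qed

definition eigen_sum :: "nat \<Rightarrow> pl_letter tensor \<Rightarrow> bool" where
  "eigen_sum n x \<longleftrightarrow> (\<exists>g N. (\<forall>k. eigen n k (g k)) \<and> (\<forall>k>N. g k = 0) \<and> x = (\<Sum>k\<le>N. g k))"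

lemma eigen_sum_add:
  assumes "eigen_sum n x" "eigen_sum n y"
  shows "eigen_sum n (x + y)"
proof -
  obtain g N where g: "\<And>k. eigen n k (g k)" "\<And>k. k > N \<Longrightarrow> g k = 0" "x = (\<Sum>k\<le>N. g k)"
    using assms(1) unfolding eigen_sum_def by auto
  obtain h M where h: "\<And>k. eigen n k (h k)" "\<And>k. k > M \<Longrightarrow> h k = 0" "y = (\<Sum>k\<le>M. h k)"
    using assms(2) unfolding eigen_sum_def by auto
  have "x = (\<Sum>k\<le>max N M. g k)" unfolding g(3)
    by (rule sum.mono_neutral_left) (auto intro!: g(2))
  moreover have "y = (\<Sum>k\<le>max N M. h k)" unfolding h(3)
    by (rule sum.mono_neutral_left) (auto intro!: h(2))
  ultimately have "x + y = (\<Sum>k\<le>max N M. g k + h k)"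
    by (simp add: sum.distrib)
  then show ?thesis
    unfolding eigen_sum_def using g h
    by (intro exI[of _ "\<lambda>k. g k + h k"] exI[of _ "max N M"]) (auto intro: eigen_add)
qed

lemma eigen_sum_eigen: "eigen n k x \<Longrightarrow> eigen_sum n x"
  unfolding eigen_sum_def by (intro exI[of _ "\<lambda>i. if i = k then x else 0"] exI[of _ k]) auto

lemma eigen_sum_scalar_mult: "eigen_sum n x \<Longrightarrow> eigen_sum n (scalar q * x)"
  unfolding eigen_sum_def
  apply (elim exE conjE)
  subgoal for g N
    by (intro exI[of _ "\<lambda>k. scalar q * g k"] exI[of _ N]) (auto simp: sum_distrib_left intro: eigen_scalar_mult)
  done

lemma eigen_sum_sum: "(\<And>i. i \<in> A \<Longrightarrow> eigen_sum n (f i)) \<Longrightarrow> eigen_sum n (sum f A)"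
  by (induction A rule: infinite_finite_induct) (auto intro: eigen_sum_add eigen_sum_eigen[of n 0])

text \<open>A barycentric coordinate is the centred one plus a constant, which is 1 for vertex 0 and
  0 otherwise; each weight thus contributes to itself and to the next one.\<close>

lemma eigen_sum_Coord_mult:
  assumes "eigen_sum n x" "j \<le> n"
  shows "eigen_sum n (letter (Coord j) * x)"
proof -
  obtain g N where g: "\<And>k. eigen n k (g k)" "x = (\<Sum>k\<le>N. g k)"
    using assms(1) unfolding eigen_sum_def by auto
  let ?c = "if j = 0 then 1 else 0 :: rat"
  have "letter (Coord j) * x = (\<Sum>k\<le>N. (letter (Coord j) - (if j = 0 then 1 else 0)) * g k) + scalar ?c * x"
    unfolding g(2) sum_distrib_left[symmetric] by (simp add: algebra_simps)
  moreover have "eigen_sum n \<dots>"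
    by (intro eigen_sum_add eigen_sum_sum eigen_sum_scalar_mult assms(1) eigen_sum_eigen[OF eigen_Coord_mult[OF g(1) assms(2)]])
  ultimately show ?thesis by simp
qed

lemma eigen_sum_degree_0:
  assumes "x \<in> tens (pl_letters n)" "x \<in> homog pl_degree 0"
  shows "eigen_sum n x"
  using assms
proof (induction rule: homog_induct)
  case zero
  then show ?case using eigen_sum_eigen[of n 0 0] by simp
next
  case (single l q)
  have "eigen n 0 1" unfolding eigen_def by (auto intro: exI[of _ 1])
  then have "eigen_sum n (Poly_Mapping.single (Word l) 1)" using single
    by (induction l)
      (auto simp: single_Word_Nil single_Word_Cons elim!: finite_pl_letters_cases intro: eigen_sum_eigen eigen_sum_Coord_mult)
  then show ?case
    using eigen_sum_scalar_mult[of n "Poly_Mapping.single (Word l) 1" q] by (simp add: scalar_mult_single)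
next
  case (add x y)
  then show ?case by (intro eigen_sum_add)
qed

text \<open>Applying the Lie derivative minus the top eigenvalue removes the top summand and
  multiplies the others by nonzero integers. This is the usual independence proof for distinct
  eigenvalues, carried out modulo the ideal.\<close>

lemma eigen_independent:
  assumes "\<And>k. eigen n k (g k)" "(\<Sum>k\<le>N. g k) \<in> pl_ideal n" "k \<le> N"
  shows "g k \<in> pl_ideal n"
  using assms
proof (induction N arbitrary: g k)
  case (Suc N)
  let ?x = "\<Sum>k\<le>Suc N. g k"
  have l: "lie (g k) = scalar (of_nat k) * g k" for k
    using Suc.prems(1) unfolding eigen_def by auto
  have "lie ?x - scalar (of_nat (Suc N)) * ?x \<in> pl_ideal n"
    using Suc.prems(2) by (intro pl.J_diff lie_J pl.J_lmult) auto
  moreover have "lie ?x - scalar (of_nat (Suc N)) * ?x = (\<Sum>k\<le>Suc N. scalar (of_nat k - of_nat (Suc N)) * g k)"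
    by (simp only: lie_simps l sum_distrib_left sum_subtractf[symmetric] left_diff_distrib[symmetric])
      (simp only: diff_conv_add_uminus scalar_add scalar_uminus)
  ultimately have "(\<Sum>k\<le>N. scalar (of_nat k - of_nat (Suc N)) * g k) \<in> pl_ideal n"
    by simp
  then have IH: "scalar (of_nat k - of_nat (Suc N)) * g k \<in> pl_ideal n" if "k \<le> N" for k
    using that Suc.prems(1) by (intro Suc.IH[of "\<lambda>k. scalar (of_nat k - of_nat (Suc N)) * g k" k]) (auto intro: eigen_scalar_mult)
  have *: "g k \<in> pl_ideal n" if "k \<le> N" for k
  proof -
    have "of_nat k - of_nat (Suc N) \<noteq> (0 :: rat)"
      using that by (simp del: of_nat_Suc)
    then show ?thesis using IH[OF that] by (rule pl.J_scalar_cancel)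
  qed
  show ?case
  proof (cases "k = Suc N")
    case True
    have "?x - (\<Sum>k\<le>N. g k) \<in> pl_ideal n"
      using * by (intro pl.J_diff[OF Suc.prems(2)] pl.J_sum) auto
    then show ?thesis using True by simp
  qed (use * Suc.prems(3) in auto)
qed simp

text \<open>Cartan's formula: contraction kills functions, so the Lie derivative of a closed
  function is 0 modulo the relations. All summands of positive weight then vanish, and the constant
  of weight 0 is left.\<close>

lemma closed_pl_function_constant:
  assumes "\<omega> \<in> grade (pl_forms n) 0" "diff (pl_forms n) \<omega> = \<zero>\<^bsub>pl_forms n\<^esub>"
  shows "\<exists>c. \<omega> = plcl n (scalar c)"
proof -
  obtain x where x: "\<omega> = plcl n x" "x \<in> tens (pl_letters n)" "x \<in> homog pl_degree 0"
    using assms(1) by (auto simp: pl_simps)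
  have "der pl_degree pl_diff_letter x \<in> pl_ideal n"
    using assms(2) x by (simp add: pl_diff pl_simps pl.cl_eq_iff)
  then have "der pl_degree euler_letter (der pl_degree pl_diff_letter x) \<in> pl_ideal n"
    by (rule eu.D_J)
  \<comment> \<open>Words of degree 0 consist of coordinates only, and these are annihilated by the
    contraction.\<close>
  moreover have "der pl_degree euler_letter x = 0"
    using x(2,3)
  proof (induction rule: homog_induct)
    case (single l q)
    have "der_list pl_degree euler_letter l = 0" using single
      by (induction l) (auto elim!: finite_pl_letters_cases)
    then show ?case by simp
  qed auto
  ultimately have lie: "lie x \<in> pl_ideal n" by (simp add: lie_def)
  obtain g N where g: "\<And>k. eigen n k (g k)" "x = (\<Sum>k\<le>N. g k)"
    using eigen_sum_degree_0[OF x(2,3)] unfolding eigen_sum_def by auto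
  have "lie x = (\<Sum>k\<le>N. scalar (of_nat k) * g k)"
    unfolding g(2) lie_simps using g(1) unfolding eigen_def by (intro sum.cong) auto
  then have k: "scalar (of_nat k) * g k \<in> pl_ideal n" if "k \<le> N" for k
    using lie that g(1) by (intro eigen_independent[of n "\<lambda>k. scalar (of_nat k) * g k" N]) (auto intro: eigen_scalar_mult)
  have *: "g k \<in> pl_ideal n" if "k \<in> {..N} - {0}" for k
    using that by (intro pl.J_scalar_cancel[OF _ k]) auto
  have "x = g 0 + (\<Sum>k\<in>{..N} - {0}. g k)"
    unfolding g(2) by (rule sum.remove) auto
  then have "x - g 0 \<in> pl_ideal n" using pl.J_sum[of "{..N} - {0}" g n] * by simp
  moreover obtain c where "g 0 = scalar c" using g(1)[of 0] unfolding eigen_def by auto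
  ultimately show ?thesis using x(1) by (auto simp: pl.cl_eq_iff intro!: exI[of _ c])
qed

text \<open>Evaluation at vertex 0 shows that constants are not identified by the relations.\<close>

lemma scalar_in_pl_ideal_iff: "scalar c \<in> pl_ideal n \<longleftrightarrow> c = 0"
proof
  \<comment> \<open>Every value is a scalar; the letter type \<open>unit\<close> merely gives
    \<open>subst\<close> a target.\<close>
  define \<epsilon> :: "pl_letter \<Rightarrow> unit tensor" where "\<epsilon> v = (if v = Coord 0 then 1 else 0)" for v
  have "subst \<epsilon> x = 0" if "x \<in> pl_ideal n" for x
    using that
  proof (induction rule: pl.J_induct)
    case (gen k r l q)
    have "(\<Sum>i\<le>n. \<epsilon> (Coord i)) = (\<Sum>i\<le>n. if i = 0 then 1 else 0)"
      by (intro sum.cong) (auto simp: \<epsilon>_def)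
    then have "subst \<epsilon> r = 0" if "r \<in> pl_relations n"
      using that by (auto simp: pl_relations_def) (simp add: \<epsilon>_def)
    moreover have "subst \<epsilon> r = 0" if "r \<in> graded_commutators (pl_letters n) pl_degree"
    proof -
      obtain v w where "r = letter v * letter w - scalar ((-1) ^ (pl_degree v * pl_degree w)) * letter w * letter v"
        using \<open>r \<in> graded_commutators (pl_letters n) pl_degree\<close> unfolding graded_commutators_def by auto
      then show ?thesis
        by (cases "v = Coord 0 \<and> w = Coord 0") (auto simp: \<epsilon>_def)
    qed
    ultimately have "subst \<epsilon> r = 0" using gen(2) by blast
    then show ?case by simp
  qed auto
  moreover assume "scalar c \<in> pl_ideal n"
  ultimately have "scalar c = (scalar 0 :: unit tensor)" by fastforce
  then show "c = 0" by (simp only: scalar_eq_iff)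
qed auto

lemma plcl_scalar_eq_iff: "plcl n (scalar c) = plcl n (scalar c') \<longleftrightarrow> c = c'"
proof -
  have "scalar c - scalar c' = (scalar (c - c') :: pl_letter tensor)"
    by (simp only: diff_conv_add_uminus scalar_add scalar_uminus)
  then show ?thesis by (simp add: pl.cl_eq_iff scalar_in_pl_ideal_iff)
qed

section \<open>Polynomial forms on a space\<close>

lemma simplex_map_standard_simplex:
  assumes "monotone_map p q \<theta>" "x \<in> standard_simplex p"
  shows "Defs.simplex_map p \<theta> x \<in> standard_simplex q"
proof -
  have x: "\<And>i. 0 \<le> x i" "\<And>i. x i \<le> 1" "(\<Sum>i\<le>p. x i) = 1"
    using assms(2) by (auto simp: standard_simplex_def)
  have "(\<Sum>i | i \<le> p \<and> \<theta> i = j. x i) \<le> (\<Sum>i\<le>p. x i)" for j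
    using x by (intro sum_mono2) auto
  moreover have "(\<Sum>i | i \<le> p \<and> \<theta> i = j. x i) = 0" if "j > q" for j
    using assms(1) that unfolding monotone_map_def by (intro sum.neutral) force
  moreover have "(\<Sum>j\<le>q. \<Sum>i | i \<le> p \<and> \<theta> i = j. x i) = 1"
    using pl_pullback_sum[OF assms(1), of x] x(3) by simp
  ultimately show ?thesis
    using x by (auto simp: standard_simplex_def Defs.simplex_map_def intro: sum_nonneg)
qed

lemma continuous_map_simplex_map:
  "continuous_map (powertop_real UNIV) (powertop_real UNIV) (Defs.simplex_map p \<theta>)"
  unfolding Defs.simplex_map_def continuous_map_componentwise_UNIV
  by (intro allI continuous_map_sum continuous_map_product_projection) auto

lemma singular_simplex_face:
  assumes "monotone_map p q \<theta>" "singular_simplex q X \<sigma>"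
  shows "singular_simplex p X (restrict (\<sigma> \<circ> Defs.simplex_map p \<theta>) (standard_simplex p))"
proof -
  have "continuous_map (subtopology (powertop_real UNIV) (standard_simplex p))
      (subtopology (powertop_real UNIV) (standard_simplex q)) (Defs.simplex_map p \<theta>)"
    using simplex_map_standard_simplex[OF assms(1)]
    by (intro continuous_map_into_subtopology continuous_map_from_subtopology continuous_map_simplex_map) auto
  moreover have "continuous_map (subtopology (powertop_real UNIV) (standard_simplex q)) X \<sigma>"
    using assms(2) by (simp add: singular_simplex_def)
  ultimately have "continuous_map (subtopology (powertop_real UNIV) (standard_simplex p)) X (\<sigma> \<circ> Defs.simplex_map p \<theta>)"
    by (rule continuous_map_compose)
  then show ?thesis
    unfolding singular_simplex_def by (auto intro: continuous_map_eq)
qed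

text \<open>Compatibility with faces, separated from the degree, so that it can be stated for the
  inhomogeneous elements of \<open>apl X\<close> too.\<close>

definition apl_family :: "'x topology \<Rightarrow> ('x sing_simplex \<Rightarrow> pl_form) \<Rightarrow> bool" where
  "apl_family X \<omega> \<longleftrightarrow> \<omega> \<in> extensional (singular_simplices X) \<and>
     (\<forall>n \<sigma>. (n, \<sigma>) \<in> singular_simplices X \<longrightarrow> \<omega> (n, \<sigma>) \<in> carrier (pl_forms n)) \<and>
     (\<forall>p q \<theta> \<sigma>. monotone_map p q \<theta> \<and> (q, \<sigma>) \<in> singular_simplices X \<longrightarrow>
          \<omega> (p, restrict (\<sigma> \<circ> Defs.simplex_map p \<theta>) (standard_simplex p)) = pl_pullback p \<theta> (\<omega> (q, \<sigma>)))"

lemma apl_grade_iff: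
  "\<omega> \<in> apl_grade X r \<longleftrightarrow> apl_family X \<omega> \<and> (\<forall>n \<sigma>. (n, \<sigma>) \<in> singular_simplices X \<longrightarrow> \<omega> (n, \<sigma>) \<in> grade (pl_forms n) r)"
proof -
  have "\<omega> \<in> carrier (pl_forms n)" if "\<omega> \<in> grade (pl_forms n) r" for \<omega> n
    using cdga.grade_carrier[OF cdga_pl_forms that] .
  then show ?thesis
    unfolding apl_grade_def apl_family_def singular_simplices_def PiE_iff mem_Collect_eq case_prod_conv Ball_def split_paired_All
    by blast
qed

lemma apl_family_carrier: "apl_family X \<omega> \<Longrightarrow> (n, \<sigma>) \<in> singular_simplices X \<Longrightarrow> \<omega> (n, \<sigma>) \<in> carrier (pl_forms n)"
  by (simp add: apl_family_def)

lemma face_in_singular_simplices: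
  "monotone_map p q \<theta> \<Longrightarrow> (q, \<sigma>) \<in> singular_simplices X \<Longrightarrow>
    (p, restrict (\<sigma> \<circ> Defs.simplex_map p \<theta>) (standard_simplex p)) \<in> singular_simplices X"
  by (auto simp: singular_simplices_def singular_simplex_face)

lemma apl_familyI:
  assumes "\<And>n \<sigma>. (n, \<sigma>) \<in> singular_simplices X \<Longrightarrow> f n \<sigma> \<in> carrier (pl_forms n)"
    and "\<And>p q \<theta> \<sigma>. monotone_map p q \<theta> \<Longrightarrow> (q, \<sigma>) \<in> singular_simplices X \<Longrightarrow>
      f p (restrict (\<sigma> \<circ> Defs.simplex_map p \<theta>) (standard_simplex p)) = pl_pullback p \<theta> (f q \<sigma>)"
  shows "apl_family X (\<lambda>(n, \<sigma>)\<in>singular_simplices X. f n \<sigma>)"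
  unfolding apl_family_def by (auto simp: assms face_in_singular_simplices)

lemma dga_homD:
  assumes "f \<in> dga_hom A B"
  shows "x \<in> carrier A \<Longrightarrow> f x \<in> carrier B"
    and "x \<in> carrier A \<Longrightarrow> y \<in> carrier A \<Longrightarrow> f (x \<oplus>\<^bsub>A\<^esub> y) = f x \<oplus>\<^bsub>B\<^esub> f y"
    and "x \<in> carrier A \<Longrightarrow> y \<in> carrier A \<Longrightarrow> f (x \<otimes>\<^bsub>A\<^esub> y) = f x \<otimes>\<^bsub>B\<^esub> f y"
    and "f \<one>\<^bsub>A\<^esub> = \<one>\<^bsub>B\<^esub>"
    and "x \<in> carrier A \<Longrightarrow> f (q \<odot>\<^bsub>A\<^esub> x) = q \<odot>\<^bsub>B\<^esub> f x"
    and "x \<in> grade A p \<Longrightarrow> f x \<in> grade B p"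
    and "x \<in> carrier A \<Longrightarrow> f (diff A x) = diff B (f x)"
  using assms unfolding dga_hom_def Ring.ring_hom_def by (auto 0 3)

lemma dga_hom_zero:
  assumes "f \<in> dga_hom A B" "cdga A" "cdga B"
  shows "f \<zero>\<^bsub>A\<^esub> = \<zero>\<^bsub>B\<^esub>"
proof -
  interpret A: cdga A by fact
  interpret B: cdga B by fact
  have z: "\<zero>\<^bsub>A\<^esub> \<in> carrier A" using A.grade_carrier[OF A.grade_zero] .
  have "f (0 \<odot>\<^bsub>A\<^esub> \<zero>\<^bsub>A\<^esub>) = 0 \<odot>\<^bsub>B\<^esub> f \<zero>\<^bsub>A\<^esub>" using dga_homD(5)[OF assms(1) z] .
  then show ?thesis using z dga_homD(1)[OF assms(1) z] by simp
qed

lemma pl_pullback_zero: "monotone_map p q \<theta> \<Longrightarrow> pl_pullback p \<theta> \<zero>\<^bsub>pl_forms q\<^esub> = \<zero>\<^bsub>pl_forms p\<^esub>"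
  by (rule dga_hom_zero[OF pl_pullback_dga_hom cdga_pl_forms cdga_pl_forms])

lemmas pl_pullback_hom = dga_homD[OF pl_pullback_dga_hom]

lemma apl_simps:
  "mult (apl X) = (\<lambda>\<omega> \<eta>. \<lambda>(n, \<sigma>)\<in>singular_simplices X. \<omega> (n, \<sigma>) \<otimes>\<^bsub>pl_forms n\<^esub> \<eta> (n, \<sigma>))"
  "add (apl X) = (\<lambda>\<omega> \<eta>. \<lambda>(n, \<sigma>)\<in>singular_simplices X. \<omega> (n, \<sigma>) \<oplus>\<^bsub>pl_forms n\<^esub> \<eta> (n, \<sigma>))"
  "one (apl X) = (\<lambda>(n, \<sigma>)\<in>singular_simplices X. \<one>\<^bsub>pl_forms n\<^esub>)"
  "zero (apl X) = (\<lambda>(n, \<sigma>)\<in>singular_simplices X. \<zero>\<^bsub>pl_forms n\<^esub>)"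
  "smult (apl X) = (\<lambda>c \<omega>. \<lambda>(n, \<sigma>)\<in>singular_simplices X. c \<odot>\<^bsub>pl_forms n\<^esub> \<omega> (n, \<sigma>))"
  "grade (apl X) = apl_grade X"
  "diff (apl X) = (\<lambda>\<omega>. \<lambda>(n, \<sigma>)\<in>singular_simplices X. diff (pl_forms n) (\<omega> (n, \<sigma>)))"
  "carrier (apl X) = {\<lambda>(n, \<sigma>)\<in>singular_simplices X. finsum (pl_forms n) (\<lambda>r. \<eta> r (n, \<sigma>)) {..N} | \<eta> N.
        \<forall>r. \<eta> r \<in> apl_grade X r}"
  by (simp_all add: apl_def)

context
  fixes X :: "'x topology"
begin

abbreviation "SS \<equiv> singular_simplices X"

lemmas pl_ring_simps = ring.ring_simprules[OF pl.ring_A]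

lemma apl_family_face:
  "apl_family X \<omega> \<Longrightarrow> monotone_map p q \<theta> \<Longrightarrow> (q, \<sigma>) \<in> SS \<Longrightarrow>
    \<omega> (p, restrict (\<sigma> \<circ> Defs.simplex_map p \<theta>) (standard_simplex p)) = pl_pullback p \<theta> (\<omega> (q, \<sigma>))"
  by (simp add: apl_family_def)

lemma apl_family_add: "apl_family X \<omega> \<Longrightarrow> apl_family X \<eta> \<Longrightarrow> apl_family X (\<omega> \<oplus>\<^bsub>apl X\<^esub> \<eta>)"
  unfolding apl_simps by (rule apl_familyI) (simp_all add: apl_family_face apl_family_carrier pl_pullback_hom pl_ring_simps)

lemma apl_grade_add: "\<omega> \<in> apl_grade X r \<Longrightarrow> \<eta> \<in> apl_grade X r \<Longrightarrow> \<omega> \<oplus>\<^bsub>apl X\<^esub> \<eta> \<in> apl_grade X r"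
  unfolding apl_grade_iff by (simp add: apl_family_add) (simp add: apl_simps(2) pl.grade_add)

lemma apl_grade_smult: "\<omega> \<in> apl_grade X r \<Longrightarrow> c \<odot>\<^bsub>apl X\<^esub> \<omega> \<in> apl_grade X r"
  unfolding apl_grade_iff apl_simps
  by (intro conjI apl_familyI; elim conjE; simp add: apl_family_face apl_family_carrier pl_pullback_hom pl.grade_smult)

lemma apl_grade_diff: "\<omega> \<in> apl_grade X r \<Longrightarrow> diff (apl X) \<omega> \<in> apl_grade X (Suc r)"
  unfolding apl_grade_iff apl_simps
  by (intro conjI apl_familyI; elim conjE; simp add: apl_family_face apl_family_carrier pl_pullback_hom pl.diff_grade pl.diff_carrier)

lemma apl_grade_mult: "\<omega> \<in> apl_grade X r \<Longrightarrow> \<eta> \<in> apl_grade X s \<Longrightarrow> \<omega> \<otimes>\<^bsub>apl X\<^esub> \<eta> \<in> apl_grade X (r + s)"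
  unfolding apl_grade_iff apl_simps
  by (intro conjI apl_familyI; elim conjE; simp add: apl_family_face apl_family_carrier pl_pullback_hom pl.mult_grade pl.A_m_closed)

lemma apl_grade_zero: "\<zero>\<^bsub>apl X\<^esub> \<in> apl_grade X r"
  unfolding apl_grade_iff apl_simps
  by (intro conjI apl_familyI) (simp_all add: pl_ring_simps pl_pullback_zero pl.grade_zero)

lemma apl_grade_one: "\<one>\<^bsub>apl X\<^esub> \<in> apl_grade X 0"
  unfolding apl_grade_iff apl_simps
  by (intro conjI apl_familyI) (simp_all add: pl.A_one_closed pl_pullback_hom(4) pl.one_grade)

lemma apl_grade_outside: "\<omega> \<in> apl_grade X r \<Longrightarrow> s \<notin> SS \<Longrightarrow> \<omega> s = undefined"
  unfolding apl_grade_iff apl_family_def extensional_def by blast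

lemma apl_grade_sum_carrier:
  "\<forall>r. \<eta> r \<in> apl_grade X r \<Longrightarrow> (\<lambda>(n, \<sigma>)\<in>SS. finsum (pl_forms n) (\<lambda>r. \<eta> r (n, \<sigma>)) {..N}) \<in> carrier (apl X)"
  unfolding apl_simps by blast

lemma apl_grade_pl_carrier: "\<omega> \<in> apl_grade X r \<Longrightarrow> (n, \<sigma>) \<in> SS \<Longrightarrow> \<omega> (n, \<sigma>) \<in> carrier (pl_forms n)"
  by (auto simp: apl_grade_iff apl_family_carrier)

lemma apl_sum_Suc:
  assumes "\<forall>r. \<eta> r \<in> apl_grade X r"
  shows "(\<lambda>(n, \<sigma>)\<in>SS. finsum (pl_forms n) (\<lambda>r. \<eta> r (n, \<sigma>)) {..Suc N}) =
    (\<lambda>(n, \<sigma>)\<in>SS. finsum (pl_forms n) (\<lambda>r. \<eta> r (n, \<sigma>)) {..N}) \<oplus>\<^bsub>apl X\<^esub> \<eta> (Suc N)"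
proof -
  have "finsum (pl_forms n) (\<lambda>r. \<eta> r (n, \<sigma>)) {..Suc N} = finsum (pl_forms n) (\<lambda>r. \<eta> r (n, \<sigma>)) {..N} \<oplus>\<^bsub>pl_forms n\<^esub> \<eta> (Suc N) (n, \<sigma>)"
    if "(n, \<sigma>) \<in> SS" for n \<sigma>
  proof -
    have c: "\<eta> r (n, \<sigma>) \<in> carrier (pl_forms n)" for r
      using assms that apl_grade_pl_carrier by blast
    then have f: "finsum (pl_forms n) (\<lambda>r. \<eta> r (n, \<sigma>)) {..N} \<in> carrier (pl_forms n)"
      by (intro pl.A_finsum_closed) auto
    have "finsum (pl_forms n) (\<lambda>r. \<eta> r (n, \<sigma>)) (insert (Suc N) {..N}) =
        \<eta> (Suc N) (n, \<sigma>) \<oplus>\<^bsub>pl_forms n\<^esub> finsum (pl_forms n) (\<lambda>r. \<eta> r (n, \<sigma>)) {..N}"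
      using c by (intro pl.A_finsum_insert) auto
    then show ?thesis using c f by (simp add: atMost_Suc pl_ring_simps)
  qed
  then show ?thesis
    unfolding apl_simps by (intro restrict_ext) auto
qed

lemma apl_sum_0:
  assumes "\<forall>r. \<eta> r \<in> apl_grade X r"
  shows "(\<lambda>(n, \<sigma>)\<in>SS. finsum (pl_forms n) (\<lambda>r. \<eta> r (n, \<sigma>)) {..0}) = \<eta> 0"
proof
  fix s :: "'x sing_simplex"
  obtain n \<sigma> where s: "s = (n, \<sigma>)" by force
  show "(\<lambda>(n, \<sigma>)\<in>SS. finsum (pl_forms n) (\<lambda>r. \<eta> r (n, \<sigma>)) {..0}) s = \<eta> 0 s"
  proof (cases "s \<in> SS")
    case True
    then have "\<eta> 0 (n, \<sigma>) \<in> carrier (pl_forms n)" using assms s apl_grade_pl_carrier by blast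
    then show ?thesis using True s pl.A_finsum_insert[of "{}" 0 "\<lambda>r. \<eta> r (n, \<sigma>)" n] by (simp add: pl_ring_simps)
  next
    case False
    moreover have "\<eta> 0 s = undefined" by (rule apl_grade_outside[OF _ False]) (use assms in blast)
    ultimately show ?thesis by simp
  qed
qed

text \<open>An element is built up by adding one homogeneous component at a time. The rule does not
  provide membership of the summands in the carrier; applications that use it carry it along in the
  claim.\<close>

lemma apl_induct [consumes 1, case_names grade add]:
  assumes "\<omega> \<in> carrier (apl X)"
    and g: "\<And>\<omega> r. \<omega> \<in> apl_grade X r \<Longrightarrow> P \<omega>"
    and a: "\<And>\<omega> \<eta>. P \<omega> \<Longrightarrow> P \<eta> \<Longrightarrow> P (\<omega> \<oplus>\<^bsub>apl X\<^esub> \<eta>)"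
  shows "P \<omega>"
proof -
  obtain \<eta> N where \<eta>: "\<forall>r. \<eta> r \<in> apl_grade X r" "\<omega> = (\<lambda>(n, \<sigma>)\<in>SS. finsum (pl_forms n) (\<lambda>r. \<eta> r (n, \<sigma>)) {..N})"
    using assms(1) unfolding apl_simps by auto
  have *: "P (\<lambda>(n, \<sigma>)\<in>SS. finsum (pl_forms n) (\<lambda>r. \<eta> r (n, \<sigma>)) {..N})" for N
  proof (induction N)
    case 0
    show ?case unfolding apl_sum_0[OF \<eta>(1)] using g \<eta>(1) by blast
  next
    case (Suc N)
    show ?case unfolding apl_sum_Suc[OF \<eta>(1)] by (rule a[OF Suc g[OF spec[OF \<eta>(1)]]])
  qed
  show ?thesis unfolding \<eta>(2) by (rule *)
qed

lemma apl_carrier_family: "\<omega> \<in> carrier (apl X) \<Longrightarrow> apl_family X \<omega>"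
proof (induction rule: apl_induct)
  case (grade \<omega> r)
  then show ?case by (simp add: apl_grade_iff)
next
  case (add \<omega> \<eta>)
  then show ?case by (intro apl_family_add)
qed

lemma apl_carrier_pl_carrier: "\<omega> \<in> carrier (apl X) \<Longrightarrow> (n, \<sigma>) \<in> SS \<Longrightarrow> \<omega> (n, \<sigma>) \<in> carrier (pl_forms n)"
  using apl_carrier_family apl_family_carrier by blast

lemma apl_carrier_extensional: "\<omega> \<in> carrier (apl X) \<Longrightarrow> \<omega> \<in> extensional SS"
  using apl_carrier_family by (auto simp: apl_family_def)

lemma apl_eqI:
  assumes "\<omega> \<in> extensional SS" "\<eta> \<in> extensional SS" "\<And>n \<sigma>. (n, \<sigma>) \<in> SS \<Longrightarrow> \<omega> (n, \<sigma>) = \<eta> (n, \<sigma>)"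
  shows "\<omega> = \<eta>"
  using assms by (metis extensionalityI surj_pair)

text \<open>Padding with zeros gives two elements a common bound on the degrees, after which they
  can be added degree by degree.\<close>

lemma apl_grade_extend:
  assumes "\<forall>r. \<eta> r \<in> apl_grade X r" "N \<le> M"
  shows "(\<lambda>(n, \<sigma>)\<in>SS. finsum (pl_forms n) (\<lambda>r. \<eta> r (n, \<sigma>)) {..N}) =
    (\<lambda>(n, \<sigma>)\<in>SS. finsum (pl_forms n) (\<lambda>r. (if r \<le> N then \<eta> r else \<zero>\<^bsub>apl X\<^esub>) (n, \<sigma>)) {..M})"
proof (rule restrict_ext, clarify)
  fix n \<sigma> assume s: "(n, \<sigma>) \<in> SS"
  have c: "\<eta> r (n, \<sigma>) \<in> carrier (pl_forms n)" for r
    using assms s apl_grade_pl_carrier by blast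
  show "finsum (pl_forms n) (\<lambda>r. \<eta> r (n, \<sigma>)) {..N} = finsum (pl_forms n) (\<lambda>r. (if r \<le> N then \<eta> r else \<zero>\<^bsub>apl X\<^esub>) (n, \<sigma>)) {..M}"
    unfolding finsum_def using assms(2) s c
    by (intro comm_monoid.finprod_mono_neutral_cong_left[OF abelian_monoid.a_comm_monoid[OF pl.A_abelian_monoid]])
      (auto simp: apl_simps pl_ring_simps)
qed

lemma apl_carrier_add:
  assumes "\<omega> \<in> carrier (apl X)" "\<eta> \<in> carrier (apl X)"
  shows "\<omega> \<oplus>\<^bsub>apl X\<^esub> \<eta> \<in> carrier (apl X)"
proof -
  obtain f N where f: "\<forall>r. f r \<in> apl_grade X r" "\<omega> = (\<lambda>(n, \<sigma>)\<in>SS. finsum (pl_forms n) (\<lambda>r. f r (n, \<sigma>)) {..N})"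
    using assms(1) unfolding apl_simps by auto
  obtain g M where g: "\<forall>r. g r \<in> apl_grade X r" "\<eta> = (\<lambda>(n, \<sigma>)\<in>SS. finsum (pl_forms n) (\<lambda>r. g r (n, \<sigma>)) {..M})"
    using assms(2) unfolding apl_simps by auto
  define f' where "f' r = (if r \<le> N then f r else \<zero>\<^bsub>apl X\<^esub>)" for r
  define g' where "g' r = (if r \<le> M then g r else \<zero>\<^bsub>apl X\<^esub>)" for r
  have gr: "\<forall>r. f' r \<in> apl_grade X r" "\<forall>r. g' r \<in> apl_grade X r"
    using f g by (auto simp: f'_def g'_def apl_grade_zero)
  have \<omega>: "\<omega> = (\<lambda>(n, \<sigma>)\<in>SS. finsum (pl_forms n) (\<lambda>r. f' r (n, \<sigma>)) {..max N M})"
    unfolding f(2) f'_def by (rule apl_grade_extend[OF f(1)]) simp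
  have \<eta>: "\<eta> = (\<lambda>(n, \<sigma>)\<in>SS. finsum (pl_forms n) (\<lambda>r. g' r (n, \<sigma>)) {..max N M})"
    unfolding g(2) g'_def by (rule apl_grade_extend[OF g(1)]) simp
  have "\<omega> \<oplus>\<^bsub>apl X\<^esub> \<eta> = (\<lambda>(n, \<sigma>)\<in>SS. finsum (pl_forms n) (\<lambda>r. (f' r \<oplus>\<^bsub>apl X\<^esub> g' r) (n, \<sigma>)) {..max N M})"
    unfolding apl_simps(2)
  proof (rule restrict_ext, clarify)
    fix n \<sigma> assume s: "(n, \<sigma>) \<in> SS"
    have c: "f' r (n, \<sigma>) \<in> carrier (pl_forms n)" "g' r (n, \<sigma>) \<in> carrier (pl_forms n)" for r
      using gr s apl_grade_pl_carrier by blast+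
    have "finsum (pl_forms n) (\<lambda>r. f' r (n, \<sigma>) \<oplus>\<^bsub>pl_forms n\<^esub> g' r (n, \<sigma>)) {..max N M} =
        finsum (pl_forms n) (\<lambda>r. f' r (n, \<sigma>)) {..max N M} \<oplus>\<^bsub>pl_forms n\<^esub> finsum (pl_forms n) (\<lambda>r. g' r (n, \<sigma>)) {..max N M}"
      using c by (intro abelian_monoid.finsum_addf[OF pl.A_abelian_monoid]) auto
    then show "\<omega> (n, \<sigma>) \<oplus>\<^bsub>pl_forms n\<^esub> \<eta> (n, \<sigma>) =
        finsum (pl_forms n) (\<lambda>r. (\<lambda>(n, \<sigma>)\<in>SS. f' r (n, \<sigma>) \<oplus>\<^bsub>pl_forms n\<^esub> g' r (n, \<sigma>)) (n, \<sigma>)) {..max N M}"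
      unfolding \<omega> \<eta> using s by simp
  qed
  then show ?thesis
    using apl_grade_sum_carrier[of "\<lambda>r. f' r \<oplus>\<^bsub>apl X\<^esub> g' r" "max N M"] gr by (simp add: apl_grade_add)
qed

lemma apl_grade_carrier:
  assumes "\<omega> \<in> apl_grade X r"
  shows "\<omega> \<in> carrier (apl X)"
proof -
  let ?\<eta> = "\<lambda>i. if i = r then \<omega> else \<zero>\<^bsub>apl X\<^esub>"
  have g: "\<forall>i. ?\<eta> i \<in> apl_grade X i" using assms by (auto simp: apl_grade_zero)
  have "finsum (pl_forms n) (\<lambda>i. ?\<eta> i (n, \<sigma>)) {..r} = \<omega> (n, \<sigma>)" if s: "(n, \<sigma>) \<in> SS" for n \<sigma>
  proof -
    have c: "\<omega> (n, \<sigma>) \<in> carrier (pl_forms n)" using assms s apl_grade_pl_carrier by blast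
    have "finsum (pl_forms n) (\<lambda>i. ?\<eta> i (n, \<sigma>)) {r} = finsum (pl_forms n) (\<lambda>i. ?\<eta> i (n, \<sigma>)) {..r}"
      unfolding finsum_def using c s
      by (intro comm_monoid.finprod_mono_neutral_cong_left[OF abelian_monoid.a_comm_monoid[OF pl.A_abelian_monoid]])
        (auto simp: apl_simps pl_ring_simps)
    then show ?thesis
      using c pl.A_finsum_insert[of "{}" r "\<lambda>i. ?\<eta> i (n, \<sigma>)" n] by (simp add: pl_ring_simps)
  qed
  then have "(\<lambda>(n, \<sigma>)\<in>SS. finsum (pl_forms n) (\<lambda>i. ?\<eta> i (n, \<sigma>)) {..r}) = \<omega>"
    using assms by (intro apl_eqI) (auto simp: apl_grade_iff apl_family_def)
  then show ?thesis using apl_grade_sum_carrier[OF g, of r] by simp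
qed

lemma apl_carrier_smult: "\<omega> \<in> carrier (apl X) \<Longrightarrow> c \<odot>\<^bsub>apl X\<^esub> \<omega> \<in> carrier (apl X)"
proof -
  assume "\<omega> \<in> carrier (apl X)"
  then have "c \<odot>\<^bsub>apl X\<^esub> \<omega> \<in> carrier (apl X) \<and> \<omega> \<in> carrier (apl X)"
  proof (induction rule: apl_induct)
    case (grade \<omega> r)
    then show ?case using apl_grade_smult apl_grade_carrier by blast
  next
    case (add \<omega> \<eta>)
    then have "c \<odot>\<^bsub>apl X\<^esub> (\<omega> \<oplus>\<^bsub>apl X\<^esub> \<eta>) = c \<odot>\<^bsub>apl X\<^esub> \<omega> \<oplus>\<^bsub>apl X\<^esub> c \<odot>\<^bsub>apl X\<^esub> \<eta>"
      unfolding apl_simps(2,5) by (intro restrict_ext) (auto simp: pl.smult_right_add apl_carrier_pl_carrier)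
    then show ?case using add by (simp add: apl_carrier_add)
  qed
  then show ?thesis by blast
qed

lemma apl_carrier_mult:
  assumes "\<omega> \<in> carrier (apl X)" "\<eta> \<in> carrier (apl X)"
  shows "\<omega> \<otimes>\<^bsub>apl X\<^esub> \<eta> \<in> carrier (apl X)"
proof -
  have "\<omega> \<otimes>\<^bsub>apl X\<^esub> \<eta> \<in> carrier (apl X) \<and> \<omega> \<in> carrier (apl X)"
    using assms(1)
  proof (induction rule: apl_induct)
    case (grade \<omega> r)
    have "\<omega> \<otimes>\<^bsub>apl X\<^esub> \<eta> \<in> carrier (apl X) \<and> \<eta> \<in> carrier (apl X)"
      using assms(2)
    proof (induction rule: apl_induct)
      case (grade \<eta> s)
      then show ?case using apl_grade_mult[OF \<open>\<omega> \<in> apl_grade X r\<close>] apl_grade_carrier by blast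
    next
      case (add \<eta>1 \<eta>2)
      then have "\<omega> \<otimes>\<^bsub>apl X\<^esub> (\<eta>1 \<oplus>\<^bsub>apl X\<^esub> \<eta>2) = \<omega> \<otimes>\<^bsub>apl X\<^esub> \<eta>1 \<oplus>\<^bsub>apl X\<^esub> \<omega> \<otimes>\<^bsub>apl X\<^esub> \<eta>2"
        unfolding apl_simps(1,2)
        by (intro restrict_ext) (auto simp: pl.A_r_distr apl_carrier_pl_carrier apl_grade_pl_carrier[OF \<open>\<omega> \<in> apl_grade X r\<close>])
      then show ?case using add by (simp add: apl_carrier_add)
    qed
    then show ?case using apl_grade_carrier[OF grade] by blast
  next
    case (add \<omega>1 \<omega>2)
    then have "(\<omega>1 \<oplus>\<^bsub>apl X\<^esub> \<omega>2) \<otimes>\<^bsub>apl X\<^esub> \<eta> = \<omega>1 \<otimes>\<^bsub>apl X\<^esub> \<eta> \<oplus>\<^bsub>apl X\<^esub> \<omega>2 \<otimes>\<^bsub>apl X\<^esub> \<eta>"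
      unfolding apl_simps(1,2)
      by (intro restrict_ext) (auto simp: pl.A_l_distr apl_carrier_pl_carrier assms(2))
    then show ?case using add by (simp add: apl_carrier_add)
  qed
  then show ?thesis by blast
qed

lemmas apl_closed = apl_carrier_add apl_carrier_smult apl_carrier_mult
  apl_grade_carrier[OF apl_grade_zero] apl_grade_carrier[OF apl_grade_one]

lemma apl_neg:
  assumes "\<omega> \<in> carrier (apl X)"
  shows "(-1) \<odot>\<^bsub>apl X\<^esub> \<omega> \<oplus>\<^bsub>apl X\<^esub> \<omega> = \<zero>\<^bsub>apl X\<^esub>"
  unfolding apl_simps(2,4,5)
  by (intro restrict_ext) (auto simp: pl.smult_minus_one apl_carrier_pl_carrier[OF assms] pl_ring_simps)

lemma ring_apl: "ring (apl X)"
proof (rule ringI)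
  show "abelian_group (apl X)"
  proof (rule abelian_groupI)
    fix \<omega> assume w: "\<omega> \<in> carrier (apl X)"
    show "\<exists>y\<in>carrier (apl X). y \<oplus>\<^bsub>apl X\<^esub> \<omega> = \<zero>\<^bsub>apl X\<^esub>"
      by (intro bexI[of _ "(-1) \<odot>\<^bsub>apl X\<^esub> \<omega>"] apl_neg[OF w] apl_carrier_smult[OF w])
    show "\<zero>\<^bsub>apl X\<^esub> \<oplus>\<^bsub>apl X\<^esub> \<omega> = \<omega>"
      by (rule apl_eqI) (auto simp: apl_simps(2,4) apl_carrier_extensional[OF w] apl_carrier_pl_carrier[OF w] pl_ring_simps)
  qed (auto simp: apl_closed, auto simp: apl_simps(2) apl_carrier_pl_carrier pl_ring_simps intro!: restrict_ext)
  show "Group.monoid (apl X)"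
  proof (rule monoidI)
    fix \<omega> assume w: "\<omega> \<in> carrier (apl X)"
    show "\<one>\<^bsub>apl X\<^esub> \<otimes>\<^bsub>apl X\<^esub> \<omega> = \<omega>" "\<omega> \<otimes>\<^bsub>apl X\<^esub> \<one>\<^bsub>apl X\<^esub> = \<omega>"
      by (rule apl_eqI; auto simp: apl_simps(1,3) apl_carrier_extensional[OF w] apl_carrier_pl_carrier[OF w] pl.A_l_one pl.A_r_one)+
  qed (auto simp: apl_closed, auto simp: apl_simps(1) apl_carrier_pl_carrier pl.A_m_assoc intro!: restrict_ext)
qed (auto simp: apl_simps(1,2) apl_carrier_pl_carrier pl.A_l_distr pl.A_r_distr intro!: restrict_ext)

lemma module_apl: "Module.module rat_ring (apl X)"
proof (rule moduleI[OF cring_rat_ring ring.is_abelian_group[OF ring_apl]])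
  fix \<omega> assume w: "\<omega> \<in> carrier (apl X)"
  show "\<one>\<^bsub>rat_ring\<^esub> \<odot>\<^bsub>apl X\<^esub> \<omega> = \<omega>"
    by (rule apl_eqI) (auto simp: apl_simps(5) apl_carrier_extensional[OF w] apl_carrier_pl_carrier[OF w])
qed (auto simp: apl_closed, auto simp: apl_simps(2,5) apl_carrier_pl_carrier pl.smult_add pl.smult_right_add pl.smult_smult intro!: restrict_ext)

lemma apl_finsum:
  assumes "finite P" "\<And>p. p \<in> P \<Longrightarrow> f p \<in> carrier (apl X)"
  shows "finsum (apl X) f P = (\<lambda>(n, \<sigma>)\<in>SS. finsum (pl_forms n) (\<lambda>p. f p (n, \<sigma>)) P)"
  using assms
proof (induction P)
  case empty
  show ?case
    unfolding abelian_monoid.finsum_empty[OF abelian_group.axioms(1)[OF ring.is_abelian_group[OF ring_apl]]] apl_simps(4)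
    by (intro restrict_ext) (clarsimp simp: abelian_monoid.finsum_empty[OF pl.A_abelian_monoid])
next
  case (insert p P)
  have "finsum (apl X) f (insert p P) = f p \<oplus>\<^bsub>apl X\<^esub> finsum (apl X) f P"
    using insert by (intro abelian_monoid.finsum_insert[OF abelian_group.axioms(1)[OF ring.is_abelian_group[OF ring_apl]]]) auto
  also have "\<dots> = (\<lambda>(n, \<sigma>)\<in>SS. finsum (pl_forms n) (\<lambda>p. f p (n, \<sigma>)) (insert p P))"
    using insert by (simp add: apl_simps(2)) (intro restrict_ext, auto simp: pl.A_finsum_insert apl_carrier_pl_carrier)
  finally show ?case .
qed

text \<open>Components are unique on each simplex. A component may vanish on some simplices and not
  on others, so the finite index set is first cut down to the simplex at hand.\<close>

lemma apl_decomposition_unique: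
  assumes f: "\<And>p. f p \<in> apl_grade X p" "finite {p. f p \<noteq> \<zero>\<^bsub>apl X\<^esub>}"
    and g: "\<And>p. g p \<in> apl_grade X p" "finite {p. g p \<noteq> \<zero>\<^bsub>apl X\<^esub>}"
    and eq: "finsum (apl X) f {p. f p \<noteq> \<zero>\<^bsub>apl X\<^esub>} = finsum (apl X) g {p. g p \<noteq> \<zero>\<^bsub>apl X\<^esub>}"
  shows "f = g"
proof (intro ext)
  fix p :: nat and s :: "'x sing_simplex"
  have *: "finite {p. f p (n, \<sigma>) \<noteq> \<zero>\<^bsub>pl_forms n\<^esub>} \<and>
      finsum (apl X) f {p. f p \<noteq> \<zero>\<^bsub>apl X\<^esub>} (n, \<sigma>) = finsum (pl_forms n) (\<lambda>p. f p (n, \<sigma>)) {p. f p (n, \<sigma>) \<noteq> \<zero>\<^bsub>pl_forms n\<^esub>}"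
    if s: "(n, \<sigma>) \<in> SS" and f: "\<And>p. f p \<in> apl_grade X p" "finite {p. f p \<noteq> \<zero>\<^bsub>apl X\<^esub>}" for f n \<sigma>
  proof -
    have sub: "{p. f p (n, \<sigma>) \<noteq> \<zero>\<^bsub>pl_forms n\<^esub>} \<subseteq> {p. f p \<noteq> \<zero>\<^bsub>apl X\<^esub>}"
      using s by (auto simp: apl_simps(4))
    have "finsum (apl X) f {p. f p \<noteq> \<zero>\<^bsub>apl X\<^esub>} (n, \<sigma>) = finsum (pl_forms n) (\<lambda>p. f p (n, \<sigma>)) {p. f p \<noteq> \<zero>\<^bsub>apl X\<^esub>}"
      using s f by (subst apl_finsum) (auto intro: apl_grade_carrier)
    also have "\<dots> = finsum (pl_forms n) (\<lambda>p. f p (n, \<sigma>)) {p. f p (n, \<sigma>) \<noteq> \<zero>\<^bsub>pl_forms n\<^esub>}"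
      unfolding finsum_def using sub f s
      by (intro comm_monoid.finprod_mono_neutral_cong_right[OF abelian_monoid.a_comm_monoid[OF pl.A_abelian_monoid]])
        (auto intro: apl_grade_pl_carrier)
    finally show ?thesis using finite_subset[OF sub f(2)] by blast
  qed
  obtain n \<sigma> where s: "s = (n, \<sigma>)" by force
  show "f p s = g p s"
  proof (cases "s \<in> SS")
    case True
    let ?x = "finsum (apl X) f {p. f p \<noteq> \<zero>\<^bsub>apl X\<^esub>} (n, \<sigma>)"
    note F = *[OF True[unfolded s] f] and G = *[OF True[unfolded s] g]
    have gr: "f p (n, \<sigma>) \<in> grade (pl_forms n) p" "g p (n, \<sigma>) \<in> grade (pl_forms n) p" for p
      using f(1) g(1) True s by (auto simp: apl_grade_iff)
    have "?x \<in> carrier (pl_forms n)"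
      unfolding conjunct2[OF F] using gr pl.grade_carrier by (intro pl.A_finsum_closed funcsetI) blast
    define P where "P h \<longleftrightarrow> (\<forall>p. h p \<in> grade (pl_forms n) p) \<and> finite {p. h p \<noteq> \<zero>\<^bsub>pl_forms n\<^esub>} \<and>
        ?x = finsum (pl_forms n) h {p. h p \<noteq> \<zero>\<^bsub>pl_forms n\<^esub>}" for h
    have "\<exists>!h. P h"
      unfolding P_def by (rule pl.grade_direct_sum) fact
    moreover have "P (\<lambda>p. f p (n, \<sigma>))"
      unfolding P_def by (intro conjI allI gr conjunct1[OF F] conjunct2[OF F])
    moreover have "P (\<lambda>p. g p (n, \<sigma>))"
      unfolding P_def eq by (intro conjI allI gr conjunct1[OF G] conjunct2[OF G])
    ultimately have "(\<lambda>p. f p (n, \<sigma>)) = (\<lambda>p. g p (n, \<sigma>))"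
      by blast
    then show ?thesis using s by metis
  next
    case False
    then show ?thesis using apl_grade_outside f(1) g(1) by metis
  qed
qed

text \<open>The equations hold simplex by simplex. Only the decomposition into components is global:
  its existence is built into the carrier, its uniqueness is
  \<open>apl_decomposition_unique\<close>.\<close>

lemma cdga_apl: "cdga (apl X)"
proof (intro cdga.intro cdga_axioms.intro ring_apl module_apl)
  fix p
  show "Module.submodule (grade (apl X) p) rat_ring (apl X)"
  proof (rule Module.module.submoduleI[OF module_apl])
    fix \<omega> assume w: "\<omega> \<in> grade (apl X) p"
    then have "\<omega> \<in> carrier (apl X)" using apl_grade_carrier by (simp add: apl_simps(6))
    then have "\<ominus>\<^bsub>apl X\<^esub> \<omega> = (-1) \<odot>\<^bsub>apl X\<^esub> \<omega>"
      by (intro abelian_group.minus_equality[OF ring.is_abelian_group[OF ring_apl]] apl_neg apl_carrier_smult)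
    then show "\<ominus>\<^bsub>apl X\<^esub> \<omega> \<in> grade (apl X) p" using w apl_grade_smult by (simp add: apl_simps(6))
  qed (auto simp: apl_simps(6) apl_grade_add apl_grade_smult apl_grade_carrier apl_grade_zero)
next
  fix \<omega> assume "\<omega> \<in> carrier (apl X)"
  then obtain \<eta> N where \<eta>: "\<forall>r. \<eta> r \<in> apl_grade X r" "\<omega> = (\<lambda>(n, \<sigma>)\<in>SS. finsum (pl_forms n) (\<lambda>r. \<eta> r (n, \<sigma>)) {..N})"
    unfolding apl_simps by auto
  define f where "f r = (if r \<le> N then \<eta> r else \<zero>\<^bsub>apl X\<^esub>)" for r
  have f: "f p \<in> apl_grade X p" for p using \<eta>(1) by (auto simp: f_def apl_grade_zero)
  have sub: "{p. f p \<noteq> \<zero>\<^bsub>apl X\<^esub>} \<subseteq> {..N}" by (auto simp: f_def)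
  then have fin: "finite {p. f p \<noteq> \<zero>\<^bsub>apl X\<^esub>}" by (rule finite_subset) auto
  have "\<omega> = (\<lambda>(n, \<sigma>)\<in>SS. finsum (pl_forms n) (\<lambda>r. f r (n, \<sigma>)) {..N})"
    unfolding \<eta>(2) f_def by (rule apl_grade_extend[OF \<eta>(1)]) simp
  also have "\<dots> = finsum (apl X) f {..N}"
    using f by (intro apl_finsum[symmetric]) (auto intro: apl_grade_carrier)
  also have "\<dots> = finsum (apl X) f {p. f p \<noteq> \<zero>\<^bsub>apl X\<^esub>}"
    unfolding finsum_def using sub f
    by (intro comm_monoid.finprod_mono_neutral_cong_right[OF abelian_monoid.a_comm_monoid[OF abelian_group.axioms(1)[OF ring.is_abelian_group[OF ring_apl]]]])
      (auto intro: apl_grade_carrier)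
  finally have \<omega>: "\<omega> = finsum (apl X) f {p. f p \<noteq> \<zero>\<^bsub>apl X\<^esub>}" .
  show "\<exists>!f. (\<forall>p. f p \<in> grade (apl X) p) \<and> finite {p. f p \<noteq> \<zero>\<^bsub>apl X\<^esub>} \<and> \<omega> = finsum (apl X) f {p. f p \<noteq> \<zero>\<^bsub>apl X\<^esub>}"
    unfolding apl_simps(6) using f fin \<omega> apl_decomposition_unique[of _ f]
    by (intro ex1I[of _ f]) auto
next
  fix \<omega> \<eta> p assume "\<omega> \<in> grade (apl X) p" and \<eta>: "\<eta> \<in> carrier (apl X)"
  then have "\<omega> (n, \<sigma>) \<in> grade (pl_forms n) p" "\<eta> (n, \<sigma>) \<in> carrier (pl_forms n)" if "(n, \<sigma>) \<in> SS" for n \<sigma>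
    using that apl_carrier_pl_carrier[OF \<eta>] by (auto simp: apl_simps(6) apl_grade_iff)
  then show "diff (apl X) (\<omega> \<otimes>\<^bsub>apl X\<^esub> \<eta>) = (diff (apl X) \<omega> \<otimes>\<^bsub>apl X\<^esub> \<eta>) \<oplus>\<^bsub>apl X\<^esub> (-1) ^ p \<odot>\<^bsub>apl X\<^esub> (\<omega> \<otimes>\<^bsub>apl X\<^esub> diff (apl X) \<eta>)"
    unfolding apl_simps(1,2,5,7) by (intro restrict_ext) (clarsimp, rule pl.diff_mult)
next
  fix \<omega> \<eta> p q assume a: "\<omega> \<in> grade (apl X) p" "\<eta> \<in> grade (apl X) q"
  then show "\<omega> \<otimes>\<^bsub>apl X\<^esub> \<eta> = (-1) ^ (p * q) \<odot>\<^bsub>apl X\<^esub> (\<eta> \<otimes>\<^bsub>apl X\<^esub> \<omega>)"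
    unfolding apl_simps by (intro restrict_ext) (clarsimp simp: apl_grade_iff, rule pl.graded_commute, simp_all)
qed (auto simp: apl_simps(6) apl_grade_one apl_grade_mult apl_grade_diff,
    auto simp: apl_simps(1-7) apl_carrier_pl_carrier pl.smult_mult_left pl.smult_mult_right pl.diff_add pl.diff_smult pl.diff_diff
     intro!: restrict_ext)

end

subsection \<open>Closed functions on a path-connected space\<close>

definition vertex :: "nat \<Rightarrow> nat \<Rightarrow> real" where
  "vertex i j = (if j = i then 1 else 0)"

definition point_simplex :: "'x \<Rightarrow> (nat \<Rightarrow> real) \<Rightarrow> 'x" where
  "point_simplex x = restrict (\<lambda>_. x) (standard_simplex 0)"

text \<open>A vertex is the face along a constant map, so compatibility with faces gives access to
  values at vertices.\<close>

lemma vertex_face: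
  "restrict (\<sigma> \<circ> Defs.simplex_map 0 (\<lambda>_. i)) (standard_simplex 0) = point_simplex (\<sigma> (vertex i))"
  unfolding point_simplex_def
proof (rule restrict_ext)
  fix z :: "nat \<Rightarrow> real" assume "z \<in> standard_simplex 0"
  then have "z 0 = 1" by (simp add: standard_simplex_def)
  have "Defs.simplex_map 0 (\<lambda>_. i) z = vertex i"
  proof
    fix j show "Defs.simplex_map 0 (\<lambda>_. i) z j = vertex i j"
      using \<open>z 0 = 1\<close> by (cases "i = j") (auto simp: Defs.simplex_map_def vertex_def)
  qed
  then show "(\<sigma> \<circ> Defs.simplex_map 0 (\<lambda>_. i)) z = \<sigma> (vertex i)" by simp
qed

lemma monotone_map_const: "i \<le> q \<Longrightarrow> monotone_map p q (\<lambda>_. i)"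
  unfolding monotone_map_def by (auto simp: mono_on_def)

lemma pl_pullback_scalar:
  "monotone_map p q \<theta> \<Longrightarrow> pl_pullback p \<theta> (plcl q (scalar c)) = plcl p (scalar c)"
  by (simp add: pl_pullback_cl)

lemma vertex_in_standard_simplex: "i \<le> n \<Longrightarrow> vertex i \<in> standard_simplex n"
  by (auto simp: standard_simplex_def vertex_def)

lemma closed_apl_function_vertex:
  assumes "\<omega> \<in> apl_grade X 0" "(q, \<sigma>) \<in> singular_simplices X" "\<omega> (q, \<sigma>) = plcl q (scalar c)" "i \<le> q"
  shows "\<omega> (0, point_simplex (\<sigma> (vertex i))) = plcl 0 (scalar c)"
proof -
  have "\<omega> (0, restrict (\<sigma> \<circ> Defs.simplex_map 0 (\<lambda>_. i)) (standard_simplex 0)) = pl_pullback 0 (\<lambda>_. i) (\<omega> (q, \<sigma>))"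
    using assms by (intro apl_family_face monotone_map_const) (auto simp: apl_grade_iff)
  then show ?thesis
    using assms by (simp add: vertex_face pl_pullback_scalar monotone_map_const)
qed

lemma path_simplex:
  assumes "pathin X g"
  shows "(1, restrict (\<lambda>t. g (t 1)) (standard_simplex 1)) \<in> singular_simplices X"
proof -
  have "continuous_map (subtopology (powertop_real UNIV) (standard_simplex 1)) (top_of_set {0..1}) (\<lambda>t. t 1)"
    by (intro continuous_map_into_subtopology continuous_map_from_subtopology continuous_map_product_projection)
      (auto simp: standard_simplex_def)
  then have "continuous_map (subtopology (powertop_real UNIV) (standard_simplex 1)) X (g \<circ> (\<lambda>t. t 1))"
    using assms unfolding pathin_def by (rule continuous_map_compose)
  then show ?thesis
    unfolding singular_simplices_def singular_simplex_def by (auto intro: continuous_map_eq)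
qed

text \<open>On each simplex a closed function is a constant. For two simplices, a path joining their
  initial vertices is itself a 1-simplex, and restriction to its two ends identifies all three
  constants.\<close>

lemma closed_apl_function_constant:
  assumes X: "path_connected_space X" and \<omega>: "\<omega> \<in> grade (apl X) 0" "diff (apl X) \<omega> = \<zero>\<^bsub>apl X\<^esub>"
  shows "\<exists>c. \<omega> = c \<odot>\<^bsub>apl X\<^esub> \<one>\<^bsub>apl X\<^esub>"
proof -
  have g: "\<omega> \<in> apl_grade X 0" using \<omega>(1) by (simp add: apl_simps)
  have const: "\<exists>c. \<omega> (n, \<sigma>) = plcl n (scalar c)" if "(n, \<sigma>) \<in> singular_simplices X" for n \<sigma>
  proof (rule closed_pl_function_constant)
    show "\<omega> (n, \<sigma>) \<in> grade (pl_forms n) 0" using g that by (auto simp: apl_grade_iff)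
    show "diff (pl_forms n) (\<omega> (n, \<sigma>)) = \<zero>\<^bsub>pl_forms n\<^esub>"
      using fun_cong[OF \<omega>(2), of "(n, \<sigma>)"] that by (simp add: apl_simps)
  qed
  have vertex_topspace: "\<sigma> (vertex 0) \<in> topspace X" if "(n, \<sigma>) \<in> singular_simplices X" for n \<sigma>
  proof -
    have "continuous_map (subtopology (powertop_real UNIV) (standard_simplex n)) X \<sigma>"
      using that by (simp add: singular_simplices_def singular_simplex_def)
    then show ?thesis
      using vertex_in_standard_simplex[of 0 n] unfolding continuous_map_def by auto
  qed
  have eq: "c = c'"
    if s: "(n, \<sigma>) \<in> singular_simplices X" "\<omega> (n, \<sigma>) = plcl n (scalar c)"
      and s': "(n', \<sigma>') \<in> singular_simplices X" "\<omega> (n', \<sigma>') = plcl n' (scalar c')" for n \<sigma> c n' \<sigma>' c'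
  proof -
    obtain g where g': "pathin X g" "g 0 = \<sigma> (vertex 0)" "g 1 = \<sigma>' (vertex 0)"
      using X vertex_topspace[OF s(1)] vertex_topspace[OF s'(1)] unfolding path_connected_space_def by blast
    let ?\<gamma> = "restrict (\<lambda>t. g (t 1)) (standard_simplex 1)"
    have \<gamma>: "(1, ?\<gamma>) \<in> singular_simplices X" by (rule path_simplex[OF g'(1)])
    obtain b where b: "\<omega> (1, ?\<gamma>) = plcl 1 (scalar b)" using const[OF \<gamma>] by blast
    have v: "?\<gamma> (vertex 0) = g 0" "?\<gamma> (vertex 1) = g 1"
      using vertex_in_standard_simplex[of 0 1] vertex_in_standard_simplex[of 1 1] by (auto simp: vertex_def)
    have "plcl 0 (scalar b) = plcl 0 (scalar c)"
      using closed_apl_function_vertex[OF g \<gamma> b, of 0] closed_apl_function_vertex[OF g s, of 0] v g' by simp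
    moreover have "plcl 0 (scalar b) = plcl 0 (scalar c')"
      using closed_apl_function_vertex[OF g \<gamma> b, of 1] closed_apl_function_vertex[OF g s', of 0] v g' by simp
    ultimately show "c = c'" by (simp add: plcl_scalar_eq_iff)
  qed
  obtain c where c: "\<And>n \<sigma>. (n, \<sigma>) \<in> singular_simplices X \<Longrightarrow> \<omega> (n, \<sigma>) = plcl n (scalar c)"
  proof (cases "singular_simplices X = {}")
    case False
    then obtain n \<sigma> where s: "(n, \<sigma>) \<in> singular_simplices X" by auto
    obtain c where "\<omega> (n, \<sigma>) = plcl n (scalar c)" using const[OF s] by blast
    then show ?thesis using that const eq[OF s] by metis
  qed auto
  have "\<omega> = c \<odot>\<^bsub>apl X\<^esub> \<one>\<^bsub>apl X\<^esub>"
  proof (rule apl_eqI)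
    show "\<omega> \<in> extensional (singular_simplices X)" using g by (simp add: apl_grade_iff apl_family_def)
  qed (simp_all add: apl_simps c pl_simps)
  then show ?thesis ..
qed

text \<open>On the 0-simplex at a point the two elements are the constants 1 and 0, which the
  relations keep apart.\<close>

lemma apl_one_not_zero:
  assumes "topspace X \<noteq> {}"
  shows "\<one>\<^bsub>apl X\<^esub> \<noteq> \<zero>\<^bsub>apl X\<^esub>"
proof
  obtain x where x: "x \<in> topspace X" using assms by blast
  have "(0, restrict (\<lambda>_. x) (standard_simplex 0)) \<in> singular_simplices X"
    unfolding singular_simplices_def singular_simplex_def using x by (auto intro: continuous_map_eq)
  moreover assume "\<one>\<^bsub>apl X\<^esub> = \<zero>\<^bsub>apl X\<^esub>"
  note fun_cong[OF this, of "(0, restrict (\<lambda>_. x) (standard_simplex 0))"]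
  ultimately have "plcl 0 (scalar 1) = plcl 0 (scalar 0)"
    by (simp add: apl_simps pl_simps)
  then show False by (simp only: plcl_scalar_eq_iff)
qed

subsection \<open>Functoriality\<close>

definition apl_map :: "'y topology \<Rightarrow> ('y \<Rightarrow> 'x) \<Rightarrow> ('x sing_simplex \<Rightarrow> pl_form) \<Rightarrow> 'y sing_simplex \<Rightarrow> pl_form" where
  "apl_map Y g \<omega> = (\<lambda>(n, \<sigma>)\<in>singular_simplices Y. \<omega> (n, Simplices.simplex_map n g \<sigma>))"

context
  fixes X :: "'x topology" and Y :: "'y topology" and g :: "'y \<Rightarrow> 'x"
  assumes g: "continuous_map Y X g"
begin

lemma simplex_map_in_singular_simplices:
  "(n, \<sigma>) \<in> singular_simplices Y \<Longrightarrow> (n, Simplices.simplex_map n g \<sigma>) \<in> singular_simplices X"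
  using singular_simplex_simplex_map[OF _ g] by (auto simp: singular_simplices_def)

lemma simplex_map_face:
  assumes "monotone_map p q \<theta>"
  shows "Simplices.simplex_map p g (restrict (\<sigma> \<circ> Defs.simplex_map p \<theta>) (standard_simplex p)) =
    restrict (Simplices.simplex_map q g \<sigma> \<circ> Defs.simplex_map p \<theta>) (standard_simplex p)"
  unfolding Simplices.simplex_map_def
  by (rule restrict_ext) (use simplex_map_standard_simplex[OF assms] in auto)

lemma apl_map_grade: "\<omega> \<in> apl_grade X r \<Longrightarrow> apl_map Y g \<omega> \<in> apl_grade Y r"
  unfolding apl_grade_iff apl_map_def
  by (intro conjI apl_familyI; elim conjE;
      simp add: apl_family_carrier simplex_map_in_singular_simplices simplex_map_face apl_family_face)

lemma apl_map_add: "apl_map Y g (\<omega> \<oplus>\<^bsub>apl X\<^esub> \<eta>) = apl_map Y g \<omega> \<oplus>\<^bsub>apl Y\<^esub> apl_map Y g \<eta>"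
  unfolding apl_map_def apl_simps by (rule restrict_ext) (clarsimp simp: simplex_map_in_singular_simplices)

lemma apl_map_carrier: "\<omega> \<in> carrier (apl X) \<Longrightarrow> apl_map Y g \<omega> \<in> carrier (apl Y)"
  by (induction rule: apl_induct) (auto simp: apl_map_add intro: apl_carrier_add apl_grade_carrier apl_map_grade)

lemma apl_map_dga_hom: "apl_map Y g \<in> dga_hom (apl X) (apl Y)"
proof -
  have *: "apl_map Y g (\<omega> \<otimes>\<^bsub>apl X\<^esub> \<eta>) = apl_map Y g \<omega> \<otimes>\<^bsub>apl Y\<^esub> apl_map Y g \<eta>"
    "apl_map Y g (c \<odot>\<^bsub>apl X\<^esub> \<omega>) = c \<odot>\<^bsub>apl Y\<^esub> apl_map Y g \<omega>"
    "apl_map Y g (diff (apl X) \<omega>) = diff (apl Y) (apl_map Y g \<omega>)"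
    "apl_map Y g \<one>\<^bsub>apl X\<^esub> = \<one>\<^bsub>apl Y\<^esub>" for \<omega> \<eta> c
    unfolding apl_map_def apl_simps by (rule restrict_ext; clarsimp simp: simplex_map_in_singular_simplices)+
  show ?thesis
    unfolding dga_hom_def Ring.ring_hom_def
    by (simp add: * apl_map_carrier apl_map_add apl_simps(6)) (use apl_map_grade in blast)
qed

end

lemma apl_map_inverse:
  assumes f: "continuous_map X Y f" and g: "continuous_map Y X g" and fg: "\<And>x. x \<in> topspace X \<Longrightarrow> g (f x) = x"
    and \<omega>: "\<omega> \<in> carrier (apl X)"
  shows "apl_map X f (apl_map Y g \<omega>) = \<omega>"
proof (rule apl_eqI)
  fix n \<sigma> assume s: "(n, \<sigma>) \<in> singular_simplices X"
  have "Simplices.simplex_map n g (Simplices.simplex_map n f \<sigma>) = \<sigma>"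
  proof
    fix t
    have "continuous_map (subtopology (powertop_real UNIV) (standard_simplex n)) X \<sigma>" "\<sigma> \<in> extensional (standard_simplex n)"
      using s by (auto simp: singular_simplices_def singular_simplex_def)
    then have "t \<in> standard_simplex n \<Longrightarrow> \<sigma> t \<in> topspace X" "t \<notin> standard_simplex n \<Longrightarrow> \<sigma> t = undefined"
      by (auto simp: continuous_map_def extensional_def)
    then show "Simplices.simplex_map n g (Simplices.simplex_map n f \<sigma>) t = \<sigma> t"
      by (cases "t \<in> standard_simplex n") (auto simp: Simplices.simplex_map_def fg)
  qed
  then show "apl_map X f (apl_map Y g \<omega>) (n, \<sigma>) = \<omega> (n, \<sigma>)"
    using s simplex_map_in_singular_simplices[OF f s] by (simp add: apl_map_def)
qed (auto simp: apl_map_def apl_carrier_extensional[OF \<omega>])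

section \<open>Quasi-isomorphisms\<close>

context cdga
begin

lemma cocycles_carrier: "x \<in> cocycles A p \<Longrightarrow> x \<in> carrier A"
  unfolding cocycles_def using grade_carrier by blast

lemma A_group: "group (add_monoid A)"
  by (rule abelian_group.a_group[OF ring.is_abelian_group[OF ring_A]])

lemmas A_ring_simps = ring.ring_simprules[OF ring_A]

lemma subgroup_cocycles: "subgroup (cocycles A p) (add_monoid A)"
proof (rule group.subgroupI[OF A_group])
  show "cocycles A p \<noteq> {}" by (auto simp: cocycles_def intro!: exI[of _ \<zero>])
  fix x assume x: "x \<in> cocycles A p"
  then show "inv\<^bsub>add_monoid A\<^esub> x \<in> cocycles A p"
    unfolding a_inv_def[symmetric] cocycles_def by (auto simp: grade_a_inv diff_a_inv grade_carrier A_ring_simps)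
  fix y assume "y \<in> cocycles A p"
  with x show "x \<otimes>\<^bsub>add_monoid A\<^esub> y \<in> cocycles A p"
    unfolding cocycles_def by (auto simp: grade_add diff_add grade_carrier A_ring_simps)
qed (auto simp: cocycles_carrier)

lemma coboundaries_cocycles: "coboundaries A p \<subseteq> cocycles A p"
  by (cases p) (auto simp: coboundaries_def cocycles_def diff_grade grade_carrier diff_diff)

lemma subgroup_coboundaries: "subgroup (coboundaries A p) (add_monoid A)"
proof (cases p)
  case 0
  then show ?thesis using group.triv_subgroup[OF A_group] by (simp add: coboundaries_def)
next
  case (Suc r)
  show ?thesis
  proof (rule group.subgroupI[OF A_group])
    show "coboundaries A p \<subseteq> carrier (add_monoid A)" using coboundaries_cocycles cocycles_carrier by auto
    from grade_zero[of r] show "coboundaries A p \<noteq> {}" unfolding Suc coboundaries_def nat.case by blast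
    fix x assume "x \<in> coboundaries A p"
    then obtain x' where x: "x' \<in> grade A r" "x = diff A x'" using Suc by (auto simp: coboundaries_def)
    then have "\<ominus> x = diff A (\<ominus> x')" by (simp add: diff_a_inv grade_carrier)
    then show "inv\<^bsub>add_monoid A\<^esub> x \<in> coboundaries A p"
      unfolding a_inv_def[symmetric] using Suc x by (auto simp: coboundaries_def grade_a_inv)
    fix y assume "y \<in> coboundaries A p"
    then obtain y' where y: "y' \<in> grade A r" "y = diff A y'" using Suc by (auto simp: coboundaries_def)
    then have "x \<oplus> y = diff A (x' \<oplus> y')" using x by (simp add: diff_add grade_carrier)
    then show "x \<otimes>\<^bsub>add_monoid A\<^esub> y \<in> coboundaries A p"
      using Suc x y by (auto simp: coboundaries_def grade_add)
  qed
qed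

lemma coboundaries_smult: "x \<in> coboundaries A p \<Longrightarrow> c \<odot> x \<in> coboundaries A p"
  by (cases p) (auto simp: coboundaries_def grade_carrier grade_smult simp flip: diff_smult)

lemma zero_in_coboundaries: "\<zero> \<in> coboundaries A p"
  using subgroup.one_closed[OF subgroup_coboundaries] by simp

abbreviation cohomology_class :: "nat \<Rightarrow> 'a \<Rightarrow> 'a set" where
  "cohomology_class p x \<equiv> coboundaries A p +>\<^bsub>A\<^esub> x"

lemma abelian_subgroup_coboundaries: "abelian_subgroup (coboundaries A p) A"
  by (intro abelian_subgroupI3 additive_subgroup.intro subgroup_coboundaries ring.is_abelian_group ring_A)

lemma carrier_cohomology: "carrier (dga_cohomology A p) = cohomology_class p ` cocycles A p"
  by (auto simp: dga_cohomology_def FactGroup_def RCOSETS_def a_r_coset_def r_coset_def)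

lemma mult_cohomology:
  assumes "x \<in> cocycles A p" "y \<in> cocycles A p"
  shows "cohomology_class p x \<otimes>\<^bsub>dga_cohomology A p\<^esub> cohomology_class p y = cohomology_class p (x \<oplus> y)"
  using abelian_subgroup.a_rcos_sum[OF abelian_subgroup_coboundaries, of x y p] assms cocycles_carrier
  by (simp add: dga_cohomology_def FactGroup_def set_mult_def set_add_def)

lemma cohomology_class_eq_iff:
  assumes "x \<in> cocycles A p" "y \<in> cocycles A p"
  shows "cohomology_class p x = cohomology_class p y \<longleftrightarrow> x \<ominus> y \<in> coboundaries A p"
proof -
  interpret abelian_subgroup "coboundaries A p" A by (rule abelian_subgroup_coboundaries)
  have c: "x \<in> carrier A" "y \<in> carrier A" using assms cocycles_carrier by auto
  have "x \<ominus> y \<in> coboundaries A p \<longleftrightarrow> x \<in> cohomology_class p y"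
    using a_rcos_module[of y x] c
    by (simp add: a_minus_def)
  also have "\<dots> \<longleftrightarrow> cohomology_class p x = cohomology_class p y"
    using c abelian_subgroup.a_repr_independence'[OF abelian_subgroup_coboundaries]
      abelian_subgroup.a_rcos_self[OF abelian_subgroup_coboundaries] by metis
  finally show ?thesis by simp
qed

end

section \<open>Maps induced in cohomology\<close>

lemma dga_hom_cocycles:
  assumes "cdga A" "cdga B" "f \<in> dga_hom A B" "x \<in> cocycles A p"
  shows "f x \<in> cocycles B p"
  using assms dga_homD[OF assms(3)] dga_hom_zero[OF assms(3,1,2)] cdga.grade_carrier[OF assms(1)]
  unfolding cocycles_def by force

lemma dga_hom_coboundaries:
  assumes "cdga A" "cdga B" "f \<in> dga_hom A B" "x \<in> coboundaries A p"
  shows "f x \<in> coboundaries B p"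
  using assms dga_homD[OF assms(3)] dga_hom_zero[OF assms(3,1,2)] cdga.grade_carrier[OF assms(1)]
  unfolding coboundaries_def by (cases p) force+

lemma dga_hom_minus:
  assumes "cdga A" "cdga B" "f \<in> dga_hom A B" "x \<in> carrier A" "y \<in> carrier A"
  shows "f (x \<ominus>\<^bsub>A\<^esub> y) = f x \<ominus>\<^bsub>B\<^esub> f y"
proof -
  interpret A: cdga A by fact
  interpret B: cdga B by fact
  have "f (x \<oplus>\<^bsub>A\<^esub> (-1) \<odot>\<^bsub>A\<^esub> y) = f x \<oplus>\<^bsub>B\<^esub> (-1) \<odot>\<^bsub>B\<^esub> f y"
    using assms dga_homD[OF assms(3)] by simp
  then show ?thesis
    using assms dga_homD(1)[OF assms(3)] by (simp add: A.smult_minus_one B.smult_minus_one a_minus_def)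
qed

text \<open>Trades the cosets of cohomology for representatives: a trivial kernel gives injectivity,
  and reaching every cocycle up to a coboundary gives surjectivity.\<close>

lemma quasi_isomorphismI:
  assumes A: "cdga A" and B: "cdga B" and f: "f \<in> dga_hom A B"
    and inj: "\<And>p x. x \<in> cocycles A p \<Longrightarrow> f x \<in> coboundaries B p \<Longrightarrow> x \<in> coboundaries A p"
    and surj: "\<And>p y. y \<in> cocycles B p \<Longrightarrow> \<exists>x\<in>cocycles A p. y \<ominus>\<^bsub>B\<^esub> f x \<in> coboundaries B p"
  shows "quasi_isomorphism A B f"
  unfolding quasi_isomorphism_def
proof (intro conjI allI f)
  fix p
  interpret A: cdga A by fact
  interpret B: cdga B by fact
  note Z = dga_hom_cocycles[OF A B f]
  have minus_cocycles: "x \<ominus>\<^bsub>A\<^esub> y \<in> cocycles A p" if "x \<in> cocycles A p" "y \<in> cocycles A p" for x y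
    using that unfolding cocycles_def by (auto simp: A.grade_minus A.diff_minus A.grade_carrier A.A_minus_eq_zero)
  \<comment> \<open>The map is defined by a union over a coset; members of the coset differ by
    coboundaries, so their images have the same class.\<close>
  have map: "cohomology_map B p f (A.cohomology_class p x) = B.cohomology_class p (f x)" if x: "x \<in> cocycles A p" for x
  proof -
    have "B.cohomology_class p (f y) = B.cohomology_class p (f x)" if mem: "y \<in> A.cohomology_class p x" for y
    proof -
      interpret abelian_subgroup "coboundaries A p" A by (rule A.abelian_subgroup_coboundaries)
      obtain b where b: "b \<in> coboundaries A p" "y = b \<oplus>\<^bsub>A\<^esub> x"
        using mem by (auto simp: a_r_coset_def r_coset_def)
      have bc: "b \<in> cocycles A p" using b A.coboundaries_cocycles by auto
      have y: "y \<in> cocycles A p" using subgroup.m_closed[OF A.subgroup_cocycles bc x] b by simp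
      have "y \<ominus>\<^bsub>A\<^esub> x = b"
        using b bc x A.cocycles_carrier by (simp add: a_minus_def A.A_ring_simps)
      then have "f y \<ominus>\<^bsub>B\<^esub> f x = f b"
        using dga_hom_minus[OF A B f, of y x] x y A.cocycles_carrier by metis
      then show ?thesis
        using B.cohomology_class_eq_iff[OF Z[OF y] Z[OF x]] dga_hom_coboundaries[OF A B f b(1)] by simp
    qed
    moreover have "x \<in> A.cohomology_class p x"
      using abelian_subgroup.a_rcos_self[OF A.abelian_subgroup_coboundaries A.cocycles_carrier[OF x]] .
    ultimately show ?thesis unfolding cohomology_map_def by blast
  qed
  show "cohomology_map B p f \<in> iso (dga_cohomology A p) (dga_cohomology B p)"
    unfolding iso_def
  proof (intro CollectI conjI)
    show "cohomology_map B p f \<in> hom (dga_cohomology A p) (dga_cohomology B p)"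
    proof (rule homI)
      fix C D assume "C \<in> carrier (dga_cohomology A p)" "D \<in> carrier (dga_cohomology A p)"
      then obtain x y where x: "C = A.cohomology_class p x" "x \<in> cocycles A p"
        and y: "D = A.cohomology_class p y" "y \<in> cocycles A p" unfolding A.carrier_cohomology by auto
      have "x \<oplus>\<^bsub>A\<^esub> y \<in> cocycles A p" using subgroup.m_closed[OF A.subgroup_cocycles x(2) y(2)] by simp
      then show "cohomology_map B p f (C \<otimes>\<^bsub>dga_cohomology A p\<^esub> D) =
          cohomology_map B p f C \<otimes>\<^bsub>dga_cohomology B p\<^esub> cohomology_map B p f D"
        using x y Z dga_homD(2)[OF f] A.cocycles_carrier by (simp add: A.mult_cohomology B.mult_cohomology map)
    qed (auto simp: A.carrier_cohomology B.carrier_cohomology map Z)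
    show "bij_betw (cohomology_map B p f) (carrier (dga_cohomology A p)) (carrier (dga_cohomology B p))"
      unfolding bij_betw_def
    proof
      show "inj_on (cohomology_map B p f) (carrier (dga_cohomology A p))"
      proof (rule inj_onI, unfold A.carrier_cohomology, elim imageE)
        fix C D x y
        assume *: "cohomology_map B p f C = cohomology_map B p f D"
          "C = A.cohomology_class p x" "x \<in> cocycles A p" "D = A.cohomology_class p y" "y \<in> cocycles A p"
        then have "f x \<ominus>\<^bsub>B\<^esub> f y \<in> coboundaries B p"
          using B.cohomology_class_eq_iff[OF Z[of x] Z[of y]] by (simp add: map)
        then have "x \<ominus>\<^bsub>A\<^esub> y \<in> coboundaries A p"
          using * inj[OF minus_cocycles[of x y]] dga_hom_minus[OF A B f, of x y] A.cocycles_carrier by simp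
        then show "C = D" using A.cohomology_class_eq_iff * by simp
      qed
      show "cohomology_map B p f ` carrier (dga_cohomology A p) = carrier (dga_cohomology B p)"
      proof
        show "carrier (dga_cohomology B p) \<subseteq> cohomology_map B p f ` carrier (dga_cohomology A p)"
        proof
          fix D assume "D \<in> carrier (dga_cohomology B p)"
          then obtain y where y: "D = B.cohomology_class p y" "y \<in> cocycles B p" unfolding B.carrier_cohomology by auto
          obtain x where x: "x \<in> cocycles A p" "y \<ominus>\<^bsub>B\<^esub> f x \<in> coboundaries B p" using surj[OF y(2)] by blast
          then have "D = cohomology_map B p f (A.cohomology_class p x)"
            using B.cohomology_class_eq_iff[OF y(2) Z[OF x(1)]] y by (simp add: map)
          then show "D \<in> cohomology_map B p f ` carrier (dga_cohomology A p)"
            using x by (auto simp: A.carrier_cohomology)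
        qed
      qed (auto simp: A.carrier_cohomology B.carrier_cohomology map Z)
    qed
  qed
qed

section \<open>Minimal Sullivan algebras from differentials of generators\<close>

text \<open>The filtration by word length; the classes of \<open>long 2\<close> are the
  decomposables.\<close>

definition long :: "nat \<Rightarrow> 'g tensor set" where
  "long k = {x. \<forall>w\<in>Poly_Mapping.keys x. k \<le> length (letters w)}"

lemma long_0 [simp]: "0 \<in> long k"
  and long_single: "k \<le> length (letters w) \<Longrightarrow> Poly_Mapping.single w q \<in> long k"
  and long_letter: "letter v \<in> long 1"
  by (auto simp: long_def letter_def split: if_splits)

lemma long_add: "x \<in> long k \<Longrightarrow> y \<in> long k \<Longrightarrow> x + y \<in> long k"
  unfolding long_def using keys_add[of x y] by blast

lemma long_mult: "x \<in> long j \<Longrightarrow> y \<in> long k \<Longrightarrow> x * y \<in> long (j + k)"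
  unfolding long_def using keys_mult[of x y] by fastforce

lemma long_scalar_mult: "x \<in> long k \<Longrightarrow> scalar q * x \<in> long k"
  unfolding long_def using keys_scalar_mult[of q x] by blast

lemma long_antimono: "j \<le> k \<Longrightarrow> x \<in> long k \<Longrightarrow> x \<in> long j"
  unfolding long_def by fastforce

text \<open>Replacing a letter by words of length at least 2 leaves no word shorter than 2, so
  decomposability is checked on generators.\<close>

lemma der_long:
  assumes "\<And>v. v \<in> S \<Longrightarrow> \<delta> v \<in> long 2" "x \<in> tens S"
  shows "der dg \<delta> x \<in> long 2"
  using assms(2)
proof (induction rule: tens_induct)
  case (single l q)
  have "der_list dg \<delta> l \<in> long 2" using single
  proof (induction l)
    case (Cons v l)
    have "\<delta> v * Poly_Mapping.single (Word l) 1 \<in> long (2 + 0)"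
      using Cons assms(1) by (intro long_mult long_single) auto
    moreover have "letter v * der_list dg \<delta> l \<in> long 2"
      using long_mult[OF long_letter, of "der_list dg \<delta> l" 2 v] Cons
      by (intro long_antimono[of 2 "1 + 2" "letter v * der_list dg \<delta> l"]) auto
    ultimately show ?case by (auto simp: mult.assoc intro!: long_add long_scalar_mult)
  qed simp
  then show ?case by (auto intro: long_scalar_mult)
qed (auto intro: long_add)

definition free_diff :: "'g set \<Rightarrow> ('g \<Rightarrow> nat) \<Rightarrow> ('g \<Rightarrow> 'g tensor) \<Rightarrow> 'g tensor set \<Rightarrow> 'g tensor set" where
  "free_diff S dg \<delta> C = (\<Union>x\<in>C. cls (gca_ideal S dg {}) (der dg \<delta> x))"

text \<open>Sullivan's filtration is encoded by a rank: the differential of a generator involves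
  only generators of smaller rank. Minimality is imposed on the chosen representatives
  \<open>\<delta> v\<close>.\<close>

locale minimal_system = differential_presentation S dg "{}" \<delta>
  for S :: "'g set" and dg :: "'g \<Rightarrow> nat" and \<delta> :: "'g \<Rightarrow> 'g tensor" +
  fixes rk :: "'g \<Rightarrow> nat"
  assumes dg_pos: "v \<in> S \<Longrightarrow> 1 \<le> dg v"
    and \<delta>_long: "v \<in> S \<Longrightarrow> \<delta> v \<in> long 2"
    and \<delta>_rk: "v \<in> S \<Longrightarrow> \<delta> v \<in> tens {w \<in> S. rk w < rk v}"
begin

sublocale presented_cdga S dg "{}" \<delta> "free_diff S dg \<delta>"
  by unfold_locales (simp add: free_diff_def UN_cl_D)

text \<open>The strict bound makes stage 0 trivial, so that the differential vanishes there at
  once.\<close>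

definition stage :: "nat \<Rightarrow> nat \<Rightarrow> 'g tensor set set" where
  "stage k p = gca_class S dg {} (\<lambda>w. length (letters w) = 1 \<and> word_degree dg w = p \<and> (\<forall>v\<in>set (letters w). rk v < k))"

text \<open>The subalgebra generated by a stage contains all tensors in letters of smaller rank,
  which is where the differentials of the next stage lie.\<close>

lemma cl_in_subalgebra:
  assumes B: "(\<Union>q. stage k q) \<subseteq> B" "subring B pres_dga" "Module.submodule B rat_ring pres_dga"
    and y: "y \<in> tens {w \<in> S. rk w < k}"
  shows "cl y \<in> B"
proof -
  have letter: "cl (letter v) \<in> B" if "v \<in> S" "rk v < k" for v
  proof -
    have "cl (letter v) \<in> stage k (dg v)"
      using that unfolding stage_def gca_class_eq
      by (intro imageI CollectI conjI tens_letter) (auto simp: letter_def)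
    then show ?thesis using B(1) by blast
  qed
  have word: "cl (Poly_Mapping.single (Word l) 1) \<in> B" if "set l \<subseteq> {w \<in> S. rk w < k}" for l
    using that
  proof (induction l)
    case Nil
    then show ?case using subringE(3)[OF B(2)] by (simp add: single_Word_Nil one_Q)
  next
    case (Cons v l)
    have "cl (letter v) \<otimes>\<^bsub>pres_dga\<^esub> cl (Poly_Mapping.single (Word l) 1) \<in> B"
      using Cons letter by (intro subringE(6)[OF B(2)]) auto
    then show ?case
      using Cons by (subst (asm) mult_Q) (auto simp: single_Word_Cons intro!: tens_letter tens_single)
  qed
  from y show ?thesis
  proof (induction rule: tens_induct)
    case zero
    then show ?case using subringE(2)[OF B(2)] by (simp add: zero_Q)
  next
    case (single l q)
    have "q \<odot>\<^bsub>pres_dga\<^esub> cl (Poly_Mapping.single (Word l) 1) \<in> B"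
      using Module.submodule.smult_closed[OF B(3), of q] word[OF single] by simp
    then show ?case
      using single by (subst (asm) smult_Q) (auto simp: scalar_mult_single intro!: tens_single)
  next
    case (add x y)
    then have "cl x \<oplus>\<^bsub>pres_dga\<^esub> cl y \<in> B" by (intro subringE(7)[OF B(2)])
    moreover have "x \<in> tens S" "y \<in> tens S"
      using add(3,4) tens_mono[of "{w \<in> S. rk w < k}" S] by auto
    ultimately show ?case by (simp add: add_Q)
  qed
qed

lemma D_stage:
  assumes "x \<in> tens S" "\<forall>w\<in>Poly_Mapping.keys x. length (letters w) = 1 \<and> (\<forall>v\<in>set (letters w). rk v < Suc k)"
  shows "D x \<in> tens {w \<in> S. rk w < k}"
proof (rule tensor_induct_keys[of x "{w. \<exists>v\<in>S. rk v < Suc k \<and> w = Word [v]}"])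
  show "Poly_Mapping.keys x \<subseteq> {w. \<exists>v\<in>S. rk v < Suc k \<and> w = Word [v]}"
  proof
    fix w assume w: "w \<in> Poly_Mapping.keys x"
    then obtain v where v: "letters w = [v]" using assms(2) by (auto simp: length_Suc_conv)
    then have "w = Word [v]" by (metis Word_letters)
    moreover have "v \<in> S" "rk v < Suc k" using v w assms by (auto simp: tens_def)
    ultimately show "w \<in> {w. \<exists>v\<in>S. rk v < Suc k \<and> w = Word [v]}" by blast
  qed
  fix w q assume "w \<in> {w. \<exists>v\<in>S. rk v < Suc k \<and> w = Word [v]}"
  then obtain v where v: "v \<in> S" "rk v < Suc k" "w = Word [v]" by auto
  have "{w \<in> S. rk w < rk v} \<subseteq> {w \<in> S. rk w < k}" using v(2) by auto
  then have "\<delta> v \<in> tens {w \<in> S. rk w < k}" using \<delta>_rk[OF v(1)] tens_mono by blast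
  then show "D (Poly_Mapping.single w q) \<in> tens {w \<in> S. rk w < k}"
    unfolding v(3) by (simp add: single_Word_Nil tens_mult)
qed (auto intro: tens_add)

text \<open>A tensor involves finitely many letters, hence letters of bounded rank.\<close>

lemma UN_stage: "(\<Union>k. stage k p) = generating_space S dg p"
proof
  show "generating_space S dg p \<subseteq> (\<Union>k. stage k p)"
  proof
    fix C assume "C \<in> generating_space S dg p"
    then obtain x where x: "C = cl x" "x \<in> tens S"
      "\<And>w. w \<in> Poly_Mapping.keys x \<Longrightarrow> length (letters w) = 1 \<and> word_degree dg w = p"
      unfolding generating_space_def gca_class_eq by blast
    let ?R = "\<Union>w\<in>Poly_Mapping.keys x. rk ` set (letters w)"
    have "finite ?R" by auto
    then have "\<forall>r\<in>?R. r < Suc (Max ?R)" by (auto simp: less_Suc_eq_le)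
    then have "C \<in> stage (Suc (Max ?R)) p"
      unfolding stage_def gca_class_eq x(1) using x(2,3) by (intro imageI) blast
    then show "C \<in> (\<Union>k. stage k p)" by blast
  qed
qed (auto simp: generating_space_def gca_class_eq stage_def)

lemma stage_submodule: "Module.submodule (stage k p) rat_ring pres_dga"
  unfolding stage_def gca_class_eq
proof (rule submodule_QI)
  fix x y q
  let ?P = "\<lambda>w. length (letters w) = 1 \<and> word_degree dg w = p \<and> (\<forall>v\<in>set (letters w). rk v < k)"
  assume x: "x \<in> {x \<in> tens S. \<forall>w\<in>Poly_Mapping.keys x. ?P w}"
  then show "scalar q * x \<in> {x \<in> tens S. \<forall>w\<in>Poly_Mapping.keys x. ?P w}"
    using keys_scalar_mult[of q x] tens_mult[OF tens_scalar, of x S q] by blast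
  assume "y \<in> {x \<in> tens S. \<forall>w\<in>Poly_Mapping.keys x. ?P w}"
  with x show "x + y \<in> {x \<in> tens S. \<forall>w\<in>Poly_Mapping.keys x. ?P w}"
    using keys_add[of x y] tens_add[of x S y] by blast
qed auto

theorem minimal_sullivan_algebra: "minimal_sullivan_algebra S dg (free_diff S dg \<delta>)"
  unfolding minimal_sullivan_algebra_def sullivan_algebra_def
proof (intro conjI exI[of _ stage] ballI allI)
  fix k p v assume "v \<in> stage (Suc k) p"
  then obtain x where x: "v = cl x" "x \<in> tens S"
    "\<forall>w\<in>Poly_Mapping.keys x. length (letters w) = 1 \<and> (\<forall>v\<in>set (letters w). rk v < Suc k)"
    unfolding stage_def gca_class_eq by blast
  have "cl (D x) \<in> generated_subalgebra pres_dga (\<Union>q. stage k q)"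
    unfolding generated_subalgebra_def using cl_in_subalgebra[OF _ _ _ D_stage[OF x(2,3)]] by blast
  then show "free_diff S dg \<delta> v \<in> generated_subalgebra pres_dga (\<Union>q. stage k q)"
    using x by (simp add: d_cl)
next
  fix p v assume "v \<in> stage 0 p"
  then obtain x where x: "v = cl x" "\<forall>w\<in>Poly_Mapping.keys x. length (letters w) = 1 \<and> (\<forall>v\<in>set (letters w). rk v < 0)"
    unfolding stage_def gca_class_eq by blast
  have "Poly_Mapping.keys x = {}"
  proof (rule ccontr)
    assume "Poly_Mapping.keys x \<noteq> {}"
    then obtain w where "w \<in> Poly_Mapping.keys x" by blast
    then show False using x(2) by (cases "letters w") auto
  qed
  then have "x = 0" by simp
  then show "free_diff S dg \<delta> v = \<zero>\<^bsub>pres_dga\<^esub>" using x(1) d_cl[of 0] by (simp add: zero_Q)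
next
  show "free_diff S dg \<delta> ` carrier pres_dga \<subseteq> decomposables S dg"
  proof
    fix C assume "C \<in> free_diff S dg \<delta> ` carrier pres_dga"
    then obtain x where x: "x \<in> tens S" "C = cl (D x)" unfolding carrier_Q using d_cl by auto
    have "D x \<in> long 2" by (rule der_long[of S, OF \<delta>_long x(1)])
    then show "C \<in> decomposables S dg"
      unfolding decomposables_def gca_class_eq x(2) long_def using D_tens[OF x(1)] by blast
  qed
next
  fix k p show "stage k p \<subseteq> stage (Suc k) p"
    unfolding stage_def gca_class_eq by (intro image_mono) (auto simp: less_Suc_eq)
qed (use UN_stage dg_pos stage_submodule cdga_axioms in auto)

end

text \<open>\<open>rel_trivial \<dots> p\<close> says that the relative cohomology of \<open>\<Lambda>V \<rightarrow> A\<close> vanishes in degree \<open>p\<close>.\<close>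

definition rel_trivial ::
    "'a dga \<Rightarrow> 'g set \<Rightarrow> ('g \<Rightarrow> nat) \<Rightarrow> 'g tensor set \<Rightarrow> ('g \<Rightarrow> 'g tensor) \<Rightarrow> ('g \<Rightarrow> 'a) \<Rightarrow> nat \<Rightarrow> bool" where
  "rel_trivial A S dg I \<delta> \<phi> p \<longleftrightarrow>
    (\<forall>z\<in>tens S \<inter> homog dg (Suc p). \<forall>a\<in>grade A p. der dg \<delta> z \<in> I \<longrightarrow> diff A a = ev A \<phi> z \<longrightarrow>
      (\<exists>x\<in>tens S \<inter> homog dg p. z - der dg \<delta> x \<in> I \<and> a \<ominus>\<^bsub>A\<^esub> ev A \<phi> x \<in> coboundaries A p))"

locale minimal_model = minimal_system S dg \<delta> rk + A: cdga A
  for S :: "'g set" and dg \<delta> rk and A :: "'a dga" +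
  fixes \<phi> :: "'g \<Rightarrow> 'a"
  assumes one_not_zero: "\<one>\<^bsub>A\<^esub> \<noteq> \<zero>\<^bsub>A\<^esub>"
    and \<phi>_grade: "v \<in> S \<Longrightarrow> \<phi> v \<in> grade A (dg v)"
    and \<phi>_\<delta>: "v \<in> S \<Longrightarrow> ev A \<phi> (\<delta> v) = diff A (\<phi> v)"
    and rel: "rel_trivial A S dg (gca_ideal S dg {}) \<delta> \<phi> p"
begin

lemma \<phi>_carrier: "v \<in> S \<Longrightarrow> \<phi> v \<in> carrier A"
  using \<phi>_grade A.grade_carrier by blast

text \<open>Generators have positive degree, so the empty word is the only word of degree 0.\<close>

lemma degree_0_scalar:
  assumes "x \<in> tens S" "x \<in> homog dg 0"
  shows "\<exists>c. x = scalar c"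
  using assms
proof (induction rule: homog_induct)
  case zero
  show ?case by (rule exI[of _ 0]) simp
next
  case (single l q)
  have "l = []"
  proof (cases l)
    case (Cons v k)
    then show ?thesis using dg_pos[of v] single by auto
  qed
  then show ?case by (intro exI[of _ q]) (simp add: scalar_def zero_word_def)
next
  case (add x y)
  then show ?case using scalar_add by metis
qed

theorem quasi_isomorphism: "\<exists>m. quasi_isomorphism (free_dga S dg (free_diff S dg \<delta>)) A m"
proof -
  obtain f where f: "f \<in> dga_hom pres_dga A" "\<And>x. x \<in> tens S \<Longrightarrow> f (cl x) = ev A \<phi> x"
    using dga_hom_exists[OF A.cdga_axioms \<phi>_grade _ \<phi>_\<delta>] by auto
  have "quasi_isomorphism pres_dga A f"
  proof (rule quasi_isomorphismI[OF cdga_axioms A.cdga_axioms f(1)])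
    fix p C assume C: "C \<in> cocycles pres_dga p" "f C \<in> coboundaries A p"
    then obtain x where x': "C = cl x" "x \<in> tens S" "x \<in> homog dg p"
      unfolding cocycles_def grade_Q by blast
    then have "D x \<in> J" using C(1) by (simp add: cocycles_def diff_Q d_cl zero_Q cl_eq_iff)
    note x = x' this
    show "C \<in> coboundaries pres_dga p"
    proof (cases p)
      case 0
      \<comment> \<open>In degree 0 the free algebra is the ground field, and injectivity means that
        1 is not 0 in \<open>A\<close>.\<close>
      obtain c where c: "x = scalar c" using degree_0_scalar x 0 by blast
      have "c \<odot>\<^bsub>A\<^esub> \<one>\<^bsub>A\<^esub> = \<zero>\<^bsub>A\<^esub>"
        using C(2) x(1,2) f(2)[of x] 0 A.ev_scalar[of S \<phi> c] \<phi>_carrier by (simp add: c coboundaries_def)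
      then have "inverse c \<odot>\<^bsub>A\<^esub> (c \<odot>\<^bsub>A\<^esub> \<one>\<^bsub>A\<^esub>) = \<zero>\<^bsub>A\<^esub>" by simp
      then have "c = 0" using one_not_zero A.A_one_closed by (cases "c = 0") (simp_all add: A.smult_smult)
      then show ?thesis using x c 0 by (simp add: coboundaries_def zero_Q)
    next
      case (Suc r)
      \<comment> \<open>A cocycle together with an element bounding its image is a relative cocycle;
        trivialising the pair exhibits \<open>x\<close> as a coboundary.\<close>
      then obtain a where a: "a \<in> grade A r" "diff A a = ev A \<phi> x"
        using C(2) x f by (auto simp: coboundaries_def)
      then obtain y where "y \<in> tens S" "y \<in> homog dg r" "x - D y \<in> J"
        using rel[of r] x Suc unfolding rel_trivial_def by blast
      then have "C = free_diff S dg \<delta> (cl y)" "cl y \<in> grade pres_dga r"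
        using x by (simp_all add: d_cl cl_eq_iff grade_Q imageI)
      then show ?thesis
        using Suc by (simp add: coboundaries_def diff_Q)
    qed
  next
    fix p a assume a: "a \<in> cocycles A p"
    \<comment> \<open>The pair \<open>(0, a)\<close> is a relative cocycle, and trivialising it
      yields a cocycle \<open>x\<close> whose image is cohomologous to \<open>a\<close>.\<close>
    have "diff A a = ev A \<phi> 0" using a A.ev_0[of S \<phi>] \<phi>_carrier by (simp add: cocycles_def)
    moreover have "a \<in> grade A p" using a by (simp add: cocycles_def)
    moreover have "(0 :: 'g tensor) \<in> tens S \<inter> homog dg (Suc p)" "D 0 \<in> J" by simp_all
    ultimately obtain x where x: "x \<in> tens S" "x \<in> homog dg p" "0 - D x \<in> J" "a \<ominus>\<^bsub>A\<^esub> ev A \<phi> x \<in> coboundaries A p"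
      using rel[of p] unfolding rel_trivial_def by blast
    have "D x \<in> J" using J_uminus[OF x(3)] by simp
    then have "cl x \<in> cocycles pres_dga p"
      using x by (auto simp: cocycles_def grade_Q diff_Q d_cl zero_Q cl_eq_iff)
    then show "\<exists>C\<in>cocycles pres_dga p. a \<ominus>\<^bsub>A\<^esub> f C \<in> coboundaries A p"
      using x(4) f(2)[OF x(1)] by (intro bexI[of _ "cl x"]) simp_all
  qed
  then show ?thesis by blast
qed

end

subsection \<open>Renaming generators\<close>

lemma subst_rename_single:
  "subst (\<lambda>v. letter (r v)) (Poly_Mapping.single (Word l) q) = Poly_Mapping.single (Word (map r l)) q"
  using prod_list_letters[of "map r l"] by (simp add: comp_def scalar_mult_single)

lemma subst_rename_long: "x \<in> long k \<Longrightarrow> subst (\<lambda>v. letter (r v)) x \<in> long k"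
proof (rule tensor_induct_keys[of x "{w. k \<le> length (letters w)}"])
  fix w q assume "w \<in> {w :: 'a word. k \<le> length (letters w)}"
  then show "subst (\<lambda>v. letter (r v)) (Poly_Mapping.single w q) \<in> long k"
    using subst_rename_single[of r "letters w" q] by (auto intro!: long_single)
next
  assume "x \<in> long k"
  then show "Poly_Mapping.keys x \<subseteq> {w. k \<le> length (letters w)}" by (auto simp: long_def)
qed (simp_all add: long_add)

lemma subst_rename_inverse:
  assumes "x \<in> tens S" "\<And>v. v \<in> S \<Longrightarrow> s (r v) = v"
  shows "subst (\<lambda>v. letter (s v)) (subst (\<lambda>v. letter (r v)) x) = x"
  using subst_cong[OF assms(1), of "\<lambda>v. letter (s (r v))" letter] assms(2) by (simp add: subst_subst)

lemma presentation_free: "presentation S dg {}"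
  by unfold_locales auto

lemma subst_rename_ideal:
  assumes "\<And>v. v \<in> S \<Longrightarrow> r v \<in> S'" "\<And>v. v \<in> S \<Longrightarrow> dg' (r v) = dg v" "x \<in> gca_ideal S dg {}"
  shows "subst (\<lambda>v. letter (r v)) x \<in> gca_ideal S' dg' {}"
  by (rule presentation.subst_J[OF presentation_free presentation_free _ _ _ assms(3)])
    (auto intro: tens_letter homog_letter assms)

lemma ev_rename:
  assumes A: "cdga A" and x: "x \<in> tens S" and \<phi>: "\<And>v. v \<in> S \<Longrightarrow> \<phi> v \<in> carrier A"
    and r: "\<And>v. v \<in> S \<Longrightarrow> \<phi>' (r v) = \<phi> v"
  shows "ev A \<phi>' (subst (\<lambda>v. letter (r v)) x) = ev A \<phi> x"
proof -
  interpret A: cdga A by (rule A)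
  have \<phi>': "v \<in> r ` S \<Longrightarrow> \<phi>' v \<in> carrier A" for v using \<phi> r by auto
  have t: "subst (\<lambda>v. letter (r v)) y \<in> tens (r ` S)" if "y \<in> tens S" for y
    using that by (rule subst_tens) (auto intro: tens_letter)
  from x show ?thesis
  proof (induction rule: tens_induct)
    case zero
    then show ?case using A.ev_0[of S \<phi>] A.ev_0[of "r ` S" \<phi>'] \<phi> \<phi>' by simp
  next
    case (single l q)
    have "ev_word A \<phi>' (map r l) = ev_word A \<phi> l"
      using single by (induction l) (auto simp: ev_word_def r)
    then show ?case
      unfolding subst_rename_single using single A.ev_single[of S \<phi> l q] A.ev_single[of "r ` S" \<phi>' "map r l" q] \<phi> \<phi>'
      by (auto simp: image_mono)
  next
    case (add x y)
    then show ?case using A.ev_add[of S \<phi>] A.ev_add[of "r ` S" \<phi>'] \<phi> \<phi>' t by simp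
  qed
qed

context minimal_model
begin

context
  fixes r :: "'g \<Rightarrow> 'h"
  assumes r: "inj_on r S"
begin

abbreviation (input) "rinv \<equiv> inv_into S r"
abbreviation (input) "ren \<equiv> subst (\<lambda>v. letter (r v))"
abbreviation (input) "unren \<equiv> subst (\<lambda>v. letter (rinv v))"
abbreviation (input) "rdg \<equiv> \<lambda>v. dg (rinv v)"
abbreviation (input) "r\<delta> \<equiv> \<lambda>v. ren (\<delta> (rinv v))"
abbreviation (input) "rI \<equiv> gca_ideal (r ` S) rdg {}"

lemma rinv: "v \<in> S \<Longrightarrow> rinv (r v) = v" "w \<in> r ` S \<Longrightarrow> rinv w \<in> S" "w \<in> r ` S \<Longrightarrow> r (rinv w) = w"
  using inv_into_f_f[OF r] inv_into_into[of w r S] f_inv_into_f[of w r S] by auto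

lemma unren_ren: "x \<in> tens S \<Longrightarrow> unren (ren x) = x"
  by (rule subst_rename_inverse[of x S]) (auto simp: rinv)

lemma ren_unren: "x \<in> tens (r ` S) \<Longrightarrow> ren (unren x) = x"
  by (rule subst_rename_inverse[of x "r ` S"]) (auto simp: f_inv_into_f)

lemma ren_tens: "x \<in> tens S \<Longrightarrow> ren x \<in> tens (r ` S)"
  by (erule subst_tens) (auto intro: tens_letter)

lemma unren_tens: "x \<in> tens (r ` S) \<Longrightarrow> unren x \<in> tens S"
  by (erule subst_tens) (auto intro: tens_letter simp: rinv)

lemma ren_homog: "x \<in> tens S \<Longrightarrow> x \<in> homog dg p \<Longrightarrow> ren x \<in> homog rdg p"
  by (erule subst_homog) (auto intro: homog_letter simp: rinv)

lemma unren_homog: "x \<in> tens (r ` S) \<Longrightarrow> x \<in> homog rdg p \<Longrightarrow> unren x \<in> homog dg p"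
  by (erule subst_homog) (auto intro: homog_letter)

lemma ren_ideal: "x \<in> J \<Longrightarrow> ren x \<in> rI"
  by (rule subst_rename_ideal) (auto simp: rinv)

lemma unren_ideal: "x \<in> rI \<Longrightarrow> unren x \<in> J"
  by (rule subst_rename_ideal) (auto simp: rinv)

lemma ren_D: "x \<in> tens S \<Longrightarrow> der rdg r\<delta> (ren x) = ren (D x)"
  by (erule subst_der) (auto intro: homog_letter simp: rinv)

lemma unren_D: "x \<in> tens (r ` S) \<Longrightarrow> D (unren x) = unren (der rdg r\<delta> x)"
  by (erule subst_der) (auto intro: homog_letter simp: rinv unren_ren d_tens)

text \<open>Every datum is read through the inverse of \<open>r\<close> and every tensor through the
  induced isomorphism of free algebras. This carries a model to the type of generators demanded by
  \<open>same_rational_homotopy_type\<close>.\<close>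

lemma minimal_model_rename:
  "minimal_model (r ` S) rdg r\<delta> (\<lambda>v. rk (rinv v)) A (\<lambda>v. \<phi> (rinv v))"
proof (intro minimal_model.intro minimal_system.intro differential_presentation.intro presentation_free
    differential_presentation_axioms.intro minimal_system_axioms.intro minimal_model_axioms.intro)
  fix v assume "v \<in> r ` S"
  then obtain w where w: "w \<in> S" "v = r w" by auto
  show "r\<delta> v \<in> tens (r ` S)" using w by (simp add: rinv ren_tens d_tens)
  show "r\<delta> v \<in> homog rdg (Suc (rdg v))" using w by (simp add: rinv ren_homog d_tens d_homog)
  show "der rdg r\<delta> (r\<delta> v) \<in> rI" using w d_d by (simp add: rinv ren_D d_tens ren_ideal)
  show "1 \<le> rdg v" using w dg_pos by (simp add: rinv)
  show "r\<delta> v \<in> long 2" using w \<delta>_long by (simp add: rinv subst_rename_long)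
  have "ren (\<delta> w) \<in> tens {v \<in> r ` S. rk (rinv v) < rk w}"
    by (rule subst_tens[OF \<delta>_rk[OF w(1)]]) (auto intro!: tens_letter simp: rinv)
  then show "r\<delta> v \<in> tens {w \<in> r ` S. rk (rinv w) < rk (rinv v)}" using w by (simp add: rinv)
  show "\<phi> (rinv v) \<in> grade A (rdg v)" using w \<phi>_grade by (simp add: rinv)
  show "ev A (\<lambda>v. \<phi> (rinv v)) (r\<delta> v) = diff A (\<phi> (rinv v))"
    using w \<phi>_\<delta> d_tens \<phi>_carrier by (subst ev_rename[OF A.cdga_axioms, of _ S]) (auto simp: rinv)
next
  fix p
  show "rel_trivial A (r ` S) rdg rI r\<delta> (\<lambda>v. \<phi> (rinv v)) p"
    unfolding rel_trivial_def
  proof (intro ballI impI)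
    fix z a assume z: "z \<in> tens (r ` S) \<inter> homog rdg (Suc p)" and a: "a \<in> grade A p"
      "diff A a = ev A (\<lambda>v. \<phi> (rinv v)) z" and D: "der rdg r\<delta> z \<in> rI"
    let ?z = "unren z"
    have ev: "ev A (\<lambda>v. \<phi> (rinv v)) (ren x) = ev A \<phi> x" if "x \<in> tens S" for x
      using that by (rule ev_rename[OF A.cdga_axioms]) (auto simp: rinv \<phi>_carrier)
    have "?z \<in> tens S" "?z \<in> homog dg (Suc p)" "D ?z \<in> J" "diff A a = ev A \<phi> ?z"
      using z D a ev[of ?z] by (auto simp: unren_tens unren_homog unren_D unren_ideal ren_unren)
    then obtain x where x: "x \<in> tens S" "x \<in> homog dg p" "?z - D x \<in> J" "a \<ominus>\<^bsub>A\<^esub> ev A \<phi> x \<in> coboundaries A p"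
      using rel[of p] a(1) unfolding rel_trivial_def by blast
    have "z - der rdg r\<delta> (ren x) = ren (?z - D x)"
      using z x by (simp add: ren_D ren_unren)
    then show "\<exists>x\<in>tens (r ` S) \<inter> homog rdg p. z - der rdg r\<delta> x \<in> rI \<and>
        a \<ominus>\<^bsub>A\<^esub> ev A (\<lambda>v. \<phi> (rinv v)) x \<in> coboundaries A p"
      using x ren_ideal[OF x(3)] by (intro bexI[of _ "ren x"]) (auto simp: ev ren_tens ren_homog)
  qed
qed (use one_not_zero A.cdga_axioms in auto)

lemma dga_isomorphic_rename:
  "dga_isomorphic (free_dga S dg (free_diff S dg \<delta>)) (free_dga (r ` S) rdg (free_diff (r ` S) rdg r\<delta>))"
proof -
  interpret N: minimal_model "r ` S" rdg r\<delta> "\<lambda>v. rk (rinv v)" A "\<lambda>v. \<phi> (rinv v)"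
    by (rule minimal_model_rename)
  define f where "f C = (\<Union>x\<in>C. N.cl (ren x))" for C
  have f: "f (cl x) = N.cl (ren x)" if "x \<in> tens S" for x
    unfolding f_def using that
    by (rule UN_cl) (auto simp: N.cl_eq_iff simp flip: subst_simps(2) intro: ren_ideal)
  have "f \<in> dga_hom pres_dga N.pres_dga"
    unfolding dga_hom_def Ring.ring_hom_def
    by (auto simp: Q_simps N.Q_simps f tens_add tens_mult ren_tens d_cl N.d_cl D_tens ren_D
        intro!: imageI ren_homog)
  moreover have "bij_betw f (carrier pres_dga) (carrier N.pres_dga)"
    unfolding bij_betw_def
  proof
    show "inj_on f (carrier pres_dga)"
    proof (rule inj_onI, unfold carrier_Q, elim imageE)
      fix C C' x y assume *: "f C = f C'" "C = cl x" "x \<in> tens S" "C' = cl y" "y \<in> tens S"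
      then have "ren (x - y) \<in> rI" by (simp add: f N.cl_eq_iff)
      then have "unren (ren (x - y)) \<in> J" by (rule unren_ideal)
      then show "C = C'" using * unren_ren[of "x - y"] by (simp add: tens_diff cl_eq_iff)
    qed
    show "f ` carrier pres_dga = carrier N.pres_dga"
    proof
      show "carrier N.pres_dga \<subseteq> f ` carrier pres_dga"
      proof
        fix C assume "C \<in> carrier N.pres_dga"
        then obtain x where "x \<in> tens (r ` S)" "C = N.cl x" unfolding N.carrier_Q by auto
        then show "C \<in> f ` carrier pres_dga"
          unfolding carrier_Q by (intro image_eqI[of _ _ "cl (unren x)"]) (auto simp: f unren_tens ren_unren)
      qed
    qed (auto simp: carrier_Q N.carrier_Q f ren_tens)
  qed
  ultimately show ?thesis unfolding dga_isomorphic_def by blast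
qed

end

end

section \<open>Existence of minimal models\<close>

text \<open>
  A generator records its degree, its image in the target algebra and a representative of its
  differential. Hence a model is just a set of generators, inclusion of sets is extension of models,
  and the generator attached to a nontrivial relative class is automatically new.
\<close>

datatype 'a gen = Gen (gdeg: nat) (gval: 'a) (gdiff_list: "('a gen list \<times> rat) list")

lemma set_gen_Gen: "set_gen (Gen p a ts) = insert a (\<Union>(l, q)\<in>set ts. \<Union>w\<in>set l. set_gen w)"
proof -
  have "Basic_BNFs.fsts t = {fst t}" for t :: "'a gen list \<times> rat"
    by (cases t) (simp add: prod_set_simps)
  then show ?thesis by (simp add: case_prod_beta)
qed

definition tensor_of :: "('g list \<times> rat) list \<Rightarrow> 'g tensor" where
  "tensor_of ts = (\<Sum>(l, q)\<leftarrow>ts. Poly_Mapping.single (Word l) q)"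

definition gdiff :: "'a gen \<Rightarrow> 'a gen tensor" where
  "gdiff v = tensor_of (gdiff_list v)"

lemma tensor_of_tens:
  "(\<And>l q. (l, q) \<in> set ts \<Longrightarrow> set l \<subseteq> S) \<Longrightarrow> tensor_of ts \<in> tens S"
proof (induction ts)
  case (Cons t ts)
  obtain l q where "t = (l, q)" by force
  moreover have "tensor_of ts \<in> tens S" "set l \<subseteq> S" using Cons calculation by auto
  ultimately show ?case by (auto simp: tensor_of_def intro!: tens_add tens_single)
qed (simp add: tensor_of_def)

lemma tensor_of_surj:
  assumes "x \<in> tens S"
  obtains ts where "tensor_of ts = x" "\<And>l q. (l, q) \<in> set ts \<Longrightarrow> set l \<subseteq> S"
proof -
  have "\<exists>ts. tensor_of ts = x \<and> (\<forall>l q. (l, q) \<in> set ts \<longrightarrow> set l \<subseteq> S)"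
    using assms
  proof (induction rule: tens_induct)
    case zero
    show ?case by (rule exI[of _ "[]"]) (simp add: tensor_of_def)
  next
    case (single l q)
    then show ?case by (intro exI[of _ "[(l, q)]"]) (simp add: tensor_of_def)
  next
    case (add x y)
    then obtain ts us where "tensor_of ts = x" "\<forall>l q. (l, q) \<in> set ts \<longrightarrow> set l \<subseteq> S"
      "tensor_of us = y" "\<forall>l q. (l, q) \<in> set us \<longrightarrow> set l \<subseteq> S"
      by blast
    then show ?case by (intro exI[of _ "ts @ us"]) (auto simp: tensor_of_def)
  qed
  then show thesis using that by blast
qed

text \<open>The generators in a differential are structurally smaller, so the size of the datatype
  is a rank function and the Sullivan filtration comes for free.\<close>

lemma size_gdiff:
  assumes "(l, q) \<in> set (gdiff_list v)" "w \<in> set l"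
  shows "size w < size v"
proof (cases v)
  case (Gen p a ts)
  have "size w < size_list size l"
    using assms(2) by (induction l) auto
  moreover have "size_list size l < size_list (size_prod (size_list size) (\<lambda>_. 0)) ts"
    using assms(1) unfolding Gen by (induction ts) auto
  ultimately show ?thesis unfolding Gen by simp
qed

lemma tens_inter: "x \<in> tens S \<Longrightarrow> x \<in> tens T \<Longrightarrow> x \<in> tens (S \<inter> T)"
  unfolding tens_def by blast

lemma gdiff_size: "gdiff v \<in> tens {w. size w < size v}"
  unfolding gdiff_def by (rule tensor_of_tens) (auto dest: size_gdiff)

abbreviation gideal :: "'a gen tensor set" where
  "gideal \<equiv> gca_ideal UNIV gdeg {}"

interpretation gp: presentation UNIV gdeg "{}"
  by (rule presentation_free)

text \<open>The substitution killing the letters outside \<open>S\<close> preserves the commutation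
  relations and fixes tensors over \<open>S\<close>. The conditions on a generator can therefore use
  one ideal, independent of \<open>S\<close>, and persist when \<open>S\<close> grows.\<close>

lemma gideal_restrict:
  assumes "x \<in> tens S"
  shows "x \<in> gca_ideal S gdeg {} \<longleftrightarrow> x \<in> gideal"
proof
  assume "x \<in> gca_ideal S gdeg {}"
  then show "x \<in> gideal" using subst_rename_ideal[of S "\<lambda>v. v" UNIV gdeg gdeg x] by simp
next
  define \<rho> where "\<rho> v = (if v \<in> S then letter v else 0)" for v :: "'a gen"
  assume "x \<in> gideal"
  then have "subst \<rho> x \<in> gca_ideal S gdeg {}"
    by (rule presentation.subst_J[OF presentation_free presentation_free, rotated -1])
      (auto simp: \<rho>_def intro: tens_letter homog_letter)
  moreover have "subst \<rho> x = subst letter x"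
    by (rule subst_cong[OF assms]) (simp add: \<rho>_def)
  ultimately show "x \<in> gca_ideal S gdeg {}" by simp
qed

abbreviation gD :: "'a gen tensor \<Rightarrow> 'a gen tensor" where
  "gD \<equiv> der gdeg gdiff"

text \<open>The bound on the degrees of the letters in \<open>gdiff v\<close> forces minimality: a
  word of degree one more than \<open>gdeg v\<close> in such letters has at least two of them. Only
  the closure of \<open>S\<close> under differentials mentions \<open>S\<close>, so the conditions
  pass to unions.\<close>

definition gen_system :: "'a dga \<Rightarrow> 'a gen set \<Rightarrow> bool" where
  "gen_system A S \<longleftrightarrow> (\<forall>v\<in>S. 1 \<le> gdeg v \<and> gval v \<in> grade A (gdeg v) \<and>
     (\<forall>l q. (l, q) \<in> set (gdiff_list v) \<longrightarrow> set l \<subseteq> S) \<and> gdiff v \<in> tens {w. gdeg w \<le> gdeg v} \<and> gdiff v \<in> homog gdeg (Suc (gdeg v)) \<and>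
     gD (gdiff v) \<in> gideal \<and> ev A gval (gdiff v) = diff A (gval v))"

lemma gen_system_tens: "gen_system A S \<Longrightarrow> v \<in> S \<Longrightarrow> gdiff v \<in> tens S"
  unfolding gen_system_def gdiff_def by (intro tensor_of_tens) blast

abbreviation grel :: "'a dga \<Rightarrow> 'a gen set \<Rightarrow> nat \<Rightarrow> bool" where
  "grel A S \<equiv> rel_trivial A S gdeg gideal gdiff gval"

text \<open>
  Attaching generators of degree \<open>q\<close> to a system whose relative cohomology vanishes in degrees
  below \<open>q\<close> preserves this vanishing, provided that they are attached along nontrivial classes.
\<close>

definition good_system :: "'a dga \<Rightarrow> 'a gen set \<Rightarrow> bool" where
  "good_system A S \<longleftrightarrow> gen_system A S \<and> (\<forall>i. i = 0 \<or> (\<exists>v\<in>S. i < gdeg v) \<longrightarrow> grel A S i)"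

text \<open>A tensor involves finitely many letters, so a relative cocycle over the union of a chain
  already lives over one member.\<close>

lemma tens_chain:
  assumes "subset.chain \<A> \<C>" "\<C> \<noteq> {}" "x \<in> tens (\<Union>\<C>)"
  shows "\<exists>T\<in>\<C>. x \<in> tens T"
  using assms(3)
proof (induction rule: tens_induct)
  case zero
  then show ?case using assms(2) by auto
next
  case (single l q)
  then have "\<exists>T\<in>\<C>. set l \<subseteq> T"
    using finite_subset_Union_chain[OF _ _ assms(2) assms(1), of "set l"] by (metis List.finite_set)
  then obtain T where "T \<in> \<C>" "set l \<subseteq> T" by blast
  then show ?case using tens_single[of "Word l" T q] by auto
next
  case (add x y)
  then obtain T U where "T \<in> \<C>" "x \<in> tens T" "U \<in> \<C>" "y \<in> tens U" by blast
  moreover have "T \<subseteq> U \<or> U \<subseteq> T" using assms(1) calculation unfolding subset.chain_def by auto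
  ultimately show ?case using tens_mono tens_add by blast
qed

context cdga
begin

lemma good_system_Union:
  assumes chain: "subset.chain (Collect (good_system A)) \<C>" and ne: "\<C> \<noteq> {}"
  shows "good_system A (\<Union>\<C>)"
proof -
  have good: "good_system A T" if "T \<in> \<C>" for T using chain that unfolding subset.chain_def by auto
  \<comment> \<open>Vanishing is only asked for cofinally in the chain: a cocycle over
    \<open>T\<close> is trivialised over a larger member \<open>U\<close>.\<close>
  have rel: "grel A (\<Union>\<C>) i" if ev: "\<And>T. T \<in> \<C> \<Longrightarrow> \<exists>U\<in>\<C>. T \<subseteq> U \<and> grel A U i" for i
    unfolding rel_trivial_def
  proof (intro ballI impI)
    fix z a assume *: "z \<in> tens (\<Union>\<C>) \<inter> homog gdeg (Suc i)" "a \<in> grade A i" "gD z \<in> gideal" "diff A a = ev A gval z"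
    obtain T where "T \<in> \<C>" "z \<in> tens T" using tens_chain[OF chain ne, of z] * by blast
    then obtain U where U: "U \<in> \<C>" "z \<in> tens U" "grel A U i" using ev[of T] tens_mono by blast
    then obtain x where "x \<in> tens U" "x \<in> homog gdeg i" "z - gD x \<in> gideal" "a \<ominus> ev A gval x \<in> coboundaries A i"
      using * unfolding rel_trivial_def by blast
    moreover have "tens U \<subseteq> tens (\<Union>\<C>)" using U by (intro tens_mono) auto
    ultimately show "\<exists>x\<in>tens (\<Union>\<C>) \<inter> homog gdeg i. z - gD x \<in> gideal \<and> a \<ominus> ev A gval x \<in> coboundaries A i"
      by blast
  qed
  have "gen_system A (\<Union>\<C>)"
    unfolding gen_system_def
  proof
    fix v assume "v \<in> \<Union>\<C>"
    then obtain T where T: "T \<in> \<C>" "v \<in> T" by auto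
    then show "1 \<le> gdeg v \<and> gval v \<in> grade A (gdeg v) \<and>
     (\<forall>l q. (l, q) \<in> set (gdiff_list v) \<longrightarrow> set l \<subseteq> \<Union>\<C>) \<and> gdiff v \<in> tens {w. gdeg w \<le> gdeg v} \<and> gdiff v \<in> homog gdeg (Suc (gdeg v)) \<and>
     gD (gdiff v) \<in> gideal \<and> ev A gval (gdiff v) = diff A (gval v)"
      using good[OF T(1)] T unfolding good_system_def gen_system_def by blast
  qed
  moreover have "grel A (\<Union>\<C>) i" if "i = 0 \<or> (\<exists>v\<in>\<Union>\<C>. i < gdeg v)" for i
  proof (rule rel)
    fix T assume T: "T \<in> \<C>"
    show "\<exists>U\<in>\<C>. T \<subseteq> U \<and> grel A U i"
    proof (cases "i = 0")
      case True
      then show ?thesis using good[OF T] T unfolding good_system_def by blast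
    next
      case False
      then obtain v U where v: "U \<in> \<C>" "v \<in> U" "i < gdeg v" using \<open>i = 0 \<or> (\<exists>v\<in>\<Union>\<C>. i < gdeg v)\<close> by blast
      \<comment> \<open>The larger of the two contains \<open>v\<close>, whose degree exceeds
        \<open>i\<close>, so its relative cohomology vanishes in degree \<open>i\<close>.\<close>
      have "T \<subseteq> U \<or> U \<subseteq> T" using chain T v(1) unfolding subset.chain_def by auto
      then show ?thesis
        using good[OF T] good[OF v(1)] T v unfolding good_system_def by blast
    qed
  qed
  ultimately show ?thesis unfolding good_system_def by blast
qed

text \<open>The free algebra on no generators is the ground field, and vanishing of the relative
  cohomology in degree 0 says that closed elements of degree 0 are constants.\<close>

lemma good_system_empty:
  assumes H0: "\<And>x. x \<in> grade A 0 \<Longrightarrow> diff A x = \<zero> \<Longrightarrow> \<exists>c. x = c \<odot> \<one>"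
  shows "good_system A {}"
proof -
  have "grel A {} 0"
    unfolding rel_trivial_def
  proof (intro ballI impI)
    fix z a assume z: "z \<in> tens {} \<inter> homog gdeg (Suc 0)" and a: "a \<in> grade A 0" "diff A a = ev A gval z"
    have "z \<in> tens {}" "z \<in> homog gdeg (Suc 0)" using z by auto
    then have "z = 0"
      by (induction rule: homog_induct) auto
    then obtain c where c: "a = c \<odot> \<one>" using a H0 ev_0[of "{}" gval] by auto
    show "\<exists>x\<in>tens {} \<inter> homog gdeg 0. z - gD x \<in> gideal \<and> a \<ominus> ev A gval x \<in> coboundaries A 0"
    proof (intro bexI conjI)
      show "z - gD (scalar c) \<in> gideal" using \<open>z = 0\<close> by simp
      have "ev A gval (scalar c) = a" using ev_scalar[of "{}" gval c] c by simp
      then show "a \<ominus> ev A gval (scalar c) \<in> coboundaries A 0"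
        using A_minus_eq_zero[of a a] grade_carrier[OF a(1)] by (simp add: coboundaries_def)
    qed auto
  qed
  then show ?thesis unfolding good_system_def gen_system_def by auto
qed

text \<open>All generators have positive degree, so in total degree at most \<open>gdeg v\<close>
  the letter \<open>v\<close> can only occur as a word by itself.\<close>

lemma tens_insert_homog:
  assumes "\<And>w. w \<in> insert v S \<Longrightarrow> 1 \<le> gdeg w" "x \<in> tens (insert v S)" "x \<in> homog gdeg p" "p \<le> gdeg v"
  shows "\<exists>q y. x = scalar q * letter v + y \<and> y \<in> tens S \<and> y \<in> homog gdeg p \<and> (p < gdeg v \<longrightarrow> q = 0)"
  using assms(2,3)
proof (induction rule: homog_induct)
  case zero
  show ?case by (intro exI[of _ 0]) simp
next
  case (single l q)
  show ?case
  proof (cases "v \<in> set l")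
    case True
    then obtain k1 k2 where l: "l = k1 @ v # k2" by (meson split_list)
    have pos: "k = [] \<or> 0 < sum_list (map gdeg k)" if "set k \<subseteq> insert v S" for k
      using that assms(1) by (cases k) force+
    have "k1 = []" "k2 = []" "p = gdeg v"
      using pos[of k1] pos[of k2] single assms(4) by (auto simp: l)
    then show ?thesis
      by (intro exI[of _ q] exI[of _ 0]) (simp add: l letter_def scalar_mult_single)
  next
    case False
    then show ?thesis using single
      by (intro exI[of _ 0] exI[of _ "Poly_Mapping.single (Word l) q"]) (auto intro!: tens_single homog_single)
  qed
next
  case (add x1 x2)
  then obtain q1 y1 q2 y2 where "x1 = scalar q1 * letter v + y1 \<and> y1 \<in> tens S \<and> y1 \<in> homog gdeg p \<and> (p < gdeg v \<longrightarrow> q1 = 0)"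
    "x2 = scalar q2 * letter v + y2 \<and> y2 \<in> tens S \<and> y2 \<in> homog gdeg p \<and> (p < gdeg v \<longrightarrow> q2 = 0)"
    by blast
  then show ?case
    by (intro exI[of _ "q1 + q2"] exI[of _ "y1 + y2"]) (auto simp: scalar_add algebra_simps tens_add homog_add)
qed

text \<open>The new generator trivialises the given pair: its differential is \<open>z\<close> and
  its image is \<open>a\<close>. In relative degrees below \<open>p\<close> it can enter a cocycle
  only linearly, and a nonzero coefficient would make \<open>(z, a)\<close> trivial over
  \<open>S\<close> already.\<close>

lemma good_system_insert:
  assumes S: "good_system A S" and less: "\<And>i. i < p \<Longrightarrow> grel A S i" and p: "1 \<le> p" "\<And>v. v \<in> S \<Longrightarrow> gdeg v \<le> p"
    and z: "z \<in> tens S" "z \<in> homog gdeg (Suc p)" "gD z \<in> gideal" and a: "a \<in> grade A p" "diff A a = ev A gval z"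
    and nontrivial: "\<not> (\<exists>x\<in>tens S \<inter> homog gdeg p. z - gD x \<in> gideal \<and> a \<ominus> ev A gval x \<in> coboundaries A p)"
  shows "\<exists>v. v \<notin> S \<and> good_system A (insert v S)"
proof -
  obtain ts where ts: "tensor_of ts = z" "\<And>l q. (l, q) \<in> set ts \<Longrightarrow> set l \<subseteq> S"
    using tensor_of_surj[OF z(1)] by blast
  define v where "v = Gen p a ts"
  have v: "gdeg v = p" "gval v = a" "gdiff v = z" "gdiff_list v = ts"
    by (simp_all add: v_def gdiff_def ts(1))
  have gval: "gval w \<in> carrier A" if "w \<in> insert v S" for w
    using S that v a(1) grade_carrier unfolding good_system_def gen_system_def by auto
  \<comment> \<open>Otherwise \<open>letter v\<close> would trivialise the pair, because the
    generator stores both \<open>z\<close> and \<open>a\<close>.\<close>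
  have "v \<notin> S"
  proof
    assume "v \<in> S"
    then have l: "letter v \<in> tens S \<inter> homog gdeg p" using v by (auto intro: tens_letter homog_letter)
    have "ev A gval (letter v) = a" using ev_letter[of S gval v] \<open>v \<in> S\<close> gval v by simp
    moreover have "a \<ominus> a = \<zero>" using A_minus_eq_zero[of a a] grade_carrier[OF a(1)] by simp
    ultimately have "a \<ominus> ev A gval (letter v) \<in> coboundaries A p"
      using zero_in_coboundaries by simp
    moreover have "z - gD (letter v) \<in> gideal" using v by simp
    ultimately show False using nontrivial l by blast
  qed
  have S_insert: "tens S \<subseteq> tens (insert v S)" by (intro tens_mono) auto
  have "tens S \<subseteq> tens {w. gdeg w \<le> p}" using p(2) by (intro tens_mono) auto
  then have gen: "gen_system A (insert v S)"
    using S ts(2) z p v a unfolding good_system_def gen_system_def by (simp add: subset_insertI2) blast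
  have pos: "1 \<le> gdeg w" if "w \<in> insert v S" for w using gen that unfolding gen_system_def by blast
  have rel: "grel A (insert v S) i" if ip: "i < p" for i
    unfolding rel_trivial_def
  proof (intro ballI impI)
    fix z' a' assume z': "z' \<in> tens (insert v S) \<inter> homog gdeg (Suc i)" and a': "a' \<in> grade A i"
      and D: "gD z' \<in> gideal" and da: "diff A a' = ev A gval z'"
    obtain q y where qy: "z' = scalar q * letter v + y" "y \<in> tens S" "y \<in> homog gdeg (Suc i)" "Suc i < gdeg v \<longrightarrow> q = 0"
      using tens_insert_homog[of v S z' "Suc i"] pos z' ip v(1) by auto
    have "q = 0"
    proof (rule ccontr)
      assume q: "q \<noteq> 0"
      then have i: "p = Suc i" using qy(4) ip v(1) by auto
      \<comment> \<open>Closedness of \<open>z'\<close> reads \<open>q * z + D y = 0\<close> modulo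
        the ideal and is solved for \<open>z\<close>; the equation for \<open>diff A a'\<close> is
        solved for \<open>a\<close> in the same way.\<close>
      let ?x = "scalar (- (1 / q)) * y"
      have "?x \<in> tens S \<inter> homog gdeg p" using qy i by (auto intro: tens_mult homog_scalar_mult)
      moreover have "z - gD ?x \<in> gideal"
      proof -
        have "scalar (1 / q) * gD z' \<in> gideal" using D by (intro gp.J_lmult) auto
        also have "scalar (1 / q) * gD z' = scalar (1 / q) * (scalar q * z) + scalar (1 / q) * gD y"
          unfolding qy(1) by (simp add: v distrib_left)
        also have "scalar (1 / q) * (scalar q * z) = scalar (1 / q * q) * z"
          by (simp only: scalar_mult mult.assoc)
        finally show ?thesis using q by (simp add: scalar_uminus)
      qed
      moreover have "a \<ominus> ev A gval ?x \<in> coboundaries A p"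
      proof -
        have c: "ev A gval y \<in> carrier A" "a \<in> carrier A" "a' \<in> carrier A"
          using ev_carrier[of S gval y] qy(2) gval grade_carrier a a' by auto
        have "ev A gval z' = q \<odot> a \<oplus> ev A gval y"
          unfolding qy(1) using ev_add[of "insert v S" gval "scalar q * letter v" y]
            ev_scalar_mult[of "insert v S" gval "letter v" q] ev_letter[of "insert v S" gval v] gval v qy(2) S_insert
          by (auto simp: tens_mult tens_letter)
        then have "(1 / q) \<odot> diff A a' = a \<oplus> (1 / q) \<odot> ev A gval y"
          using da c q by (simp add: smult_right_add smult_smult)
        moreover have "a \<ominus> ev A gval ?x = a \<oplus> (1 / q) \<odot> ev A gval y"
          using ev_scalar_mult[of S gval y "- (1 / q)"] gval qy(2) c smult_minus_one[of "(- (1 / q)) \<odot> ev A gval y"]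
          by (simp add: a_minus_def smult_smult flip: smult_minus_one)
        moreover have "(1 / q) \<odot> diff A a' \<in> coboundaries A p"
          by (rule coboundaries_smult) (use a' in \<open>auto simp: i coboundaries_def\<close>)
        ultimately show ?thesis by simp
      qed
      ultimately show False using nontrivial by blast
    qed
    then have "z' \<in> tens S" "z' \<in> homog gdeg (Suc i)" using qy by auto
    then obtain x where "x \<in> tens S" "x \<in> homog gdeg i" "z' - gD x \<in> gideal" "a' \<ominus> ev A gval x \<in> coboundaries A i"
      using less[OF ip] a' D da unfolding rel_trivial_def by blast
    then show "\<exists>x\<in>tens (insert v S) \<inter> homog gdeg i. z' - gD x \<in> gideal \<and> a' \<ominus> ev A gval x \<in> coboundaries A i"
      using S_insert by blast
  qed
  have "grel A (insert v S) i" if "i = 0 \<or> (\<exists>w\<in>insert v S. i < gdeg w)" for i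
  proof (rule rel)
    show "i < p" using that p v by (auto dest: less_le_trans)
  qed
  then show ?thesis using gen \<open>v \<notin> S\<close> unfolding good_system_def by blast
qed

text \<open>The second clause confines the labels of all nested generators to the carrier, which is
  what the cardinality estimate is based on.\<close>

lemma minimal_model_exists:
  assumes one: "\<one> \<noteq> \<zero>" and H0: "\<And>x. x \<in> grade A 0 \<Longrightarrow> diff A x = \<zero> \<Longrightarrow> \<exists>c. x = c \<odot> \<one>"
  shows "\<exists>M. minimal_model M gdeg gdiff size A gval \<and> (\<forall>v\<in>M. set_gen v \<subseteq> carrier A)"
proof -
  have "\<exists>M\<in>Collect (good_system A). \<forall>X\<in>Collect (good_system A). M \<subseteq> X \<longrightarrow> X = M"
  proof (rule subset_Zorn')
    fix \<C> assume chain: "subset.chain (Collect (good_system A)) \<C>"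
    have "good_system A (\<Union>\<C>)"
    proof (cases "\<C> = {}")
      case True
      have "good_system A {}" by (rule good_system_empty) (rule H0)
      then show ?thesis by (simp add: True)
    qed (rule good_system_Union[OF chain])
    then show "\<Union>\<C> \<in> Collect (good_system A)" by simp
  qed
  then obtain M where M: "good_system A M" and max: "\<And>X. good_system A X \<Longrightarrow> M \<subseteq> X \<Longrightarrow> X = M"
    by blast
  have sys: "gen_system A M" using M unfolding good_system_def by blast
  have rel: "grel A M p" for p
  proof (induction p rule: less_induct)
    case (less p)
    show ?case
    proof (rule ccontr)
      assume *: "\<not> grel A M p"
      \<comment> \<open>A failure in degree \<open>p\<close> can thus occur only if \<open>p\<close>
        is positive and no generator has degree above \<open>p\<close>; this is exactly where a
        generator can be attached.\<close>
      have M': "grel A M i" if "i = 0 \<or> (\<exists>v\<in>M. i < gdeg v)" for i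
        using M that unfolding good_system_def by blast
      have p: "1 \<le> p" using * M'[of p] by (cases "p = 0") auto
      have le: "gdeg v \<le> p" if "v \<in> M" for v
        using * M'[of p] that by (meson not_le)
      obtain z a where "z \<in> tens M" "z \<in> homog gdeg (Suc p)" "gD z \<in> gideal" "a \<in> grade A p" "diff A a = ev A gval z"
        "\<not> (\<exists>x\<in>tens M \<inter> homog gdeg p. z - gD x \<in> gideal \<and> a \<ominus> ev A gval x \<in> coboundaries A p)"
        using * unfolding rel_trivial_def by blast
      then obtain v where "v \<notin> M" "good_system A (insert v M)"
        using good_system_insert[OF M less.IH p le] by blast
      then show False using max[of "insert v M"] by blast
    qed
  qed
  have "minimal_model M gdeg gdiff size A gval"
  proof (intro minimal_model.intro minimal_system.intro differential_presentation.intro presentation_free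
    differential_presentation_axioms.intro minimal_system_axioms.intro minimal_model_axioms.intro one cdga_axioms)
    fix v assume v: "v \<in> M"
    show *: "gdiff v \<in> tens M" "gdiff v \<in> homog gdeg (Suc (gdeg v))" "1 \<le> gdeg v"
      "gval v \<in> grade A (gdeg v)" "ev A gval (gdiff v) = diff A (gval v)"
      using gen_system_tens[OF sys v] sys v unfolding gen_system_def by blast+
    have dM: "w \<in> M \<Longrightarrow> gdiff w \<in> tens M" for w by (rule gen_system_tens[OF sys])
    have "gD (gdiff v) \<in> tens M" by (rule der_tens[OF *(1) dM])
    then show "gD (gdiff v) \<in> gca_ideal M gdeg {}"
      using gideal_restrict sys v unfolding gen_system_def by blast
    show "gdiff v \<in> tens {w \<in> M. size w < size v}"
      using tens_inter[OF *(1) gdiff_size[of v]] by (simp add: Int_def)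
    have "gdiff v \<in> tens {w. gdeg w \<le> gdeg v}" using sys v unfolding gen_system_def by blast
    then have small: "w \<in> Poly_Mapping.keys (gdiff v) \<Longrightarrow> u \<in> set (letters w) \<Longrightarrow> gdeg u \<le> gdeg v" for w u
      unfolding tens_def by blast
    show "gdiff v \<in> long 2"
      unfolding long_def
    proof (intro CollectI ballI)
      fix w assume w: "w \<in> Poly_Mapping.keys (gdiff v)"
      then have "sum_list (map gdeg (letters w)) = Suc (gdeg v)"
        using *(2) by (simp add: homog_def word_degree_def)
      \<comment> \<open>A case split into empty, singleton and longer lists: the empty word has
        degree 0, and a single letter has degree at most \<open>gdeg v\<close>.\<close>
      then show "2 \<le> length (letters w)"
        using small[OF w] by (cases "letters w" rule: remdups_adj.cases) auto
    qed
  next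
    fix p show "rel_trivial A M gdeg (gca_ideal M gdeg {}) gdiff gval p"
      unfolding rel_trivial_def
    proof (intro ballI impI)
      fix z a assume z: "z \<in> tens M \<inter> homog gdeg (Suc p)" and D: "gD z \<in> gca_ideal M gdeg {}"
        and a: "a \<in> grade A p" "diff A a = ev A gval z"
      have t: "gD x \<in> tens M" if "x \<in> tens M" for x
        using that by (rule der_tens) (rule gen_system_tens[OF sys])
      have "gD z \<in> gideal" using z D gideal_restrict[OF t, of z] by blast
      then obtain x where x: "x \<in> tens M" "x \<in> homog gdeg p" "z - gD x \<in> gideal" "a \<ominus> ev A gval x \<in> coboundaries A p"
        using rel[of p] z a unfolding rel_trivial_def by blast
      have "z - gD x \<in> gca_ideal M gdeg {}"
        using gideal_restrict[of "z - gD x" M] x z t by (simp add: tens_diff)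
      then show "\<exists>x\<in>tens M \<inter> homog gdeg p. z - gD x \<in> gca_ideal M gdeg {} \<and> a \<ominus> ev A gval x \<in> coboundaries A p"
        using x by blast
    qed
  qed auto
  moreover have "set_gen v \<subseteq> carrier A" if "v \<in> M" for v
    using that
  proof (induction v rule: measure_induct_rule[of size])
    case (less v)
    obtain p a ts where v: "v = Gen p a ts" by (cases v) auto
    have "a \<in> carrier A" using sys less.prems grade_carrier unfolding gen_system_def v by force
    moreover have "set_gen w \<subseteq> carrier A" if "(l, q) \<in> set ts" "w \<in> set l" for l q w
    proof (rule less.IH)
      show "size w < size v" using size_gdiff[of l q v w] that by (simp add: v)
      have "\<forall>l q. (l, q) \<in> set (gdiff_list v) \<longrightarrow> set l \<subseteq> M"
        using sys less.prems unfolding gen_system_def by blast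
      then show "w \<in> M" using that by (auto simp: v)
    qed
    ultimately show ?case unfolding v set_gen_Gen by blast
  qed
  ultimately show ?thesis by blast
qed

end

section \<open>Counting generators\<close>

lemma infinite_lists_lepoll:
  assumes "infinite C"
  shows "lists C \<lesssim> C"
proof -
  obtain e where e: "inj_on e (C \<times> C)" "e ` (C \<times> C) \<subseteq> C"
    using card_of_Times_same_infinite[OF assms] card_of_ordLeq[of "C \<times> C" C] ordIso_iff_ordLeq by blast
  obtain i :: "nat \<Rightarrow> 'a" where i: "inj i" "range i \<subseteq> C"
    using infinite_countable_subset[OF assms] by blast
  \<comment> \<open>Folding with the pairing function is injective only among lists of equal length;
    the length is therefore paired with the code below.\<close>
  define enc where "enc l = foldr (\<lambda>x y. e (x, y)) l (i 0)" for l
  have enc: "enc l \<in> C" if "l \<in> lists C" for l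
    using that i(2) e(2) by (induction l) (auto simp: enc_def)
  have inj: "k = l" if "k \<in> lists C" "l \<in> lists C" "length k = length l" "enc k = enc l" for k l
    using that(3,1,2,4)
  proof (induction k l rule: list_induct2)
    case (Cons x k y l)
    have "e (x, enc k) = e (y, enc l)" using Cons.prems by (simp add: enc_def)
    then have "(x, enc k) = (y, enc l)"
      using Cons.prems enc by (intro inj_onD[OF e(1)]) auto
    then show ?case using Cons by auto
  qed simp
  have "inj_on (\<lambda>l. e (i (length l), enc l)) (lists C)"
  proof (rule inj_onI)
    fix k l assume *: "k \<in> lists C" "l \<in> lists C" "e (i (length k), enc k) = e (i (length l), enc l)"
    then have "(i (length k), enc k) = (i (length l), enc l)"
      using enc i(2) by (intro inj_onD[OF e(1)]) auto
    then show "k = l" using inj * injD[OF i(1)] by auto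
  qed
  moreover have "(\<lambda>l. e (i (length l), enc l)) ` lists C \<subseteq> C"
    using enc i(2) e(2) by blast
  ultimately show ?thesis unfolding lepoll_def by blast
qed

lemma infinite_Times_lepoll:
  assumes "infinite C" "A \<lesssim> C" "B \<lesssim> C"
  shows "A \<times> B \<lesssim> C"
proof -
  have "A \<times> B \<lesssim> C \<times> C" using assms by (intro times_lepoll_mono)
  also have "C \<times> C \<lesssim> C"
    using card_of_Times_same_infinite[OF assms(1)] card_of_ordLeq[of "C \<times> C" C] ordIso_iff_ordLeq
    unfolding lepoll_def by blast
  finally show ?thesis .
qed

lemma countable_lepoll: "countable A \<Longrightarrow> infinite C \<Longrightarrow> A \<lesssim> C"
  using lepoll_trans[of A "UNIV :: nat set" C] infinite_le_lepoll[of C]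
  by (auto simp: countable_def lepoll_def)

text \<open>A generator is a finite tree labelled by numbers, elements of \<open>C\<close> and
  rationals. Codes are assigned recursively by an injection of the data at a node into the infinite
  set \<open>C\<close>.\<close>

lemma gens_lepoll:
  fixes C :: "'a set"
  assumes "infinite C"
  shows "{v :: 'a gen. set_gen v \<subseteq> C} \<lesssim> C"
proof -
  let ?T = "lists (lists C \<times> (UNIV :: rat set))"
  have L: "lists C \<lesssim> C" by (rule infinite_lists_lepoll[OF assms])
  have "lists C \<times> (UNIV :: rat set) \<lesssim> C"
    by (intro infinite_Times_lepoll assms L countable_lepoll) auto
  then have "?T \<lesssim> C" using lists_lepoll_mono L lepoll_trans by blast
  then have "C \<times> ?T \<lesssim> C"
    by (rule infinite_Times_lepoll[OF assms lepoll_refl])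
  then have "(UNIV :: nat set) \<times> C \<times> ?T \<lesssim> C"
    by (rule infinite_Times_lepoll[OF assms countable_lepoll[OF _ assms], rotated]) simp
  then obtain e where e: "inj_on e ((UNIV :: nat set) \<times> C \<times> ?T)" "e ` ((UNIV :: nat set) \<times> C \<times> ?T) \<subseteq> C"
    unfolding lepoll_def by blast
  \<comment> \<open>The recursor hands over each nested generator together with its code;
    \<open>snd\<close> keeps the code.\<close>
  define enc :: "'a gen \<Rightarrow> 'a" where
    "enc = rec_gen (\<lambda>p a ts. e (p, a, map (map_prod (map snd) id) ts))"
  have enc_Gen: "enc (Gen p a ts) = e (p, a, map (map_prod (map enc) id) ts)" for p a ts
    by (simp add: enc_def comp_def map_prod_def split_def)
  let ?H = "{v :: 'a gen. set_gen v \<subseteq> C}"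
  have sub: "w \<in> ?H" if "Gen p a ts \<in> ?H" "(l, q) \<in> set ts" "w \<in> set l" for p a ts l q w
    using that unfolding mem_Collect_eq set_gen_Gen by blast
  have enc_C: "enc v \<in> C" if "v \<in> ?H" for v
    using that
  proof (induction v rule: measure_induct_rule[of size])
    case (less v)
    obtain p a ts where v: "v = Gen p a ts" by (cases v) auto
    have "enc w \<in> C" if "(l, q) \<in> set ts" "w \<in> set l" for l q w
      using less.IH[of w] size_gdiff[of l q v w] that sub[of p a ts l q w] less.prems by (auto simp: v)
    then have "map (map_prod (map enc) id) ts \<in> ?T" by (auto simp: lists_eq_set)
    moreover have "a \<in> C" using less.prems by (auto simp: v)
    ultimately show ?case unfolding v enc_Gen using e(2) by blast
  qed
  have inj: "v = w" if "v \<in> ?H" "w \<in> ?H" "enc v = enc w" for v w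
    using that
  proof (induction v arbitrary: w rule: measure_induct_rule[of size])
    case (less v w)
    obtain p a ts where v: "v = Gen p a ts" by (cases v) auto
    obtain p' a' ts' where w: "w = Gen p' a' ts'" by (cases w) auto
    have T: "map (map_prod (map enc) id) ts \<in> ?T" if "Gen p a ts \<in> ?H" for p a ts
      using enc_C sub[OF that] by (fastforce simp: lists_eq_set)
    have "(p, a, map (map_prod (map enc) id) ts) = (p', a', map (map_prod (map enc) id) ts')"
      using less.prems T[of p a ts] T[of p' a' ts'] unfolding v w enc_Gen
      by (intro inj_onD[OF e(1)]) auto
    then have eq: "p = p'" "a = a'" "map (map_prod (map enc) id) ts = map (map_prod (map enc) id) ts'" by auto
    have "ts = ts'"
    proof (rule list.inj_map_strong[OF _ eq(3)])
      fix t t' assume t: "t \<in> set ts" "t' \<in> set ts'" "map_prod (map enc) id t = map_prod (map enc) id t'"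
      obtain l q l' q' where t_eq: "t = (l, q)" "t' = (l', q')" by force
      have "l = l'"
      proof (rule list.inj_map_strong[of l l' enc enc])
        fix u u' assume u: "u \<in> set l" "u' \<in> set l'" "enc u = enc u'"
        show "u = u'"
        proof (rule less.IH)
          show "size u < size v" using size_gdiff[of l q v u] t u by (simp add: v t_eq)
          show "u \<in> ?H" "u' \<in> ?H" using sub[of p a ts l q u] sub[of p' a' ts' l' q' u'] less.prems t u
            by (auto simp: v w t_eq)
        qed fact
      qed (use t t_eq in simp)
      then show "t = t'" using t by (simp add: t_eq)
    qed
    then show ?case using eq by (simp add: v w)
  qed
  then show ?thesis
    unfolding lepoll_def using enc_C by (intro exI[of _ enc]) (auto intro!: inj_onI)
qed

section \<open>Hermitian linear algebra\<close>

text \<open>The squared norm, as a complex number so that it can be a denominator in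
  \<open>pr\<close> without coercions.\<close>

definition nsq :: "nat \<Rightarrow> (nat \<Rightarrow> complex) \<Rightarrow> complex" where
  "nsq N v = (\<Sum>k<N. v k * cnj (v k))"

definition ip :: "nat \<Rightarrow> (nat \<Rightarrow> complex) \<Rightarrow> (nat \<Rightarrow> complex) \<Rightarrow> complex" where
  "ip N v w = (\<Sum>k<N. v k * cnj (w k))"

text \<open>Off the index range \<open>pr\<close> is 0, so that equality of functions means equality of projections.\<close>

definition pr :: "nat \<Rightarrow> (nat \<Rightarrow> complex) \<Rightarrow> nat \<times> nat \<Rightarrow> complex" where
  "pr N v = (\<lambda>(a, b). if a < N \<and> b < N then v a * cnj (v b) / nsq N v else 0)"

definition perp :: "nat \<Rightarrow> (nat \<Rightarrow> complex) \<Rightarrow> (nat \<Rightarrow> complex) \<Rightarrow> nat \<Rightarrow> complex" where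
  "perp N v w = (\<lambda>a. w a - ip N w v / nsq N v * v a)"

lemma nsq_real: "nsq N v = of_real (\<Sum>k<N. (cmod (v k))\<^sup>2)"
  by (simp add: nsq_def complex_norm_square flip: of_real_power)

lemma nsq_eq_0_iff: "nsq N v = 0 \<longleftrightarrow> (\<forall>k<N. v k = 0)"
proof -
  have "nsq N v = 0 \<longleftrightarrow> (\<Sum>k<N. (cmod (v k))\<^sup>2) = 0"
    by (simp only: nsq_real of_real_eq_0_iff)
  also have "\<dots> \<longleftrightarrow> (\<forall>k<N. v k = 0)"
    by (subst sum_nonneg_eq_0_iff) auto
  finally show ?thesis .
qed

lemma nsq_cong: "(\<And>k. k < N \<Longrightarrow> v k = w k) \<Longrightarrow> nsq N v = nsq N w"
  by (simp add: nsq_def)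

lemma ip_cong: "(\<And>k. k < N \<Longrightarrow> v k = v' k) \<Longrightarrow> (\<And>k. k < N \<Longrightarrow> w k = w' k) \<Longrightarrow> ip N v w = ip N v' w'"
  by (simp add: ip_def)

lemma ip_self: "ip N v v = nsq N v"
  by (simp add: ip_def nsq_def)

lemma ip_scale: "ip N (\<lambda>k. c * v k) (\<lambda>k. d * w k) = c * cnj d * ip N v w"
  by (simp add: ip_def sum_distrib_left mult_ac)

lemma ip_add_left: "ip N (\<lambda>k. v k + w k) u = ip N v u + ip N w u"
  by (simp add: ip_def distrib_right sum.distrib)

lemma ip_diff_left: "ip N (\<lambda>k. v k - w k) u = ip N v u - ip N w u"
  by (simp add: ip_def left_diff_distrib sum_subtractf)

lemma ip_scale_left: "ip N (\<lambda>k. c * v k) w = c * ip N v w"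
  using ip_scale[of N c v 1 w] by simp

lemma nsq_scale: "nsq N (\<lambda>k. c * v k) = c * cnj c * nsq N v"
  using ip_scale[of N c v c v] by (simp add: ip_self)

lemma pr_cong: "(\<And>k. k < N \<Longrightarrow> v k = w k) \<Longrightarrow> pr N v = pr N w"
  using nsq_cong[of N v w] by (auto simp: pr_def fun_eq_iff)

lemma pr_scale: "c \<noteq> 0 \<Longrightarrow> pr N (\<lambda>k. c * v k) = pr N v"
  unfolding pr_def nsq_scale by (auto simp: fun_eq_iff)

lemma pr_multiple: "c \<noteq> 0 \<Longrightarrow> (\<And>k. k < N \<Longrightarrow> v k = c * w k) \<Longrightarrow> pr N v = pr N w"
  using pr_scale[of c N w] pr_cong[of N v "\<lambda>k. c * w k"] by simp

text \<open>Every column of the projection is a multiple of the vector; a column \<open>b\<close>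
  with \<open>w b\<close> nonzero recovers it up to a factor.\<close>

lemma pr_eqD:
  assumes "pr N v = pr N w" "\<exists>k<N. v k \<noteq> 0" "\<exists>k<N. w k \<noteq> 0"
  shows "\<exists>c. c \<noteq> 0 \<and> (\<forall>k<N. v k = c * w k)"
proof -
  obtain b where b: "b < N" "w b \<noteq> 0" using assms(3) by blast
  have n: "nsq N v \<noteq> 0" "nsq N w \<noteq> 0" using assms(2,3) by (auto simp: nsq_eq_0_iff)
  have eq: "v a * cnj (v b) / nsq N v = w a * cnj (w b) / nsq N w" if "a < N" for a
    using fun_cong[OF assms(1), of "(a, b)"] that b by (simp add: pr_def)
  have vb: "v b \<noteq> 0" using eq[OF b(1)] b n by auto
  define c where "c = cnj (w b) * nsq N v / (nsq N w * cnj (v b))"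
  have "v a = c * w a" if "a < N" for a
    using eq[OF that] n vb by (simp add: c_def field_simps)
  moreover have "c \<noteq> 0" using n vb b by (simp add: c_def)
  ultimately show ?thesis by blast
qed

lemma perp_cong:
  "(\<And>k. k < N \<Longrightarrow> v k = v' k) \<Longrightarrow> (\<And>k. k < N \<Longrightarrow> w k = w' k) \<Longrightarrow> a < N \<Longrightarrow> perp N v w a = perp N v' w' a"
  using ip_cong[of N w w' v v'] nsq_cong[of N v v'] by (simp add: perp_def)

lemma perp_combination:
  "nsq N v \<noteq> 0 \<Longrightarrow> perp N v (\<lambda>a. c * w a + d * v a) = (\<lambda>a. c * perp N v w a)"
  unfolding perp_def ip_add_left ip_scale_left ip_self by (auto simp: fun_eq_iff field_simps)

lemma perp_scale_base: "c \<noteq> 0 \<Longrightarrow> perp N (\<lambda>k. c * v k) w = perp N v w"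
  using ip_scale[of N 1 w c v] by (auto simp: perp_def nsq_scale fun_eq_iff)

lemma perp_base_multiple:
  assumes "c \<noteq> 0" "\<And>k. k < N \<Longrightarrow> v k = c * v' k" "a < N"
  shows "perp N v w a = perp N v' w a"
  using perp_cong[of N v "\<lambda>k. c * v' k" w w a] perp_scale_base[of c N v' w] assms by simp

lemma ip_perp: "nsq N v \<noteq> 0 \<Longrightarrow> ip N (perp N v w) v = 0"
  unfolding perp_def ip_diff_left ip_scale_left ip_self by simp

lemma perp_orthogonal: "ip N w v = 0 \<Longrightarrow> perp N v w = w"
  by (simp add: perp_def)

section \<open>Padded vectors and flags\<close>

definition skip :: "nat \<Rightarrow> nat \<Rightarrow> nat" where
  "skip i a = (if a < i then a else Suc a)"

text \<open>\<open>ins i c\<close> undoes the omission of coordinate \<open>i\<close> made by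
  \<open>skip i\<close>, which is the indexing of \<open>CP_chart\<close>.\<close>

definition ins :: "nat \<Rightarrow> complex \<Rightarrow> (nat \<Rightarrow> complex) \<Rightarrow> nat \<Rightarrow> complex" where
  "ins i c w k = (if k < i then w k else if k = i then c else w (k - 1))"

lemma ins_skip [simp]: "ins i c w (skip i a) = w a"
  and ins_self [simp]: "ins i c w i = c"
  by (auto simp: ins_def skip_def)

lemma skip_less: "a < n \<Longrightarrow> skip i a < Suc n"
  and skip_neq [simp]: "skip i a \<noteq> i"
  by (auto simp: skip_def)

lemma skip_cases:
  assumes "k < Suc n" "i \<le> n"
  obtains "k = i" | a where "a < n" "k = skip i a"
proof -
  consider "k < i" | "k = i" | "i < k" by linarith
  then show thesis
  proof cases
    case 1 then show ?thesis using that(2)[of k] assms by (auto simp: skip_def)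
  next
    case 3 then show ?thesis using that(2)[of "k - 1"] assms by (auto simp: skip_def)
  qed (rule that(1))
qed

lemma skip_inj: "skip i a = skip i b \<longleftrightarrow> a = b"
  by (auto simp: skip_def split: if_splits)

definition flag :: "nat \<Rightarrow> nat \<Rightarrow> (nat \<Rightarrow> complex) \<Rightarrow> (nat \<Rightarrow> complex) \<Rightarrow> (nat \<times> nat \<Rightarrow> complex) \<times> (nat \<times> nat \<Rightarrow> complex)" where
  "flag n i v w = (pr (Suc n) v, pr (Suc n) (perp (Suc n) v (ins i 0 w)))"

lemma nsq_nonzero: "i < N \<Longrightarrow> v i \<noteq> 0 \<Longrightarrow> nsq N v \<noteq> 0"
  by (auto simp: nsq_eq_0_iff)

text \<open>Makes the flag a function of the two lines, whatever representatives are chosen.\<close>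

lemma flag_multiple:
  assumes "c \<noteq> 0" "d \<noteq> 0" "i \<le> n" "\<And>k. k < Suc n \<Longrightarrow> v k = c * v' k" "\<And>k. k < n \<Longrightarrow> w k = d * w' k" "v i \<noteq> 0"
  shows "flag n i v w = flag n i v' w'"
proof -
  have v': "nsq (Suc n) v' \<noteq> 0" using assms by (intro nsq_nonzero[of i]) auto
  have w: "ins i 0 w k = d * ins i 0 w' k + 0 * v' k" if "k < Suc n" for k
    using that assms by (auto simp: ins_def)
  have "perp (Suc n) v (ins i 0 w) k = d * perp (Suc n) v' (ins i 0 w') k" if "k < Suc n" for k
  proof -
    have "perp (Suc n) v (ins i 0 w) k = perp (Suc n) v' (ins i 0 w) k"
      by (rule perp_base_multiple[OF assms(1,4) that])
    also have "\<dots> = perp (Suc n) v' (\<lambda>k. d * ins i 0 w' k + 0 * v' k) k"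
      by (rule perp_cong[OF refl w that])
    finally show ?thesis unfolding perp_combination[OF v'] .
  qed
  then have "pr (Suc n) (perp (Suc n) v (ins i 0 w)) = pr (Suc n) (perp (Suc n) v' (ins i 0 w'))"
    by (rule pr_multiple[OF assms(2)])
  then show ?thesis
    unfolding flag_def using pr_multiple[OF assms(1,4)] by simp
qed

text \<open>\<open>w'\<close> is the image of \<open>w\<close> under the Jacobian matrix of the change of charts from \<open>j\<close> to \<open>i\<close>.\<close>

lemma flag_glue:
  assumes "c \<noteq> 0" "i \<le> n" "j \<le> n" "v i \<noteq> 0"
    and w': "\<And>a. a < n \<Longrightarrow> w' a = c * (ins j 0 w (skip i a) * v i - v (skip i a) * ins j 0 w i)"
  shows "flag n i v w' = flag n j v w"
proof -
  let ?W = "ins j 0 w"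
  have v: "nsq (Suc n) v \<noteq> 0" using assms by (intro nsq_nonzero[of i]) auto
  \<comment> \<open>The padded image is \<open>?W\<close> rescaled plus the multiple of
    \<open>v\<close> that clears position \<open>i\<close>; \<open>perp\<close> removes this
    multiple.\<close>
  have "ins i 0 w' k = (c * v i) * ?W k + (- c * ?W i) * v k" if "k < Suc n" for k
    using that assms(2) by (rule skip_cases) (auto simp: w' algebra_simps)
  then have "perp (Suc n) v (ins i 0 w') k = c * v i * perp (Suc n) v ?W k" if "k < Suc n" for k
    using perp_cong[of "Suc n" v v "ins i 0 w'" "\<lambda>k. (c * v i) * ?W k + (- c * ?W i) * v k" k] that
      perp_combination[OF v, of "c * v i" ?W "- c * ?W i"] by simp
  then have "pr (Suc n) (perp (Suc n) v (ins i 0 w')) = pr (Suc n) (perp (Suc n) v ?W)"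
    using assms by (intro pr_multiple[of "c * v i"]) auto
  then show ?thesis by (simp add: flag_def)
qed

text \<open>A multiple of \<open>v\<close> that vanishes in position \<open>i\<close> is zero,
  whereas the padded vector vanishes there without being zero.\<close>

lemma perp_ins_nonzero:
  assumes "i \<le> n" "v i \<noteq> 0" "\<exists>k<n. w k \<noteq> 0"
  shows "\<exists>k<Suc n. perp (Suc n) v (ins i 0 w) k \<noteq> 0"
proof (rule ccontr)
  define c where "c = ip (Suc n) (ins i 0 w) v / nsq (Suc n) v"
  assume "\<not> ?thesis"
  then have eq: "ins i 0 w k = c * v k" if "k < Suc n" for k
    using that by (auto simp: perp_def c_def)
  then have "c = 0" using eq[of i] assms by simp
  then have "ins i 0 w (skip i a) = 0" if "a < n" for a
    using eq[of "skip i a"] skip_less[OF that, of i] by simp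
  then show False using assms(3) ins_skip by metis
qed

lemma flag_inj:
  assumes "flag n i v w = flag n i v' w'" "i \<le> n" "v i \<noteq> 0" "v' i \<noteq> 0" "\<exists>k<n. w k \<noteq> 0" "\<exists>k<n. w' k \<noteq> 0"
  shows "(\<exists>c. c \<noteq> 0 \<and> (\<forall>k<Suc n. v k = c * v' k)) \<and> (\<exists>d. d \<noteq> 0 \<and> (\<forall>k<n. w k = d * w' k))"
proof -
  have "\<exists>k<Suc n. v k \<noteq> 0" "\<exists>k<Suc n. v' k \<noteq> 0" using assms by (auto intro!: exI[of _ i])
  then obtain c where c: "c \<noteq> 0" "\<And>k. k < Suc n \<Longrightarrow> v k = c * v' k"
    using pr_eqD[of "Suc n" v v'] assms(1) by (auto simp: flag_def)
  have "pr (Suc n) (perp (Suc n) v (ins i 0 w)) = pr (Suc n) (perp (Suc n) v' (ins i 0 w'))"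
    using assms(1) by (simp add: flag_def)
  also have "\<dots> = pr (Suc n) (perp (Suc n) v (ins i 0 w'))"
    by (rule pr_cong) (rule perp_base_multiple[OF c, symmetric])
  finally obtain d where d: "d \<noteq> 0" "\<And>k. k < Suc n \<Longrightarrow> perp (Suc n) v (ins i 0 w) k = d * perp (Suc n) v (ins i 0 w') k"
    using pr_eqD[OF _ perp_ins_nonzero[of i n v w] perp_ins_nonzero[of i n v w']] assms(2,3,5,6) by blast
  \<comment> \<open>The coefficient of \<open>v\<close> left over after undoing both projections.
    Position \<open>i\<close>, where both padded vectors are 0, shows that it vanishes.\<close>
  let ?e = "ip (Suc n) (ins i 0 w) v / nsq (Suc n) v - d * (ip (Suc n) (ins i 0 w') v / nsq (Suc n) v)"
  have eq: "ins i 0 w k = d * ins i 0 w' k + ?e * v k" if "k < Suc n" for k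
    using d(2)[OF that] unfolding perp_def by (simp add: algebra_simps)
  have "?e = 0" using eq[of i] assms by simp
  then have "w a = d * w' a" if "a < n" for a
    using eq[of "skip i a"] skip_less[OF that, of i] by simp
  then show ?thesis using c d(1) by blast
qed

subsection \<open>Unitary matrices\<close>

definition unitary_fun :: "nat \<Rightarrow> (nat \<Rightarrow> nat \<Rightarrow> complex) \<Rightarrow> bool" where
  "unitary_fun N A \<longleftrightarrow> (\<forall>i<N. \<forall>j<N. (\<Sum>k<N. cnj (A k i) * A k j) = (if i = j then 1 else 0))"

lemma unitary_fun_cong:
  "(\<And>i j. i < N \<Longrightarrow> j < N \<Longrightarrow> A i j = B i j) \<Longrightarrow> unitary_fun N A \<Longrightarrow> unitary_fun N B"
  unfolding unitary_fun_def by simp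

lemma unitary_fun_mult:
  assumes "unitary_fun N A" "unitary_fun N B"
  shows "unitary_fun N (\<lambda>i j. \<Sum>l<N. A i l * B l j)"
  unfolding unitary_fun_def
proof (intro allI impI)
  fix i j assume ij: "i < N" "j < N"
  have "(\<Sum>k<N. cnj (\<Sum>l<N. A k l * B l i) * (\<Sum>m<N. A k m * B m j)) =
      (\<Sum>k<N. \<Sum>l<N. \<Sum>m<N. cnj (B l i) * (B m j * (cnj (A k l) * A k m)))"
    by (intro sum.cong refl) (simp only: cnj_sum sum_product, intro sum.cong refl, simp add: mult_ac)
  also have "\<dots> = (\<Sum>l<N. \<Sum>k<N. \<Sum>m<N. cnj (B l i) * (B m j * (cnj (A k l) * A k m)))"
    by (rule sum.swap)
  also have "\<dots> = (\<Sum>l<N. \<Sum>m<N. \<Sum>k<N. cnj (B l i) * (B m j * (cnj (A k l) * A k m)))"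
    by (intro sum.cong refl sum.swap)
  also have "\<dots> = (\<Sum>l<N. \<Sum>m<N. cnj (B l i) * (B m j * (\<Sum>k<N. cnj (A k l) * A k m)))"
    by (simp add: sum_distrib_left)
  also have "\<dots> = (\<Sum>l<N. \<Sum>m<N. if l = m then cnj (B l i) * B m j else 0)"
    using assms(1) unfolding unitary_fun_def by (intro sum.cong refl) auto
  also have "\<dots> = (\<Sum>l<N. cnj (B l i) * B l j)"
    by (simp add: sum.delta)
  also have "\<dots> = (if i = j then 1 else 0)"
    using assms(2) ij unfolding unitary_fun_def by blast
  finally show "(\<Sum>k<N. cnj (\<Sum>l<N. A k l * B l i) * (\<Sum>l<N. A k l * B l j)) = (if i = j then 1 else 0)" .
qed

text \<open>Householder reflection; for \<open>x = 0\<close> division by zero makes it the identity.\<close>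

definition refl_fun :: "nat \<Rightarrow> (nat \<Rightarrow> complex) \<Rightarrow> nat \<Rightarrow> nat \<Rightarrow> complex" where
  "refl_fun N x k j = (if k = j then 1 else 0) - 2 * x k * cnj (x j) / nsq N x"

lemma cnj_nsq [simp]: "cnj (nsq N x) = nsq N x"
  by (simp add: nsq_real)

lemma refl_fun_fix: "x j = 0 \<Longrightarrow> refl_fun N x k j = (if k = j then 1 else 0)"
  by (simp add: refl_fun_def)

lemma refl_fun_hermitian: "cnj (refl_fun N x k j) = refl_fun N x j k"
  by (simp add: refl_fun_def mult_ac)

lemma refl_fun_square:
  assumes "i < N" "j < N"
  shows "(\<Sum>k<N. refl_fun N x i k * refl_fun N x k j) = (if i = j then 1 else 0)"
proof (cases "nsq N x = 0")
  case True
  then have "refl_fun N x k j = (if k = j then 1 else 0)" for k j by (simp add: refl_fun_def)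
  then show ?thesis using assms by (simp add: if_distrib[where f="\<lambda>y. _ * y"] cong: if_cong)
next
  case False
  let ?c = "2 / nsq N x"
  have "(\<Sum>k<N. refl_fun N x i k * refl_fun N x k j) =
      (\<Sum>k<N. (if k = i then (if i = j then 1 else 0) else 0) - (if k = i then ?c * x i * cnj (x j) else 0)
        - (if k = j then ?c * x i * cnj (x j) else 0) + ?c * ?c * x i * cnj (x j) * (x k * cnj (x k)))"
    by (intro sum.cong refl) (auto simp: refl_fun_def algebra_simps)
  also have "\<dots> = (if i = j then 1 else 0) - ?c * x i * cnj (x j) - ?c * x i * cnj (x j) + ?c * ?c * x i * cnj (x j) * nsq N x"
  proof -
    have "(\<Sum>k<N. ?c * ?c * x i * cnj (x j) * (x k * cnj (x k))) = ?c * ?c * x i * cnj (x j) * nsq N x"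
      by (simp only: nsq_def sum_distrib_left)
    then show ?thesis using assms by (simp only: sum.distrib sum_subtractf) simp
  qed
  also have "\<dots> = (if i = j then 1 else 0)"
    using False by (simp add: field_simps)
  finally show ?thesis .
qed

lemma unitary_refl_fun: "unitary_fun N (refl_fun N x)"
  unfolding unitary_fun_def refl_fun_hermitian by (simp add: refl_fun_square)

text \<open>A reflection is Hermitian, so it can carry the basis vector number \<open>m\<close> to
  the unit vector \<open>u\<close> only if \<open>u m\<close> is real;
  \<open>normalize_exists\<close> arranges this by a choice of phase.\<close>

lemma refl_fun_column:
  assumes "m < N" "nsq N u = 1" "cnj (u m) = u m" "k < N"
  shows "refl_fun N (\<lambda>k. u k - (if k = m then 1 else 0)) k m = u k"
proof -
  let ?x = "\<lambda>k. u k - (if k = m then 1 else 0)"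
  have "nsq N ?x = (\<Sum>k<N. u k * cnj (u k) - (if k = m then u m + cnj (u m) - 1 else 0))"
    unfolding nsq_def by (intro sum.cong refl) (auto simp: algebra_simps)
  also have "\<dots> = 2 * (1 - u m)"
    using assms by (simp add: sum_subtractf nsq_def)
  finally have n: "nsq N ?x = 2 * (1 - u m)" .
  show ?thesis
  proof (cases "u m = 1")
    case True
    then have "\<forall>k<N. ?x k = 0" using n nsq_eq_0_iff[of N ?x] by simp
    then show ?thesis using n True assms(4) by (auto simp: refl_fun_def)
  next
    case False
    have "2 * ?x k * cnj (?x m) / nsq N ?x = - ?x k"
      using False unfolding n by (simp add: assms(3) field_simps)
    then show ?thesis unfolding refl_fun_def by simp
  qed
qed

lemma phase_exists: "\<exists>d. d \<noteq> 0 \<and> d * cnj d = 1 \<and> cnj (d * z) = d * z" for z :: complex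
proof (cases "z = 0")
  case False
  let ?d = "cnj z / of_real (cmod z)"
  have "?d * cnj ?d = 1" "cnj (?d * z) = ?d * z"
    using False by (simp_all add: mult.commute complex_norm_square[symmetric] power2_eq_square flip: of_real_mult)
  then show ?thesis using False by (intro exI[of _ ?d]) auto
qed (auto intro: exI[of _ 1])

text \<open>The norm fixes the factor up to a phase, which is spent on making entry \<open>m\<close>
  real.\<close>

lemma normalize_exists:
  assumes "\<exists>k<N. v k \<noteq> 0"
  shows "\<exists>c. c \<noteq> 0 \<and> nsq N (\<lambda>k. c * v k) = 1 \<and> cnj (c * v m) = c * v m"
proof -
  let ?s = "sqrt (\<Sum>k<N. (cmod (v k))\<^sup>2)"
  have s0: "(\<Sum>k<N. (cmod (v k))\<^sup>2) \<ge> 0" by (rule sum_nonneg) auto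
  have "nsq N v \<noteq> 0" using assms by (auto simp: nsq_eq_0_iff)
  then have "(\<Sum>k<N. (cmod (v k))\<^sup>2) \<noteq> 0" unfolding nsq_real by (metis of_real_0)
  then have s: "?s > 0" using s0 by (simp add: less_le)
  have sq: "of_real ?s * of_real ?s = nsq N v"
    unfolding nsq_real using s0 by (simp flip: of_real_mult)
  obtain d where d: "d \<noteq> 0" "d * cnj d = 1" "cnj (d * v m) = d * v m" using phase_exists by blast
  let ?c = "d / of_real ?s"
  have "nsq N (\<lambda>k. ?c * v k) = (d * cnj d) * nsq N v / (of_real ?s * of_real ?s)"
    unfolding nsq_scale by simp
  also have "\<dots> = 1" using \<open>nsq N v \<noteq> 0\<close> unfolding sq by (simp add: d(2))
  finally have "nsq N (\<lambda>k. ?c * v k) = 1" .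
  moreover have "cnj (?c * v m) = ?c * v m"
    using d(3) by (simp add: divide_simps)
  ultimately show ?thesis using d s by (intro exI[of _ ?c]) auto
qed

text \<open>A product of two reflections. The first sends basis vector 0 to the normalised
  \<open>v\<close>; as \<open>w\<close> is orthogonal to \<open>v\<close>, its reflected copy has
  entry 0 in position 0. The second sends basis vector 1 to this copy, normalised, and therefore
  fixes basis vector 0.\<close>

lemma unitary_completion:
  assumes v: "\<exists>k<Suc (Suc m). v k \<noteq> 0" and w: "\<exists>k<Suc (Suc m). w k \<noteq> 0" and orth: "ip (Suc (Suc m)) w v = 0"
  shows "\<exists>A c d. unitary_fun (Suc (Suc m)) A \<and> c \<noteq> 0 \<and> d \<noteq> 0 \<and>
    (\<forall>k<Suc (Suc m). A k 0 = c * v k) \<and> (\<forall>k<Suc (Suc m). A k 1 = d * w k)"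
proof -
  let ?N = "Suc (Suc m)"
  obtain c where c: "c \<noteq> 0" "nsq ?N (\<lambda>k. c * v k) = 1" "cnj (c * v 0) = c * v 0"
    using normalize_exists[OF v] by blast
  let ?u = "\<lambda>k. c * v k"
  let ?R = "refl_fun ?N (\<lambda>k. ?u k - (if k = 0 then 1 else 0))"
  have R0: "?R k 0 = c * v k" if "k < ?N" for k
    using refl_fun_column[of 0 ?N ?u k] c that by simp
  let ?w' = "\<lambda>k. \<Sum>l<?N. ?R k l * w l"
  \<comment> \<open>Reflections are involutions, so \<open>w\<close> is recovered from its reflected
    copy.\<close>
  have RR: "(\<Sum>l<?N. ?R k l * ?w' l) = w k" if "k < ?N" for k
  proof -
    have "(\<Sum>l<?N. ?R k l * ?w' l) = (\<Sum>l<?N. \<Sum>j<?N. ?R k l * ?R l j * w j)"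
      by (simp only: sum_distrib_left mult.assoc)
    also have "\<dots> = (\<Sum>j<?N. (\<Sum>l<?N. ?R k l * ?R l j) * w j)"
      by (subst sum.swap) (simp only: sum_distrib_right)
    also have "\<dots> = (\<Sum>j<?N. (if k = j then 1 else 0) * w j)"
      using that by (intro sum.cong refl arg_cong2[where f="(*)"] refl_fun_square) auto
    also have "\<dots> = w k" using that by (simp add: if_distrib[where f="\<lambda>y. y * _"] cong: if_cong)
    finally show ?thesis .
  qed
  have w'0: "?w' 0 = 0"
  proof -
    have "?w' 0 = (\<Sum>l<?N. cnj (?R l 0) * w l)" by (simp only: refl_fun_hermitian)
    also have "\<dots> = (\<Sum>l<?N. cnj c * (w l * cnj (v l)))"
      using R0 by (intro sum.cong refl) (simp add: mult_ac)
    also have "\<dots> = cnj c * ip ?N w v" unfolding ip_def by (rule sum_distrib_left[symmetric])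
    finally show ?thesis using orth by simp
  qed
  have "\<exists>k<?N. ?w' k \<noteq> 0"
  proof (rule ccontr)
    assume "\<not> ?thesis"
    then have "w k = 0" if "k < ?N" for k using RR[OF that] by (simp del: sum.lessThan_Suc)
    then show False using w by blast
  qed
  then obtain d where d: "d \<noteq> 0" "nsq ?N (\<lambda>k. d * ?w' k) = 1" "cnj (d * ?w' 1) = d * ?w' 1"
    using normalize_exists[of ?N ?w' 1] by blast
  let ?x = "\<lambda>k. d * ?w' k - (if k = 1 then 1 else 0)"
  let ?R' = "refl_fun ?N ?x"
  have R'1: "?R' k 1 = d * ?w' k" if "k < ?N" for k
    using refl_fun_column[of 1 ?N "\<lambda>k. d * ?w' k" k] d that by (simp del: sum.lessThan_Suc)
  have R'0: "?R' k 0 = (if k = 0 then 1 else 0)" for k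
    by (rule refl_fun_fix) (simp only: w'0, simp)
  let ?A = "\<lambda>i j. \<Sum>l<?N. ?R i l * ?R' l j"
  have "unitary_fun ?N ?A" by (intro unitary_fun_mult unitary_refl_fun)
  moreover have "?A k 0 = c * v k" if "k < ?N" for k
    using R0[OF that] by (simp only: R'0) (simp add: if_distrib[where f="\<lambda>y. _ * y"] del: sum.lessThan_Suc cong: if_cong)
  moreover have "?A k 1 = d * w k" if "k < ?N" for k
  proof -
    have "?A k 1 = (\<Sum>l<?N. d * (?R k l * ?w' l))"
      using R'1 by (intro sum.cong refl) (simp only: lessThan_iff mult.left_commute)
    also have "\<dots> = d * w k" using RR[OF that] by (simp only: sum_distrib_left[symmetric])
    finally show ?thesis .
  qed
  ultimately show ?thesis using c(1) d(1) by blast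
qed

section \<open>Unitary groups, block matrices and cosets\<close>

definition adj :: "nat \<Rightarrow> complex mat \<Rightarrow> complex mat" where
  "adj m A = mat m m (\<lambda>(i, j). cnj (A $$ (j, i)))"

lemma mat_adjoint_eq: "A \<in> carrier_mat m m \<Longrightarrow> mat_adjoint A = adj m A"
  unfolding mat_adjoint_def adj_def by (rule eq_matI) (auto simp: mat_of_rows_def)

lemma unitary_group_iff:
  "A \<in> carrier (unitary_group m) \<longleftrightarrow> A \<in> carrier_mat m m \<and> unitary_fun m (\<lambda>i j. A $$ (i, j))"
proof (cases "A \<in> carrier_mat m m")
  case True
  have "(adj m A * A) $$ (i, j) = (\<Sum>k<m. cnj (A $$ (k, i)) * A $$ (k, j))" if "i < m" "j < m" for i j
    using True that by (simp add: adj_def scalar_prod_def lessThan_atLeast0)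
  moreover have "adj m A * A \<in> carrier_mat m m" using True by (auto simp: adj_def)
  ultimately have "adj m A * A = 1\<^sub>m m \<longleftrightarrow> unitary_fun m (\<lambda>i j. A $$ (i, j))"
    unfolding unitary_fun_def by (auto simp: mat_eq_iff)
  then show ?thesis using True by (simp add: unitary_group_def mat_adjoint_eq)
qed (simp add: unitary_group_def)

lemma unitary_rows:
  assumes "A \<in> carrier (unitary_group m)" "i < m" "j < m"
  shows "(\<Sum>k<m. A $$ (i, k) * cnj (A $$ (j, k))) = (if i = j then 1 else 0)"
proof -
  have A: "A \<in> carrier_mat m m" "adj m A * A = 1\<^sub>m m"
    using assms(1) by (auto simp: unitary_group_def mat_adjoint_eq)
  have "adj m A \<in> carrier_mat m m" by (simp add: adj_def)
  then have "A * adj m A = 1\<^sub>m m" using mat_mult_left_right_inverse A by blast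
  then have "(A * adj m A) $$ (i, j) = (if i = j then 1 else 0)" using assms by simp
  then show ?thesis using A assms by (simp add: adj_def scalar_prod_def lessThan_atLeast0)
qed

lemma diag_block_mat_index:
  assumes "A \<in> carrier_mat 1 1" "B \<in> carrier_mat 1 1" "C \<in> carrier_mat m m" "k < Suc (Suc m)" "l < Suc (Suc m)"
  shows "diag_block_mat [A, B, C] $$ (k, l) =
    (if k = 0 \<and> l = 0 then A $$ (0, 0) else if k = 1 \<and> l = 1 then B $$ (0, 0)
     else if 2 \<le> k \<and> 2 \<le> l then C $$ (k - 2, l - 2) else 0)"
  using assms by (cases k; cases l) (auto simp: Let_def less_Suc_eq_0_disj numeral_2_eq_2)

lemma diag_block_mat_carrier:
  assumes "A \<in> carrier_mat 1 1" "B \<in> carrier_mat 1 1" "C \<in> carrier_mat m m"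
  shows "diag_block_mat [A, B, C] \<in> carrier_mat (Suc (Suc m)) (Suc (Suc m))"
  using assms by (auto simp: Let_def)

text \<open>Once the first two columns have the block shape, their diagonal entries have modulus 1.
  Rows of a unitary matrix have norm 1 as well, so the rest of the first two rows vanishes.\<close>

lemma block_unitary_iff:
  "h \<in> block_unitary 1 1 m \<longleftrightarrow> h \<in> carrier (unitary_group (Suc (Suc m))) \<and>
    (\<forall>k<Suc (Suc m). (k \<noteq> 0 \<longrightarrow> h $$ (k, 0) = 0) \<and> (k \<noteq> 1 \<longrightarrow> h $$ (k, 1) = 0))"
  (is "_ \<longleftrightarrow> ?R")
proof
  let ?N = "Suc (Suc m)"
  assume "h \<in> block_unitary 1 1 m"
  then obtain A B C where h: "h = diag_block_mat [A, B, C]" and ABC: "A \<in> carrier (unitary_group 1)"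
    "B \<in> carrier (unitary_group 1)" "C \<in> carrier (unitary_group m)"
    unfolding block_unitary_def by blast
  have c: "A \<in> carrier_mat 1 1" "B \<in> carrier_mat 1 1" "C \<in> carrier_mat m m" using ABC by (auto simp: unitary_group_iff)
  note i = diag_block_mat_index[OF c, folded h]
  have "unitary_fun ?N (\<lambda>i j. h $$ (i, j))"
    unfolding unitary_fun_def
  proof (intro allI impI)
    fix i j assume ij: "i < ?N" "j < ?N"
    have "(\<Sum>k<?N. cnj (h $$ (k, i)) * h $$ (k, j)) = cnj (h $$ (0, i)) * h $$ (0, j) + (cnj (h $$ (1, i)) * h $$ (1, j)
        + (\<Sum>k<m. cnj (h $$ (Suc (Suc k), i)) * h $$ (Suc (Suc k), j)))"
      by (simp only: sum.lessThan_Suc_shift One_nat_def add.assoc)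
    also have "(\<Sum>k<m. cnj (h $$ (Suc (Suc k), i)) * h $$ (Suc (Suc k), j)) =
        (if 2 \<le> i \<and> 2 \<le> j then (\<Sum>k<m. cnj (C $$ (k, i - 2)) * C $$ (k, j - 2)) else 0)"
      using ij by (auto simp: i)
    also have "\<dots> = (if 2 \<le> i \<and> 2 \<le> j \<and> i = j then 1 else 0)"
      using ABC(3) ij unfolding unitary_group_iff unitary_fun_def by auto
    also have "cnj (h $$ (0, i)) * h $$ (0, j) = (if i = 0 \<and> j = 0 then 1 else 0)"
      using ABC(1) ij unfolding unitary_group_iff unitary_fun_def by (auto simp: i)
    also have "cnj (h $$ (1, i)) * h $$ (1, j) = (if i = 1 \<and> j = 1 then 1 else 0)"
      using ABC(2) ij unfolding unitary_group_iff unitary_fun_def by (auto simp: i)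
    finally show "(\<Sum>k<?N. cnj (h $$ (k, i)) * h $$ (k, j)) = (if i = j then 1 else 0)"
      by auto
  qed
  moreover have "h \<in> carrier_mat ?N ?N" unfolding h by (rule diag_block_mat_carrier[OF c])
  ultimately show ?R by (auto simp: unitary_group_iff i)
next
  let ?N = "Suc (Suc m)"
  assume R: ?R
  then have hc: "h \<in> carrier_mat ?N ?N" and hu: "unitary_fun ?N (\<lambda>i j. h $$ (i, j))" by (auto simp: unitary_group_iff)
  have col: "k < ?N \<Longrightarrow> k \<noteq> 0 \<Longrightarrow> h $$ (k, 0) = 0" "k < ?N \<Longrightarrow> k \<noteq> 1 \<Longrightarrow> h $$ (k, 1) = 0" for k using R by auto
  have diag: "cnj (h $$ (i, i)) * h $$ (i, i) = 1" if "i \<in> {0, 1}" for i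
  proof -
    have "(\<Sum>k<?N. cnj (h $$ (k, i)) * h $$ (k, i)) = (\<Sum>k\<in>{i}. cnj (h $$ (k, i)) * h $$ (k, i))"
    proof (intro sum.mono_neutral_right ballI)
      fix k assume "k \<in> {..<?N} - {i}"
      then have "h $$ (k, i) = 0" using col[of k] that by auto
      then show "cnj (h $$ (k, i)) * h $$ (k, i) = 0" by simp
    qed (use that in auto)
    moreover have "(\<Sum>k<?N. cnj (h $$ (k, i)) * h $$ (k, i)) = 1" using hu that unfolding unitary_fun_def by auto
    ultimately show ?thesis by simp
  qed
  have row: "h $$ (i, l) = 0" if "i \<in> {0, 1}" "l < ?N" "l \<noteq> i" for i l
  proof -
    have i: "i < ?N" using that by auto
    have "(\<Sum>k<?N. h $$ (i, k) * cnj (h $$ (i, k))) = 1" using unitary_rows[of h ?N i i] R i by simp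
    then have "nsq ?N (\<lambda>k. h $$ (i, k)) = 1" by (simp only: nsq_def)
    moreover have "nsq ?N (\<lambda>k. h $$ (i, k)) = of_real (\<Sum>k<?N. (cmod (h $$ (i, k)))\<^sup>2)" by (rule nsq_real)
    ultimately have s: "(\<Sum>k<?N. (cmod (h $$ (i, k)))\<^sup>2) = 1" by (metis of_real_eq_1_iff)
    have d: "(cmod (h $$ (i, i)))\<^sup>2 = 1"
      using diag[OF that(1)] by (metis complex_norm_square mult.commute of_real_eq_1_iff)
    have "(\<Sum>k<?N. (cmod (h $$ (i, k)))\<^sup>2) = (cmod (h $$ (i, i)))\<^sup>2 + (\<Sum>k\<in>{..<?N} - {i}. (cmod (h $$ (i, k)))\<^sup>2)"
      using i by (intro sum.remove) auto
    then have "(\<Sum>k\<in>{..<?N} - {i}. (cmod (h $$ (i, k)))\<^sup>2) = 0" using s d by simp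
    then have "\<forall>k\<in>{..<?N} - {i}. (cmod (h $$ (i, k)))\<^sup>2 = 0" by (subst (asm) sum_nonneg_eq_0_iff) auto
    then show ?thesis using that by auto
  qed
  define A where "A = mat 1 1 (\<lambda>_. h $$ (0, 0))"
  define B where "B = mat 1 1 (\<lambda>_. h $$ (1, 1))"
  define C where "C = mat m m (\<lambda>(k, l). h $$ (k + 2, l + 2))"
  have c: "A \<in> carrier_mat 1 1" "B \<in> carrier_mat 1 1" "C \<in> carrier_mat m m" by (auto simp: A_def B_def C_def)
  have "h = diag_block_mat [A, B, C]"
  proof (rule eq_matI)
    fix k l assume "k < dim_row (diag_block_mat [A, B, C])" "l < dim_col (diag_block_mat [A, B, C])"
    then have kl: "k < ?N" "l < ?N" using diag_block_mat_carrier[OF c] by auto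
    have SS: "Suc (Suc (x - 2)) = x" if "2 \<le> x" for x :: nat using that by simp
    have "k = 0 \<or> k = 1 \<or> 2 \<le> k" "l = 0 \<or> l = 1 \<or> 2 \<le> l" by auto
    then show "h $$ (k, l) = diag_block_mat [A, B, C] $$ (k, l)"
      unfolding diag_block_mat_index[OF c kl] using kl row[of k l] col[of k]
      by (auto simp: A_def B_def C_def SS)
  qed (use hc diag_block_mat_carrier[OF c] in auto)
  moreover have "A \<in> carrier (unitary_group 1)" "B \<in> carrier (unitary_group 1)"
    unfolding unitary_group_iff unitary_fun_def using c diag by (auto simp: A_def B_def)
  moreover have "unitary_fun m (\<lambda>i j. C $$ (i, j))"
    unfolding unitary_fun_def
  proof (intro allI impI)
    fix i j assume ij: "i < m" "j < m"
    have "(\<Sum>k<?N. cnj (h $$ (k, i + 2)) * h $$ (k, j + 2)) = (if i + 2 = j + 2 then 1 else 0)"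
      using hu ij unfolding unitary_fun_def by auto
    moreover have "(\<Sum>k<?N. cnj (h $$ (k, i + 2)) * h $$ (k, j + 2)) = (\<Sum>k<m. cnj (C $$ (k, i)) * C $$ (k, j))"
      using ij row[of 0] row[of 1] by (simp add: sum.lessThan_Suc_shift C_def del: sum.lessThan_Suc)
    ultimately show "(\<Sum>k<m. cnj (C $$ (k, i)) * C $$ (k, j)) = (if i = j then 1 else 0)" by simp
  qed
  moreover have "C \<in> carrier (unitary_group m)"
    using \<open>unitary_fun m (\<lambda>i j. C $$ (i, j))\<close> c(3) unfolding unitary_group_iff by blast
  ultimately show "h \<in> block_unitary 1 1 m"
    unfolding block_unitary_def by blast
qed

abbreviation colv :: "complex mat \<Rightarrow> nat \<Rightarrow> nat \<Rightarrow> complex" where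
  "colv A j \<equiv> \<lambda>k. A $$ (k, j)"

lemma unitary_column_nonzero:
  assumes "A \<in> carrier (unitary_group m)" "j < m"
  shows "\<exists>k<m. colv A j k \<noteq> 0"
proof (rule ccontr)
  assume "\<not> ?thesis"
  then have "(\<Sum>k<m. cnj (A $$ (k, j)) * A $$ (k, j)) = 0" by simp
  then show False using assms unfolding unitary_group_iff unitary_fun_def by auto
qed

lemma unitary_mult: 
  assumes "A \<in> carrier (unitary_group m)" "B \<in> carrier (unitary_group m)"
  shows "A * B \<in> carrier (unitary_group m)"
proof -
  have c: "A \<in> carrier_mat m m" "B \<in> carrier_mat m m" using assms by (auto simp: unitary_group_iff)
  have "unitary_fun m (\<lambda>i j. \<Sum>l<m. A $$ (i, l) * B $$ (l, j))"
    using assms by (intro unitary_fun_mult) (auto simp: unitary_group_iff)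
  then have "unitary_fun m (\<lambda>i j. (A * B) $$ (i, j))"
    by (rule unitary_fun_cong[rotated]) (use c in \<open>simp add: scalar_prod_def lessThan_atLeast0\<close>)
  then show ?thesis using c by (auto simp: unitary_group_iff)
qed

lemma unitary_adj:
  assumes "A \<in> carrier (unitary_group m)"
  shows "adj m A \<in> carrier (unitary_group m)" "A * adj m A = 1\<^sub>m m"
proof -
  have A: "A \<in> carrier_mat m m" using assms by (auto simp: unitary_group_iff)
  have "(\<Sum>k<m. cnj (adj m A $$ (k, i)) * adj m A $$ (k, j)) = (if i = j then 1 else 0)" if "i < m" "j < m" for i j
    using unitary_rows[OF assms that] that by (simp add: adj_def)
  then show "adj m A \<in> carrier (unitary_group m)"
    by (auto simp: unitary_group_iff unitary_fun_def adj_def)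
  show "A * adj m A = 1\<^sub>m m"
    using unitary_rows[OF assms] A by (intro eq_matI) (auto simp: adj_def scalar_prod_def lessThan_atLeast0)
qed

text \<open>\<open>B\<close> lies in the coset of \<open>A\<close> when the adjoint of
  \<open>A\<close> times \<open>B\<close> is a block matrix. Its entries are inner products of
  columns, so this says that the first two columns are proportional in pairs.\<close>

lemma coset_eq:
  assumes A: "A \<in> carrier (unitary_group (Suc (Suc m)))"
  shows "A <#\<^bsub>unitary_group (Suc (Suc m))\<^esub> block_unitary 1 1 m =
    {B \<in> carrier (unitary_group (Suc (Suc m))).
      pr (Suc (Suc m)) (colv B 0) = pr (Suc (Suc m)) (colv A 0) \<and> pr (Suc (Suc m)) (colv B 1) = pr (Suc (Suc m)) (colv A 1)}"
    (is "_ = ?R")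
proof
  let ?N = "Suc (Suc m)"
  have Ac: "A \<in> carrier_mat ?N ?N" using A by (auto simp: unitary_group_iff)
  show "A <#\<^bsub>unitary_group ?N\<^esub> block_unitary 1 1 m \<subseteq> ?R"
  proof
    fix B assume "B \<in> A <#\<^bsub>unitary_group ?N\<^esub> block_unitary 1 1 m"
    then obtain h where h: "h \<in> block_unitary 1 1 m" "B = A * h" by (auto simp: l_coset_def unitary_group_def)
    have hU: "h \<in> carrier (unitary_group ?N)" and h0: "\<And>k. k < ?N \<Longrightarrow> k \<noteq> 0 \<Longrightarrow> h $$ (k, 0) = 0"
      and h1: "\<And>k. k < ?N \<Longrightarrow> k \<noteq> 1 \<Longrightarrow> h $$ (k, 1) = 0" using h(1) unfolding block_unitary_iff by blast+
    have hc: "h \<in> carrier_mat ?N ?N" using hU by (auto simp: unitary_group_iff)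
    have col: "B $$ (k, i) = h $$ (i, i) * A $$ (k, i)" if "k < ?N" "i \<in> {0, 1}" for k i
    proof -
      have "B $$ (k, i) = (\<Sum>l<?N. A $$ (k, l) * h $$ (l, i))"
        using Ac hc that unfolding h(2) by (auto simp: scalar_prod_def lessThan_atLeast0)
      also have "\<dots> = (\<Sum>l\<in>{i}. A $$ (k, l) * h $$ (l, i))"
      proof (intro sum.mono_neutral_right ballI)
        fix l assume "l \<in> {..<?N} - {i}"
        then have "h $$ (l, i) = 0" using h0[of l] h1[of l] that(2) by auto
        then show "A $$ (k, l) * h $$ (l, i) = 0" by simp
      qed (use that in auto)
      finally show ?thesis by simp
    qed
    have nz: "h $$ (i, i) \<noteq> 0" if "i \<in> {0, 1}" for i
      using unitary_column_nonzero[OF hU, of i] that h0 h1 by auto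
    have "pr ?N (colv B i) = pr ?N (colv A i)" if "i \<in> {0, 1}" for i
      by (rule pr_multiple[OF nz[OF that] col[OF _ that]])
    moreover have "B \<in> carrier (unitary_group ?N)" unfolding h(2) by (rule unitary_mult[OF A hU])
    ultimately show "B \<in> ?R" by auto
  qed
  show "?R \<subseteq> A <#\<^bsub>unitary_group ?N\<^esub> block_unitary 1 1 m"
  proof
    fix B assume "B \<in> ?R"
    then have B: "B \<in> carrier (unitary_group ?N)" and eq: "\<And>i. i \<in> {0, 1} \<Longrightarrow> pr ?N (colv B i) = pr ?N (colv A i)" by auto
    have Bc: "B \<in> carrier_mat ?N ?N" using B by (auto simp: unitary_group_iff)
    let ?h = "adj ?N A * B"
    have hU: "?h \<in> carrier (unitary_group ?N)" using A B by (intro unitary_mult unitary_adj)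
    have "A * ?h = (A * adj ?N A) * B"
      using Ac Bc by (intro assoc_mult_mat[symmetric]) (auto simp: adj_def)
    then have Ah: "A * ?h = B" using unitary_adj(2)[OF A] Bc by simp
    have "?h $$ (k, i) = 0" if k: "k < ?N" "k \<noteq> i" and i: "i \<in> {0, 1}" for k i
    proof -
      have "i < ?N" using i by auto
      then obtain c where c: "\<And>l. l < ?N \<Longrightarrow> B $$ (l, i) = c * A $$ (l, i)"
        using pr_eqD[OF eq[OF i] unitary_column_nonzero[OF B] unitary_column_nonzero[OF A]] by blast
      have "?h $$ (k, i) = (\<Sum>l<?N. cnj (A $$ (l, k)) * B $$ (l, i))"
        using k i Bc by (auto simp: adj_def scalar_prod_def lessThan_atLeast0)
      also have "\<dots> = c * (\<Sum>l<?N. cnj (A $$ (l, k)) * A $$ (l, i))"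
        unfolding sum_distrib_left by (intro sum.cong refl) (simp add: c mult_ac)
      also have "\<dots> = 0" using A k \<open>i < ?N\<close> unfolding unitary_group_iff unitary_fun_def by simp
      finally show ?thesis .
    qed
    then have "?h \<in> block_unitary 1 1 m" unfolding block_unitary_iff using hU by auto
    then have "A \<otimes>\<^bsub>unitary_group ?N\<^esub> ?h \<in> A <#\<^bsub>unitary_group ?N\<^esub> block_unitary 1 1 m"
      unfolding l_coset_def by blast
    then show "B \<in> A <#\<^bsub>unitary_group ?N\<^esub> block_unitary 1 1 m"
      using Ah by (simp add: unitary_group_def)
  qed
qed

section \<open>Lines, charts and the transition functions of the tangent bundle\<close>

lemma topspace_cvec_space [simp]: "topspace (cvec_space k) = carrier_vec k"
  by (auto simp: cvec_space_def topspace_pullback_topology)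

lemma topspace_lines_space: "topspace (lines_space k) = complex_line ` (carrier_vec k - {0\<^sub>v k})"
  by (simp add: lines_space_def topspace_quotient_topology Diff_eq)

lemma vec_neq_0_iff: "v \<in> carrier_vec k \<Longrightarrow> v \<noteq> 0\<^sub>v k \<longleftrightarrow> (\<exists>i<k. v $ i \<noteq> 0)"
  by (auto simp: vec_eq_iff)

lemma complex_line_eqI:
  assumes "v \<in> carrier_vec k" "w \<in> carrier_vec k" "c \<noteq> 0" "\<And>i. i < k \<Longrightarrow> v $ i = c * w $ i"
  shows "complex_line v = complex_line w"
proof -
  have v: "v = c \<cdot>\<^sub>v w" and w: "w = inverse c \<cdot>\<^sub>v v" using assms by (auto simp: vec_eq_iff)
  have "\<exists>b. a \<cdot>\<^sub>v v = b \<cdot>\<^sub>v w" for a by (rule exI[of _ "a * c"]) (simp add: v smult_smult_assoc)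
  moreover have "\<exists>b. a \<cdot>\<^sub>v w = b \<cdot>\<^sub>v v" for a by (rule exI[of _ "a * inverse c"]) (subst w, simp add: smult_smult_assoc)
  ultimately show ?thesis unfolding complex_line_def by (simp only: simp_thms set_eq_iff mem_Collect_eq) metis
qed

lemma complex_line_memI: "v \<in> complex_line v"
  unfolding complex_line_def by (rule CollectI, rule exI[of _ 1]) auto

lemma complex_line_eqD:
  assumes "complex_line v = complex_line w" "v \<in> carrier_vec k" "v \<noteq> 0\<^sub>v k" "w \<in> carrier_vec k"
  shows "\<exists>c. c \<noteq> 0 \<and> (\<forall>i<k. v $ i = c * w $ i)"
proof -
  have "v \<in> complex_line w" using complex_line_memI[of v] assms(1) by simp
  then obtain c where c: "v = c \<cdot>\<^sub>v w" by (auto simp: complex_line_def)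
  then have "c \<noteq> 0" using assms(2-4) by (auto simp: vec_eq_iff)
  then show ?thesis using c assms by auto
qed

text \<open>A line is a bare set of vectors, so the dimension of the zero vector is read off from
  the candidate itself.\<close>

definition rep :: "complex Matrix.vec set \<Rightarrow> complex Matrix.vec" where
  "rep L = (SOME v. v \<in> L \<and> v \<noteq> 0\<^sub>v (dim_vec v))"

lemma rep_complex_line:
  assumes "v \<in> carrier_vec k" "v \<noteq> 0\<^sub>v k"
  shows "\<exists>c. c \<noteq> 0 \<and> (\<forall>i<k. rep (complex_line v) $ i = c * v $ i)"
proof -
  have "v \<in> complex_line v \<and> v \<noteq> 0\<^sub>v (dim_vec v)" using complex_line_memI assms by auto
  then have r: "rep (complex_line v) \<in> complex_line v" "rep (complex_line v) \<noteq> 0\<^sub>v (dim_vec (rep (complex_line v)))"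
    using someI[of "\<lambda>u. u \<in> complex_line v \<and> u \<noteq> 0\<^sub>v (dim_vec u)" v] unfolding rep_def by blast+
  from r(1) obtain c where c: "rep (complex_line v) = c \<cdot>\<^sub>v v" by (auto simp: complex_line_def)
  then have "c \<noteq> 0" using r(2) assms by (auto simp: vec_eq_iff)
  then show ?thesis using c assms by auto
qed

lemma mem_CP_domain_iff:
  assumes "i \<le> n"
  shows "L \<in> CP_domain n i \<longleftrightarrow> (\<exists>v\<in>carrier_vec (Suc n). v $ i \<noteq> 0 \<and> L = complex_line v)"
proof
  assume "L \<in> CP_domain n i"
  then obtain v u where v: "v \<in> carrier_vec (Suc n)" "v \<noteq> 0\<^sub>v (Suc n)" "L = complex_line v" "u \<in> L" "u $ i \<noteq> 0"
    unfolding CP_domain_def CP_def topspace_lines_space by auto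
  then have "v $ i \<noteq> 0" using assms by (auto simp: complex_line_def)
  then show "\<exists>v\<in>carrier_vec (Suc n). v $ i \<noteq> 0 \<and> L = complex_line v" using v by auto
next
  assume "\<exists>v\<in>carrier_vec (Suc n). v $ i \<noteq> 0 \<and> L = complex_line v"
  then obtain v where v: "v \<in> carrier_vec (Suc n)" "v $ i \<noteq> 0" "L = complex_line v" by auto
  then have "v \<noteq> 0\<^sub>v (Suc n)" using assms by auto
  then show "L \<in> CP_domain n i"
    unfolding CP_domain_def CP_def topspace_lines_space using v complex_line_memI[of v] by auto
qed

lemma complex_line_mem_CP_domain:
  assumes "i \<le> n" "v \<in> carrier_vec (Suc n)"
  shows "complex_line v \<in> CP_domain n i \<longleftrightarrow> v $ i \<noteq> 0"
proof
  assume "complex_line v \<in> CP_domain n i"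
  then obtain u where u: "u \<in> carrier_vec (Suc n)" "u $ i \<noteq> 0" "complex_line v = complex_line u"
    unfolding mem_CP_domain_iff[OF assms(1)] by auto
  have "u \<noteq> 0\<^sub>v (Suc n)" using u assms by auto
  then show "v $ i \<noteq> 0" using complex_line_eqD[OF u(3)[symmetric] u(1) _ assms(2)] u(2) assms(1)
    by (metis le_imp_less_Suc mult_zero_right)
qed (use assms mem_CP_domain_iff in blast)

lemma CP_chart_complex_line:
  assumes "i \<le> n" "v \<in> carrier_vec (Suc n)" "v $ i \<noteq> 0"
  shows "CP_chart n i (complex_line v) = Matrix.vec n (\<lambda>k. v $ skip i k / v $ i)"
proof -
  have "(THE u. u \<in> complex_line v \<and> u $ i = 1) = inverse (v $ i) \<cdot>\<^sub>v v"
  proof (rule the_equality)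
    fix u assume "u \<in> complex_line v \<and> u $ i = 1"
    then obtain c where c: "u = c \<cdot>\<^sub>v v" "u $ i = 1" by (auto simp: complex_line_def)
    then have "c = inverse (v $ i)" using assms by (simp add: field_simps)
    then show "u = inverse (v $ i) \<cdot>\<^sub>v v" using c by simp
  qed (use assms in \<open>auto simp: complex_line_def\<close>)
  then show ?thesis
    unfolding CP_chart_def Let_def using assms skip_less[of _ n i]
    by (auto simp: vec_eq_iff skip_def[symmetric] field_simps)
qed

text \<open>A spanning vector of the line with given chart coordinates: the omitted coordinate
  \<open>j\<close> is restored as 1.\<close>

definition affine_point :: "nat \<Rightarrow> nat \<Rightarrow> complex Matrix.vec \<Rightarrow> complex Matrix.vec" where
  "affine_point n j z = Matrix.vec (Suc n) (ins j 1 (($) z))"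

lemma affine_point_carrier [simp]: "affine_point n j z \<in> carrier_vec (Suc n)"
  by (simp add: affine_point_def)

lemma affine_point_index: "k < Suc n \<Longrightarrow> affine_point n j z $ k = ins j 1 (($) z) k"
  by (simp add: affine_point_def)

lemma CP_chart_affine_point:
  assumes "j \<le> n" "z \<in> carrier_vec n"
  shows "CP_chart n j (complex_line (affine_point n j z)) = z"
proof -
  have "affine_point n j z $ j = 1" using assms by (simp add: affine_point_index)
  then show ?thesis
    using CP_chart_complex_line[OF assms(1), of "affine_point n j z"] assms skip_less[of _ n j]
    by (auto simp: vec_eq_iff affine_point_index)
qed

lemma affine_point_CP_chart:
  assumes "j \<le> n" "L \<in> CP_domain n j"
  shows "complex_line (affine_point n j (CP_chart n j L)) = L"
proof -
  obtain v where v: "v \<in> carrier_vec (Suc n)" "v $ j \<noteq> 0" "L = complex_line v"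
    using assms unfolding mem_CP_domain_iff[OF assms(1)] by auto
  have "affine_point n j (CP_chart n j L) $ k = inverse (v $ j) * v $ k" if "k < Suc n" for k
    using that assms(1)
  proof (rule skip_cases)
    fix a assume a: "a < n" "k = skip j a"
    then show ?thesis
      using v that by (simp add: affine_point_index CP_chart_complex_line[OF assms(1) v(1,2)] field_simps)
  qed (use v that in \<open>simp add: affine_point_index\<close>)
  then show ?thesis unfolding v(3)
    by (intro complex_line_eqI[of _ "Suc n" _ "inverse (v $ j)"]) (use v in auto)
qed

lemma inv_CP_chart:
  assumes "j \<le> n" "z \<in> carrier_vec n"
  shows "the_inv_into (CP_domain n j) (CP_chart n j) z = complex_line (affine_point n j z)"
proof (rule the_inv_into_f_eq)
  show "inj_on (CP_chart n j) (CP_domain n j)"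
    by (rule inj_on_inverseI[where g = "\<lambda>z. complex_line (affine_point n j z)"]) (rule affine_point_CP_chart[OF assms(1)])
  show "complex_line (affine_point n j z) \<in> CP_domain n j"
    using assms by (subst complex_line_mem_CP_domain) (auto simp: affine_point_index)
qed (rule CP_chart_affine_point[OF assms])

section \<open>Jacobian matrices of the changes of charts\<close>

lemma sum_skip_delta:
  assumes "k < Suc n" "j \<le> n"
  shows "(\<Sum>b<n. (if k = skip j b then 1 else 0) * w b) = ins j 0 w k"
  using assms
proof (rule skip_cases)
  fix a assume a: "a < n" "k = skip j a"
  have "(\<Sum>b<n. (if k = skip j b then 1 else 0) * w b) = (\<Sum>b<n. if b = a then w b else 0)"
    by (intro sum.cong) (auto simp: a skip_inj)
  then show ?thesis using a by simp
next
  assume "k = j"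
  then have "k \<noteq> skip j b" for b by (metis skip_neq)
  then show ?thesis using \<open>k = j\<close> by simp
qed

lemma deriv_quotient_affine:
  fixes q :: complex
  assumes "q \<noteq> 0"
  shows "deriv (\<lambda>t. (p + \<alpha> * (t - s)) / (q + \<beta> * (t - s))) s = (\<alpha> * q - p * \<beta>) / q\<^sup>2"
  by (rule DERIV_imp_deriv) (use assms in \<open>auto intro!: derivative_eq_intros simp: power2_eq_square\<close>)

text \<open>Along a coordinate line the change of charts is a quotient of two affine functions of
  the parameter, so the entry is an instance of the quotient rule.\<close>

lemma jacobian_entry:
  assumes ij: "i \<le> n" "j \<le> n" and z: "z \<in> carrier_vec n" and a: "a < n" and b: "b < n"
    and nz: "ins j 1 (($) z) i \<noteq> 0"
  defines "u \<equiv> ins j 1 (($) z)"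
  shows "complex_jacobian n (CP_chart n i \<circ> the_inv_into (CP_domain n j) (CP_chart n j)) z $$ (a, b) =
    ((if skip i a = skip j b then 1 else 0) * u i - u (skip i a) * (if i = skip j b then 1 else 0)) / (u i)\<^sup>2"
proof -
  let ?Z = "\<lambda>t. Matrix.vec n (\<lambda>c. if c = b then t else z $ c)"
  let ?l = "\<lambda>k t. u k + (if k = skip j b then 1 else 0) * (t - z $ b)"
  have Zk: "affine_point n j (?Z t) $ k = ?l k t" if "k < Suc n" for t k
    using that ij(2)
  proof (rule skip_cases)
    fix c assume c: "c < n" "k = skip j c"
    then show ?thesis using that b by (simp add: affine_point_index u_def skip_inj)
  next
    assume "k = j"
    moreover then have "k \<noteq> skip j b" by (metis skip_neq)
    ultimately show ?thesis using that by (simp add: affine_point_index u_def)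
  qed
  have u: "u i \<noteq> 0" using nz by (simp add: u_def)
  \<comment> \<open>The formula for the change of charts holds where the denominator is nonzero; a
    neighbourhood is enough for the derivative.\<close>
  have "open {t. ?l i t \<noteq> 0}" by (intro open_Collect_neq continuous_intros)
  moreover have "z $ b \<in> {t. ?l i t \<noteq> 0}" using u by (simp only: mem_Collect_eq diff_self mult_zero_right add_0_right simp_thms not_False_eq_True)
  ultimately have "eventually (\<lambda>t. t \<in> {t. ?l i t \<noteq> 0}) (nhds (z $ b))" by (rule eventually_nhds_in_open)
  then have "eventually (\<lambda>t. (CP_chart n i \<circ> the_inv_into (CP_domain n j) (CP_chart n j)) (?Z t) $ a =
      ?l (skip i a) t / ?l i t) (nhds (z $ b))"
  proof (eventually_elim)
    case (elim t)
    have "affine_point n j (?Z t) $ i \<noteq> 0" using elim ij Zk[of i t] by simp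
    then show ?case
      using a ij skip_less[OF a, of i] by (simp add: inv_CP_chart CP_chart_complex_line Zk)
  qed
  then have "deriv (\<lambda>t. (CP_chart n i \<circ> the_inv_into (CP_domain n j) (CP_chart n j)) (?Z t) $ a) (z $ b) =
      deriv (\<lambda>t. ?l (skip i a) t / ?l i t) (z $ b)"
    by (rule deriv_cong_ev) simp
  also have "\<dots> = ((if skip i a = skip j b then 1 else 0) * u i - u (skip i a) * (if i = skip j b then 1 else 0)) / (u i)\<^sup>2"
    by (rule deriv_quotient_affine[OF u])
  finally show ?thesis using a b by (simp add: complex_jacobian_def)
qed

definition glue :: "nat \<Rightarrow> nat \<Rightarrow> nat \<Rightarrow> complex Matrix.vec set \<Rightarrow> complex mat" where
  "glue n i j x = trans (tangent_bundle_CP n) i j x"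

text \<open>The quotient rule for the affine coordinates relative to \<open>i\<close>, in the
  direction of the padded \<open>w\<close>. The base point is rescaled to have entry 1 in position
  \<open>j\<close>, which accounts for the factor \<open>v $ j / (v $ i)\<^sup>2\<close>.\<close>

lemma glue_mult_vec:
  assumes ij: "i \<le> n" "j \<le> n" and v: "v \<in> carrier_vec (Suc n)" "v $ i \<noteq> 0" "v $ j \<noteq> 0"
    and w: "w \<in> carrier_vec n" and a: "a < n"
  shows "(glue n i j (complex_line v) *\<^sub>v w) $ a =
    v $ j / (v $ i)\<^sup>2 * (ins j 0 (($) w) (skip i a) * v $ i - v $ skip i a * ins j 0 (($) w) i)"
proof -
  let ?z = "CP_chart n j (complex_line v)"
  let ?W = "ins j 0 (($) w)"
  have z: "?z \<in> carrier_vec n" unfolding CP_chart_complex_line[OF ij(2) v(1,3)] by simp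
  define u where "u = ins j 1 (($) ?z)"
  have uk: "u k = v $ k / v $ j" if "k < Suc n" for k
    using that ij(2)
    by (rule skip_cases) (use v in \<open>auto simp: u_def CP_chart_complex_line[OF ij(2) v(1,3)]\<close>)
  have "u i \<noteq> 0" using uk[of i] ij v by simp
  note J = jacobian_entry[OF ij z a _ this[unfolded u_def], folded u_def]
  have jac: "glue n i j (complex_line v) = complex_jacobian n (CP_chart n i \<circ> the_inv_into (CP_domain n j) (CP_chart n j)) ?z"
    by (simp add: glue_def tangent_bundle_CP_def complex_tangent_bundle_def)
  have "(glue n i j (complex_line v) *\<^sub>v w) $ a = (\<Sum>b<n. glue n i j (complex_line v) $$ (a, b) * w $ b)"
    using a w by (simp add: jac complex_jacobian_def scalar_prod_def lessThan_atLeast0)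
  also have "\<dots> = (\<Sum>b<n. u i / (u i)\<^sup>2 * ((if skip i a = skip j b then 1 else 0) * w $ b) - u (skip i a) / (u i)\<^sup>2 * ((if i = skip j b then 1 else 0) * w $ b))"
    by (intro sum.cong refl) (simp add: jac J diff_divide_distrib algebra_simps)
  also have "\<dots> = u i / (u i)\<^sup>2 * ?W (skip i a) - u (skip i a) / (u i)\<^sup>2 * ?W i"
    unfolding sum_subtractf sum_distrib_left[symmetric]
    using ij skip_less[OF a] by (simp add: sum_skip_delta)
  also have "\<dots> = v $ j / (v $ i)\<^sup>2 * (?W (skip i a) * v $ i - v $ skip i a * ?W i)"
    using v skip_less[OF a] ij by (simp add: uk field_simps power2_eq_square)
  finally show ?thesis .
qed

lemma glue_carrier: "glue n i j x \<in> carrier_mat n n"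
  by (simp add: glue_def tangent_bundle_CP_def complex_tangent_bundle_def complex_jacobian_def)

text \<open>A vanishing image makes the padded \<open>w\<close> a multiple of \<open>v\<close>, and
  position \<open>j\<close> forces this multiple to be 0.\<close>

lemma glue_nonzero:
  assumes ij: "i \<le> n" "j \<le> n" and v: "v \<in> carrier_vec (Suc n)" "v $ i \<noteq> 0" "v $ j \<noteq> 0"
    and w: "w \<in> carrier_vec n" "w \<noteq> 0\<^sub>v n"
  shows "glue n i j (complex_line v) *\<^sub>v w \<noteq> 0\<^sub>v n"
proof
  assume "glue n i j (complex_line v) *\<^sub>v w = 0\<^sub>v n"
  then have 0: "ins j 0 (($) w) (skip i a) * v $ i - v $ skip i a * ins j 0 (($) w) i = 0" if "a < n" for a
    using glue_mult_vec[OF ij v w(1) that] that v by simp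
  let ?c = "ins j 0 (($) w) i / v $ i"
  have eq: "ins j 0 (($) w) k = ?c * v $ k" if "k < Suc n" for k
    using that ij(1)
    by (rule skip_cases) (use 0 v in \<open>auto simp: field_simps\<close>)
  have "?c = 0" using eq[of j] ij v by simp
  then have "w $ b = 0" if "b < n" for b
    using eq[OF skip_less[OF that, of j]] unfolding \<open>?c = 0\<close> by simp
  then show False using w by (auto simp: vec_eq_iff)
qed

lemma projective_map_complex_line:
  assumes "A \<in> carrier_mat n n" "w \<in> carrier_vec n"
  shows "projective_map A (complex_line w) = complex_line (A *\<^sub>v w)"
proof -
  have "A *\<^sub>v (c \<cdot>\<^sub>v w) = c \<cdot>\<^sub>v (A *\<^sub>v w)" for c by (rule mult_mat_vec[OF assms])
  then show ?thesis unfolding projective_map_def complex_line_def by (auto simp: image_iff) metis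
qed

section \<open>Flags of glued tangent lines\<close>

definition line_flag where
  "line_flag n = (\<lambda>(i, x, l). flag n i (($) (rep x)) (($) (rep l)))"

lemma line_flag_complex_line:
  assumes "i \<le> n" "v \<in> carrier_vec (Suc n)" "v $ i \<noteq> 0" "w \<in> carrier_vec n" "w \<noteq> 0\<^sub>v n"
  shows "line_flag n (i, complex_line v, complex_line w) = flag n i (($) v) (($) w)"
proof -
  have "v \<noteq> 0\<^sub>v (Suc n)" using assms by auto
  then obtain c d where "c \<noteq> 0" "d \<noteq> 0" "\<And>k. k < Suc n \<Longrightarrow> rep (complex_line v) $ k = c * v $ k"
    "\<And>k. k < n \<Longrightarrow> rep (complex_line w) $ k = d * w $ k"
    using rep_complex_line[OF assms(2)] rep_complex_line[OF assms(4,5)] by auto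
  then show ?thesis unfolding line_flag_def prod.case
    by (intro flag_multiple[of c d]) (use assms in auto)
qed

definition charted_lines :: "nat \<Rightarrow> (nat \<times> complex Matrix.vec set \<times> complex Matrix.vec set) set" where
  "charted_lines n = (SIGMA i:{..n}. CP_domain n i \<times> topspace (lines_space n))"

lemma charted_linesE:
  assumes "e \<in> charted_lines n"
  obtains i v w where "i \<le> n" "v \<in> carrier_vec (Suc n)" "v $ i \<noteq> 0" "w \<in> carrier_vec n" "w \<noteq> 0\<^sub>v n"
    "e = (i, complex_line v, complex_line w)"
proof -
  obtain i x l where e: "e = (i, x, l)" "i \<le> n" "x \<in> CP_domain n i" "l \<in> topspace (lines_space n)"
    using assms unfolding charted_lines_def by auto
  then show thesis using that unfolding mem_CP_domain_iff[OF e(2)] topspace_lines_space by blast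
qed

lemma charted_linesI:
  assumes "i \<le> n" "v \<in> carrier_vec (Suc n)" "v $ i \<noteq> 0" "w \<in> carrier_vec n" "w \<noteq> 0\<^sub>v n"
  shows "(i, complex_line v, complex_line w) \<in> charted_lines n"
  unfolding charted_lines_def topspace_lines_space using assms
  by (auto simp: complex_line_mem_CP_domain)

text \<open>The quotient map of the gluing: the class of a point is the set of its coordinate
  triples, one for each chart around the base point.\<close>

definition tangent_line where
  "tangent_line n e =
    glue_rel {..n} (CP_domain n) (lines_space n) (\<lambda>i j x. projective_map (trans (tangent_bundle_CP n) i j x)) `` {e}"

lemma tangent_line_complex_line:
  assumes "j \<le> n" "v \<in> carrier_vec (Suc n)" "v $ j \<noteq> 0" "w \<in> carrier_vec n" "w \<noteq> 0\<^sub>v n"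
  shows "tangent_line n (j, complex_line v, complex_line w) =
    {(i, complex_line v, complex_line (glue n i j (complex_line v) *\<^sub>v w)) | i. i \<le> n \<and> v $ i \<noteq> 0}"
proof -
  have "complex_line w \<in> topspace (lines_space n)" using assms by (auto simp: topspace_lines_space)
  then show ?thesis
    unfolding tangent_line_def glue_rel_def glue_def[symmetric]
    using assms by (auto simp: projective_map_complex_line[OF glue_carrier] complex_line_mem_CP_domain)
qed

lemma line_flag_glue:
  assumes ij: "i \<le> n" "j \<le> n" and v: "v \<in> carrier_vec (Suc n)" "v $ i \<noteq> 0" "v $ j \<noteq> 0"
    and w: "w \<in> carrier_vec n" "w \<noteq> 0\<^sub>v n"
  shows "line_flag n (i, complex_line v, complex_line (glue n i j (complex_line v) *\<^sub>v w)) =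
    line_flag n (j, complex_line v, complex_line w)"
proof -
  let ?w = "glue n i j (complex_line v) *\<^sub>v w"
  have w': "?w \<in> carrier_vec n" using mult_mat_vec_carrier[OF glue_carrier w(1)] .
  have "v $ j / (v $ i)\<^sup>2 \<noteq> 0" using v by simp
  then have "flag n i (($) v) (($) ?w) = flag n j (($) v) (($) w)"
    by (rule flag_glue[where v = "($) v", OF _ ij v(2)]) (rule glue_mult_vec[OF ij v w(1)])
  then show ?thesis
    by (simp add: line_flag_complex_line[OF ij(1) v(1,2) w' glue_nonzero[OF ij v w]]
        line_flag_complex_line[OF ij(2) v(1,3) w])
qed

text \<open>All members of a class have the same flag. Conversely, equal flags have the same base
  line, and in every chart around it \<open>flag_inj\<close> determines the tangent line, so the two
  classes list the same coordinates.\<close>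

lemma tangent_line_eq_iff:
  assumes "e \<in> charted_lines n" "e' \<in> charted_lines n"
  shows "tangent_line n e = tangent_line n e' \<longleftrightarrow> line_flag n e = line_flag n e'"
proof -
  obtain j v w where e: "j \<le> n" "v \<in> carrier_vec (Suc n)" "v $ j \<noteq> 0" "w \<in> carrier_vec n" "w \<noteq> 0\<^sub>v n"
    "e = (j, complex_line v, complex_line w)" by (rule charted_linesE[OF assms(1)])
  obtain j' v' w' where e': "j' \<le> n" "v' \<in> carrier_vec (Suc n)" "v' $ j' \<noteq> 0" "w' \<in> carrier_vec n" "w' \<noteq> 0\<^sub>v n"
    "e' = (j', complex_line v', complex_line w')" by (rule charted_linesE[OF assms(2)])
  note K = tangent_line_complex_line[OF e(1-5), folded e(6)]
  note K' = tangent_line_complex_line[OF e'(1-5), folded e'(6)]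
  have F: "line_flag n d = line_flag n e" if "d \<in> tangent_line n e" for d
  proof -
    have "\<exists>i. d = (i, complex_line v, complex_line (glue n i j (complex_line v) *\<^sub>v w)) \<and> i \<le> n \<and> v $ i \<noteq> 0"
      using that unfolding K by (rule CollectD)
    then obtain i where i: "i \<le> n" "v $ i \<noteq> 0" "d = (i, complex_line v, complex_line (glue n i j (complex_line v) *\<^sub>v w))"
      by blast
    show ?thesis unfolding i(3) e(6) by (rule line_flag_glue[OF i(1) e(1,2) i(2) e(3-5)])
  qed
  have F': "line_flag n d = line_flag n e'" if "d \<in> tangent_line n e'" for d
  proof -
    have "\<exists>i. d = (i, complex_line v', complex_line (glue n i j' (complex_line v') *\<^sub>v w')) \<and> i \<le> n \<and> v' $ i \<noteq> 0"
      using that unfolding K' by (rule CollectD)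
    then obtain i where i: "i \<le> n" "v' $ i \<noteq> 0" "d = (i, complex_line v', complex_line (glue n i j' (complex_line v') *\<^sub>v w'))"
      by blast
    show ?thesis unfolding i(3) e'(6) by (rule line_flag_glue[OF i(1) e'(1,2) i(2) e'(3-5)])
  qed
  show ?thesis
  proof
    have "tangent_line n e \<noteq> {}" unfolding K using e by auto
    moreover assume "tangent_line n e = tangent_line n e'"
    ultimately show "line_flag n e = line_flag n e'" using F F' by (metis ex_in_conv)
  next
    assume eq: "line_flag n e = line_flag n e'"
    have "pr (Suc n) (($) v) = pr (Suc n) (($) v')"
      using eq line_flag_complex_line[OF e(1-5)] line_flag_complex_line[OF e'(1-5)] unfolding e(6) e'(6)
      by (simp add: flag_def)
    then obtain c where c: "c \<noteq> 0" "\<And>k. k < Suc n \<Longrightarrow> v $ k = c * v' $ k"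
      using pr_eqD[of "Suc n" "($) v" "($) v'"] e e' by (metis le_imp_less_Suc)
    have line: "complex_line v' = complex_line v" by (rule complex_line_eqI[OF e(2) e'(2) c, symmetric])
    have "complex_line (glue n i j (complex_line v) *\<^sub>v w) = complex_line (glue n i j' (complex_line v) *\<^sub>v w')"
      if i: "i \<le> n" "v $ i \<noteq> 0" for i
    proof -
      have i': "v' $ i \<noteq> 0" using c(2)[of i] i by auto
      have vj': "v $ j' \<noteq> 0" using c(1) c(2)[of j'] e' by auto
      note f = line_flag_glue[OF i(1) e(1,2) i(2) e(3,4,5)] line_flag_glue[OF i(1) e'(1) e(2) i(2) vj' e'(4,5)]
      note nz = glue_nonzero[OF i(1) e(1,2) i(2) e(3,4,5)] glue_nonzero[OF i(1) e'(1) e(2) i(2) vj' e'(4,5)]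
      have cv: "glue n i j (complex_line v) *\<^sub>v w \<in> carrier_vec n" "glue n i j' (complex_line v) *\<^sub>v w' \<in> carrier_vec n"
        using e(4) e'(4) mult_mat_vec_carrier[OF glue_carrier] by blast+
      have "flag n i (($) v) (($) (glue n i j (complex_line v) *\<^sub>v w)) = flag n i (($) v) (($) (glue n i j' (complex_line v) *\<^sub>v w'))"
        using f eq unfolding line_flag_complex_line[OF i(1) e(2) i(2) cv(1) nz(1)]
          line_flag_complex_line[OF i(1) e(2) i(2) cv(2) nz(2)] e(6) e'(6) line by simp
      from flag_inj[OF this i(1,2,2)] obtain d where "d \<noteq> 0"
        "\<forall>k<n. (glue n i j (complex_line v) *\<^sub>v w) $ k = d * (glue n i j' (complex_line v) *\<^sub>v w') $ k"
        using nz unfolding vec_neq_0_iff[OF cv(1)] vec_neq_0_iff[OF cv(2)] by auto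
      then show ?thesis by (intro complex_line_eqI[OF cv]) auto
    qed
    moreover have "v $ i \<noteq> 0 \<longleftrightarrow> v' $ i \<noteq> 0" if "i \<le> n" for i using c(1) c(2)[of i] that by auto
    ultimately show "tangent_line n e = tangent_line n e'"
      unfolding K K' line by (auto intro!: exI)
  qed
qed

section \<open>The flag homeomorphism\<close>

lemma continuous_map_euclidean_mult:
  fixes f g :: "'a \<Rightarrow> complex"
  assumes "continuous_map X euclidean f" "continuous_map X euclidean g"
  shows "continuous_map X euclidean (\<lambda>x. f x * g x)"
proof -
  have "continuous_map (prod_topology euclidean euclidean) euclidean (\<lambda>p. fst p * snd p :: complex)"
    by (simp add: euclidean_product_topology flip: prod_topology_subtopology_eu)
       (auto simp: continuous_map_iff_continuous2 intro!: continuous_intros)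
  from continuous_map_compose[OF continuous_map_pairedI[OF assms] this] show ?thesis by (simp add: o_def)
qed

lemma continuous_map_euclidean_compose:
  assumes "continuous_map X euclidean f" "continuous_on S h" "f ` topspace X \<subseteq> S"
  shows "continuous_map X euclidean (\<lambda>x. h (f x))"
proof -
  have f: "continuous_map X (top_of_set S) f" using assms by (intro continuous_map_into_subtopology) auto
  have h: "continuous_map (top_of_set S) euclidean h" using assms(2) by simp
  show ?thesis using continuous_map_compose[OF f h] by (simp add: o_def)
qed

lemma continuous_map_euclidean_divide:
  fixes f g :: "'a \<Rightarrow> complex"
  assumes "continuous_map X euclidean f" "continuous_map X euclidean g" "\<And>x. x \<in> topspace X \<Longrightarrow> g x \<noteq> 0"
  shows "continuous_map X euclidean (\<lambda>x. f x / g x)"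
proof -
  have "continuous_map X euclidean (\<lambda>x. inverse (g x))"
    by (rule continuous_map_euclidean_compose[OF assms(2), of "- {0}"]) (use assms(3) in \<open>auto intro!: continuous_intros\<close>)
  from continuous_map_euclidean_mult[OF assms(1) this] show ?thesis by (simp add: divide_inverse)
qed

lemma continuous_map_euclidean_cnj:
  "continuous_map X euclidean f \<Longrightarrow> continuous_map X euclidean (\<lambda>x. cnj (f x))"
  by (rule continuous_map_euclidean_compose[of _ _ UNIV]) (auto intro!: continuous_intros)

lemmas continuous_map_complex_intros =
  continuous_map_euclidean_mult continuous_map_euclidean_divide continuous_map_euclidean_cnj
  continuous_map_sum continuous_map_diff continuous_map_add

lemma continuous_map_cvec_index:
  assumes "i < k"
  shows "continuous_map (cvec_space k) euclidean (\<lambda>v. v $ i)"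
proof -
  have "continuous_map (product_topology (\<lambda>_. euclidean) {..<k}) euclidean (\<lambda>f. f i)"
    by (rule continuous_map_product_projection) (use assms in auto)
  then show ?thesis unfolding cvec_space_def
    by (rule continuous_map_eq[OF continuous_map_pullback]) (use assms in \<open>auto simp: topspace_pullback_topology\<close>)
qed

lemma continuous_map_into_cvec:
  assumes "\<And>x. x \<in> topspace X \<Longrightarrow> f x \<in> carrier_vec k" "\<And>i. i < k \<Longrightarrow> continuous_map X euclidean (\<lambda>x. f x $ i)"
  shows "continuous_map X (cvec_space k) f"
  unfolding cvec_space_def
  by (rule continuous_map_pullback') (use assms in \<open>auto simp: continuous_map_componentwise\<close>)

lemma quotient_map_complex_line:
  "quotient_map (subtopology (cvec_space k) (- {0\<^sub>v k})) (lines_space k) complex_line"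
  unfolding lines_space_def by (rule quotient_map_quotient_topology)

lemma continuous_map_into_lines:
  assumes "\<And>x. x \<in> topspace X \<Longrightarrow> f x \<in> carrier_vec k \<and> f x \<noteq> 0\<^sub>v k" "\<And>i. i < k \<Longrightarrow> continuous_map X euclidean (\<lambda>x. f x $ i)"
  shows "continuous_map X (lines_space k) (\<lambda>x. complex_line (f x))"
proof -
  have "continuous_map X (subtopology (cvec_space k) (- {0\<^sub>v k})) f"
    by (intro continuous_map_into_subtopology continuous_map_into_cvec) (use assms in auto)
  from continuous_map_compose[OF this quotient_imp_continuous_map[OF quotient_map_complex_line]] show ?thesis
    by (simp add: o_def)
qed

lemma nsq_vec_nonzero: "v \<in> carrier_vec k \<Longrightarrow> v \<noteq> 0\<^sub>v k \<Longrightarrow> nsq k (($) v) \<noteq> 0"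
  by (simp add: nsq_eq_0_iff vec_neq_0_iff)

lemma pr_rep_complex_line:
  assumes "v \<in> carrier_vec k" "v \<noteq> 0\<^sub>v k"
  shows "pr k (($) (rep (complex_line v))) = pr k (($) v)"
proof -
  obtain c where "c \<noteq> 0" "\<And>i. i < k \<Longrightarrow> rep (complex_line v) $ i = c * v $ i" using rep_complex_line[OF assms] by blast
  then show ?thesis by (rule pr_multiple)
qed

lemma continuous_map_pr:
  assumes "\<And>i. i < k \<Longrightarrow> continuous_map X euclidean (\<lambda>x. f x i)" "\<And>x. x \<in> topspace X \<Longrightarrow> nsq k (f x) \<noteq> 0"
  shows "continuous_map X euclidean (\<lambda>x. pr k (f x) p)"
proof (cases p)
  case (Pair a b)
  show ?thesis
  proof (cases "a < k \<and> b < k")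
    case True
    have "continuous_map X euclidean (\<lambda>x. f x a * cnj (f x b) / (\<Sum>i<k. f x i * cnj (f x i)))"
      using assms True by (intro continuous_map_complex_intros) (auto simp: nsq_def)
    then show ?thesis using True Pair by (simp add: pr_def nsq_def)
  qed (auto simp: Pair pr_def)
qed

text \<open>The choice made by \<open>rep\<close> need not be continuous, but the projection does
  not see it: composed with the quotient map it is the projection onto the vector itself.\<close>

lemma continuous_map_pr_rep: "continuous_map (lines_space k) euclidean (\<lambda>L. pr k (($) (rep L)) p)"
proof -
  let ?Z = "subtopology (cvec_space k) (- {0\<^sub>v k})"
  have "continuous_map ?Z euclidean (\<lambda>v. pr k (($) v) p)"
    by (rule continuous_map_pr) (auto simp: nsq_vec_nonzero intro: continuous_map_from_subtopology continuous_map_cvec_index)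
  then have "continuous_map ?Z euclidean (\<lambda>v. pr k (($) (rep (complex_line v))) p)"
    by (rule continuous_map_eq) (auto simp: pr_rep_complex_line)
  then show ?thesis
    unfolding continuous_compose_quotient_map_eq[OF quotient_map_complex_line, symmetric] o_def .
qed

text \<open>
  The projection onto the second line of the flag, up to a scalar factor, in terms of the
  projections \<open>P\<close> and \<open>Q\<close> onto the base line and the line in chart coordinates.
\<close>

definition flag_form where
  "flag_form n i P Q a b =
    (\<Sum>k<Suc n. \<Sum>l<Suc n. ((if a = k then 1 else 0) - P (a, k)) *
       (if k = i \<or> l = i then 0 else Q (if k < i then k else k - 1, if l < i then l else l - 1)) *
       cnj ((if b = l then 1 else 0) - P (b, l) :: complex))"

text \<open>In matrix terms u = (1 - P) W, and W times its adjoint is the padded Q up to the factor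
  \<open>nsq n w\<close>; the form is (1 - P) times the padded Q times the adjoint of (1 -
  P).\<close>

lemma flag_form_eq:
  assumes i: "i \<le> n" and v: "v i \<noteq> 0" and w: "nsq n w \<noteq> 0" and ab: "a < Suc n" "b < Suc n"
  defines "u \<equiv> perp (Suc n) v (ins i 0 w)"
  shows "u a * cnj (u b) = nsq n w * flag_form n i (pr (Suc n) v) (pr n w) a b"
proof -
  let ?E = "\<lambda>a k. (if a = k then 1 else 0) - pr (Suc n) v (a, k)"
  let ?W = "ins i 0 w"
  have u: "u a = (\<Sum>k<Suc n. ?E a k * ?W k)" if "a < Suc n" for a
  proof -
    have "(\<Sum>k<Suc n. ?E a k * ?W k) = (\<Sum>k<Suc n. (if k = a then ?W k else 0)) - (\<Sum>k<Suc n. pr (Suc n) v (a, k) * ?W k)"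
      unfolding sum_subtractf[symmetric] by (intro sum.cong) (auto simp: algebra_simps)
    also have "\<dots> = ?W a - (\<Sum>k<Suc n. ?W k * cnj (v k) / nsq (Suc n) v * v a)"
      using that by (auto simp: pr_def mult_ac simp del: sum.lessThan_Suc intro!: sum.cong)
    also have "\<dots> = u a" by (simp only: u_def perp_def ip_def sum_divide_distrib sum_distrib_right)
    finally show ?thesis by simp
  qed
  have W: "?W k * cnj (?W l) = nsq n w * (if k = i \<or> l = i then 0 else pr n w (if k < i then k else k - 1, if l < i then l else l - 1))"
    if "k < Suc n" "l < Suc n" for k l
    using that w i by (auto simp: ins_def pr_def)
  have "u a * cnj (u b) = (\<Sum>k<Suc n. \<Sum>l<Suc n. ?E a k * ?W k * cnj (?E b l * ?W l))"
    by (simp only: u[OF ab(1)] u[OF ab(2)] cnj_sum sum_product)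
  also have "\<dots> = (\<Sum>k<Suc n. \<Sum>l<Suc n. nsq n w * (?E a k * (if k = i \<or> l = i then 0 else pr n w (if k < i then k else k - 1, if l < i then l else l - 1)) * cnj (?E b l)))"
  proof (intro sum.cong refl)
    fix k l assume "k \<in> {..<Suc n}" "l \<in> {..<Suc n}"
    then have kl: "k < Suc n" "l < Suc n" by auto
    have "?E a k * ?W k * cnj (?E b l * ?W l) = ?E a k * cnj (?E b l) * (?W k * cnj (?W l))"
      by (simp only: complex_cnj_mult mult_ac)
    then show "?E a k * ?W k * cnj (?E b l * ?W l) =
        nsq n w * (?E a k * (if k = i \<or> l = i then 0 else pr n w (if k < i then k else k - 1, if l < i then l else l - 1)) * cnj (?E b l))"
      unfolding W[OF kl] by (simp only: mult_ac)
  qed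
  also have "\<dots> = nsq n w * flag_form n i (pr (Suc n) v) (pr n w) a b"
    by (simp only: flag_form_def sum_distrib_left)
  finally show ?thesis .
qed

text \<open>Dividing by the trace turns a multiple of a projection of rank one into the projection
  and removes the factor \<open>nsq n w\<close>, which depends on the representative.\<close>

lemma snd_flag:
  assumes i: "i \<le> n" and v: "v i \<noteq> 0" and w: "nsq n w \<noteq> 0"
  defines "T \<equiv> flag_form n i (pr (Suc n) v) (pr n w)"
  shows "(\<Sum>c<Suc n. T c c) \<noteq> 0"
    and "a < Suc n \<Longrightarrow> b < Suc n \<Longrightarrow> snd (flag n i v w) (a, b) = T a b / (\<Sum>c<Suc n. T c c)"
proof -
  let ?u = "perp (Suc n) v (ins i 0 w)"
  have u: "nsq (Suc n) ?u = nsq n w * (\<Sum>c<Suc n. T c c)"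
    unfolding sum_distrib_left nsq_def[of _ ?u] T_def
    by (intro sum.cong refl flag_form_eq[where v = v, OF i v w]) auto
  have "nsq (Suc n) ?u \<noteq> 0"
    using perp_ins_nonzero[where v = v, OF i v] w unfolding nsq_eq_0_iff by blast
  then show "(\<Sum>c<Suc n. T c c) \<noteq> 0" using u by auto
  show "a < Suc n \<Longrightarrow> b < Suc n \<Longrightarrow> snd (flag n i v w) (a, b) = T a b / (\<Sum>c<Suc n. T c c)"
    unfolding flag_def snd_conv pr_def prod.case u
    using flag_form_eq[where v = v, OF i v w, of a b] w by (simp add: T_def del: sum.lessThan_Suc)
qed

definition projection_pairs :: "((nat \<times> nat \<Rightarrow> complex) \<times> (nat \<times> nat \<Rightarrow> complex)) topology" where
  "projection_pairs = prod_topology (product_topology (\<lambda>_. euclidean) UNIV) (product_topology (\<lambda>_. euclidean) UNIV)"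

lemma continuous_map_into_projection_pairs:
  "continuous_map X projection_pairs f \<longleftrightarrow>
    (\<forall>p. continuous_map X euclidean (\<lambda>x. fst (f x) p)) \<and> (\<forall>p. continuous_map X euclidean (\<lambda>x. snd (f x) p))"
  by (simp add: projection_pairs_def continuous_map_pairwise continuous_map_componentwise_UNIV)

lemma Hausdorff_projection_pairs: "Hausdorff_space projection_pairs"
  by (simp add: projection_pairs_def Hausdorff_space_prod_topology Hausdorff_space_product_topology)

lemma topspace_projection_pairs [simp]: "topspace projection_pairs = UNIV"
  by (simp add: projection_pairs_def)

definition chart_space where
  "chart_space n i = prod_topology (subtopology (CP n) (CP_domain n i)) (lines_space n)"

lemma CP_domain_subset: "CP_domain n i \<subseteq> topspace (CP n)"
  by (auto simp: CP_domain_def)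

lemma topspace_chart_space: "topspace (chart_space n i) = CP_domain n i \<times> topspace (lines_space n)"
  using CP_domain_subset by (auto simp: chart_space_def)

lemma rep_nonzero:
  assumes "l \<in> topspace (lines_space n)" shows "nsq n (($) (rep l)) \<noteq> 0"
proof -
  obtain v where v: "v \<in> carrier_vec n" "v \<noteq> 0\<^sub>v n" "l = complex_line v" using assms by (auto simp: topspace_lines_space)
  obtain c where c: "c \<noteq> 0" "\<forall>i<n. rep l $ i = c * v $ i" using rep_complex_line[OF v(1,2)] v(3) by blast
  then show ?thesis using v(2) unfolding vec_neq_0_iff[OF v(1)] nsq_eq_0_iff by auto
qed

lemma rep_CP_domain:
  assumes "x \<in> CP_domain n i" "i \<le> n" shows "rep x $ i \<noteq> 0"
proof -
  obtain v where v: "v \<in> carrier_vec (Suc n)" "v $ i \<noteq> 0" "x = complex_line v"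
    using assms mem_CP_domain_iff by blast
  have "v \<noteq> 0\<^sub>v (Suc n)" using v assms by auto
  from rep_complex_line[OF v(1) this] show ?thesis using v assms(2) by auto
qed

text \<open>The padded vector and its orthogonal component depend on representatives. The expression
  by \<open>flag_form\<close> involves only the two projections, which are continuous in the
  lines.\<close>

lemma continuous_map_line_flag:
  assumes i: "i \<le> n"
  shows "continuous_map (chart_space n i) projection_pairs (\<lambda>y. line_flag n (i, y))"
proof -
  let ?X = "chart_space n i"
  have fst: "continuous_map ?X (lines_space (Suc n)) fst"
    using continuous_map_fst[of "subtopology (CP n) (CP_domain n i)" "lines_space n"]
    by (simp add: chart_space_def CP_def continuous_map_in_subtopology)
  have snd: "continuous_map ?X (lines_space n) snd" unfolding chart_space_def by (rule continuous_map_snd)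
  have P: "continuous_map ?X euclidean (\<lambda>y. pr (Suc n) (($) (rep (fst y))) p)" for p
    using continuous_map_compose[OF fst continuous_map_pr_rep] by (simp add: o_def)
  have Q: "continuous_map ?X euclidean (\<lambda>y. pr n (($) (rep (snd y))) p)" for p
    using continuous_map_compose[OF snd continuous_map_pr_rep] by (simp add: o_def)
  let ?T = "\<lambda>y. flag_form n i (pr (Suc n) (($) (rep (fst y)))) (pr n (($) (rep (snd y))))"
  have nz: "rep (fst y) $ i \<noteq> 0" "nsq n (($) (rep (snd y))) \<noteq> 0" if "y \<in> topspace ?X" for y
    using that rep_CP_domain[OF _ i] rep_nonzero by (auto simp: topspace_chart_space)
  have T: "continuous_map ?X euclidean (\<lambda>y. ?T y a b)" for a b
    unfolding flag_form_def by (intro continuous_map_complex_intros P) (auto intro: Q)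
  have "continuous_map ?X euclidean (\<lambda>y. snd (line_flag n (i, y)) (a, b))" for a b
  proof (cases "a < Suc n \<and> b < Suc n")
    case True
    have "continuous_map ?X euclidean (\<lambda>y. ?T y a b / (\<Sum>c<Suc n. ?T y c c))"
      using nz by (intro continuous_map_complex_intros T snd_flag(1)[OF i]) auto
    then show ?thesis
    proof (rule continuous_map_eq)
      fix y assume "y \<in> topspace ?X"
      from nz[OF this] show "?T y a b / (\<Sum>c<Suc n. ?T y c c) = snd (line_flag n (i, y)) (a, b)"
        using snd_flag(2)[OF i, of "($) (rep (fst y))" "($) (rep (snd y))" a b] True
        by (simp add: line_flag_def case_prod_beta del: sum.lessThan_Suc)
    qed
  next
    case False
    have "snd (line_flag n (i, y)) (a, b) = 0" for y
      using False by (auto simp: line_flag_def case_prod_beta flag_def pr_def)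
    then show ?thesis by simp
  qed
  moreover have "continuous_map ?X euclidean (\<lambda>y. fst (line_flag n (i, y)) p)" for p
    using P by (simp add: line_flag_def case_prod_beta flag_def)
  ultimately show ?thesis
    unfolding continuous_map_into_projection_pairs by (simp add: split_paired_all)
qed

definition charted_space where
  "charted_space n = sum_topology (chart_space n) {..n}"

lemma topspace_charted_space: "topspace (charted_space n) = charted_lines n"
  by (simp add: charted_space_def charted_lines_def topspace_sum_topology topspace_chart_space o_def)

abbreviation PTCP where "PTCP n \<equiv> projectivization (tangent_bundle_CP n)"

lemma quotient_map_tangent_line: "quotient_map (charted_space n) (PTCP n) (tangent_line n)"
proof -
  have "PTCP n = quotient_topology (charted_space n) (tangent_line n)"
    unfolding projectivization_def glued_space_def charted_space_def tangent_line_def chart_space_def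
    by (simp add: tangent_bundle_CP_def complex_tangent_bundle_def fun_eq_iff)
  then show ?thesis using quotient_map_quotient_topology by simp
qed

text \<open>One direction of \<open>tangent_line_eq_iff\<close> lets the flag descend to the glued
  space, the other makes the induced map injective.\<close>

lemma PTCP_flag_map:
  obtains F where "continuous_map (PTCP n) projection_pairs F"
    "\<And>e. e \<in> charted_lines n \<Longrightarrow> F (tangent_line n e) = line_flag n e"
    "inj_on F (topspace (PTCP n))"
proof -
  have "continuous_map (charted_space n) projection_pairs (line_flag n)"
    unfolding charted_space_def continuous_map_def openin_sum_topology
  proof (intro conjI allI impI)
    fix V assume V: "openin projection_pairs V"
    show "\<forall>i\<in>{..n}. openin (chart_space n i) {x. (i, x) \<in> {x \<in> topspace (sum_topology (chart_space n) {..n}). line_flag n x \<in> V}}"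
    proof
      fix i assume i: "i \<in> {..n}"
      have "openin (chart_space n i) {x \<in> topspace (chart_space n i). line_flag n (i, x) \<in> V}"
        using openin_continuous_map_preimage[OF continuous_map_line_flag V, of i n] i by simp
      moreover have "{x. (i, x) \<in> {x \<in> topspace (sum_topology (chart_space n) {..n}). line_flag n x \<in> V}} =
          {x \<in> topspace (chart_space n i). line_flag n (i, x) \<in> V}"
        using i by (auto simp: topspace_sum_topology)
      ultimately show "openin (chart_space n i) {x. (i, x) \<in> {x \<in> topspace (sum_topology (chart_space n) {..n}). line_flag n x \<in> V}}"
        by simp
    qed
  qed auto
  from quotient_map_lift_exists[OF quotient_map_tangent_line this]
  obtain F where F: "continuous_map (PTCP n) projection_pairs F"
    "\<And>e. e \<in> charted_lines n \<Longrightarrow> F (tangent_line n e) = line_flag n e"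
    unfolding topspace_charted_space using tangent_line_eq_iff by metis
  have "topspace (PTCP n) = tangent_line n ` charted_lines n"
    using quotient_imp_surjective_map[OF quotient_map_tangent_line, of n] by (simp add: topspace_charted_space)
  then have "inj_on F (topspace (PTCP n))"
    using F(2) tangent_line_eq_iff by (auto simp: inj_on_def)
  with F show thesis by (rule that)
qed

section \<open>The unitary group and its map to the glued space\<close>

definition unitary_space where
  "unitary_space N = subtopology (cmat_space N) (carrier (unitary_group N))"

lemma topspace_cmat_space [simp]: "topspace (cmat_space k) = carrier_mat k k"
  by (auto simp: cmat_space_def topspace_pullback_topology)

lemma topspace_unitary_space [simp]: "topspace (unitary_space N) = carrier (unitary_group N)"
  by (auto simp: unitary_space_def unitary_group_def)

lemma continuous_map_cmat_index:
  assumes "i < k" "j < k"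
  shows "continuous_map (cmat_space k) euclidean (\<lambda>A. A $$ (i, j))"
proof -
  have "continuous_map (product_topology (\<lambda>_. euclidean) ({..<k} \<times> {..<k})) euclidean (\<lambda>f. f (i, j))"
    by (rule continuous_map_product_projection) (use assms in auto)
  then show ?thesis unfolding cmat_space_def
    by (rule continuous_map_eq[OF continuous_map_pullback]) (use assms in \<open>auto simp: topspace_pullback_topology\<close>)
qed

text \<open>Columns of norm 1 have entries in the unit disc, so the group is the image of a closed
  subset of a product of discs.\<close>

lemma compact_unitary_space:
  assumes N: "N > 0"
  shows "compact_space (unitary_space N)"
proof -
  let ?D = "{..<N} \<times> {..<N}"
  let ?P = "product_topology (\<lambda>_. euclidean :: complex topology) ?D"
  let ?K = "Pi\<^sub>E ?D (\<lambda>_. cball 0 1 :: complex set)"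
  let ?C = "{f \<in> topspace ?P. unitary_fun N (\<lambda>i j. f (i, j))}"
  have K: "compactin ?P ?K" by (simp add: compactin_PiE)
  \<comment> \<open>The unitarity equations, one for each pair of columns; each of them cuts out a
    closed set.\<close>
  define e where "e = (\<lambda>(i :: nat, j :: nat) f. \<Sum>k<N. cnj (f (k, i)) * (f (k, j) :: complex))"
  define c where "c = (\<lambda>(i, j). if i = (j :: nat) then 1 else 0 :: complex)"
  have "continuous_map ?P euclidean (\<lambda>f. f p)" if "p \<in> ?D" for p
    using that by (rule continuous_map_product_projection)
  then have "continuous_map ?P euclidean (e p)" if "p \<in> ?D" for p
    using that unfolding e_def case_prod_beta by (intro continuous_map_complex_intros) auto
  then have "closedin ?P {f \<in> topspace ?P. e p f \<in> {c p}}" if "p \<in> ?D" for p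
    using that by (intro closedin_continuous_map_preimage) auto
  then have "closedin ?P (\<Inter>p\<in>?D. {f \<in> topspace ?P. e p f \<in> {c p}})"
    using N by (intro closedin_INT) auto
  moreover have "(\<Inter>p\<in>?D. {f \<in> topspace ?P. e p f \<in> {c p}}) = ?C"
    using N by (auto simp: unitary_fun_def e_def c_def)
  ultimately have "compactin ?P (?K \<inter> ?C)" using compact_Int_closedin[OF K] by simp
  moreover have "continuous_map ?P (cmat_space N) (mat N N)"
    unfolding cmat_space_def
  proof (rule continuous_map_pullback')
    show "continuous_map ?P ?P ((\<lambda>A. \<lambda>ij\<in>?D. A $$ ij) \<circ> mat N N)"
      by (rule continuous_map_eq[OF continuous_map_id]) (auto simp: fun_eq_iff restrict_def PiE_def extensional_def)
  qed auto
  ultimately have "compactin (cmat_space N) (mat N N ` (?K \<inter> ?C))" by (rule image_compactin)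
  moreover have "mat N N ` (?K \<inter> ?C) = carrier (unitary_group N)"
  proof
    show "mat N N ` (?K \<inter> ?C) \<subseteq> carrier (unitary_group N)"
      unfolding unitary_group_iff by (auto simp: unitary_group_iff elim!: unitary_fun_cong[rotated])
    show "carrier (unitary_group N) \<subseteq> mat N N ` (?K \<inter> ?C)"
    proof
      fix A assume A: "A \<in> carrier (unitary_group N)"
      then have Ac: "A \<in> carrier_mat N N" and Au: "unitary_fun N (\<lambda>i j. A $$ (i, j))" by (auto simp: unitary_group_iff)
      have "norm (A $$ (i, j)) \<le> 1" if "i < N" "j < N" for i j
      proof -
        have "(\<Sum>k<N. cnj (A $$ (k, j)) * A $$ (k, j)) = 1" using Au that unfolding unitary_fun_def by auto
        then have "nsq N (\<lambda>k. A $$ (k, j)) = 1" by (simp add: nsq_def mult.commute)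
        then have "complex_of_real (\<Sum>k<N. (cmod (A $$ (k, j)))\<^sup>2) = 1" by (simp only: nsq_real)
        then have "(\<Sum>k<N. (cmod (A $$ (k, j)))\<^sup>2) = 1" by (metis of_real_eq_1_iff)
        moreover have "(cmod (A $$ (i, j)))\<^sup>2 \<le> (\<Sum>k<N. (cmod (A $$ (k, j)))\<^sup>2)"
          using that by (intro member_le_sum) auto
        ultimately show ?thesis by (simp add: power2_le_iff_abs_le abs_square_le_1)
      qed
      then have "(\<lambda>p\<in>?D. A $$ p) \<in> ?K \<inter> ?C"
        using Au by (auto elim!: unitary_fun_cong[rotated])
      moreover have "A = mat N N (\<lambda>p\<in>?D. A $$ p)" using Ac by auto
      ultimately show "A \<in> mat N N ` (?K \<inter> ?C)" by blast
    qed
  qed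
  ultimately show ?thesis unfolding unitary_space_def by (intro compact_space_subtopology) simp
qed

text \<open>The tangent vector is the second column minus the multiple of the first that clears
  entry \<open>i\<close>, with that entry dropped. For unitary \<open>A\<close> the orthogonal
  component of its padding is the second column again.\<close>

definition unitary_line where
  "unitary_line n i A = (i, complex_line (Matrix.vec (Suc n) (colv A 0)),
     complex_line (Matrix.vec n (\<lambda>a. A $$ (skip i a, 1) - A $$ (i, 1) / A $$ (i, 0) * A $$ (skip i a, 0))))"

definition column_flag where
  "column_flag N A = (pr N (colv A 0), pr N (colv A 1))"

lemma
  assumes A: "A \<in> carrier (unitary_group (Suc n))" and n: "0 < n" and i: "i \<le> n" "A $$ (i, 0) \<noteq> 0"
  shows unitary_second_nonzero:
      "Matrix.vec n (\<lambda>a. A $$ (skip i a, 1) - A $$ (i, 1) / A $$ (i, 0) * A $$ (skip i a, 0)) \<noteq> 0\<^sub>v n"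
    and unitary_line_charted: "unitary_line n i A \<in> charted_lines n"
    and line_flag_unitary_line: "line_flag n (unitary_line n i A) = column_flag (Suc n) A"
proof -
  define c where "c = A $$ (i, 1) / A $$ (i, 0)"
  define w where "w = Matrix.vec n (\<lambda>a. A $$ (skip i a, 1) - c * A $$ (skip i a, 0))"
  let ?v = "Matrix.vec (Suc n) (colv A 0)"
  have ins: "ins i 0 (($) w) k = 1 * colv A 1 k + (- c) * colv A 0 k" if "k < Suc n" for k
    using that i(1)
    by (rule skip_cases) (use i in \<open>auto simp: w_def c_def\<close>)
  have orth: "ip (Suc n) (colv A 1) (colv A 0) = 0"
  proof -
    have "\<forall>i<Suc n. \<forall>j<Suc n. (\<Sum>k<Suc n. cnj (A $$ (k, i)) * A $$ (k, j)) = (if i = j then 1 else 0)"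
      using A unfolding unitary_group_iff unitary_fun_def by blast
    from this[rule_format, of 0 1] n show ?thesis
      unfolding ip_def by (simp add: mult.commute del: sum.lessThan_Suc)
  qed
  have nz0: "nsq (Suc n) (colv A 0) \<noteq> 0" using i by (intro nsq_nonzero[of i]) auto
  show w0: "Matrix.vec n (\<lambda>a. A $$ (skip i a, 1) - A $$ (i, 1) / A $$ (i, 0) * A $$ (skip i a, 0)) \<noteq> 0\<^sub>v n"
  proof
    assume "Matrix.vec n (\<lambda>a. A $$ (skip i a, 1) - A $$ (i, 1) / A $$ (i, 0) * A $$ (skip i a, 0)) = 0\<^sub>v n"
    then have wz: "w = 0\<^sub>v n" by (simp add: w_def c_def)
    have "ins i 0 (($) w) k = 0" if "k < Suc n" for k
      using that i(1) by (rule skip_cases) (auto simp: wz)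
    then have eq: "colv A 1 k = c * colv A 0 k" if "k < Suc n" for k
      using ins[OF that] that by simp
    have "0 = ip (Suc n) (\<lambda>k. c * colv A 0 k) (colv A 0)"
      unfolding orth[symmetric] by (rule ip_cong) (use eq in auto)
    then have "c = 0" using nz0 by (simp add: ip_scale_left ip_self)
    then show False using eq unitary_column_nonzero[OF A, of 1] n by auto
  qed
  have vi: "?v $ i \<noteq> 0" using i by simp
  have w: "w \<in> carrier_vec n" "w \<noteq> 0\<^sub>v n" using w0 by (auto simp: w_def c_def)
  have ul: "unitary_line n i A = (i, complex_line ?v, complex_line w)"
    by (simp add: unitary_line_def w_def c_def)
  show "unitary_line n i A \<in> charted_lines n"
    unfolding ul by (rule charted_linesI[OF i(1) _ vi w]) simp
  have "perp (Suc n) (($) ?v) (ins i 0 (($) w)) k = colv A 1 k" if "k < Suc n" for k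
  proof -
    have "perp (Suc n) (($) ?v) (ins i 0 (($) w)) k = perp (Suc n) (colv A 0) (\<lambda>k. 1 * colv A 1 k + (- c) * colv A 0 k) k"
      by (rule perp_cong) (use that ins in auto)
    also have "\<dots> = 1 * perp (Suc n) (colv A 0) (colv A 1) k" unfolding perp_combination[OF nz0] ..
    also have "\<dots> = colv A 1 k" unfolding perp_orthogonal[OF orth] by simp
    finally show ?thesis .
  qed
  then have "pr (Suc n) (perp (Suc n) (($) ?v) (ins i 0 (($) w))) = pr (Suc n) (colv A 1)" by (rule pr_cong)
  moreover have "pr (Suc n) (($) ?v) = pr (Suc n) (colv A 0)" by (rule pr_cong) simp
  ultimately show "line_flag n (unitary_line n i A) = column_flag (Suc n) A"
    unfolding ul line_flag_complex_line[OF i(1) vec_carrier vi w] by (simp add: flag_def column_flag_def)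
qed

lemma continuous_unitary_line:
  assumes n: "0 < n" and i: "i \<le> n"
  shows "continuous_map (subtopology (unitary_space (Suc n)) {A. A $$ (i, 0) \<noteq> 0}) (PTCP n) (\<lambda>A. tangent_line n (unitary_line n i A))"
proof -
  let ?X = "subtopology (unitary_space (Suc n)) {A. A $$ (i, 0) \<noteq> 0}"
  have entry: "continuous_map ?X euclidean (\<lambda>A. A $$ (k, l))" if "k < Suc n" "l < Suc n" for k l
    using that unfolding unitary_space_def by (intro continuous_map_from_subtopology continuous_map_cmat_index)
  have A: "A \<in> carrier (unitary_group (Suc n))" "A $$ (i, 0) \<noteq> 0" if "A \<in> topspace ?X" for A using that by auto
  let ?f = "\<lambda>A. complex_line (Matrix.vec (Suc n) (colv A 0))"
  let ?g = "\<lambda>A. complex_line (Matrix.vec n (\<lambda>a. A $$ (skip i a, 1) - A $$ (i, 1) / A $$ (i, 0) * A $$ (skip i a, 0)))"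
  have "continuous_map ?X (lines_space (Suc n)) ?f"
    using A(2) i by (intro continuous_map_into_lines) (auto simp: vec_neq_0_iff entry intro!: exI[of _ i])
  moreover have "?f A \<in> CP_domain n i" if "A \<in> topspace ?X" for A
    unfolding complex_line_mem_CP_domain[OF i vec_carrier] using A(2)[OF that] i by simp
  ultimately have f: "continuous_map ?X (subtopology (CP n) (CP_domain n i)) ?f"
    unfolding CP_def by (intro continuous_map_into_subtopology funcsetI)
  have g: "continuous_map ?X (lines_space n) ?g"
  proof (rule continuous_map_into_lines)
    fix k assume k: "k < n"
    have "continuous_map ?X euclidean (\<lambda>A. A $$ (skip i k, 1) - A $$ (i, 1) / A $$ (i, 0) * A $$ (skip i k, 0))"
      using n i skip_less[OF k, of i] by (intro continuous_map_complex_intros entry) auto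
    then show "continuous_map ?X euclidean (\<lambda>A. Matrix.vec n (\<lambda>a. A $$ (skip i a, 1) - A $$ (i, 1) / A $$ (i, 0) * A $$ (skip i a, 0)) $ k)"
      using k by simp
  qed (use unitary_second_nonzero[OF A(1) n i A(2)] in auto)
  have "continuous_map ?X (chart_space n i) (\<lambda>A. (?f A, ?g A))"
    unfolding chart_space_def by (rule continuous_map_pairedI[OF f g])
  from continuous_map_compose[OF this continuous_map_component_injection[of i "{..n}" "chart_space n"]]
  have "continuous_map ?X (charted_space n) (unitary_line n i)"
    using i unfolding charted_space_def unitary_line_def o_def by simp
  from continuous_map_compose[OF this quotient_imp_continuous_map[OF quotient_map_tangent_line]]
  show ?thesis by (simp add: o_def)
qed

text \<open>Some entry of the first column is nonzero, but no index works for all matrices. The maps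
  of the single charts agree on overlaps because they have the same flag, and are pasted over the
  open sets where the entry is nonzero.\<close>

lemma unitary_PTCP_map:
  assumes n: "0 < n"
  obtains \<Phi> where "continuous_map (unitary_space (Suc n)) (PTCP n) \<Phi>"
    "\<And>A. A \<in> carrier (unitary_group (Suc n)) \<Longrightarrow>
      \<exists>e\<in>charted_lines n. \<Phi> A = tangent_line n e \<and> line_flag n e = column_flag (Suc n) A"
proof -
  have ex: "\<exists>i\<in>{..n}. A $$ (i, 0) \<noteq> 0" if "A \<in> carrier (unitary_group (Suc n))" for A
    using unitary_column_nonzero[OF that, of 0] by (auto simp: less_Suc_eq_le)
  define idx where "idx A = (SOME i. i \<in> {..n} \<and> A $$ (i, 0) \<noteq> 0)" for A :: "complex mat"
  have idx: "idx A \<in> {..n} \<and> A $$ (idx A, 0) \<noteq> 0" if "A \<in> carrier (unitary_group (Suc n))" for A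
    unfolding idx_def using ex[OF that] by (rule someI_ex[of "\<lambda>i. i \<in> {..n} \<and> A $$ (i, 0) \<noteq> 0", simplified Bex_def[symmetric]])
  show thesis
  proof
    show "continuous_map (unitary_space (Suc n)) (PTCP n) (\<lambda>A. tangent_line n (unitary_line n (idx A) A))"
    proof (rule pasting_lemma[where I = "{..n}" and T = "\<lambda>i. {A \<in> carrier (unitary_group (Suc n)). A $$ (i, 0) \<noteq> 0}" and f = "\<lambda>i A. tangent_line n (unitary_line n i A)"])
      fix i assume i: "i \<in> {..n}"
      have "continuous_map (unitary_space (Suc n)) euclidean (\<lambda>A. A $$ (i, 0))"
        unfolding unitary_space_def using i by (intro continuous_map_from_subtopology continuous_map_cmat_index) auto
      from openin_continuous_map_preimage[OF this, of "- {0}"]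
      show "openin (unitary_space (Suc n)) {A \<in> carrier (unitary_group (Suc n)). A $$ (i, 0) \<noteq> 0}"
        by (simp add: open_Compl)
      have "subtopology (unitary_space (Suc n)) {A \<in> carrier (unitary_group (Suc n)). A $$ (i, 0) \<noteq> 0} =
          subtopology (unitary_space (Suc n)) {A. A $$ (i, 0) \<noteq> 0}"
        using subtopology_restrict[of "unitary_space (Suc n)" "{A. A $$ (i, 0) \<noteq> 0}"] by (simp add: Int_def)
      then show "continuous_map (subtopology (unitary_space (Suc n)) {A \<in> carrier (unitary_group (Suc n)). A $$ (i, 0) \<noteq> 0})
          (PTCP n) (\<lambda>A. tangent_line n (unitary_line n i A))"
        using continuous_unitary_line[OF n, of i] i by simp
    next
      fix i j A
      assume "i \<in> {..n}" "j \<in> {..n}" and "A \<in> topspace (unitary_space (Suc n)) \<inter> {A \<in> carrier (unitary_group (Suc n)). A $$ (i, 0) \<noteq> 0} \<inter> {A \<in> carrier (unitary_group (Suc n)). A $$ (j, 0) \<noteq> 0}"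
      then have h: "A \<in> carrier (unitary_group (Suc n))" "i \<le> n" "j \<le> n" "A $$ (i, 0) \<noteq> 0" "A $$ (j, 0) \<noteq> 0" by auto
      show "tangent_line n (unitary_line n i A) = tangent_line n (unitary_line n j A)"
        unfolding tangent_line_eq_iff[OF unitary_line_charted[OF h(1) n h(2,4)] unitary_line_charted[OF h(1) n h(3,5)]]
          line_flag_unitary_line[OF h(1) n h(2,4)] line_flag_unitary_line[OF h(1) n h(3,5)] ..
    qed (use idx in auto)
    show "\<exists>e\<in>charted_lines n. tangent_line n (unitary_line n (idx A) A) = tangent_line n e \<and> line_flag n e = column_flag (Suc n) A"
      if "A \<in> carrier (unitary_group (Suc n))" for A
      using idx[OF that] unitary_line_charted[OF that n] line_flag_unitary_line[OF that n] by auto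
  qed
qed

text \<open>The vector of the base line and the orthogonal component of the padded tangent vector
  extend, after rescaling, to a unitary matrix.\<close>

lemma line_flag_column_flag:
  assumes "e \<in> charted_lines (Suc m)"
  shows "\<exists>A\<in>carrier (unitary_group (Suc (Suc m))). line_flag (Suc m) e = column_flag (Suc (Suc m)) A"
proof -
  let ?n = "Suc m" and ?N = "Suc (Suc m)"
  obtain i v w where e: "i \<le> ?n" "v \<in> carrier_vec ?N" "v $ i \<noteq> 0" "w \<in> carrier_vec ?n" "w \<noteq> 0\<^sub>v ?n"
    "e = (i, complex_line v, complex_line w)" by (rule charted_linesE[OF assms])
  let ?u = "perp ?N (($) v) (ins i 0 (($) w))"
  have nz: "\<exists>k<?N. v $ k \<noteq> 0" using e by (auto intro!: exI[of _ i])
  have "\<exists>k<?N. ?u k \<noteq> 0" using e vec_neq_0_iff[OF e(4)] by (intro perp_ins_nonzero) auto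
  from unitary_completion[OF nz this ip_perp] nz
  obtain A c d where A: "unitary_fun ?N A" "c \<noteq> 0" "d \<noteq> 0" "\<forall>k<?N. A k 0 = c * v $ k" "\<forall>k<?N. A k 1 = d * ?u k"
    unfolding nsq_eq_0_iff by blast
  let ?A = "mat ?N ?N (\<lambda>(i, j). A i j)"
  have "?A \<in> carrier (unitary_group ?N)"
    unfolding unitary_group_iff using A(1) by (auto elim!: unitary_fun_cong[rotated])
  moreover have "pr ?N (colv ?A 0) = pr ?N (($) v)" by (rule pr_multiple[OF A(2)]) (use A(4) in auto)
  moreover have "pr ?N (colv ?A 1) = pr ?N ?u" by (rule pr_multiple[OF A(3)]) (use A(5) in auto)
  ultimately show ?thesis
    unfolding e(6) line_flag_complex_line[OF e(1-5)] by (auto simp: flag_def column_flag_def intro!: bexI[of _ ?A])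
qed

lemma continuous_column_flag:
  assumes n: "0 < n"
  shows "continuous_map (unitary_space (Suc n)) projection_pairs (column_flag (Suc n))"
proof -
  have entry: "continuous_map (unitary_space (Suc n)) euclidean (\<lambda>A. A $$ (k, l))" if "k < Suc n" "l < Suc n" for k l
    using that unfolding unitary_space_def by (intro continuous_map_from_subtopology continuous_map_cmat_index)
  have "continuous_map (unitary_space (Suc n)) euclidean (\<lambda>A. pr (Suc n) (colv A j) p)" if j: "j < Suc n" for j p
  proof (rule continuous_map_pr)
    fix A assume "A \<in> topspace (unitary_space (Suc n))"
    then show "nsq (Suc n) (colv A j) \<noteq> 0"
      using unitary_column_nonzero[OF _ j] unfolding nsq_eq_0_iff by auto
  qed (rule entry[OF _ j])
  then show ?thesis
    unfolding continuous_map_into_projection_pairs column_flag_def using n by simp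
qed

lemma coset_eq_iff:
  assumes "A \<in> carrier (unitary_group (Suc (Suc m)))" "B \<in> carrier (unitary_group (Suc (Suc m)))"
  shows "A <#\<^bsub>unitary_group (Suc (Suc m))\<^esub> block_unitary 1 1 m = B <#\<^bsub>unitary_group (Suc (Suc m))\<^esub> block_unitary 1 1 m \<longleftrightarrow>
    column_flag (Suc (Suc m)) A = column_flag (Suc (Suc m)) B" (is "?l \<longleftrightarrow> ?r")
proof
  assume ?l
  then have "A \<in> B <#\<^bsub>unitary_group (Suc (Suc m))\<^esub> block_unitary 1 1 m"
    unfolding coset_eq[OF assms(1)] using assms(1) by blast
  then show ?r unfolding coset_eq[OF assms(2)] by (simp add: column_flag_def)
next
  assume ?r
  then show ?l unfolding coset_eq[OF assms(1)] coset_eq[OF assms(2)] by (simp add: column_flag_def)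
qed

text \<open>A continuous injection of a compact space into a Hausdorff space is a homeomorphism onto
  its image.\<close>

lemma homeomorphic_spaces_by_common_image:
  assumes "continuous_map X Z F" "inj_on F (topspace X)" "compact_space X"
    and "continuous_map Y Z G" "inj_on G (topspace Y)" "compact_space Y"
    and Z: "Hausdorff_space Z" and img: "F ` topspace X = G ` topspace Y"
  shows "X homeomorphic_space Y"
proof -
  have "V homeomorphic_space subtopology Z (F ` topspace X)"
    if H: "continuous_map V Z H" "inj_on H (topspace V)" "compact_space V" "F ` topspace X = H ` topspace V"
    for H and V :: "'d topology"
  proof -
    have "continuous_map V (subtopology Z (F ` topspace X)) H"
      using H by (intro continuous_map_into_subtopology) auto
    moreover have "H ` topspace V = topspace (subtopology Z (F ` topspace X))"
      using continuous_map_image_subset_topspace[OF H(1)] H(4) by auto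
    ultimately have "homeomorphic_map V (subtopology Z (F ` topspace X)) H"
      using H Z by (intro continuous_imp_homeomorphic_map Hausdorff_space_subtopology)
    then show ?thesis by (rule homeomorphic_map_imp_homeomorphic_space)
  qed
  note * = this
  have "X homeomorphic_space subtopology Z (F ` topspace X)" by (rule *[OF assms(1-3) refl])
  moreover have "Y homeomorphic_space subtopology Z (F ` topspace X)" by (rule *[OF assms(4-6) img])
  ultimately show ?thesis using homeomorphic_space_trans homeomorphic_space_sym by blast
qed

theorem PTCP_homeomorphic_flag_manifold:
  "PTCP (Suc m) homeomorphic_space unitary_homogeneous_space (Suc (Suc m)) (block_unitary 1 1 m)"
    (is "?X homeomorphic_space ?Y")
proof -
  let ?n = "Suc m" and ?N = "Suc (Suc m)"
  let ?U = "unitary_space ?N"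
  let ?\<pi> = "\<lambda>A. A <#\<^bsub>unitary_group ?N\<^esub> block_unitary 1 1 m"
  obtain F where F: "continuous_map ?X projection_pairs F" "\<And>e. e \<in> charted_lines ?n \<Longrightarrow> F (tangent_line ?n e) = line_flag ?n e"
    "inj_on F (topspace ?X)" by (rule PTCP_flag_map[of ?n]) (rule that)
  obtain \<Phi> where \<Phi>: "continuous_map ?U ?X \<Phi>"
    "\<And>A. A \<in> carrier (unitary_group ?N) \<Longrightarrow>
      \<exists>e\<in>charted_lines ?n. \<Phi> A = tangent_line ?n e \<and> line_flag ?n e = column_flag ?N A"
    by (rule unitary_PTCP_map[of ?n, OF zero_less_Suc]) (rule that)
  have cU: "compact_space ?U" by (rule compact_unitary_space) simp
  have X: "topspace ?X = tangent_line ?n ` charted_lines ?n"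
    using quotient_imp_surjective_map[OF quotient_map_tangent_line, of ?n] by (simp add: topspace_charted_space)
  have surj: "\<Phi> ` topspace ?U = topspace ?X"
  proof
    show "\<Phi> ` topspace ?U \<subseteq> topspace ?X" using \<Phi>(2) unfolding X by auto
    show "topspace ?X \<subseteq> \<Phi> ` topspace ?U"
      unfolding X
    proof
      fix x assume "x \<in> tangent_line ?n ` charted_lines ?n"
      then obtain e where e: "e \<in> charted_lines ?n" "x = tangent_line ?n e" by auto
      obtain A where A: "A \<in> carrier (unitary_group ?N)" "line_flag ?n e = column_flag ?N A"
        using line_flag_column_flag[OF e(1)] by auto
      obtain e' where "e' \<in> charted_lines ?n" "\<Phi> A = tangent_line ?n e'" "line_flag ?n e' = column_flag ?N A"
        using \<Phi>(2)[OF A(1)] by auto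
      then have "\<Phi> A = x" using tangent_line_eq_iff[OF e(1), of e'] e A by simp
      then show "x \<in> \<Phi> ` topspace ?U" using A by auto
    qed
  qed
  have FU: "F ` topspace ?X = column_flag ?N ` topspace ?U"
    unfolding surj[symmetric] image_image
  proof (rule image_cong[OF refl])
    fix A assume "A \<in> topspace ?U"
    then show "F (\<Phi> A) = column_flag ?N A" using \<Phi>(2)[of A] F(2) by auto
  qed
  \<comment> \<open>The surjection from the unitary group carries its compactness to the glued
    space.\<close>
  have cX: "compact_space ?X"
    using image_compactin[OF _ \<Phi>(1), of "topspace ?U"] cU by (simp add: compact_space_def surj del: topspace_unitary_space)
  have qY: "quotient_map ?U ?Y ?\<pi>"
    unfolding unitary_homogeneous_space_def unitary_space_def by (rule quotient_map_quotient_topology)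
  have Y: "topspace ?Y = ?\<pi> ` topspace ?U" by (rule quotient_imp_surjective_map[OF qY, symmetric])
  have cY: "compact_space ?Y"
    unfolding compact_space_def Y
    by (rule image_compactin[OF cU[unfolded compact_space_def] quotient_imp_continuous_map[OF qY]])
  have fibres: "\<And>A B. A \<in> topspace ?U \<Longrightarrow> B \<in> topspace ?U \<Longrightarrow> ?\<pi> A = ?\<pi> B \<Longrightarrow> column_flag ?N A = column_flag ?N B"
    unfolding topspace_unitary_space by (simp only: coset_eq_iff)
  obtain G where G: "continuous_map ?Y projection_pairs G" "\<And>A. A \<in> topspace ?U \<Longrightarrow> G (?\<pi> A) = column_flag ?N A"
  proof (rule quotient_map_lift_exists[OF qY continuous_column_flag[OF zero_less_Suc] fibres])
    fix G assume "continuous_map ?Y projection_pairs G" "\<And>A. A \<in> topspace ?U \<Longrightarrow> G (?\<pi> A) = column_flag ?N A"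
    then show thesis by (rule that)
  qed
  have "inj_on G (topspace ?Y)"
    unfolding Y by (rule inj_onI, elim imageE) (simp only: G(2) topspace_unitary_space coset_eq_iff)
  moreover have "F ` topspace ?X = G ` topspace ?Y"
    unfolding Y FU image_image by (rule image_cong[OF refl]) (simp only: G(2))
  ultimately show ?thesis
    using homeomorphic_spaces_by_common_image[OF F(1,3) cX G(1) _ cY Hausdorff_projection_pairs] by blast
qed

section \<open>Path-connectedness of the projectivized tangent bundle\<close>

lemma pathin_lines:
  assumes "v \<in> carrier_vec k" "w \<in> carrier_vec k"
    and nz: "\<And>t. t \<in> {0..1} \<Longrightarrow> Matrix.vec k (\<lambda>i. (1 - of_real t) * v $ i + of_real t * w $ i) \<noteq> 0\<^sub>v k"
  shows "pathin (lines_space k) (\<lambda>t. complex_line (Matrix.vec k (\<lambda>i. (1 - of_real t) * v $ i + of_real t * w $ i)))"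
  unfolding pathin_def
proof (rule continuous_map_into_lines)
  fix i assume "i < k"
  then show "continuous_map (top_of_set {0..1}) euclidean (\<lambda>t. Matrix.vec k (\<lambda>i. (1 - of_real t) * v $ i + of_real t * w $ i) $ i)"
    by (auto intro!: continuous_intros)
qed (use nz in auto)

text \<open>The segment between spanning vectors joins the lines unless it meets 0, in which case
  the vectors are proportional and the lines equal.\<close>

lemma path_connected_lines_space: "path_connected_space (lines_space k)"
  unfolding path_connected_space_def
proof (intro ballI)
  fix x y assume "x \<in> topspace (lines_space k)" "y \<in> topspace (lines_space k)"
  then obtain v w where v: "v \<in> carrier_vec k" "v \<noteq> 0\<^sub>v k" "x = complex_line v"
    and w: "w \<in> carrier_vec k" "w \<noteq> 0\<^sub>v k" "y = complex_line w"
    unfolding topspace_lines_space by auto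
  let ?s = "\<lambda>t. Matrix.vec k (\<lambda>i. (1 - complex_of_real t) * v $ i + complex_of_real t * w $ i)"
  show "\<exists>g. pathin (lines_space k) g \<and> g 0 = x \<and> g 1 = y"
  proof (cases "\<exists>t\<in>{0..1}. ?s t = 0\<^sub>v k")
    case False
    have "?s 0 = v" "?s 1 = w" using v w by auto
    then have "complex_line (?s 0) = x" "complex_line (?s 1) = y" using v w by (simp_all only:)
    moreover have "pathin (lines_space k) (\<lambda>t. complex_line (?s t))" by (rule pathin_lines[OF v(1) w(1)]) (use False in blast)
    ultimately show ?thesis by blast
  next
    case True
    then obtain t where t: "?s t = 0\<^sub>v k" by blast
    have eq: "(1 - complex_of_real t) * v $ i + complex_of_real t * w $ i = 0" if "i < k" for i
      using arg_cong[OF t, of "\<lambda>v. v $ i"] that by simp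
    have "t \<noteq> 1"
    proof
      assume "t = 1"
      then have "\<forall>i<k. w $ i = 0" using eq by simp
      then show False using w(2) unfolding vec_neq_0_iff[OF w(1)] by blast
    qed
    then have t1: "1 - complex_of_real t \<noteq> 0" by (metis of_real_1 of_real_eq_iff right_minus_eq)
    have eq': "v $ i = - complex_of_real t / (1 - complex_of_real t) * w $ i" if "i < k" for i
      using eq[OF that] t1 by (simp add: field_simps eq_neg_iff_add_eq_0)
    have "t \<noteq> 0"
    proof
      assume "t = 0"
      then have "\<forall>i<k. v $ i = 0" using eq by simp
      then show False using v(2) unfolding vec_neq_0_iff[OF v(1)] by blast
    qed
    then have "x = y" unfolding v(3) w(3)
      by (intro complex_line_eqI[OF v(1) w(1) _ eq']) (use t1 in auto)
    moreover have "y \<in> topspace (lines_space k)" using w by (auto simp: topspace_lines_space)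
    ultimately show ?thesis by (intro exI[of _ "\<lambda>_. y"]) simp
  qed
qed

text \<open>With entry \<open>i\<close> normalised to 1 the domain becomes an affine space, and
  segments stay inside it.\<close>

lemma path_connected_CP_domain:
  assumes i: "i \<le> n"
  shows "path_connected_space (subtopology (CP n) (CP_domain n i))"
  unfolding path_connected_space_def
proof (intro ballI)
  have norm: "\<exists>v\<in>carrier_vec (Suc n). v $ i = 1 \<and> x = complex_line v" if x: "x \<in> CP_domain n i" for x
  proof -
    obtain v where v: "v \<in> carrier_vec (Suc n)" "v $ i \<noteq> 0" "x = complex_line v"
      using x unfolding mem_CP_domain_iff[OF i] by blast
    have "complex_line (inverse (v $ i) \<cdot>\<^sub>v v) = complex_line v"
      by (rule complex_line_eqI[of _ "Suc n" _ "inverse (v $ i)"]) (use v in auto)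
    then show ?thesis using v i by (intro bexI[of _ "inverse (v $ i) \<cdot>\<^sub>v v"]) auto
  qed
  fix x y assume "x \<in> topspace (subtopology (CP n) (CP_domain n i))" "y \<in> topspace (subtopology (CP n) (CP_domain n i))"
  then obtain v w where v: "v \<in> carrier_vec (Suc n)" "v $ i = 1" "x = complex_line v"
    and w: "w \<in> carrier_vec (Suc n)" "w $ i = 1" "y = complex_line w"
    using norm[of x] norm[of y] by auto
  let ?s = "\<lambda>t. Matrix.vec (Suc n) (\<lambda>i. (1 - complex_of_real t) * v $ i + complex_of_real t * w $ i)"
  have si: "?s t $ i = 1" for t using v w i by (simp add: algebra_simps)
  have "?s 0 = v" "?s 1 = w" using v w by auto
  then have "complex_line (?s 0) = x" "complex_line (?s 1) = y" using v w by (simp_all only:)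
  moreover have "pathin (CP n) (\<lambda>t. complex_line (?s t))"
    unfolding CP_def
  proof (rule pathin_lines[OF v(1) w(1)])
    fix t :: real show "?s t \<noteq> 0\<^sub>v (Suc n)" using si[of t] i by (metis index_zero_vec(1) le_imp_less_Suc zero_neq_one)
  qed
  moreover have "complex_line (?s t) \<in> CP_domain n i" for t
    unfolding complex_line_mem_CP_domain[OF i vec_carrier] si by simp
  ultimately show "\<exists>g. pathin (subtopology (CP n) (CP_domain n i)) g \<and> g 0 = x \<and> g 1 = y"
    unfolding pathin_subtopology by blast
qed

text \<open>Each chart is a product of path-connected spaces. All charts share a point over the line
  spanned by the vector with all entries 1, which lies in every domain.\<close>

lemma path_connected_PTCP:
  assumes n: "0 < n"
  shows "path_connected_space (PTCP n)" and "topspace (PTCP n) \<noteq> {}"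
proof -
  let ?\<S> = "(\<lambda>i. (\<lambda>y. tangent_line n (i, y)) ` topspace (chart_space n i)) ` {..n}"
  define v where "v = Matrix.vec (Suc n) (\<lambda>_. 1 :: complex)"
  define w where "w = Matrix.vec n (\<lambda>_. 1 :: complex)"
  have v: "v \<in> carrier_vec (Suc n)" "v $ i \<noteq> 0" if "i \<le> n" for i using that by (auto simp: v_def)
  have "w $ 0 \<noteq> 0" using n by (simp add: w_def)
  moreover have wc: "w \<in> carrier_vec n" by (simp add: w_def)
  ultimately have w: "w \<in> carrier_vec n" "w \<noteq> 0\<^sub>v n" using n unfolding vec_neq_0_iff[OF wc] by blast+
  let ?e = "(0 :: nat, complex_line v, complex_line w)"
  have e: "?e \<in> charted_lines n" by (rule charted_linesI[OF _ v w]) auto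
  have "tangent_line n ?e \<in> (\<lambda>y. tangent_line n (i, y)) ` topspace (chart_space n i)" if i: "i \<le> n" for i
  proof -
    let ?w = "glue n i 0 (complex_line v) *\<^sub>v w"
    have w': "?w \<in> carrier_vec n" "?w \<noteq> 0\<^sub>v n"
      using mult_mat_vec_carrier[OF glue_carrier w(1)] glue_nonzero[OF i _ v(1) v(2) v(2) w] i by auto
    have e': "(i, complex_line v, complex_line ?w) \<in> charted_lines n" by (rule charted_linesI[OF i v[OF i] w'])
    have "line_flag n (i, complex_line v, complex_line ?w) = line_flag n ?e"
      by (rule line_flag_glue[OF i _ v(1) v(2) v(2) w]) (use i in auto)
    then have "tangent_line n ?e = tangent_line n (i, complex_line v, complex_line ?w)"
      using tangent_line_eq_iff[OF e e'] by simp
    moreover have "(complex_line v, complex_line ?w) \<in> topspace (chart_space n i)"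
      using e' by (simp add: charted_lines_def topspace_chart_space)
    ultimately show ?thesis by blast
  qed
  then have "tangent_line n ?e \<in> \<Inter>?\<S>" by blast
  then have int: "\<Inter>?\<S> \<noteq> {}" by blast
  have "path_connectedin (PTCP n) S" if "S \<in> ?\<S>" for S
  proof -
    obtain i where i: "i \<le> n" "S = (\<lambda>y. tangent_line n (i, y)) ` topspace (chart_space n i)" using \<open>S \<in> ?\<S>\<close> by auto
    have "continuous_map (chart_space n i) (charted_space n) (Pair i)"
      unfolding charted_space_def using i by (intro continuous_map_component_injection) auto
    from continuous_map_compose[OF this quotient_imp_continuous_map[OF quotient_map_tangent_line]]
    have c: "continuous_map (chart_space n i) (PTCP n) (\<lambda>y. tangent_line n (i, y))" by (simp add: o_def)
    have "path_connected_space (chart_space n i)"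
      unfolding chart_space_def path_connected_space_prod_topology
      using path_connected_CP_domain[OF i(1)] path_connected_lines_space by blast
    then have "path_connectedin (chart_space n i) (topspace (chart_space n i))" by (simp add: path_connectedin_topspace)
    from path_connectedin_continuous_map_image[OF c this] show ?thesis unfolding i(2) .
  qed
  then have pc: "path_connectedin (PTCP n) (\<Union>?\<S>)" using int by (rule path_connectedin_Union)
  have X: "topspace (PTCP n) = tangent_line n ` charted_lines n"
    using quotient_imp_surjective_map[OF quotient_map_tangent_line, of n] by (simp add: topspace_charted_space)
  then have "\<Union>?\<S> = topspace (PTCP n)"
    by (auto simp: charted_lines_def topspace_chart_space)
  from pc[unfolded this] show "path_connected_space (PTCP n)" by (simp only: path_connectedin_topspace)
  show "topspace (PTCP n) \<noteq> {}" using X e by auto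
qed

section \<open>Minimal models along isomorphisms\<close>

lemma ev_hom:
  assumes A: "cdga A" and B: "cdga B" and f: "f \<in> dga_hom A B"
    and \<phi>: "\<And>v. v \<in> S \<Longrightarrow> \<phi> v \<in> carrier A" and x: "x \<in> tens S"
  shows "ev B (\<lambda>v. f (\<phi> v)) x = f (ev A \<phi> x)"
proof -
  interpret A: cdga A by (rule A)
  interpret B: cdga B by (rule B)
  have \<phi>': "v \<in> S \<Longrightarrow> f (\<phi> v) \<in> carrier B" for v using \<phi> dga_homD(1)[OF f] by blast
  from x show ?thesis
  proof (induction rule: tens_induct)
    case zero
    then show ?case using A.ev_0[of S \<phi>] B.ev_0[of S "\<lambda>v. f (\<phi> v)"] \<phi> \<phi>' dga_hom_zero[OF f A B] by simp
  next
    case (single l q)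
    have "ev_word B (\<lambda>v. f (\<phi> v)) l = f (ev_word A \<phi> l)"
      using single
    proof (induction l)
      case Nil
      then show ?case by (simp add: ev_word_def dga_homD(4)[OF f])
    next
      case (Cons v l)
      have "ev_word A \<phi> l \<in> carrier A" using A.ev_word_carrier[of S \<phi> l] \<phi> Cons by auto
      then show ?case using Cons \<phi> by (simp add: ev_word_def dga_homD(3)[OF f])
    qed
    moreover have "ev_word A \<phi> l \<in> carrier A" using A.ev_word_carrier[of S \<phi> l] \<phi> single by auto
    ultimately show ?case
      using single A.ev_single[of S \<phi> l q] B.ev_single[of S "\<lambda>v. f (\<phi> v)" l q] \<phi> \<phi>' by (simp add: dga_homD(5)[OF f])
  next
    case (add x y)
    then show ?case
      using A.ev_add[of S \<phi>] B.ev_add[of S "\<lambda>v. f (\<phi> v)"] A.ev_carrier[of S \<phi>] \<phi> \<phi>' by (simp add: dga_homD(2)[OF f])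
  qed
qed

text \<open>Only the map to the target algebra changes: relative cocycles are pulled back along
  \<open>g\<close>, trivialised in \<open>A\<close>, and the result is pushed forward along
  \<open>f\<close>.\<close>

lemma (in minimal_model) minimal_model_transport:
  assumes B: "cdga B" and f: "f \<in> dga_hom A B" and g: "g \<in> dga_hom B A"
    and gf: "\<And>x. x \<in> carrier A \<Longrightarrow> g (f x) = x" and fg: "\<And>y. y \<in> carrier B \<Longrightarrow> f (g y) = y"
  shows "minimal_model S dg \<delta> rk B (\<lambda>v. f (\<phi> v))"
proof -
  interpret B: cdga B by (rule B)
  have ev: "ev B (\<lambda>v. f (\<phi> v)) x = f (ev A \<phi> x)" if "x \<in> tens S" for x
    by (rule ev_hom[OF A.cdga_axioms B f \<phi>_carrier that])
  have evc: "ev A \<phi> x \<in> carrier A" if "x \<in> tens S" for x by (rule A.ev_carrier[OF \<phi>_carrier that])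
  show ?thesis
  proof (intro minimal_model.intro minimal_system_axioms B minimal_model_axioms.intro)
    show "\<one>\<^bsub>B\<^esub> \<noteq> \<zero>\<^bsub>B\<^esub>"
      using one_not_zero dga_homD(4)[OF g] dga_hom_zero[OF g B A.cdga_axioms] by metis
    fix v assume v: "v \<in> S"
    then show "f (\<phi> v) \<in> grade B (dg v)" using dga_homD(6)[OF f] \<phi>_grade by blast
    show "ev B (\<lambda>v. f (\<phi> v)) (\<delta> v) = diff B (f (\<phi> v))"
      using v by (simp add: ev d_tens \<phi>_\<delta> dga_homD(7)[OF f] \<phi>_carrier)
  next
    fix p
    show "rel_trivial B S dg (gca_ideal S dg {}) \<delta> (\<lambda>v. f (\<phi> v)) p"
      unfolding rel_trivial_def
    proof (intro ballI impI)
      fix z b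
      assume z: "z \<in> tens S \<inter> homog dg (Suc p)" "der dg \<delta> z \<in> gca_ideal S dg {}"
        and b: "b \<in> grade B p" "diff B b = ev B (\<lambda>v. f (\<phi> v)) z"
      have bc: "b \<in> carrier B" using b(1) by (rule B.grade_carrier)
      have "diff A (g b) = g (f (ev A \<phi> z))" using b(2) z(1) by (simp add: ev dga_homD(7)[OF g bc, symmetric])
      also have "\<dots> = ev A \<phi> z" using z(1) by (simp add: gf evc)
      finally obtain x where x: "x \<in> tens S \<inter> homog dg p" "z - der dg \<delta> x \<in> gca_ideal S dg {}"
        "g b \<ominus>\<^bsub>A\<^esub> ev A \<phi> x \<in> coboundaries A p"
        using rel[of p] z dga_homD(6)[OF g b(1)] unfolding rel_trivial_def by blast
      have "b \<ominus>\<^bsub>B\<^esub> ev B (\<lambda>v. f (\<phi> v)) x = f (g b \<ominus>\<^bsub>A\<^esub> ev A \<phi> x)"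
        using x(1) bc by (simp add: ev fg evc dga_homD(1)[OF g] dga_hom_minus[OF A.cdga_axioms B f])
      then show "\<exists>x\<in>tens S \<inter> homog dg p. z - der dg \<delta> x \<in> gca_ideal S dg {} \<and> b \<ominus>\<^bsub>B\<^esub> ev B (\<lambda>v. f (\<phi> v)) x \<in> coboundaries B p"
        using x dga_hom_coboundaries[OF A.cdga_axioms B f x(3)] by auto
    qed
  qed
qed

text \<open>The multiples of 1 form a copy of the rationals. This makes \<open>gens_lepoll\<close>
  applicable to the algebra of forms.\<close>

lemma (in cdga) infinite_carrier:
  assumes "\<one> \<noteq> \<zero>"
  shows "infinite (carrier A)"
proof -
  have "inj (\<lambda>q. q \<odot> \<one>)"
  proof (rule injI)
    fix q p :: rat
    assume eq: "q \<odot> \<one> = p \<odot> \<one>"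
    show "q = p"
    proof (rule ccontr)
      assume "q \<noteq> p"
      have "q \<odot> \<one> \<oplus> (-1) \<odot> (p \<odot> \<one>) = (q - p) \<odot> \<one>"
        using A_one_closed smult_add[of \<one> q "- p"] by (simp add: smult_smult)
      moreover have "q \<odot> \<one> \<oplus> (-1) \<odot> (p \<odot> \<one>) = \<zero>"
        using A_one_closed smult_add[of \<one> p "- p"] by (simp add: eq smult_smult)
      ultimately have "(q - p) \<odot> \<one> = \<zero>" by simp
      then have "inverse (q - p) \<odot> ((q - p) \<odot> \<one>) = \<zero>" by (simp only: smult_zero)
      then show False using assms \<open>q \<noteq> p\<close> A_one_closed by (simp add: smult_smult)
    qed
  qed
  then have "infinite (range (\<lambda>q. q \<odot> \<one>))" by (simp add: finite_image_iff infinite_UNIV_char_0)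
  moreover have "range (\<lambda>q. q \<odot> \<one>) \<subseteq> carrier A" using A_one_closed by auto
  ultimately show ?thesis using finite_subset by blast
qed

theorem homeomorphic_spaces_same_rational_homotopy_type:
  assumes "X homeomorphic_space Y" "path_connected_space X" "topspace X \<noteq> {}"
  shows "same_rational_homotopy_type X Y"
proof -
  obtain f g where f: "continuous_map X Y f" and g: "continuous_map Y X g"
    and gf: "\<And>x. x \<in> topspace X \<Longrightarrow> g (f x) = x" and fg: "\<And>y. y \<in> topspace Y \<Longrightarrow> f (g y) = y"
    using assms(1) unfolding homeomorphic_space_def homeomorphic_maps_def by blast
  interpret X: cdga "apl X" by (rule cdga_apl)
  have one: "\<one>\<^bsub>apl X\<^esub> \<noteq> \<zero>\<^bsub>apl X\<^esub>" by (rule apl_one_not_zero[OF assms(3)])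
  obtain M where M: "minimal_model M gdeg gdiff size (apl X) gval" "\<And>v. v \<in> M \<Longrightarrow> set_gen v \<subseteq> carrier (apl X)"
    using X.minimal_model_exists[OF one closed_apl_function_constant[OF assms(2)]] by blast
  interpret M: minimal_model M gdeg gdiff size "apl X" gval by (rule M)
  have "M \<lesssim> {v. set_gen v \<subseteq> carrier (apl X)}" using M(2) by (intro subset_imp_lepoll) auto
  also have "\<dots> \<lesssim> carrier (apl X)" by (rule gens_lepoll[OF X.infinite_carrier[OF one]])
  finally obtain e where e: "inj_on e M" "e ` M \<subseteq> carrier (apl X)" unfolding lepoll_def by blast
  \<comment> \<open>The second component is injective by itself; the label 0 supplies the number
    that the type \<open>generator\<close> asks for.\<close>
  define r where "r v = (0 :: nat, e v)" for v
  have r: "inj_on r M" using e(1) by (auto simp: inj_on_def r_def)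
  have inv_gf: "apl_map X f (apl_map Y g \<omega>) = \<omega>" if "\<omega> \<in> carrier (apl X)" for \<omega>
    by (rule apl_map_inverse[OF f g gf that])
  have inv_fg: "apl_map Y g (apl_map X f \<omega>) = \<omega>" if "\<omega> \<in> carrier (apl Y)" for \<omega>
    by (rule apl_map_inverse[OF g f fg that])
  note X_model = M.minimal_model_rename[OF r]
  interpret MX: minimal_model "r ` M" "\<lambda>v. gdeg (inv_into M r v)" "\<lambda>v. subst (\<lambda>v. letter (r v)) (gdiff (inv_into M r v))"
    "\<lambda>v. size (inv_into M r v)" "apl X" "\<lambda>v. gval (inv_into M r v)" by (rule X_model)
  interpret Y: minimal_model "r ` M" "\<lambda>v. gdeg (inv_into M r v)" "\<lambda>v. subst (\<lambda>v. letter (r v)) (gdiff (inv_into M r v))"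
    "\<lambda>v. size (inv_into M r v)" "apl Y" "\<lambda>v. apl_map Y g (gval (inv_into M r v))"
    by (rule MX.minimal_model_transport[OF cdga_apl apl_map_dga_hom[OF g] apl_map_dga_hom[OF f] inv_gf inv_fg])
  \<comment> \<open>Generators of a model of \<open>Y\<close> must be labelled by forms on
    \<open>Y\<close>. Carrying labels along \<open>apl_map\<close> is injective because the inverse
    homeomorphism carries them back.\<close>
  define q where "q v = (fst v, apl_map Y g (snd v))" for v :: "nat \<times> ('a sing_simplex \<Rightarrow> pl_form)"
  have q: "inj_on q (r ` M)"
  proof (rule inj_on_inverseI)
    fix v assume "v \<in> r ` M"
    then show "(\<lambda>v. (fst v, apl_map X f (snd v))) (q v) = v" using e(2) inv_gf by (auto simp: r_def q_def)
  qed
  note Y_model = Y.minimal_model_rename[OF q]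
  show ?thesis
    unfolding same_rational_homotopy_type_def minimal_sullivan_model_def
    by (intro exI, intro conjI)
      (rule MX.minimal_sullivan_algebra MX.quasi_isomorphism minimal_model.quasi_isomorphism[OF Y_model]
        minimal_system.minimal_sullivan_algebra[OF minimal_model.axioms(1)[OF Y_model]] MX.dga_isomorphic_rename[OF q])+
qed

theorem theorem3p2:
  fixes n :: nat
  assumes "n \<ge> 2"
  shows "same_rational_homotopy_type
    (projectivization (tangent_bundle_CP n))
    (unitary_homogeneous_space (n + 1) (block_unitary 1 1 (n - 1)))"
proof -
  \<comment> \<open>With \<open>n = Suc m\<close> the subtraction in the block size disappears, and
    the unitary group has size \<open>Suc (Suc m)\<close>.\<close>
  obtain m where m: "n = Suc m" using assms by (cases n) auto
  show ?thesis
    unfolding m using PTCP_homeomorphic_flag_manifold[of m] path_connected_PTCP[of "Suc m"]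
    by (intro homeomorphic_spaces_same_rational_homotopy_type) simp_all
qed

end
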